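(* Let $\gamma\neq0$ be an isolated eigenvalue of the solution operator $K$ with finite algebraic multiplicity, let $E_\gamma$, $E^*_\gamma$ be the spectral projections of $K$ and $K^*$ at $\gamma$ and $\bar\gamma$, and let $F_{\gamma,N}$, $F^*_{\gamma,N}$ be the spectral projections of $T_N=\Pi_NK\Pi_N$ and $T_N^*$ given by the same contours. Assume that the eigenfunctions in $E_\gamma(V)$ belong to $\mathcal{H}^s(\mathbb{T}^n)$, $s\in\mathbb{N}^+$. Then there is a constant $C>0$ independent of $N$ such that, for $N$ sufficiently large, $$\hat\delta\big(F_{\gamma,N}(V),E_\gamma(V)\big)\le C(1+N^2)^{\frac{1-s}{2}},\qquad \hat\delta\big(F^*_{\gamma,N}(V),E^*_\gamma(V)\big)\le C(1+N^2)^{\frac{1-s}{2}}.$$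
   Context: Let $d\le n$ and let $\bm{P}\in\mathbb{R}^{d\times n}$ be a projection matrix: its columns are $\mathbb{Q}$-linearly independent and its real rank is $d$. A function $f$ on $\mathbb{R}^d$ is quasiperiodic if $f(\bm{x})=F(\bm{P}^T\bm{x})$ for a continuous periodic $F$ on $\mathbb{T}^n=(\mathbb{R}/2\pi\mathbb{Z})^n$, called its parent function. The coefficient $\alpha$ is bounded quasiperiodic with parent function $\mathcal{A}\in C(\mathbb{T}^n)$, and there are constants $C_0,C_1>0$ with $C_0|\bm\xi|^2\le\bm\xi^T\alpha(\bm{x})\bm\xi\le C_1|\bm\xi|^2$ for all $\bm{x},\bm\xi\in\mathbb{R}^d$. $(F,G)=\frac{1}{|\mathbb{T}^n|}\int_{\mathbb{T}^n}F\bar G\,d\bm{y}$. $V=\mathcal{H}^1_{\bm{P}}(\mathbb{T}^n)=\{U\in\mathcal{L}^2(\mathbb{T}^n):\bm{P}\nabla U\in[\mathcal{L}^2(\mathbb{T}^n)]^d\}$ (weak derivatives), with norm $\|U\|_V=((U,U)+(\bm{P}\nabla U,\bm{P}\nabla U))^{1/2}$. $\mathcal{H}^s(\mathbb{T}^n)$ is the usual Sobolev space. $a(\mathcal{U},\mathcal{V})=(\mathcal{A}\bm{P}\nabla\mathcal{U},\bm{P}\nabla\mathcal{V})+(\mathcal{U},\mathcal{V})$, and $K:V\to V$ is defined by $a(K\mathcal{F},\mathcal{V})=(\mathcal{F},\mathcal{V})$ for all $\mathcal{V}\in V$. For $N\in\mathbb{N}^+$, $V^N=\mathrm{span}\{e^{i\bm{k}^T\bm{y}}:\bm{k}\in\mathbb{Z}^n,\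 -N/2\le k_j<N/2\}$, and $\Pi_N:V\to V^N$ is defined by $a(\Pi_N\mathcal{U}-\mathcal{U},\mathcal{V})=0$ for all $\mathcal{V}\in V^N$. Adjoints are taken with respect to the inner product $a(\cdot,\cdot)$ on $V$. Let $\Gamma_\gamma\subset\rho(K)$ be a circle centered at $\gamma$ that, together with its interior, contains no point of $\sigma(K)\cup\{0\}$ other than $\gamma$, and let $\bar\Gamma_\gamma$ be its complex conjugate. With $R_z(B)=(zI-B)^{-1}$: $E_\gamma=\frac1{2\pi i}\int_{\Gamma_\gamma}R_z(K)dz$, $F_{\gamma,N}=\frac1{2\pi i}\int_{\Gamma_\gamma}R_z(T_N)dz$, $E^*_\gamma=\frac1{2\pi i}\int_{\bar\Gamma_\gamma}R_z(K^* )dz$, $F^*_{\gamma,N}=\frac1{2\pi i}\int_{\bar\Gamma_\gamma}R_z(T_N^* )dz$. For closed subspaces $Y,Z$ of $V$: $\delta(x,Z)=\inf_{y\in Z}\|x-y\|_V$, $\delta(Y,Z)=\sup_{x\in Y,\ \|x\|_V=1}\delta(x,Z)$, $\hat\delta(Y,Z)=\max\{\delta(Y,Z),\delta(Z,Y)\}$. *)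

theory Defs
  imports "HOL-Analysis.Analysis" "HOL-Complex_Analysis.Complex_Analysis"
begin

section \<open>The Hilbert space of square-integrable functions on the torus\<close>

text \<open>Functions on the torus are functions on the full space which are \<open>2\<pi>\<close>-periodic in every
  coordinate; integrals are taken over the fundamental domain \<open>[0,2\<pi>]\<^sup>n\<close>.\<close>

definition torus_periodic :: "(real^'n \<Rightarrow> 'b) \<Rightarrow> bool" where
  "torus_periodic F \<longleftrightarrow> (\<forall>y j. F (y + (2 * pi) *\<^sub>R axis j 1) = F y)"

definition torus_measure :: "(real^'n) measure" where
  "torus_measure = restrict_space lborel (cbox 0 (\<chi> j. 2 * pi))"

definition torus_mean :: "(real^'n \<Rightarrow> complex) \<Rightarrow> complex" where
  "torus_mean F = (LINT y|torus_measure. F y) / (2 * of_real pi) ^ CARD('n)"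

definition l2fun :: "(real^'n \<Rightarrow> complex) \<Rightarrow> bool" where
  "l2fun F \<longleftrightarrow> torus_periodic F \<and> F \<in> borel_measurable borel \<and>
     integrable torus_measure (\<lambda>y. (cmod (F y))\<^sup>2)"

definition l2eq :: "(real^'n \<Rightarrow> complex) \<Rightarrow> (real^'n \<Rightarrow> complex) \<Rightarrow> bool" where
  "l2eq F G \<longleftrightarrow> l2fun F \<and> l2fun G \<and> (AE y in torus_measure. F y = G y)"

lemma measurable_torus:
  assumes "F \<in> borel_measurable borel"
  shows "F \<in> borel_measurable torus_measure"
  using assms unfolding torus_measure_def
  by (intro measurable_restrict_space1) simp

lemma l2fun_measurable: "l2fun F \<Longrightarrow> F \<in> borel_measurable torus_measure"
  unfolding l2fun_def by (auto intro: measurable_torus)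

lemma l2fun_zero: "l2fun (\<lambda>_. 0)"
  by (simp add: l2fun_def torus_periodic_def)

lemma l2fun_cmult:
  assumes "l2fun F" shows "l2fun (\<lambda>y. c * F y)"
  using assms by (auto simp: l2fun_def torus_periodic_def norm_mult power_mult_distrib)

lemma l2fun_add:
  assumes "l2fun F" "l2fun G" shows "l2fun (\<lambda>y. F y + G y)"
proof -
  have m: "F \<in> borel_measurable borel" "G \<in> borel_measurable borel"
    using assms by (auto simp: l2fun_def)
  have "integrable torus_measure (\<lambda>y. (cmod (F y + G y))\<^sup>2)"
  proof (rule Bochner_Integration.integrable_bound)
    show "integrable torus_measure (\<lambda>y. 2 * (cmod (F y))\<^sup>2 + 2 * (cmod (G y))\<^sup>2)"
      using assms by (auto simp: l2fun_def)
    show "(\<lambda>y. (cmod (F y + G y))\<^sup>2) \<in> borel_measurable torus_measure"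
      by (rule measurable_torus) (use m in measurable)
    have "(cmod (a + b))\<^sup>2 \<le> 2 * (cmod a)\<^sup>2 + 2 * (cmod b)\<^sup>2" for a b
    proof -
      have "(cmod (a + b))\<^sup>2 \<le> (cmod a + cmod b)\<^sup>2"
        by (intro power_mono norm_triangle_ineq) auto
      also have "\<dots> \<le> 2 * (cmod a)\<^sup>2 + 2 * (cmod b)\<^sup>2"
        using sum_squares_ge_zero[of "cmod a - cmod b" 0]
        by (simp add: power2_eq_square algebra_simps)
      finally show ?thesis .
    qed
    then show "AE y in torus_measure. norm ((cmod (F y + G y))\<^sup>2)
        \<le> norm (2 * (cmod (F y))\<^sup>2 + 2 * (cmod (G y))\<^sup>2)"
      by auto
  qed
  then show ?thesis
    using assms m by (auto simp: l2fun_def torus_periodic_def)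
qed

lemma l2fun_prod_integrable:
  assumes "l2fun F" "l2fun G"
  shows "integrable torus_measure (\<lambda>y. F y * cnj (G y))"
proof (rule Bochner_Integration.integrable_bound)
  have m: "F \<in> borel_measurable borel" "G \<in> borel_measurable borel"
    using assms by (auto simp: l2fun_def)
  show "integrable torus_measure (\<lambda>y. (cmod (F y))\<^sup>2 + (cmod (G y))\<^sup>2)"
    using assms by (auto simp: l2fun_def)
  have cm: "(\<lambda>y. cnj (G y)) \<in> borel_measurable borel"
    by (intro borel_measurable_continuous_on[where f=cnj] continuous_on_cnj continuous_on_id m)
  show "(\<lambda>y. F y * cnj (G y)) \<in> borel_measurable torus_measure"
    by (rule measurable_torus) (use m cm in measurable)
  have "cmod a * cmod b \<le> (cmod a)\<^sup>2 + (cmod b)\<^sup>2" for a b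
    using sum_squares_bound[of "cmod a" "cmod b"]
      mult_nonneg_nonneg[OF norm_ge_zero[of a] norm_ge_zero[of b]]
    by linarith
  then show "AE y in torus_measure. norm (F y * cnj (G y))
      \<le> norm ((cmod (F y))\<^sup>2 + (cmod (G y))\<^sup>2)"
    by (auto simp: norm_mult)
qed

quotient_type 'n torus_l2 = "real^'n \<Rightarrow> complex" / partial: l2eq
proof (rule part_equivpI)
  show "\<exists>F::real^'n \<Rightarrow> complex. l2eq F F"
    using l2fun_zero by (intro exI[of _ "\<lambda>_. 0"]) (simp add: l2eq_def)
  show "symp (l2eq :: (real^'n \<Rightarrow> complex) \<Rightarrow> _)"
    by (auto simp: symp_def l2eq_def elim: AE_mp)
  show "transp (l2eq :: (real^'n \<Rightarrow> complex) \<Rightarrow> _)"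
  proof (rule transpI)
    fix F G H :: "real^'n \<Rightarrow> complex"
    assume a: "l2eq F G" "l2eq G H"
    then have "AE y in torus_measure. F y = G y" "AE y in torus_measure. G y = H y"
      by (auto simp: l2eq_def)
    then have "AE y in torus_measure. F y = H y" by eventually_elim simp
    with a show "l2eq F H" by (simp add: l2eq_def)
  qed
qed

lift_definition cinner :: "('n::finite) torus_l2 \<Rightarrow> 'n torus_l2 \<Rightarrow> complex"
  is "\<lambda>F G. torus_mean (\<lambda>y. F y * cnj (G y))"
proof -
  fix F F' G G' :: "real^'n \<Rightarrow> complex"
  assume a: "l2eq F F'" "l2eq G G'"
  then have ae: "AE y in torus_measure. F y = F' y" "AE y in torus_measure. G y = G' y"
    and l: "l2fun F" "l2fun F'" "l2fun G" "l2fun G'"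
    by (auto simp: l2eq_def)
  from ae have "AE y in torus_measure. F y * cnj (G y) = F' y * cnj (G' y)"
    by eventually_elim simp
  then have "(LINT y|torus_measure. F y * cnj (G y)) = (LINT y|torus_measure. F' y * cnj (G' y))"
    using l by (intro integral_cong_AE borel_measurable_integrable l2fun_prod_integrable)
  then show "torus_mean (\<lambda>y. F y * cnj (G y)) = torus_mean (\<lambda>y. F' y * cnj (G' y))"
    by (simp add: torus_mean_def)
qed

lift_definition scaleC :: "complex \<Rightarrow> ('n::finite) torus_l2 \<Rightarrow> 'n torus_l2"  (infixr \<open>*\<^sub>C\<close> 75)
  is "\<lambda>c F y. c * F y"
  by (auto simp: l2eq_def l2fun_cmult)

instantiation torus_l2 :: (finite) real_inner
begin

lift_definition zero_torus_l2 :: "'a torus_l2" is "\<lambda>_. 0"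
  by (simp add: l2eq_def l2fun_zero)

lift_definition plus_torus_l2 :: "'a torus_l2 \<Rightarrow> 'a torus_l2 \<Rightarrow> 'a torus_l2"
  is "\<lambda>F G y. F y + G y"
proof -
  fix F F' G G' :: "real^'a \<Rightarrow> complex"
  assume a: "l2eq F F'" "l2eq G G'"
  then have "AE y in torus_measure. F y = F' y" "AE y in torus_measure. G y = G' y"
    by (auto simp: l2eq_def)
  then have "AE y in torus_measure. F y + G y = F' y + G' y"
    by eventually_elim simp
  with a show "l2eq (\<lambda>y. F y + G y) (\<lambda>y. F' y + G' y)"
    by (simp add: l2eq_def l2fun_add)
qed

definition uminus_torus_l2 :: "'a torus_l2 \<Rightarrow> 'a torus_l2" where
  "uminus_torus_l2 U = (-1) *\<^sub>C U"

definition minus_torus_l2 :: "'a torus_l2 \<Rightarrow> 'a torus_l2 \<Rightarrow> 'a torus_l2" where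
  "minus_torus_l2 U W = U + (- W)"

definition scaleR_torus_l2 :: "real \<Rightarrow> 'a torus_l2 \<Rightarrow> 'a torus_l2" where
  "scaleR_torus_l2 r U = complex_of_real r *\<^sub>C U"

definition inner_torus_l2 :: "'a torus_l2 \<Rightarrow> 'a torus_l2 \<Rightarrow> real" where
  "inner_torus_l2 U W = Re (cinner U W)"

definition norm_torus_l2 :: "'a torus_l2 \<Rightarrow> real" where
  "norm_torus_l2 U = sqrt (Re (cinner U U))"

definition sgn_torus_l2 :: "'a torus_l2 \<Rightarrow> 'a torus_l2" where
  "sgn_torus_l2 U = inverse (norm U) *\<^sub>R U"

definition dist_torus_l2 :: "'a torus_l2 \<Rightarrow> 'a torus_l2 \<Rightarrow> real" where
  "dist_torus_l2 U W = norm (U - W)"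

definition uniformity_torus_l2 :: "('a torus_l2 \<times> 'a torus_l2) filter" where
  "uniformity_torus_l2 = (INF e\<in>{0<..}. principal {(U, W). dist U W < e})"

definition open_torus_l2 :: "'a torus_l2 set \<Rightarrow> bool" where
  "open_torus_l2 S \<longleftrightarrow> (\<forall>U\<in>S. eventually (\<lambda>(U', W). U' = U \<longrightarrow> W \<in> S) uniformity)"

instance
proof
  fix U V W :: "'a torus_l2" and r t :: real
  show "U + V + W = U + (V + W)"
    by transfer (auto simp: l2eq_def add.assoc intro: l2fun_add)
  show "U + V = V + U"
    by transfer (auto simp: l2eq_def add.commute intro: l2fun_add)
  show "0 + U = U"
    by transfer (auto simp: l2eq_def)
  show "- U + U = 0"
    unfolding uminus_torus_l2_def
    by transfer (auto simp: l2eq_def intro: l2fun_add l2fun_zero l2fun_cmult[where c="-1", simplified])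
  show "U - V = U + - V"
    by (simp add: minus_torus_l2_def)
  show "r *\<^sub>R (U + V) = r *\<^sub>R U + r *\<^sub>R V"
    unfolding scaleR_torus_l2_def
    by transfer (auto simp: l2eq_def distrib_left distrib_right intro!: l2fun_add l2fun_cmult)
  show "(r + t) *\<^sub>R U = r *\<^sub>R U + t *\<^sub>R U"
    unfolding scaleR_torus_l2_def
    by transfer (auto simp: l2eq_def distrib_left distrib_right intro!: l2fun_add l2fun_cmult)
  show "r *\<^sub>R t *\<^sub>R U = (r * t) *\<^sub>R U"
    unfolding scaleR_torus_l2_def
    by transfer (auto simp: l2eq_def mult.assoc intro!: l2fun_cmult)
  show "1 *\<^sub>R U = U"
    unfolding scaleR_torus_l2_def by transfer (auto simp: l2eq_def)
  show "dist U V = norm (U - V)" by (simp add: dist_torus_l2_def)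
  show "sgn U = inverse (norm U) *\<^sub>R U" by (simp add: sgn_torus_l2_def)
  show "norm U = sqrt (inner U U)" by (simp add: norm_torus_l2_def inner_torus_l2_def)
  show "inner U V = inner V U"
  proof -
    have "cinner U V = cnj (cinner V U)"
      by transfer (simp add: torus_mean_def mult.commute flip: Bochner_Integration.integral_cnj)
    then show ?thesis by (simp add: inner_torus_l2_def)
  qed
  show "inner (U + V) W = inner U W + inner V W"
  proof -
    have "cinner (U + V) W = cinner U W + cinner V W"
      by transfer (simp add: torus_mean_def l2eq_def distrib_right add_divide_distrib l2fun_prod_integrable)
    then show ?thesis by (simp add: inner_torus_l2_def)
  qed
  show "inner (r *\<^sub>R U) V = r * inner U V"
  proof -
    have "cinner (c *\<^sub>C U) V = c * cinner U V" for c
      by transfer (simp add: torus_mean_def mult.assoc)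
    then show ?thesis by (simp add: inner_torus_l2_def scaleR_torus_l2_def)
  qed
  have key: "Re (torus_mean (\<lambda>y. F y * cnj (F y)))
      = (LINT y|torus_measure. (cmod (F y))\<^sup>2) / (2 * pi) ^ CARD('a)" for F :: "real^'a \<Rightarrow> complex"
  proof -
    have "(LINT y|torus_measure. F y * cnj (F y)) = complex_of_real (LINT y|torus_measure. (cmod (F y))\<^sup>2)"
      unfolding integral_complex_of_real[symmetric] complex_norm_square[symmetric] of_real_power ..
    moreover have "(2 * complex_of_real pi) ^ CARD('a) = complex_of_real ((2 * pi) ^ CARD('a))"
      by simp
    ultimately show ?thesis
      unfolding torus_mean_def by (simp only: flip: of_real_divide) simp
  qed
  show "0 \<le> inner U U"
    unfolding inner_torus_l2_def by transfer (simp add: key)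
  show "inner U U = 0 \<longleftrightarrow> U = 0"
    unfolding inner_torus_l2_def
  proof transfer
    fix F :: "real^'a \<Rightarrow> complex" assume F: "l2eq F F"
    then have i: "integrable torus_measure (\<lambda>y. (cmod (F y))\<^sup>2)"
      by (simp add: l2eq_def l2fun_def)
    have "(LINT y|torus_measure. (cmod (F y))\<^sup>2) = 0 \<longleftrightarrow> (AE y in torus_measure. F y = 0)"
      using integral_nonneg_eq_0_iff_AE[OF i] by simp
    then show "Re (torus_mean (\<lambda>y. F y * cnj (F y))) = 0 \<longleftrightarrow> l2eq F (\<lambda>_. 0)"
      using F by (auto simp: key l2eq_def l2fun_zero)
  qed
qed (simp_all add: uniformity_torus_l2_def open_torus_l2_def)

end

global_interpretation cvec: vector_space "scaleC :: complex \<Rightarrow> ('n::finite) torus_l2 \<Rightarrow> 'n torus_l2"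
  defines cspan = cvec.span
proof
  fix c e :: complex and U W :: "'n torus_l2"
  show "c *\<^sub>C (U + W) = c *\<^sub>C U + c *\<^sub>C W"
    by transfer (auto simp: l2eq_def distrib_left distrib_right intro!: l2fun_add l2fun_cmult)
  show "(c + e) *\<^sub>C U = c *\<^sub>C U + e *\<^sub>C U"
    by transfer (auto simp: l2eq_def distrib_left distrib_right intro!: l2fun_add l2fun_cmult)
  show "c *\<^sub>C e *\<^sub>C U = (c * e) *\<^sub>C U"
    by transfer (auto simp: l2eq_def mult.assoc intro!: l2fun_cmult)
  show "1 *\<^sub>C U = U" by transfer (auto simp: l2eq_def)
qed


section \<open>Weak derivatives and function spaces\<close>

primrec Ck :: "nat \<Rightarrow> (real^'n \<Rightarrow> complex) \<Rightarrow> bool" where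
  "Ck 0 f \<longleftrightarrow> continuous_on UNIV f"
| "Ck (Suc k) f \<longleftrightarrow> f differentiable_on UNIV \<and>
     (\<forall>j. Ck k (\<lambda>y. frechet_derivative f (at y) (axis j 1)))"

definition torus_test :: "(real^'n \<Rightarrow> complex) \<Rightarrow> bool" where
  "torus_test \<phi> \<longleftrightarrow> torus_periodic \<phi> \<and> (\<forall>k. Ck k \<phi>)"

text \<open>\<open>weak_deriv v U G\<close>: the distributional derivative of \<open>U\<close> in direction \<open>v\<close> is \<open>G\<close>. Integrals do
  not depend on the representatives picked by \<^term>\<open>rep_torus_l2\<close>.\<close>

definition weak_deriv :: "real^'n \<Rightarrow> ('n::finite) torus_l2 \<Rightarrow> 'n torus_l2 \<Rightarrow> bool" where
  "weak_deriv v U G \<longleftrightarrow> (\<forall>\<phi>. torus_test \<phi> \<longrightarrow>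
     torus_mean (\<lambda>y. rep_torus_l2 U y * frechet_derivative \<phi> (at y) v)
       = - torus_mean (\<lambda>y. rep_torus_l2 G y * \<phi> y))"

text \<open>The \<open>i\<close>-th component of \<open>P \<nabla> U\<close> is \<open>\<Sum>\<^sub>j P\<^sub>i\<^sub>j \<partial>\<^sub>j U\<close>, the derivative in the direction of the
  \<open>i\<close>-th row \<open>P $ i\<close>.\<close>

definition has_weak_Pgrad :: "real^'n^'d \<Rightarrow> ('n::finite) torus_l2 \<Rightarrow> ('n torus_l2)^'d \<Rightarrow> bool" where
  "has_weak_Pgrad P U G \<longleftrightarrow> (\<forall>i. weak_deriv (P $ i) U (G $ i))"

definition Pgrad :: "real^'n^'d \<Rightarrow> ('n::finite) torus_l2 \<Rightarrow> ('n torus_l2)^'d" where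
  "Pgrad P U = (THE G. has_weak_Pgrad P U G)"

definition HP1 :: "real^'n^'d \<Rightarrow> ('n::finite) torus_l2 set" where
  "HP1 P = {U. \<exists>G. has_weak_Pgrad P U G}"

definition normV :: "real^'n^'d \<Rightarrow> ('n::finite) torus_l2 \<Rightarrow> real" where
  "normV P U = sqrt (Re (cinner U U + (\<Sum>i\<in>UNIV. cinner (Pgrad P U $ i) (Pgrad P U $ i))))"

text \<open>Hence \<open>U \<mapsto> (U, P \<nabla> U)\<close> is an isometry of \<open>V\<close> into \<open>\<L>\<^sup>2 \<times> [\<L>\<^sup>2]\<^sup>d\<close>, which
  is used below to integrate \<open>V\<close>-valued functions with the library integral.\<close>

lemma normV_eq_norm: "normV P U = norm (U, Pgrad P U)"
  by (simp add: normV_def norm_prod_def norm_vec_def L2_set_def norm_torus_l2_def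
      power2_norm_eq_inner inner_torus_l2_def sum_nonneg
      flip: inner_torus_l2_def)

text \<open>The Sobolev space of integer order: all weak partial derivatives up to that order are
  square-integrable.\<close>

primrec Hs :: "nat \<Rightarrow> ('n::finite) torus_l2 set" where
  "Hs 0 = UNIV"
| "Hs (Suc s) = {U. \<forall>j. \<exists>G \<in> Hs s. weak_deriv (axis j 1) U G}"


section \<open>Projection matrices\<close>

definition projection_matrix :: "real^'n^'d \<Rightarrow> bool" where
  "projection_matrix P \<longleftrightarrow> CARD('d) \<le> CARD('n) \<and> rank P = CARD('d) \<and>
     (\<forall>q :: 'n \<Rightarrow> rat. (\<Sum>j\<in>UNIV. of_rat (q j) *\<^sub>R column j P) = 0 \<longrightarrow> (\<forall>j. q j = 0))"


section \<open>The form, the solution operator and its Galerkin approximation\<close>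

definition aform :: "real^'n^'d \<Rightarrow> (real^'n \<Rightarrow> real^'d^'d) \<Rightarrow>
    ('n::finite) torus_l2 \<Rightarrow> 'n torus_l2 \<Rightarrow> complex" where
  "aform P A U W =
     torus_mean (\<lambda>y. \<Sum>i\<in>UNIV. (\<Sum>j\<in>UNIV. of_real (A y $ i $ j) * rep_torus_l2 (Pgrad P U $ j) y)
                        * cnj (rep_torus_l2 (Pgrad P W $ i) y))
     + cinner U W"

definition solution_op :: "real^'n^'d \<Rightarrow> (real^'n \<Rightarrow> real^'d^'d) \<Rightarrow>
    ('n::finite) torus_l2 \<Rightarrow> 'n torus_l2" where
  "solution_op P A F = (THE U. U \<in> HP1 P \<and> (\<forall>W\<in>HP1 P. aform P A U W = cinner F W))"

definition expo :: "int^'n \<Rightarrow> ('n::finite) torus_l2" where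
  "expo k = abs_torus_l2 (\<lambda>y. exp (\<i> * of_real (\<Sum>j\<in>UNIV. of_int (k $ j) * y $ j)))"

definition VN :: "nat \<Rightarrow> ('n::finite) torus_l2 set" where
  "VN N = cspan (expo ` {k. \<forall>j. - real N / 2 \<le> of_int (k $ j) \<and> of_int (k $ j) < real N / 2})"

definition galerkin_proj :: "real^'n^'d \<Rightarrow> (real^'n \<Rightarrow> real^'d^'d) \<Rightarrow> nat \<Rightarrow>
    ('n::finite) torus_l2 \<Rightarrow> 'n torus_l2" where
  "galerkin_proj P A N U = (THE X. X \<in> VN N \<and> (\<forall>W\<in>VN N. aform P A (X - U) W = 0))"

definition TN :: "real^'n^'d \<Rightarrow> (real^'n \<Rightarrow> real^'d^'d) \<Rightarrow> nat \<Rightarrow>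
    ('n::finite) torus_l2 \<Rightarrow> 'n torus_l2" where
  "TN P A N = galerkin_proj P A N \<circ> solution_op P A \<circ> galerkin_proj P A N"

definition a_adjoint :: "real^'n^'d \<Rightarrow> (real^'n \<Rightarrow> real^'d^'d) \<Rightarrow>
    (('n::finite) torus_l2 \<Rightarrow> 'n torus_l2) \<Rightarrow> 'n torus_l2 \<Rightarrow> 'n torus_l2" where
  "a_adjoint P A B W =
     (THE X. X \<in> HP1 P \<and> (\<forall>U\<in>HP1 P. aform P A (B U) W = aform P A U X))"


section \<open>Spectral theory of operators on \<open>V = HP1 P\<close>\<close>

definition resolvent_set :: "real^'n^'d \<Rightarrow> (('n::finite) torus_l2 \<Rightarrow> 'n torus_l2) \<Rightarrow> complex set" where
  "resolvent_set P B = {z. bij_betw (\<lambda>U. z *\<^sub>C U - B U) (HP1 P) (HP1 P) \<and>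
     (\<exists>M. \<forall>U\<in>HP1 P. normV P U \<le> M * normV P (z *\<^sub>C U - B U))}"

definition spectrum :: "real^'n^'d \<Rightarrow> (('n::finite) torus_l2 \<Rightarrow> 'n torus_l2) \<Rightarrow> complex set" where
  "spectrum P B = - resolvent_set P B"

definition resolvent :: "real^'n^'d \<Rightarrow> (('n::finite) torus_l2 \<Rightarrow> 'n torus_l2) \<Rightarrow> complex \<Rightarrow>
    'n torus_l2 \<Rightarrow> 'n torus_l2" where
  "resolvent P B z = inv_into (HP1 P) (\<lambda>U. z *\<^sub>C U - B U)"

text \<open>\<open>has_V_integral P g I\<close>: the function \<open>g\<close> on \<open>[0,1]\<close> with values in \<open>V\<close> is integrable with
  respect to the norm of \<open>V\<close>, with integral \<open>I\<close>.\<close>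

definition has_V_integral :: "real^'n^'d \<Rightarrow> (real \<Rightarrow> ('n::finite) torus_l2) \<Rightarrow> 'n torus_l2 \<Rightarrow> bool" where
  "has_V_integral P g I \<longleftrightarrow> I \<in> HP1 P \<and> (\<forall>t\<in>{0..1}. g t \<in> HP1 P) \<and>
     ((\<lambda>t. (g t, Pgrad P (g t))) has_integral (I, Pgrad P I)) {0..1}"

text \<open>The Riesz projection \<open>(2\<pi>i)\<^sup>-\<^sup>1 \<integral> R\<^sub>z(B) dz\<close> over the positively oriented circle of
  centre \<open>c\<close> and radius \<open>r\<close>. The operator-valued integral is evaluated pointwise.\<close>

definition spectral_proj :: "real^'n^'d \<Rightarrow> (('n::finite) torus_l2 \<Rightarrow> 'n torus_l2) \<Rightarrow>
    complex \<Rightarrow> real \<Rightarrow> 'n torus_l2 \<Rightarrow> 'n torus_l2" where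
  "spectral_proj P B c r U = (1 / (2 * of_real pi * \<i>)) *\<^sub>C
     (THE I. has_V_integral P
        (\<lambda>t. vector_derivative (circlepath c r) (at t within {0..1})
                *\<^sub>C resolvent P B (circlepath c r t) U) I)"

definition eigenvector :: "real^'n^'d \<Rightarrow> (('n::finite) torus_l2 \<Rightarrow> 'n torus_l2) \<Rightarrow>
    complex \<Rightarrow> 'n torus_l2 \<Rightarrow> bool" where
  "eigenvector P B c U \<longleftrightarrow> U \<in> HP1 P \<and> U \<noteq> 0 \<and> B U = c *\<^sub>C U"

definition generalized_eigenspace :: "real^'n^'d \<Rightarrow> (('n::finite) torus_l2 \<Rightarrow> 'n torus_l2) \<Rightarrow>
    complex \<Rightarrow> 'n torus_l2 set" where
  "generalized_eigenspace P B c = {U \<in> HP1 P. \<exists>m. ((\<lambda>W. c *\<^sub>C W - B W) ^^ m) U = 0}"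

definition finite_algebraic_multiplicity :: "real^'n^'d \<Rightarrow>
    (('n::finite) torus_l2 \<Rightarrow> 'n torus_l2) \<Rightarrow> complex \<Rightarrow> bool" where
  "finite_algebraic_multiplicity P B c \<longleftrightarrow>
     (\<exists>S. finite S \<and> generalized_eigenspace P B c \<subseteq> cspan S)"


section \<open>Gap between subspaces\<close>

definition distV :: "real^'n^'d \<Rightarrow> ('n::finite) torus_l2 \<Rightarrow> 'n torus_l2 set \<Rightarrow> real" where
  "distV P U Z = (INF W\<in>Z. normV P (U - W))"

text \<open>The supremum over an empty unit sphere (\<open>Y = 0\<close>) is \<open>0\<close>, as usual.\<close>

definition gap1 :: "real^'n^'d \<Rightarrow> ('n::finite) torus_l2 set \<Rightarrow> 'n torus_l2 set \<Rightarrow> real" where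
  "gap1 P Y Z = (if \<exists>U\<in>Y. normV P U = 1
     then (SUP U\<in>{U \<in> Y. normV P U = 1}. distV P U Z) else 0)"

definition gap :: "real^'n^'d \<Rightarrow> ('n::finite) torus_l2 set \<Rightarrow> 'n torus_l2 set \<Rightarrow> real" where
  "gap P Y Z = max (gap1 P Y Z) (gap1 P Z Y)"

end

theory Submission
  imports Defs "HOL-Computational_Algebra.Fundamental_Theorem_Algebra"
begin

text \<open>The space \<open>V\<close> with the form \<open>a\<close> is a Hilbert space, and the norm of the form is equivalent to
  the norm of \<open>V\<close> (\<open>norm_equiv\<close>, \<open>V_complete\<close>). Here the coefficient has to be elliptic on the
  whole torus, whereas ellipticity is only known along the image of \<open>P\<^sup>T\<close>. Since the columns of
  \<open>P\<close> are rationally independent, Kronecker's theorem makes this image dense modulo \<open>2\<pi>\<close>, and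
  continuity does the rest (\<open>elliptic_everywhere\<close>). For a Hermitian form \<open>K\<close> and \<open>T\<^sub>N\<close> are
  self-adjoint, so \<open>\<gamma>\<close> is real, the adjoint operators are the operators themselves, and the second
  estimate is the first one. The argument then rests on four facts.

  (1) The contour integral \<open>E\<close> maps into the eigenspace \<open>M = ker (K - \<gamma>)\<close> and fixes it. The algebraic
  and the geometric eigenspace agree by self-adjointness; in terms of the resolvent, this follows by
  shrinking the circle and using \<open>\<parallel>R\<^sub>z\<parallel> \<le> 1 / \<bar>Im z\<bar>\<close> (\<open>Riesz_projection_range\<close>).

  (2) The matrix \<open>P\<close> must be square. If \<open>d < n\<close>, there are frequencies \<open>k\<close> with \<open>\<bar>k\<bar>\<close> large and \<open>P k\<close>
  small, by Dirichlet's approximation theorem. Multiplying an eigenvector by such a character gives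
  approximate eigenvectors that tend weakly to zero and have constant norm in \<open>L\<^sup>2\<close>. Up to a small
  error, \<open>E\<close> fixes them, so they would converge in norm in the finite-dimensional \<open>M\<close>: a
  contradiction (\<open>isolated_eigenvalue_imp_square\<close>).

  (3) For a square matrix \<open>P\<close>, \<open>K\<close> is compact, because the norm of \<open>V\<close> controls high frequencies, and
  so \<open>\<parallel>K - T\<^sub>N\<parallel> \<rightarrow> 0\<close> (\<open>TN_tendsto_norm\<close>). On \<open>M\<close> the defect is smaller:
  \<open>\<parallel>(K - T\<^sub>N) u\<parallel> \<le> (1 + \<bar>\<gamma>\<bar>) \<parallel>u - \<Pi>\<^sub>N u\<parallel>\<close> (\<open>TN_defect_eigenvector\<close>), and cutting off the Fourier series
  of functions in \<open>H\<^sup>s\<close> shows that this is \<open>O((1 + N\<^sup>2)\<^sup>(\<^sup>1\<^sup>-\<^sup>s\<^sup>)\<^sup>/\<^sup>2)\<close> (\<open>galerkin_rate\<close>,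
  \<open>eigenspace_galerkin_rate\<close>).

  (4) \<open>T\<^sub>N\<close> has finite rank, so the spectral theorem exhibits \<open>F\<^sub>N\<close> as the orthogonal projection onto the
  eigenvectors of \<open>T\<^sub>N\<close> with eigenvalue inside the circle (\<open>finite_rank_diagonal\<close>). Hence \<open>u - F\<^sub>N u\<close>
  is controlled by the defect \<open>(K - T\<^sub>N) u\<close> for \<open>u\<close> in \<open>M\<close>, which bounds one half of the gap. For
  large \<open>N\<close> the projection \<open>F\<^sub>N\<close> maps \<open>M\<close> onto its range, so every element of the range is \<open>F\<^sub>N u\<close>
  for some \<open>u\<close> in \<open>M\<close>, and the same estimate bounds the other half
  (\<open>Riesz_projection_perturbation\<close>).\<close>

section \<open>Complex inner product spaces given by a form\<close>

text \<open>The form \<open>a\<close> is an inner product only on the set \<open>V\<close>, a subspace of an ambient vector space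
  that carries another inner product. Everything is therefore relative to the carrier \<open>V\<close>.\<close>

locale cinner_space = vector_space scale
  for scale :: "complex \<Rightarrow> 'h::ab_group_add \<Rightarrow> 'h"  (infixr \<open>\<odot>\<close> 75) +
  fixes V :: "'h set" and a :: "'h \<Rightarrow> 'h \<Rightarrow> complex"
  assumes subspace_V: "subspace V"
    and a_add_left: "x \<in> V \<Longrightarrow> y \<in> V \<Longrightarrow> w \<in> V \<Longrightarrow> a (x + y) w = a x w + a y w"
    and a_scale_left: "x \<in> V \<Longrightarrow> w \<in> V \<Longrightarrow> a (c \<odot> x) w = c * a x w"
    and a_cnj: "x \<in> V \<Longrightarrow> y \<in> V \<Longrightarrow> a x y = cnj (a y x)"
    and a_pos: "x \<in> V \<Longrightarrow> x \<noteq> 0 \<Longrightarrow> 0 < Re (a x x)"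
begin

definition nrm :: "'h \<Rightarrow> real" where "nrm x = sqrt (Re (a x x))"

lemma V_add [simp, intro]: "x \<in> V \<Longrightarrow> y \<in> V \<Longrightarrow> x + y \<in> V"
  and V_scale [simp, intro]: "x \<in> V \<Longrightarrow> c \<odot> x \<in> V"
  and V_zero [simp, intro]: "0 \<in> V"
  and V_diff [simp, intro]: "x \<in> V \<Longrightarrow> y \<in> V \<Longrightarrow> x - y \<in> V"
  and V_uminus [simp, intro]: "x \<in> V \<Longrightarrow> - x \<in> V"
  and V_sum [intro]: "(\<And>i. i \<in> I \<Longrightarrow> g i \<in> V) \<Longrightarrow> sum g I \<in> V"
  using subspace_V
  by (auto intro: subspace_add subspace_scale subspace_0 subspace_diff subspace_neg subspace_sum)

lemma a_zero_left [simp]: "w \<in> V \<Longrightarrow> a 0 w = 0"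
  using a_scale_left[of 0 w 0] by simp

lemma a_uminus_left: "x \<in> V \<Longrightarrow> w \<in> V \<Longrightarrow> a (- x) w = - a x w"
  using a_scale_left[of x w "-1"] by simp

lemma a_diff_left: "x \<in> V \<Longrightarrow> y \<in> V \<Longrightarrow> w \<in> V \<Longrightarrow> a (x - y) w = a x w - a y w"
  using a_add_left[of x "- y" w] by (simp add: a_uminus_left)

lemma a_add_right: "x \<in> V \<Longrightarrow> y \<in> V \<Longrightarrow> w \<in> V \<Longrightarrow> a w (x + y) = a w x + a w y"
  by (subst (1 2 3) a_cnj) (auto simp: a_add_left)

lemma a_scale_right: "x \<in> V \<Longrightarrow> w \<in> V \<Longrightarrow> a w (c \<odot> x) = cnj c * a w x"
  by (subst (1 2) a_cnj) (auto simp: a_scale_left)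

lemma a_zero_right [simp]: "w \<in> V \<Longrightarrow> a w 0 = 0"
  using a_scale_right[of 0 w 0] by simp

lemma a_diff_right: "x \<in> V \<Longrightarrow> y \<in> V \<Longrightarrow> w \<in> V \<Longrightarrow> a w (x - y) = a w x - a w y"
  by (subst (1 2 3) a_cnj) (auto simp: a_diff_left)

lemmas a_simps = a_add_left a_add_right a_diff_left a_diff_right a_scale_left a_scale_right

lemma a_sum_left:
  "(\<And>i. i \<in> I \<Longrightarrow> g i \<in> V) \<Longrightarrow> w \<in> V \<Longrightarrow> a (\<Sum>i\<in>I. g i) w = (\<Sum>i\<in>I. a (g i) w)"
  by (induction I rule: infinite_finite_induct) (auto simp: a_add_left V_sum)

lemma a_sum_right:
  "(\<And>i. i \<in> I \<Longrightarrow> g i \<in> V) \<Longrightarrow> w \<in> V \<Longrightarrow> a w (\<Sum>i\<in>I. g i) = (\<Sum>i\<in>I. a w (g i))"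
  by (induction I rule: infinite_finite_induct) (auto simp: a_add_right V_sum)

lemma a_self_real: "x \<in> V \<Longrightarrow> a x x = of_real (Re (a x x))"
  using a_cnj[of x x] by (simp add: complex_eq_iff)

lemma a_self_nonneg: "x \<in> V \<Longrightarrow> 0 \<le> Re (a x x)"
  by (cases "x = 0") (auto dest: a_pos intro: less_imp_le)

lemma nrm_sq: "x \<in> V \<Longrightarrow> (nrm x)\<^sup>2 = Re (a x x)"
  by (simp add: nrm_def a_self_nonneg)

lemma a_self: "x \<in> V \<Longrightarrow> a x x = of_real ((nrm x)\<^sup>2)"
  by (simp add: nrm_sq a_self_real[symmetric])

lemma nrm_nonneg [simp]: "x \<in> V \<Longrightarrow> 0 \<le> nrm x"
  by (simp add: nrm_def a_self_nonneg)

lemma nrm_eq_0 [simp]: "x \<in> V \<Longrightarrow> nrm x = 0 \<longleftrightarrow> x = 0"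
  using a_pos[of x] by (cases "x = 0") (auto simp: nrm_def)

lemma nrm_zero [simp]: "nrm 0 = 0" by simp

lemma eqI_form:
  assumes "x \<in> V" "y \<in> V" "\<And>v. v \<in> V \<Longrightarrow> a x v = a y v" shows "x = y"
proof -
  have "a (x - y) (x - y) = 0" using assms by (simp add: a_diff_left)
  then have "nrm (x - y) = 0" by (simp add: nrm_def)
  then show ?thesis using assms by simp
qed

lemma nrm_scale: "x \<in> V \<Longrightarrow> nrm (c \<odot> x) = cmod c * nrm x"
proof -
  assume x: "x \<in> V"
  have "a (c \<odot> x) (c \<odot> x) = (c * cnj c) * a x x" using x by (simp add: a_simps)
  also have "\<dots> = of_real ((cmod c * nrm x)\<^sup>2)"
    by (simp add: a_self[OF x] complex_norm_square[symmetric] power_mult_distrib)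
  finally have "Re (a (c \<odot> x) (c \<odot> x)) = (cmod c * nrm x)\<^sup>2" by (metis Re_complex_of_real)
  then show ?thesis using a_self_nonneg[OF x] by (simp add: nrm_def real_sqrt_abs abs_mult)
qed

lemma nrm_uminus: "x \<in> V \<Longrightarrow> nrm (- x) = nrm x"
  using nrm_scale[of x "-1"] by simp

lemma nrm_minus_commute: "x \<in> V \<Longrightarrow> y \<in> V \<Longrightarrow> nrm (x - y) = nrm (y - x)"
  using nrm_uminus[of "x - y"] by simp

lemma nrm_sq_add:
  "x \<in> V \<Longrightarrow> y \<in> V \<Longrightarrow> (nrm (x + y))\<^sup>2 = (nrm x)\<^sup>2 + 2 * Re (a x y) + (nrm y)\<^sup>2"
  using a_cnj[of x y] by (simp add: nrm_sq a_simps)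

lemma nrm_sq_diff:
  "x \<in> V \<Longrightarrow> y \<in> V \<Longrightarrow> (nrm (x - y))\<^sup>2 = (nrm x)\<^sup>2 - 2 * Re (a x y) + (nrm y)\<^sup>2"
  using a_cnj[of x y] by (simp add: nrm_sq a_simps)

lemma Cauchy_Schwarz: assumes "x \<in> V" "y \<in> V" shows "cmod (a x y) \<le> nrm x * nrm y"
proof (cases "y = 0")
  case False
  then have ny: "nrm y > 0" using assms nrm_nonneg[of y] nrm_eq_0[of y] by linarith
  define t where "t = a x y / of_real ((nrm y)\<^sup>2)"
  have "0 \<le> (nrm (x - t \<odot> y))\<^sup>2" by simp
  also have "\<dots> = (nrm x)\<^sup>2 - 2 * Re (cnj t * a x y) + (cmod t * nrm y)\<^sup>2"
    using assms by (simp add: nrm_sq_diff nrm_scale a_simps)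
  also have "cnj t * a x y = of_real ((cmod (a x y))\<^sup>2 / (nrm y)\<^sup>2)"
    by (simp add: t_def complex_norm_square[symmetric] mult.commute flip: of_real_power)
  also have "(cmod t * nrm y)\<^sup>2 = (cmod (a x y))\<^sup>2 / (nrm y)\<^sup>2"
    using ny by (simp add: t_def norm_divide norm_mult norm_power power_mult_distrib power_divide)
       (simp add: field_simps power2_eq_square power4_eq_xxxx)
  finally have "(cmod (a x y))\<^sup>2 \<le> (nrm x)\<^sup>2 * (nrm y)\<^sup>2" using ny by (simp add: field_simps)
  then show ?thesis using assms
    by (metis mult_nonneg_nonneg nrm_nonneg power2_le_imp_le power_mult_distrib)
qed (use assms in simp)

lemma nrm_triangle: assumes "x \<in> V" "y \<in> V" shows "nrm (x + y) \<le> nrm x + nrm y"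
proof (rule power2_le_imp_le)
  have "Re (a x y) \<le> nrm x * nrm y"
    using Cauchy_Schwarz[OF assms] complex_Re_le_cmod[of "a x y"] by linarith
  then show "(nrm (x + y))\<^sup>2 \<le> (nrm x + nrm y)\<^sup>2"
    using assms by (simp add: nrm_sq_add power2_sum)
qed (use assms in simp)

lemma nrm_triangle_diff: "x \<in> V \<Longrightarrow> y \<in> V \<Longrightarrow> nrm (x - y) \<le> nrm x + nrm y"
  using nrm_triangle[of x "- y"] by (simp add: nrm_uminus)

lemma nrm_sum_le:
  "(\<And>i. i \<in> I \<Longrightarrow> g i \<in> V) \<Longrightarrow> nrm (\<Sum>i\<in>I. g i) \<le> (\<Sum>i\<in>I. nrm (g i))"
proof (induction I rule: infinite_finite_induct)
  case (insert i I)
  then show ?case using nrm_triangle[of "g i" "sum g I"] by (force intro: V_sum)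
qed auto

text \<open>Convergence and completeness are phrased through \<^term>\<open>nrm\<close>, because the space is a
  subset of a type whose own topology is a different one.\<close>

definition complete_in :: "'h set \<Rightarrow> bool" where
  "complete_in Y \<longleftrightarrow> (\<forall>X::nat \<Rightarrow> 'h. (\<forall>n. X n \<in> Y) \<and>
     (\<forall>e>0. \<exists>M. \<forall>m\<ge>M. \<forall>n\<ge>M. nrm (X m - X n) < e) \<longrightarrow>
     (\<exists>l\<in>Y. (\<lambda>n. nrm (X n - l)) \<longlonglongrightarrow> 0))"

text \<open>Riesz representation by the direct method: the representing vector minimises
  \<open>\<parallel>w\<parallel>\<^sup>2 - 2 Re (g w)\<close>, and the parallelogram law makes minimising sequences Cauchy.\<close>

lemma Riesz_representation:
  assumes Y: "subspace Y" "Y \<subseteq> V" "complete_in Y"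
    and add: "\<And>x y. x \<in> Y \<Longrightarrow> y \<in> Y \<Longrightarrow> g (x + y) = g x + g y"
    and sc: "\<And>c x. x \<in> Y \<Longrightarrow> g (c \<odot> x) = cnj c * g x"
    and bd: "\<And>x. x \<in> Y \<Longrightarrow> cmod (g x) \<le> C * nrm x"
  shows "\<exists>u\<in>Y. \<forall>w\<in>Y. a u w = g w"
proof -
  define J where "J w = (nrm w)\<^sup>2 - 2 * Re (g w)" for w
  have YV: "x \<in> Y \<Longrightarrow> x \<in> V" for x using Y by auto
  have Yadd: "x \<in> Y \<Longrightarrow> y \<in> Y \<Longrightarrow> x + y \<in> Y" and Ysc: "x \<in> Y \<Longrightarrow> c \<odot> x \<in> Y"
    and Ydiff: "x \<in> Y \<Longrightarrow> y \<in> Y \<Longrightarrow> x - y \<in> Y" and Y0: "0 \<in> Y" for x y c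
    using Y(1) by (auto intro: subspace_add subspace_scale subspace_diff subspace_0)
  have gdiff: "g (x - y) = g x - g y" if "x \<in> Y" "y \<in> Y" for x y
    using add[of "x" "(-1) \<odot> y"] sc[of y "-1"] Ysc[OF that(2), of "-1"] that by simp
  have lower: "- C\<^sup>2 \<le> J w" if "w \<in> Y" for w
  proof -
    have "Re (g w) \<le> C * nrm w" using bd[OF that] complex_Re_le_cmod[of "g w"] by linarith
    then have "J w \<ge> (nrm w - C)\<^sup>2 - C\<^sup>2" by (simp add: J_def power2_eq_square algebra_simps)
    then show ?thesis using zero_le_power2[of "nrm w - C"] by linarith
  qed
  define m where "m = (INF w\<in>Y. J w)"
  have bddJ: "bdd_below (J ` Y)" using lower by (intro bdd_belowI2[of _ "- C\<^sup>2"])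
  have mle: "m \<le> J w" if "w \<in> Y" for w
    unfolding m_def by (rule cINF_lower[OF bddJ that])
  have "\<exists>w\<in>Y. J w < m + inverse (real (Suc n))" for n
  proof -
    have "(INF w\<in>Y. J w) < m + inverse (real (Suc n))" by (simp add: m_def)
    then show ?thesis using cINF_less_iff[OF _ bddJ] Y0 by blast
  qed
  then obtain X where X: "\<And>n. X n \<in> Y" "\<And>n. J (X n) < m + inverse (real (Suc n))" by metis
  have par: "(nrm (x - y))\<^sup>2 \<le> 2 * (J x + J y - 2 * m)" if "x \<in> Y" "y \<in> Y" for x y
  proof -
    have h: "(1/2) \<odot> (x + y) \<in> Y" using that Yadd Ysc by blast
    have "J ((1/2) \<odot> (x + y)) = (nrm (x + y))\<^sup>2 / 4 - Re (g x + g y)"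
      using that YV by (simp add: J_def nrm_scale sc Yadd add power_mult_distrib norm_divide power2_eq_square add_divide_distrib)
    moreover have "(nrm (x + y))\<^sup>2 + (nrm (x - y))\<^sup>2 = 2 * (nrm x)\<^sup>2 + 2 * (nrm y)\<^sup>2"
      using that YV by (simp add: nrm_sq_add nrm_sq_diff)
    ultimately show ?thesis using mle[OF h] by (simp add: J_def)
  qed
  have "\<exists>M. \<forall>i\<ge>M. \<forall>j\<ge>M. nrm (X i - X j) < e" if "e > 0" for e
  proof -
    have "0 < e\<^sup>2 / 4" using that by simp
    then obtain M where M: "inverse (real (Suc M)) < e\<^sup>2 / 4"
      using reals_Archimedean by blast
    have "nrm (X i - X j) < e" if "i \<ge> M" "j \<ge> M" for i j
    proof -
      have inv: "inverse (real (Suc i)) \<le> inverse (real (Suc M))"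
        "inverse (real (Suc j)) \<le> inverse (real (Suc M))" using that by (auto simp: field_simps)
      have "J (X i) < m + e\<^sup>2 / 4" "J (X j) < m + e\<^sup>2 / 4"
        using X(2)[of i] X(2)[of j] order.strict_trans1[OF inv(1) M] order.strict_trans1[OF inv(2) M] by linarith+
      moreover have "(nrm (X i - X j))\<^sup>2 \<le> 2 * (J (X i) + J (X j) - 2 * m)" using par X by blast
      ultimately have "(nrm (X i - X j))\<^sup>2 < e\<^sup>2" by (simp add: field_simps)
      then show ?thesis using \<open>e > 0\<close> by (simp add: power2_less_imp_less)
    qed
    then show ?thesis by blast
  qed
  then obtain u where u: "u \<in> Y" "(\<lambda>n. nrm (X n - u)) \<longlonglongrightarrow> 0"
    using Y(3) X(1) unfolding complete_in_def by blast
  have Ju: "J u \<le> J w" if "w \<in> Y" for w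
  proof -
    have est: "J u \<le> J (X n) + (2 * nrm u + 2 * C) * nrm (X n - u)" for n
    proof -
      have "(nrm (X n))\<^sup>2 = (nrm u)\<^sup>2 + 2 * Re (a u (X n - u)) + (nrm (X n - u))\<^sup>2"
        using nrm_sq_add[of u "X n - u"] YV X u by simp
      moreover have "Re (a u (X n - u)) \<ge> - (nrm u * nrm (X n - u))"
        using Cauchy_Schwarz[of u "X n - u"] abs_Re_le_cmod[of "a u (X n - u)"] YV X u by fastforce
      moreover have "Re (g (X n)) - Re (g u) \<le> C * nrm (X n - u)"
        using bd[of "X n - u"] complex_Re_le_cmod[of "g (X n - u)"] Ydiff X u by (fastforce simp: gdiff)
      moreover have "(2 * nrm u + 2 * C) * nrm (X n - u) = 2 * (nrm u * nrm (X n - u)) + 2 * (C * nrm (X n - u))"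
        by (simp add: algebra_simps)
      ultimately show ?thesis using zero_le_power2[of "nrm (X n - u)"] unfolding J_def by linarith
    qed
    have "(\<lambda>n. m + inverse (real (Suc n)) + (2 * nrm u + 2 * C) * nrm (X n - u))
        \<longlonglongrightarrow> m + 0 + (2 * nrm u + 2 * C) * 0"
      by (intro tendsto_intros LIMSEQ_inverse_real_of_nat u)
    moreover have "J u \<le> m + inverse (real (Suc n)) + (2 * nrm u + 2 * C) * nrm (X n - u)" for n
      using est[of n] X(2)[of n] by linarith
    ultimately have "J u \<le> m" by (auto intro: LIMSEQ_le_const)
    then show ?thesis using mle[OF that] by linarith
  qed
  have "a u w = g w" if w: "w \<in> Y" for w
  proof -
    define d where "d = a u w - g w"
    have key: "2 * e * (cmod d)\<^sup>2 \<le> e\<^sup>2 * (cmod d)\<^sup>2 * (nrm w)\<^sup>2" for e :: real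
    proof -
      define t where "t = of_real (- e) * d"
      have "J u \<le> J (u + t \<odot> w)" using Ju Yadd Ysc u w by blast
      also have "\<dots> = J u + 2 * Re (cnj t * d) + (cmod t)\<^sup>2 * (nrm w)\<^sup>2"
        using u w YV Ysc
        by (simp add: J_def d_def nrm_sq_add nrm_scale add sc a_simps power_mult_distrib right_diff_distrib)
      also have "cnj t * d = - of_real (e * (cmod d)\<^sup>2)"
        unfolding t_def of_real_mult complex_norm_square by (simp add: mult.assoc mult.commute[of "cnj d"])
      also have "(cmod t)\<^sup>2 = e\<^sup>2 * (cmod d)\<^sup>2" by (simp add: t_def norm_mult power_mult_distrib)
      finally show ?thesis by simp
    qed
    have "d = 0"
    proof (rule ccontr)
      assume "d \<noteq> 0"
      then have "2 * e \<le> e\<^sup>2 * (nrm w)\<^sup>2" for e using key[of e] by (simp add: mult.commute mult.left_commute)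
      note small = this
      define p where "p = (nrm w)\<^sup>2 + 1"
      have p: "p > 0" unfolding p_def by (rule add_nonneg_pos) auto
      have "2 * (1 / p) * p\<^sup>2 \<le> (1 / p)\<^sup>2 * (nrm w)\<^sup>2 * p\<^sup>2"
        by (intro mult_right_mono small) simp
      then have "2 * p \<le> (nrm w)\<^sup>2" using p by (simp add: power2_eq_square)
      moreover have "(nrm w)\<^sup>2 = p - 1" by (simp add: p_def)
      ultimately show False using p by linarith
    qed
    then show ?thesis by (simp add: d_def)
  qed
  then show ?thesis using u(1) by blast
qed

lemma orthogonal_projection_exists:
  assumes "subspace Y" "Y \<subseteq> V" "complete_in Y" "x \<in> V"
  shows "\<exists>y\<in>Y. \<forall>w\<in>Y. a (x - y) w = 0"
proof -
  have "\<exists>y\<in>Y. \<forall>w\<in>Y. a y w = a x w"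
    using assms Cauchy_Schwarz by (intro Riesz_representation[where C = "nrm x"]) (auto simp: a_simps subset_iff)
  then show ?thesis using assms by (metis a_diff_left eq_iff_diff_eq_0 subset_iff)
qed

end

section \<open>Bounded self-adjoint operators and their resolvents\<close>

locale sa_operator = cinner_space scale V a
  for scale :: "complex \<Rightarrow> 'h::ab_group_add \<Rightarrow> 'h"  (infixr \<open>\<odot>\<close> 75) and V a +
  fixes T :: "'h \<Rightarrow> 'h" and L :: real
  assumes complete_V: "complete_in V"
    and T_V [simp, intro]: "x \<in> V \<Longrightarrow> T x \<in> V"
    and T_add: "x \<in> V \<Longrightarrow> y \<in> V \<Longrightarrow> T (x + y) = T x + T y"
    and T_scale: "x \<in> V \<Longrightarrow> T (c \<odot> x) = c \<odot> T x"
    and T_bound: "x \<in> V \<Longrightarrow> nrm (T x) \<le> L * nrm x"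
    and T_sym: "x \<in> V \<Longrightarrow> y \<in> V \<Longrightarrow> a (T x) y = a x (T y)"
begin

lemma T_diff: "x \<in> V \<Longrightarrow> y \<in> V \<Longrightarrow> T (x - y) = T x - T y"
  using T_add[of x "(-1) \<odot> y"] T_scale[of y "-1"] by simp

lemma T_zero [simp]: "T 0 = 0"
  using T_scale[of 0 0] by simp

text \<open>The operator is self-adjoint, so a lower bound on \<open>z - T\<close> suffices for \<open>z\<close> to lie in the
  resolvent set; see \<open>shift_surj\<close>.\<close>

definition reg :: "complex \<Rightarrow> bool" where
  "reg z \<longleftrightarrow> (\<exists>c>0. \<forall>x\<in>V. c * nrm x \<le> nrm (z \<odot> x - T x))"

definition R :: "complex \<Rightarrow> 'h \<Rightarrow> 'h" where
  "R z = inv_into V (\<lambda>x. z \<odot> x - T x)"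

lemma nrm_shift_cnj:
  assumes x: "x \<in> V" shows "nrm (cnj z \<odot> x - T x) = nrm (z \<odot> x - T x)"
proof -
  have "Im (a x (T x)) = 0" using a_cnj[of x "T x"] T_sym[of x x] x by (simp add: complex_eq_iff)
  then have "(nrm (cnj z \<odot> x - T x))\<^sup>2 = (nrm (z \<odot> x - T x))\<^sup>2"
    using x by (simp add: nrm_sq_diff nrm_scale a_simps)
  then show ?thesis using x by (simp add: power2_eq_iff_nonneg)
qed

lemma nrm_shift_Im:
  assumes x: "x \<in> V" shows "\<bar>Im z\<bar> * nrm x \<le> nrm (z \<odot> x - T x)"
proof (cases "x = 0")
  case False
  then have nx: "nrm x > 0" using x by (metis less_eq_real_def nrm_eq_0 nrm_nonneg)
  have "Im (a (T x) x) = 0" using a_cnj[of x "T x"] T_sym[of x x] x by (simp add: complex_eq_iff)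
  then have "Im (a (z \<odot> x - T x) x) = Im z * (nrm x)\<^sup>2"
    using x by (simp add: a_simps a_self flip: of_real_power)
  then have "\<bar>Im z\<bar> * (nrm x)\<^sup>2 \<le> cmod (a (z \<odot> x - T x) x)"
    using abs_Im_le_cmod[of "a (z \<odot> x - T x) x"] by (simp add: abs_mult)
  also have "\<dots> \<le> nrm (z \<odot> x - T x) * nrm x" using x by (intro Cauchy_Schwarz) auto
  finally show ?thesis using nx by (simp add: power2_eq_square)
qed simp

text \<open>For a self-adjoint operator a lower bound on \<open>z - T\<close> already gives surjectivity: the range is
  complete, and a vector orthogonal to it is annihilated by \<open>cnj z - T\<close>, which has the same
  lower bound.\<close>

lemma shift_surj:
  assumes z: "reg z" and x: "x \<in> V"
  shows "\<exists>y\<in>V. z \<odot> y - T y = x"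
proof -
  obtain c where c: "c > 0" "\<And>x. x \<in> V \<Longrightarrow> c * nrm x \<le> nrm (z \<odot> x - T x)"
    using z unfolding reg_def by blast
  define S where "S y = z \<odot> y - T y" for y
  have SV: "y \<in> V \<Longrightarrow> S y \<in> V" for y by (auto simp: S_def)
  have Sadd: "S (y + w) = S y + S w" if "y \<in> V" "w \<in> V" for y w
    using that by (simp add: S_def T_add scale_right_distrib)
  have Sdiff: "S (y - w) = S y - S w" if "y \<in> V" "w \<in> V" for y w
    using that by (simp add: S_def T_diff scale_right_diff_distrib)
  have Ssc: "S (k \<odot> y) = k \<odot> S y" if "y \<in> V" for y k
    using that by (simp add: S_def T_scale scale_right_diff_distrib mult.commute)
  have sub: "subspace (S ` V)"
    unfolding subspace_def
  proof (intro conjI ballI allI)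
    show "0 \<in> S ` V" by (rule image_eqI[of _ _ 0]) (auto simp: S_def)
    show "u + v \<in> S ` V" if "u \<in> S ` V" "v \<in> S ` V" for u v
      using that by (auto simp flip: Sadd)
    show "k \<odot> u \<in> S ` V" if "u \<in> S ` V" for u k
      using that by (auto simp flip: Ssc)
  qed
  have comp: "complete_in (S ` V)"
    unfolding complete_in_def
  proof (intro allI impI, elim conjE)
    fix X :: "nat \<Rightarrow> 'h"
    assume X: "\<forall>n. X n \<in> S ` V" and cau: "\<forall>e>0. \<exists>M. \<forall>m\<ge>M. \<forall>n\<ge>M. nrm (X m - X n) < e"
    have "\<forall>n. \<exists>y. y \<in> V \<and> X n = S y" using X by blast
    from choice[OF this] obtain Y where Y: "\<And>n. Y n \<in> V" "\<And>n. X n = S (Y n)" by auto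
    have le: "nrm (Y m - Y n) \<le> nrm (X m - X n) / c" for m n
    proof -
      have "c * nrm (Y m - Y n) \<le> nrm (S (Y m - Y n))" using c(2)[of "Y m - Y n"] Y by (simp add: S_def)
      also have "S (Y m - Y n) = X m - X n" using Y by (simp add: Sdiff)
      finally show ?thesis using c(1) by (simp add: field_simps)
    qed
    have "\<exists>M. \<forall>m\<ge>M. \<forall>n\<ge>M. nrm (Y m - Y n) < e" if "e > 0" for e
    proof -
      have "e * c > 0" using that c by simp
      then obtain M where "\<forall>m\<ge>M. \<forall>n\<ge>M. nrm (X m - X n) < e * c" using cau by blast
      then have "\<forall>m\<ge>M. \<forall>n\<ge>M. nrm (X m - X n) / c < e" using c(1) by (simp add: divide_less_eq)
      then show ?thesis using le by (meson le_less_trans)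
    qed
    then obtain l where l: "l \<in> V" "(\<lambda>n. nrm (Y n - l)) \<longlonglongrightarrow> 0"
      using complete_V Y(1) unfolding complete_in_def by blast
    have bound: "nrm (X n - S l) \<le> (cmod z + L) * nrm (Y n - l)" for n
    proof -
      have "nrm (X n - S l) = nrm (z \<odot> (Y n - l) - T (Y n - l))"
        using Sdiff[of "Y n" l] Y l by (simp add: S_def)
      also have "\<dots> \<le> nrm (z \<odot> (Y n - l)) + nrm (T (Y n - l))"
        using Y l by (intro nrm_triangle_diff) auto
      also have "\<dots> \<le> (cmod z + L) * nrm (Y n - l)"
        using T_bound[of "Y n - l"] Y l by (simp add: nrm_scale distrib_right)
      finally show ?thesis .
    qed
    have "(\<lambda>n. nrm (X n - S l)) \<longlonglongrightarrow> 0"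
    proof (rule tendsto_sandwich[of "\<lambda>_. 0"])
      show "(\<lambda>n. (cmod z + L) * nrm (Y n - l)) \<longlonglongrightarrow> 0"
        by (rule tendsto_mult_right_zero[OF l(2)])
      show "\<forall>\<^sub>F n in sequentially. 0 \<le> nrm (X n - S l)"
        by (rule always_eventually) (use Y l SV in auto)
      show "\<forall>\<^sub>F n in sequentially. nrm (X n - S l) \<le> (cmod z + L) * nrm (Y n - l)"
        by (rule always_eventually) (use bound in blast)
    qed simp
    then show "\<exists>l\<in>S ` V. (\<lambda>n. nrm (X n - l)) \<longlonglongrightarrow> 0" using l by blast
  qed
  obtain y where y: "y \<in> V" "\<And>w. w \<in> V \<Longrightarrow> a (x - S y) (S w) = 0"
    using orthogonal_projection_exists[OF sub _ comp x] SV by auto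
  define d where "d = x - S y"
  have d: "d \<in> V" using x y SV by (simp add: d_def)
  have "cnj z \<odot> d - T d = 0"
  proof (rule eqI_form)
    fix v assume v: "v \<in> V"
    have "a (cnj z \<odot> d - T d) v = a d (S v)" using d v by (simp add: S_def a_simps T_sym)
    then show "a (cnj z \<odot> d - T d) v = a 0 v" using y(2)[OF v] v by (simp add: d_def)
  qed (use d in auto)
  then have "nrm (z \<odot> d - T d) = 0" using nrm_shift_cnj[OF d, of z] by simp
  then have "c * nrm d \<le> 0" using c(2)[OF d] by simp
  then have "nrm d = 0" using c(1) d nrm_nonneg[of d] by (smt (verit) mult_pos_pos)
  then have "S y = x" using d by (simp add: d_def)
  then show ?thesis using y(1) by (auto simp: S_def)
qed

lemma shift_inj:
  assumes "reg z" "x \<in> V" "y \<in> V" "z \<odot> x - T x = z \<odot> y - T y" shows "x = y"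
proof -
  obtain c where c: "c > 0" "\<And>x. x \<in> V \<Longrightarrow> c * nrm x \<le> nrm (z \<odot> x - T x)"
    using assms(1) unfolding reg_def by blast
  have "z \<odot> (x - y) - T (x - y) = 0"
    using assms by (simp add: T_diff scale_right_diff_distrib algebra_simps)
  then have "c * nrm (x - y) \<le> 0" using c(2)[of "x - y"] assms by simp
  then have "nrm (x - y) = 0" using c(1) assms nrm_nonneg[of "x - y"] by (smt (verit) mult_pos_pos V_diff)
  then show ?thesis using assms by simp
qed

lemma R_V [simp, intro]: "reg z \<Longrightarrow> x \<in> V \<Longrightarrow> R z x \<in> V"
  and R_eq: "reg z \<Longrightarrow> x \<in> V \<Longrightarrow> z \<odot> R z x - T (R z x) = x"
proof -
  assume "reg z" "x \<in> V"
  then obtain y where y: "y \<in> V" "x = z \<odot> y - T y" using shift_surj[of z x] by blast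
  have im: "x \<in> (\<lambda>x. z \<odot> x - T x) ` V" unfolding y(2) using y(1) by (rule imageI)
  show "R z x \<in> V" unfolding R_def by (rule inv_into_into[OF im])
  show "z \<odot> R z x - T (R z x) = x" unfolding R_def using f_inv_into_f[OF im] .
qed

lemma R_unique: "reg z \<Longrightarrow> y \<in> V \<Longrightarrow> z \<odot> y - T y = x \<Longrightarrow> R z x = y"
  by (rule shift_inj[of z]) (auto simp: R_eq)

lemma T_R: "reg z \<Longrightarrow> x \<in> V \<Longrightarrow> T (R z x) = z \<odot> R z x - x"
  using R_eq[of z x] by (simp add: algebra_simps)

lemma R_bound:
  assumes "\<forall>x\<in>V. c * nrm x \<le> nrm (z \<odot> x - T x)" "c > 0" "x \<in> V"
  shows "nrm (R z x) \<le> nrm x / c"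
proof -
  have "reg z" using assms unfolding reg_def by blast
  then show ?thesis using assms(1)[rule_format, of "R z x"] assms R_eq[of z x] by (simp add: field_simps)
qed

lemma R_add: "reg z \<Longrightarrow> x \<in> V \<Longrightarrow> y \<in> V \<Longrightarrow> R z (x + y) = R z x + R z y"
  by (rule R_unique) (auto simp: T_add T_R scale_right_distrib)

lemma R_scale: "reg z \<Longrightarrow> x \<in> V \<Longrightarrow> R z (c \<odot> x) = c \<odot> R z x"
  by (rule R_unique) (auto simp: T_scale T_R scale_right_diff_distrib mult.commute)

lemma R_diff: "reg z \<Longrightarrow> x \<in> V \<Longrightarrow> y \<in> V \<Longrightarrow> R z (x - y) = R z x - R z y"
  by (rule R_unique) (auto simp: T_diff T_R scale_right_diff_distrib)

lemma resolvent_identity: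
  assumes "reg z" "reg w" "x \<in> V"
  shows "R z x - R w x = (w - z) \<odot> R z (R w x)"
proof -
  have "R w x + (w - z) \<odot> R z (R w x) = R z x"
  proof (rule R_unique[symmetric, OF assms(1)])
    show "z \<odot> (R w x + (w - z) \<odot> R z (R w x)) - T (R w x + (w - z) \<odot> R z (R w x)) = x"
      using assms
      by (simp add: T_add T_scale T_R scale_right_distrib scale_right_diff_distrib mult.commute)
         (simp add: scale_left_diff_distrib)
  qed (use assms in auto)
  then show ?thesis by (simp add: algebra_simps)
qed

lemma R_near:
  assumes "\<forall>x\<in>V. c * nrm x \<le> nrm (z \<odot> x - T x)" "c > 0" "dist w z \<le> c / 2"
  shows "\<forall>x\<in>V. c / 2 * nrm x \<le> nrm (w \<odot> x - T x)"
proof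
  fix x assume x: "x \<in> V"
  have eq: "z \<odot> x - T x = (w \<odot> x - T x) - (w - z) \<odot> x" by (simp add: scale_left_diff_distrib)
  have "nrm (z \<odot> x - T x) \<le> nrm (w \<odot> x - T x) + nrm ((w - z) \<odot> x)"
    unfolding eq using x by (intro nrm_triangle_diff) auto
  then have "nrm (z \<odot> x - T x) \<le> nrm (w \<odot> x - T x) + cmod (w - z) * nrm x"
    using x by (simp add: nrm_scale)
  moreover have "cmod (w - z) * nrm x \<le> c / 2 * nrm x"
    using assms x by (intro mult_right_mono) (auto simp: dist_norm)
  moreover have "c * nrm x \<le> nrm (z \<odot> x - T x)" using assms x by blast
  ultimately show "c / 2 * nrm x \<le> nrm (w \<odot> x - T x)" by (simp add: field_simps)
qed

lemma open_reg: "open {z. reg z}"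
  unfolding open_dist
proof
  fix z assume "z \<in> {z. reg z}"
  then obtain c where c: "\<forall>x\<in>V. c * nrm x \<le> nrm (z \<odot> x - T x)" "c > 0"
    unfolding reg_def by blast
  have "reg w" if "dist w z < c / 2" for w
    unfolding reg_def using R_near[OF c, of w] that c(2) by (intro exI[of _ "c/2"]) auto
  then show "\<exists>e>0. \<forall>y. dist y z < e \<longrightarrow> y \<in> {z. reg z}" using c(2) by (intro exI[of _ "c/2"]) auto
qed

lemma form_R_deriv:
  assumes z: "reg z" and x: "x \<in> V" and v: "v \<in> V"
  shows "((\<lambda>w. a (R w x) v) has_field_derivative - a (R z (R z x)) v) (at z)"
proof -
  obtain c where c: "\<forall>x\<in>V. c * nrm x \<le> nrm (z \<odot> x - T x)" "c > 0"
    using z unfolding reg_def by blast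
  define y where "y = R z x"
  have y: "y \<in> V" using x z by (simp add: y_def)
  have near: "reg w" "\<forall>x\<in>V. c / 2 * nrm x \<le> nrm (w \<odot> x - T x)" if "dist w z \<le> c / 2" for w
  proof -
    show "\<forall>x\<in>V. c / 2 * nrm x \<le> nrm (w \<odot> x - T x)" using R_near[OF c that] .
    then show "reg w" unfolding reg_def using c(2) by (intro exI[of _ "c/2"]) auto
  qed
  have est: "cmod (a (R w y) v - a (R z y) v) \<le> dist w z * (nrm y * 2 / c\<^sup>2 * nrm v)"
    if w: "dist w z \<le> c / 2" for w
  proof -
    have "nrm (R w (R z y)) \<le> nrm (R z y) / (c/2)"
      using near[OF w] c y z by (intro R_bound) auto
    also have "\<dots> \<le> (nrm y / c) / (c/2)"
      using c y by (intro divide_right_mono R_bound) auto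
    finally have n: "nrm (R w (R z y)) \<le> nrm y * 2 / c\<^sup>2" by (simp add: power2_eq_square)
    have "a (R w y) v - a (R z y) v = a ((z - w) \<odot> R w (R z y)) v"
      using resolvent_identity[OF near(1)[OF w] z y] near(1)[OF w] z y v by (simp flip: a_diff_left)
    also have "cmod \<dots> = dist w z * cmod (a (R w (R z y)) v)"
      using near(1)[OF w] z y v by (simp add: a_simps norm_mult dist_norm norm_minus_commute)
    also have "\<dots> \<le> dist w z * (nrm (R w (R z y)) * nrm v)"
      using near(1)[OF w] z y v by (intro mult_left_mono Cauchy_Schwarz) auto
    also have "\<dots> \<le> dist w z * (nrm y * 2 / c\<^sup>2 * nrm v)"
      using n v by (intro mult_left_mono mult_right_mono) auto
    finally show ?thesis .
  qed
  have ev: "\<forall>\<^sub>F w in at z. dist w z \<le> c / 2"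
    using c(2) by (auto simp: eventually_at intro!: exI[of _ "c/2"])
  have "((\<lambda>w. a (R w y) v - a (R z y) v) \<longlongrightarrow> 0) (at z)"
  proof (rule Lim_null_comparison)
    show "\<forall>\<^sub>F w in at z. norm (a (R w y) v - a (R z y) v) \<le> dist w z * (nrm y * 2 / c\<^sup>2 * nrm v)"
      using ev by eventually_elim (rule est)
    have "((\<lambda>w. dist w z * (nrm y * 2 / c\<^sup>2 * nrm v)) \<longlongrightarrow> dist z z * (nrm y * 2 / c\<^sup>2 * nrm v)) (at z)"
      by (intro tendsto_intros)
    then show "((\<lambda>w. dist w z * (nrm y * 2 / c\<^sup>2 * nrm v)) \<longlongrightarrow> 0) (at z)" by simp
  qed
  then have lim: "((\<lambda>w. - a (R w y) v) \<longlongrightarrow> - a (R z y) v) (at z)"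
    by (intro tendsto_minus) (simp add: Lim_null[symmetric])
  show ?thesis
    unfolding has_field_derivative_iff y_def[symmetric]
  proof (rule Lim_transform_eventually[OF lim])
    show "\<forall>\<^sub>F w in at z. - a (R w y) v = (a (R w x) v - a y v) / (w - z)"
      using ev eventually_neq_at_within[of z]
    proof eventually_elim
      case (elim w)
      have "a (R w x) v - a y v = a ((z - w) \<odot> R w y) v"
        using resolvent_identity[OF near(1)[OF elim(1)] z x] near(1)[OF elim(1)] x y v
        by (simp add: y_def flip: a_diff_left)
      then show ?case using near(1)[OF elim(1)] y v elim(2) by (simp add: a_simps field_simps)
    qed
  qed
qed

lemma form_R_holomorphic: "x \<in> V \<Longrightarrow> v \<in> V \<Longrightarrow> (\<lambda>z. a (R z x) v) holomorphic_on {z. reg z}"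
  unfolding holomorphic_on_open[OF open_reg] using form_R_deriv by blast

text \<open>The lower bound of \<open>z - T\<close> is a \<open>1\<close>-Lipschitz function of \<open>z\<close>, so it attains its minimum
  on a compact set.\<close>

lemma uniform_lower_bound:
  assumes "compact C" "\<And>z. z \<in> C \<Longrightarrow> reg z"
  shows "\<exists>m>0. \<forall>z\<in>C. \<forall>x\<in>V. m * nrm x \<le> nrm (z \<odot> x - T x)"
proof -
  have "\<forall>z\<in>C. \<exists>c>0. \<forall>x\<in>V. c * nrm x \<le> nrm (z \<odot> x - T x)" using assms(2) unfolding reg_def by blast
  then obtain c where c: "\<And>z. z \<in> C \<Longrightarrow> c z > 0"
    "\<And>z. z \<in> C \<Longrightarrow> \<forall>x\<in>V. c z * nrm x \<le> nrm (z \<odot> x - T x)" by metis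
  have "C \<subseteq> (\<Union>z\<in>C. ball z (c z / 2))" using c(1) by force
  then obtain D where D: "D \<subseteq> C" "finite D" "C \<subseteq> (\<Union>z\<in>D. ball z (c z / 2))"
    using compactE_image[OF assms(1), of C "\<lambda>z. ball z (c z / 2)"] by (metis open_ball)
  define m where "m = Min (insert 1 ((\<lambda>z. c z / 2) ` D))"
  have "m > 0" unfolding m_def using D c(1) by (subst Min_gr_iff) auto
  moreover have "m \<le> c z / 2" if "z \<in> D" for z
    unfolding m_def using D that by (intro Min_le) auto
  ultimately have m: "m > 0" "\<And>z. z \<in> D \<Longrightarrow> m \<le> c z / 2" by blast+
  have "m * nrm x \<le> nrm (z \<odot> x - T x)" if "z \<in> C" "x \<in> V" for z x
  proof -
    from subsetD[OF D(3) that(1)] obtain w where w: "w \<in> D" "dist w z < c w / 2" by auto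
    then have "c w / 2 * nrm x \<le> nrm (z \<odot> x - T x)"
      using R_near[of "c w" w z] c D that by (auto simp: dist_commute)
    then show ?thesis using m(2)[OF w(1)] that
      by (meson mult_right_mono nrm_nonneg order_trans)
  qed
  then show ?thesis using m(1) by blast
qed

subsection \<open>The Riesz projection at an isolated point of the spectrum\<close>

text \<open>The Riesz projection is used only through its scalar form \<open>a (E x) v\<close>. That \<open>E\<close> maps into
  the eigenspace, rather than into something larger, is where self-adjointness enters. With
  \<open>B = T - \<gamma>\<close>, the number \<open>a (B\<^sup>2 E x) v\<close> is the integral of \<open>(z - \<gamma>)\<^sup>2 a (R z x) v\<close> up to an
  entire integrand, over a circle of any small radius \<open>\<rho>\<close>. Replacing \<open>(z - \<gamma>)\<^sup>2\<close> by
  \<open>(z - \<gamma>)\<^sup>2 - \<rho>\<^sup>2\<close>, whose modulus on the circle is \<open>2 \<rho> \<bar>Im z\<bar>\<close>, compensates the bound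
  \<open>1 / \<bar>Im z\<bar>\<close> of the resolvent, and the remaining term \<open>\<rho>\<^sup>2 a (E x) v\<close> vanishes in the limit.\<close>

context
  fixes \<gamma> :: complex and r :: real and E :: "'h \<Rightarrow> 'h"
  assumes real: "Im \<gamma> = 0" and r: "r > 0"
    and reg: "\<And>z. z \<in> cball \<gamma> r \<Longrightarrow> z \<noteq> \<gamma> \<Longrightarrow> reg z"
    and E_V: "\<And>x. x \<in> V \<Longrightarrow> E x \<in> V"
    and E_form: "\<And>x v. x \<in> V \<Longrightarrow> v \<in> V \<Longrightarrow>
      a (E x) v = contour_integral (circlepath \<gamma> r) (\<lambda>z. a (R z x) v) / (2 * of_real pi * \<i>)"
begin

lemma R_eigenvector:
  assumes "x \<in> V" "T x = \<gamma> \<odot> x" "reg z" "z \<noteq> \<gamma>" shows "R z x = (1 / (z - \<gamma>)) \<odot> x"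
proof (rule R_unique)
  have "z \<odot> (1 / (z - \<gamma>)) \<odot> x - T ((1 / (z - \<gamma>)) \<odot> x) = (z * (1 / (z - \<gamma>)) - (1 / (z - \<gamma>)) * \<gamma>) \<odot> x"
    using assms by (simp add: T_scale scale_left_diff_distrib)
  also have "z * (1 / (z - \<gamma>)) - (1 / (z - \<gamma>)) * \<gamma> = 1"
    using assms(4) by (simp add: mult.commute flip: diff_divide_distrib)
  finally show "z \<odot> (1 / (z - \<gamma>)) \<odot> x - T ((1 / (z - \<gamma>)) \<odot> x) = x" by simp
qed (use assms in auto)

lemma Riesz_projection_eigenvector:
  assumes "x \<in> V" "T x = \<gamma> \<odot> x" shows "E x = x"
proof (rule eqI_form)
  fix v assume v: "v \<in> V"
  have "contour_integral (circlepath \<gamma> r) (\<lambda>z. a (R z x) v)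
      = contour_integral (circlepath \<gamma> r) (\<lambda>z. a x v / (z - \<gamma>))"
  proof (rule contour_integral_eq)
    fix z assume "z \<in> path_image (circlepath \<gamma> r)"
    then have z: "z \<in> cball \<gamma> r" "z \<noteq> \<gamma>" using r by (auto simp: path_image_circlepath)
    then show "a (R z x) v = a x v / (z - \<gamma>)"
      using R_eigenvector[OF assms reg] assms v by (simp add: a_simps)
  qed
  also have "\<dots> = 2 * of_real pi * \<i> * a x v"
    by (rule contour_integral_unique, rule Cauchy_integral_circlepath[where f = "\<lambda>_. a x v"])
       (use r in \<open>auto intro: holomorphic_intros continuous_intros\<close>)
  finally show "a (E x) v = a x v" using assms v by (simp add: E_form)
qed (use assms E_V in auto)

lemma Riesz_projection_range:
  assumes x: "x \<in> V" shows "T (E x) = \<gamma> \<odot> E x"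
proof -
  define B where "B y = T y - \<gamma> \<odot> y" for y
  have BV: "y \<in> V \<Longrightarrow> B y \<in> V" for y by (simp add: B_def)
  have Bdiff: "B (y - w) = B y - B w" if "y \<in> V" "w \<in> V" for y w
    using that by (simp add: B_def T_diff scale_right_diff_distrib)
  have Bsc: "B (k \<odot> y) = k \<odot> B y" if "y \<in> V" for y k
    using that by (simp add: B_def T_scale scale_right_diff_distrib mult.commute)
  have \<gamma>: "cnj \<gamma> = \<gamma>" using real by (simp add: complex_eq_iff)
  have Bsym: "a (B y) w = a y (B w)" if "y \<in> V" "w \<in> V" for y w
    using that by (simp add: B_def a_simps T_sym \<gamma>)
  have "B (B (E x)) = 0"
  proof (rule eqI_form)
    fix v assume v: "v \<in> V"
    define f where "f z = a (R z x) v" for z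
    define h where "h z = a (R z x) (B (B v))" for z
    let ?S = "insert \<gamma> {z. reg z}"
    have sub: "ball \<gamma> r \<subseteq> ?S" using reg by auto
    have "open ?S"
    proof -
      have "?S = {z. reg z} \<union> ball \<gamma> r" using sub r by auto
      then show ?thesis using open_reg by auto
    qed
    have hol: "(\<lambda>z. a (R z x) w) holomorphic_on ?S - {\<gamma>}" if "w \<in> V" for w
      by (rule holomorphic_on_subset[OF form_R_holomorphic]) (use x that in auto)
    have cb: "cball \<gamma> r \<subseteq> ?S" using reg by auto
    define c where "c = contour_integral (circlepath \<gamma> r) f"
    define H where "H = contour_integral (circlepath \<gamma> r) h"
    have B2: "h z = (z - \<gamma>)\<^sup>2 * f z - (z - \<gamma>) * a x v - a (B x) v" if z: "reg z" for z
    proof -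
      have BR: "B (R z x) = (z - \<gamma>) \<odot> R z x - x"
        unfolding B_def T_R[OF z x] scale_left_diff_distrib by (simp add: algebra_simps)
      have "B (B (R z x)) = (z - \<gamma>) \<odot> B (R z x) - B x"
        by (subst BR) (use z x in \<open>simp add: Bdiff Bsc\<close>)
      also have "\<dots> = ((z - \<gamma>)\<^sup>2) \<odot> R z x - (z - \<gamma>) \<odot> x - B x"
        unfolding BR by (simp add: scale_right_diff_distrib power2_eq_square)
      finally show ?thesis
        using z x v BV unfolding h_def f_def by (simp add: a_simps flip: Bsym)
    qed
    have bound: "cmod H \<le> \<rho> * (2 * pi * (2 * \<rho> * (nrm x * nrm v) + \<rho> * cmod (a x v) + cmod (a (B x) v)) + \<rho> * cmod c)"
      if \<rho>: "0 < \<rho>" "\<rho> \<le> r" for \<rho>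
    proof -
      note ch = contour_integral_circlepath_eq[OF \<open>open ?S\<close> hol[of "B (B v)", folded h_def, OF BV[OF BV[OF v]]] \<rho> cb]
      note cf = contour_integral_circlepath_eq[OF \<open>open ?S\<close> hol[OF v, folded f_def] \<rho> cb]
      have "((\<lambda>z. h z - of_real (\<rho>\<^sup>2) * f z) has_contour_integral (H - of_real (\<rho>\<^sup>2) * c)) (circlepath \<gamma> \<rho>)"
        using ch cf unfolding H_def c_def
        by (intro has_contour_integral_diff has_contour_integral_lmul)
           (auto simp: has_contour_integral_integral)
      then have "cmod (H - of_real (\<rho>\<^sup>2) * c)
          \<le> (2 * \<rho> * (nrm x * nrm v) + \<rho> * cmod (a x v) + cmod (a (B x) v)) * (2 * pi * \<rho>)"
      proof (rule has_contour_integral_bound_circlepath)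
        fix z assume z: "cmod (z - \<gamma>) = \<rho>"
        then have "z \<noteq> \<gamma>" "z \<in> cball \<gamma> r" using \<rho> by (auto simp: dist_norm norm_minus_commute)
        then have rz: "reg z" using reg by blast
        define u where "u = z - \<gamma>"
        have imu: "Im u = Im z" using real by (simp add: u_def)
        \<comment> \<open>On the circle \<open>\<rho>\<^sup>2 = u cnj u\<close>, and \<open>u - cnj u\<close> is twice the imaginary part of \<open>z\<close>.\<close>
        have "u\<^sup>2 - of_real (\<rho>\<^sup>2) = u * (u - cnj u)"
          using z complex_norm_square[of u] by (simp add: power2_eq_square right_diff_distrib flip: u_def)
        also have "u - cnj u = 2 * \<i> * of_real (Im z)" using imu by (simp add: complex_eq_iff)
        finally have "cmod (u\<^sup>2 - of_real (\<rho>\<^sup>2)) = 2 * \<rho> * \<bar>Im z\<bar>"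
          using z by (simp add: norm_mult u_def)
        moreover have "\<bar>Im z\<bar> * cmod (f z) \<le> nrm x * nrm v"
        proof -
          have "\<bar>Im z\<bar> * cmod (f z) \<le> \<bar>Im z\<bar> * (nrm (R z x) * nrm v)"
            unfolding f_def using rz x v by (intro mult_left_mono Cauchy_Schwarz) auto
          also have "\<dots> = (\<bar>Im z\<bar> * nrm (R z x)) * nrm v" by simp
          also have "\<dots> \<le> nrm x * nrm v"
            using nrm_shift_Im[of "R z x" z] R_eq[OF rz x] rz x v by (intro mult_right_mono) auto
          finally show ?thesis .
        qed
        moreover define p where "p = (u\<^sup>2 - of_real (\<rho>\<^sup>2)) * f z"
        ultimately have p: "cmod p \<le> 2 * \<rho> * (nrm x * nrm v)"
          using \<rho> by (simp add: norm_mult mult.assoc)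
        have eq: "h z - of_real (\<rho>\<^sup>2) * f z = p - u * a x v - a (B x) v"
          using B2[OF rz] by (simp add: u_def p_def algebra_simps)
        have "cmod (u * a x v) = \<rho> * cmod (a x v)" using z by (simp add: norm_mult u_def)
        then show "cmod (h z - of_real (\<rho>\<^sup>2) * f z)
            \<le> 2 * \<rho> * (nrm x * nrm v) + \<rho> * cmod (a x v) + cmod (a (B x) v)"
          using norm_triangle_ineq4[of "p - u * a x v" "a (B x) v"]
            norm_triangle_ineq4[of p "u * a x v"] p unfolding eq by linarith
      qed (use \<rho> x v in auto)
      moreover have "cmod H \<le> cmod (H - of_real (\<rho>\<^sup>2) * c) + \<rho>\<^sup>2 * cmod c"
        using norm_triangle_ineq[of "H - of_real (\<rho>\<^sup>2) * c" "of_real (\<rho>\<^sup>2) * c"] by (simp add: norm_mult norm_power)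
      ultimately show ?thesis by (simp add: algebra_simps power2_eq_square)
    qed
    have "H = 0"
    proof -
      have "((\<lambda>\<rho>. \<rho> * (2 * pi * (2 * \<rho> * (nrm x * nrm v) + \<rho> * cmod (a x v) + cmod (a (B x) v)) + \<rho> * cmod c))
          \<longlongrightarrow> 0 * (2 * pi * (2 * 0 * (nrm x * nrm v) + 0 * cmod (a x v) + cmod (a (B x) v)) + 0 * cmod c)) (at_right 0)"
        by (intro tendsto_intros)
      moreover have "\<forall>\<^sub>F \<rho> in at_right 0. cmod H \<le> \<rho> * (2 * pi * (2 * \<rho> * (nrm x * nrm v) + \<rho> * cmod (a x v) + cmod (a (B x) v)) + \<rho> * cmod c)"
        using eventually_at_right_real[OF r] by eventually_elim (use bound in auto)
      ultimately have "cmod H \<le> 0" by (intro tendsto_lowerbound[of _ 0]) auto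
      then show ?thesis by simp
    qed
    moreover have "h = (\<lambda>z. a (R z x) (B (B v)))" by (simp add: h_def fun_eq_iff)
    ultimately show "a (B (B (E x))) v = a 0 v"
      using x v BV E_V by (simp add: Bsym E_form H_def)
  qed (use BV E_V x in auto)
  then have "a (B (E x)) (B (E x)) = 0" using x BV E_V by (simp add: Bsym)
  then have "B (E x) = 0" using x BV E_V by (metis nrm_def nrm_eq_0 real_sqrt_zero zero_complex.simps(1))
  then show ?thesis by (simp add: B_def)
qed

text \<open>The vector \<open>e = E x\<close> lies in the eigenspace, so \<open>(z - \<gamma>) a (R z x) e = a x e = 0\<close> on the
  circle, and integration gives \<open>a (E x) (E x) = 0\<close>.\<close>

lemma Riesz_projection_orthogonal:
  assumes x: "x \<in> V" and orth: "\<And>u. u \<in> V \<Longrightarrow> T u = \<gamma> \<odot> u \<Longrightarrow> a x u = 0"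
  shows "E x = 0"
proof -
  let ?e = "E x"
  have e: "?e \<in> V" "T ?e = \<gamma> \<odot> ?e" using x E_V Riesz_projection_range by auto
  have \<gamma>: "cnj \<gamma> = \<gamma>" using real by (simp add: complex_eq_iff)
  have "contour_integral (circlepath \<gamma> r) (\<lambda>z. a (R z x) ?e) = contour_integral (circlepath \<gamma> r) (\<lambda>z. 0)"
  proof (rule contour_integral_eq)
    fix z assume "z \<in> path_image (circlepath \<gamma> r)"
    then have z: "z \<in> cball \<gamma> r" "z \<noteq> \<gamma>" using r by (auto simp: path_image_circlepath)
    then have rz: "reg z" by (rule reg)
    have "0 = a x ?e" using orth e by simp
    also have "\<dots> = a (z \<odot> R z x - T (R z x)) ?e" using R_eq[OF rz x] by simp
    also have "\<dots> = (z - \<gamma>) * a (R z x) ?e"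
      using e rz x by (simp add: a_simps T_sym \<gamma> left_diff_distrib)
    finally show "a (R z x) ?e = 0" using z by simp
  qed
  then have "a ?e ?e = 0" using E_form[OF x e(1)] by simp
  then show ?thesis using e by (metis nrm_def nrm_eq_0 real_sqrt_zero zero_complex.simps(1))
qed

end

end

section \<open>Symmetric operators of finite rank\<close>

context cinner_space
begin

definition orthonormal :: "'h set \<Rightarrow> bool" where
  "orthonormal S \<longleftrightarrow> S \<subseteq> V \<and> (\<forall>e\<in>S. \<forall>f\<in>S. a e f = (if e = f then 1 else 0))"

lemma orthonormal_V: "orthonormal S \<Longrightarrow> e \<in> S \<Longrightarrow> e \<in> V"
  by (auto simp: orthonormal_def)

lemma orthonormal_form: "orthonormal S \<Longrightarrow> e \<in> S \<Longrightarrow> f \<in> S \<Longrightarrow> a e f = (if e = f then 1 else 0)"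
  by (auto simp: orthonormal_def)

lemma orthonormal_coeff:
  assumes "orthonormal S" "finite S" "e \<in> S"
  shows "a (\<Sum>f\<in>S. c f \<odot> f) e = c e"
proof -
  have "a (\<Sum>f\<in>S. c f \<odot> f) e = (\<Sum>f\<in>S. c f * a f e)"
    using assms by (subst a_sum_left) (auto simp: a_simps orthonormal_V)
  also have "\<dots> = (\<Sum>f\<in>S. if f = e then c e else 0)"
    using assms by (intro sum.cong) (auto simp: orthonormal_form)
  finally show ?thesis using assms by simp
qed

lemma orthonormal_residual:
  assumes "orthonormal S" "finite S" "x \<in> V" "e \<in> S"
  shows "a (x - (\<Sum>f\<in>S. a x f \<odot> f)) e = 0"
  using assms orthonormal_coeff[of S e "a x"]
  by (subst a_diff_left) (auto intro!: V_sum simp: orthonormal_V)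

lemma nrm_sq_orthonormal:
  assumes S: "orthonormal S" "finite S" and y: "y \<in> V" "\<And>e. e \<in> S \<Longrightarrow> a y e = 0"
  shows "(nrm ((\<Sum>e\<in>S. c e \<odot> e) + y))\<^sup>2 = (\<Sum>e\<in>S. (cmod (c e))\<^sup>2) + (nrm y)\<^sup>2"
proof -
  let ?s = "\<Sum>e\<in>S. c e \<odot> e"
  have s: "?s \<in> V" using S by (auto intro!: V_sum simp: orthonormal_V)
  have "a ?s y = (\<Sum>e\<in>S. c e * a e y)"
    using S y by (subst a_sum_left) (auto simp: a_simps orthonormal_V)
  also have "\<dots> = 0" using S y a_cnj[of _ y] by (auto intro!: sum.neutral simp: orthonormal_V)
  finally have sy: "a ?s y = 0" .
  have "a ?s ?s = (\<Sum>e\<in>S. cnj (c e) * a ?s e)"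
    using S s a_sum_right[of S "\<lambda>e. c e \<odot> e" ?s] by (simp add: a_simps orthonormal_V)
  also have "\<dots> = (\<Sum>e\<in>S. of_real ((cmod (c e))\<^sup>2))"
    using S by (intro sum.cong) (auto simp: orthonormal_coeff complex_norm_square mult.commute simp del: of_real_power)
  finally have "(nrm ?s)\<^sup>2 = (\<Sum>e\<in>S. (cmod (c e))\<^sup>2)" using s by (simp add: nrm_sq)
  then show ?thesis using s y sy by (simp add: nrm_sq_add)
qed

text \<open>If \<open>T\<close> leaves a finite-dimensional space invariant, then \<open>x, T x, T\<^sup>2 x, \<dots>\<close> are linearly
  dependent, so that \<open>p(T) x = 0\<close> for some polynomial \<open>p \<noteq> 0\<close>. Splitting off the roots of \<open>p\<close> one
  by one produces an eigenvector.\<close>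

definition poly_op :: "('h \<Rightarrow> 'h) \<Rightarrow> complex poly \<Rightarrow> 'h \<Rightarrow> 'h" where
  "poly_op T p x = (\<Sum>i\<le>degree p. coeff p i \<odot> (T ^^ i) x)"

lemma poly_op_altdef: "degree p \<le> n \<Longrightarrow> poly_op T p x = (\<Sum>i\<le>n. coeff p i \<odot> (T ^^ i) x)"
  unfolding poly_op_def by (intro sum.mono_neutral_left) (auto simp: coeff_eq_0)

lemma eigenvector_of_poly_op:
  assumes X: "subspace X" and TX: "\<And>x. x \<in> X \<Longrightarrow> T x \<in> X"
    and add: "\<And>x y. x \<in> X \<Longrightarrow> y \<in> X \<Longrightarrow> T (x + y) = T x + T y"
    and sc: "\<And>c x. x \<in> X \<Longrightarrow> T (c \<odot> x) = c \<odot> T x"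
    and "p \<noteq> 0" "x \<in> X" "x \<noteq> 0" "poly_op T p x = 0"
  shows "\<exists>e\<in>X. \<exists>l. e \<noteq> 0 \<and> T e = l \<odot> e"
  using assms(5-)
proof (induction "degree p" arbitrary: p)
  case 0
  then have "coeff p 0 \<noteq> 0" using leading_coeff_0_iff[of p] by simp
  then show ?case using 0 by (simp add: poly_op_def)
next
  case (Suc n)
  have pow: "(T ^^ i) x \<in> X" for i by (induction i) (auto simp: TX Suc)
  have Xs: "(\<Sum>i\<in>I. g i \<odot> (T ^^ i) x) \<in> X" for I :: "nat set" and g
    by (intro subspace_sum[OF X] subspace_scale[OF X] pow)
  have Tsum: "T (\<Sum>i\<in>I. g i \<odot> (T ^^ i) x) = (\<Sum>i\<in>I. g i \<odot> (T ^^ Suc i) x)" for I :: "nat set" and g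
  proof (induction I rule: infinite_finite_induct)
    case (insert i I)
    then show ?case using Xs[of g I] pow[of i] subspace_scale[OF X] by (simp add: add sc)
  qed (use sc[of 0 0] subspace_0[OF X] in auto)
  obtain l where "poly p l = 0"
    using fundamental_theorem_of_algebra[of p] Suc.hyps(2) by (auto simp: constant_degree)
  then obtain q where q: "p = [:- l, 1:] * q" by (auto simp: poly_eq_0_iff_dvd)
  have q0: "q \<noteq> 0" using Suc.prems(1) q by auto
  have "degree p = degree [:- l, 1:] + degree q"
    unfolding q using q0 by (intro degree_mult_eq) auto
  then have dq: "degree q = n" using Suc.hyps(2) by simp
  let ?y = "poly_op T q x"
  have yX: "?y \<in> X" unfolding poly_op_def by (rule Xs)
  show ?case
  proof (cases "?y = 0")
    case True
    then show ?thesis using Suc.hyps(1)[of q] dq q0 Suc.prems by blast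
  next
    case False
    have cp: "coeff p i = (if i = 0 then 0 else coeff q (i - 1)) - l * coeff q i" for i
      by (simp add: q coeff_pCons split: nat.split)
    have "0 = poly_op T p x" using Suc.prems by simp
    also have "\<dots> = (\<Sum>i\<le>Suc n. (if i = 0 then 0 else coeff q (i - 1)) \<odot> (T ^^ i) x)
        - (\<Sum>i\<le>Suc n. (l * coeff q i) \<odot> (T ^^ i) x)"
      using Suc.hyps(2) by (simp add: poly_op_altdef[of p "Suc n"] cp scale_left_diff_distrib sum_subtractf
          del: sum.atMost_Suc funpow.simps)
    also have "(\<Sum>i\<le>Suc n. (if i = 0 then 0 else coeff q (i - 1)) \<odot> (T ^^ i) x)
        = (\<Sum>i\<le>n. coeff q i \<odot> (T ^^ Suc i) x)"
      by (subst sum.atMost_Suc_shift) simp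
    also have "\<dots> = T ?y" unfolding poly_op_def dq Tsum ..
    also have "(\<Sum>i\<le>Suc n. (l * coeff q i) \<odot> (T ^^ i) x) = l \<odot> ?y"
      using dq by (subst poly_op_altdef[of q "Suc n"]) (auto simp: scale_sum_right simp del: sum.atMost_Suc)
    finally have "T ?y = l \<odot> ?y" by simp
    then show ?thesis using yX False by blast
  qed
qed

lemma eigenvector_exists:
  assumes X: "subspace X" "X \<subseteq> span B" "finite B" and TX: "\<And>x. x \<in> X \<Longrightarrow> T x \<in> X"
    and add: "\<And>x y. x \<in> X \<Longrightarrow> y \<in> X \<Longrightarrow> T (x + y) = T x + T y"
    and sc: "\<And>c x. x \<in> X \<Longrightarrow> T (c \<odot> x) = c \<odot> T x"
    and x: "x \<in> X" "x \<noteq> 0"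
  shows "\<exists>e\<in>X. \<exists>l. e \<noteq> 0 \<and> T e = l \<odot> e"
proof -
  define n where "n = card B"
  define g where "g i = (T ^^ i) x" for i
  have gX: "g i \<in> X" for i unfolding g_def by (induction i) (auto simp: TX x)
  have "\<exists>p. p \<noteq> 0 \<and> poly_op T p x = 0"
  proof (cases "inj_on g {..n}")
    case False
    then obtain i j where ij: "i \<le> n" "j \<le> n" "i \<noteq> j" "g i = g j" by (auto simp: inj_on_def)
    let ?p = "monom 1 i - monom (1::complex) j"
    have c: "coeff ?p k = (if k = i then 1 else 0) - (if k = j then 1 else 0)" for k by auto
    have "degree ?p \<le> n" using ij by (intro degree_diff_le) (auto intro: order_trans[OF degree_monom_le])
    then have "poly_op T ?p x = (\<Sum>k\<le>n. coeff ?p k \<odot> g k)" by (simp add: poly_op_altdef g_def)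
    also have "\<dots> = (\<Sum>k\<le>n. (if k = i then g k else 0) - (if k = j then g k else 0))"
      unfolding c by (rule sum.cong) auto
    also have "\<dots> = (\<Sum>k\<le>n. if k = i then g k else 0) - (\<Sum>k\<le>n. if k = j then g k else 0)"
      by (rule sum_subtractf)
    also have "\<dots> = 0" using ij by simp
    finally show ?thesis using c[of i] ij(3) by (intro exI[of _ ?p]) (auto dest: arg_cong[where f = "\<lambda>p. coeff p i"])
  next
    case True
    have "dependent (g ` {..n})"
    proof (rule ccontr)
      assume "independent (g ` {..n})"
      then have "card (g ` {..n}) \<le> card B"
        using independent_span_bound[OF X(3), of "g ` {..n}"] gX X(2) by auto
      then show False using card_image[OF True] by (simp add: n_def)
    qed
    then obtain u v where u: "(\<Sum>v\<in>g ` {..n}. u v \<odot> v) = 0" "v \<in> g ` {..n}" "u v \<noteq> 0"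
      unfolding dependent_finite[OF finite_imageI[OF finite_atMost]] by blast
    define p where "p = (\<Sum>i\<le>n. monom (u (g i)) i)"
    have cp: "coeff p i = (if i \<le> n then u (g i) else 0)" for i
      by (simp add: p_def coeff_sum)
    have "degree p \<le> n" by (rule degree_le) (simp add: cp)
    then have "poly_op T p x = (\<Sum>i\<le>n. u (g i) \<odot> g i)" by (simp add: poly_op_altdef cp g_def)
    also have "\<dots> = (\<Sum>v\<in>g ` {..n}. u v \<odot> v)" by (simp add: sum.reindex[OF True])
    finally have "poly_op T p x = 0" using u(1) by (rule trans)
    moreover have "p \<noteq> 0"
    proof -
      obtain i where "i \<le> n" "v = g i" using u(2) by auto
      then have "coeff p i \<noteq> 0" using u(3) cp[of i] by simp
      then show ?thesis by auto
    qed
    ultimately show ?thesis by blast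
  qed
  then show ?thesis using eigenvector_of_poly_op[OF X(1) TX add sc _ x] by blast
qed

text \<open>A normalised eigenvector \<open>f\<close> is split off. Its orthogonal complement in \<open>X\<close> is invariant because
  \<open>T\<close> is symmetric, and has smaller dimension.\<close>

theorem finite_spectral_theorem:
  assumes "subspace X" "X \<subseteq> V" "X \<subseteq> span B" "finite B" "\<And>x. x \<in> X \<Longrightarrow> T x \<in> X"
    and add: "\<And>x y. x \<in> X \<Longrightarrow> y \<in> X \<Longrightarrow> T (x + y) = T x + T y"
    and sc: "\<And>c x. x \<in> X \<Longrightarrow> T (c \<odot> x) = c \<odot> T x"
    and sym: "\<And>x y. x \<in> X \<Longrightarrow> y \<in> X \<Longrightarrow> a (T x) y = a x (T y)"
  shows "\<exists>S l. finite S \<and> S \<subseteq> X \<and> orthonormal S \<and> (\<forall>e\<in>S. T e = l e \<odot> e) \<and>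
           (\<forall>x\<in>X. x = (\<Sum>e\<in>S. a x e \<odot> e))"
  using assms
proof (induction "card B" arbitrary: X B rule: less_induct)
  case less
  note XV = less.prems(2)
  show ?case
  proof (cases "X = {0}")
    case True
    then show ?thesis by (intro exI[of _ "{}"]) (auto simp: orthonormal_def)
  next
    case False
    then obtain x where "x \<in> X" "x \<noteq> 0" using subspace_0[OF less.prems(1)] by auto
    then obtain e l where e: "e \<in> X" "e \<noteq> 0" "T e = l \<odot> e"
      using eigenvector_exists[OF less.prems(1,3,4,5,6,7)] by blast
    have "e \<in> V" using e(1) XV by blast
    then have ne: "nrm e > 0" using e(2) nrm_nonneg[of e] nrm_eq_0[of e] by linarith
    define f where "f = of_real (1 / nrm e) \<odot> e"
    have f: "f \<in> X" "f \<in> V" "T f = l \<odot> f"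
      using e XV subspace_scale[OF less.prems(1)] less.prems(7) by (auto simp: f_def mult.commute)
    have "nrm f = 1" using ne e XV by (simp add: f_def nrm_scale subset_iff norm_divide)
    then have ff: "a f f = 1" using a_self[OF f(2)] by simp
    have lreal: "cnj l = l"
      using less.prems(8)[OF f(1) f(1)] ff unfolding f(3) by (simp add: a_simps f(2))
    define X' where "X' = {x \<in> X. a x f = 0}"
    have X'X: "X' \<subseteq> X" by (auto simp: X'_def)
    have sub: "subspace X'"
      unfolding subspace_def X'_def
      using XV f less.prems(1) by (auto simp: a_simps subset_iff intro: subspace_add subspace_scale subspace_0)
    have TX': "T x \<in> X'" if "x \<in> X'" for x
      using that less.prems(5,8) f XV by (auto simp: X'_def a_simps subset_iff)
    obtain B' where B': "B' \<subseteq> X'" "independent B'" "X' \<subseteq> span B'"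
      using maximal_independent_subset[of X'] by blast
    have fB': "f \<notin> span B'"
    proof
      assume "f \<in> span B'"
      then have "f \<in> X'" using span_minimal[OF B'(1) sub] by blast
      then show False using ff by (simp add: X'_def)
    qed
    have ind: "independent (insert f B')" using fB' B'(2) by (rule independent_insertI)
    have "finite (insert f B') \<and> card (insert f B') \<le> card B"
      using B'(1) X'X f less.prems(3) by (intro independent_span_bound[OF less.prems(4) ind]) auto
    moreover have "f \<notin> B'" using fB' span_base by blast
    ultimately have fin: "finite B'" "card B' < card B" by auto
    have in_X: "x \<in> X" if "x \<in> X'" for x using that X'X by blast
    have "\<exists>S l. finite S \<and> S \<subseteq> X' \<and> orthonormal S \<and> (\<forall>e\<in>S. T e = l e \<odot> e) \<and>
           (\<forall>x\<in>X'. x = (\<Sum>e\<in>S. a x e \<odot> e))"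
    proof (rule less.hyps[OF fin(2) sub _ B'(3) fin(1) TX'])
      show "X' \<subseteq> V" using X'X XV by blast
      show "T (x + y) = T x + T y" "a (T x) y = a x (T y)" if "x \<in> X'" "y \<in> X'" for x y
        using less.prems(6,8) in_X that by blast+
      show "T (c \<odot> x) = c \<odot> T x" if "x \<in> X'" for c x using less.prems(7) in_X that by blast
    qed
    then obtain S l' where S: "finite S" "S \<subseteq> X'" "orthonormal S" "\<forall>e\<in>S. T e = l' e \<odot> e"
      "\<forall>x\<in>X'. x = (\<Sum>e\<in>S. a x e \<odot> e)" by blast
    have Sf: "a e f = 0" "a f e = 0" if "e \<in> S" for e
    proof -
      show "a e f = 0" using that S(2) by (auto simp: X'_def)
      then show "a f e = 0" using a_cnj[OF f(2) orthonormal_V[OF S(3) that]] by simp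
    qed
    have fS: "f \<notin> S"
    proof
      assume "f \<in> S"
      then have "a f f = 0" by (rule Sf(1))
      then show False using ff by simp
    qed
    have "orthonormal (insert f S)"
      unfolding orthonormal_def
    proof (intro conjI ballI)
      show "insert f S \<subseteq> V" using S(3) f(2) unfolding orthonormal_def by blast
      show "a e g = (if e = g then 1 else 0)" if "e \<in> insert f S" "g \<in> insert f S" for e g
        using that Sf ff fS orthonormal_form[OF S(3)] by (elim insertE) auto
    qed
    moreover have "\<forall>e\<in>insert f S. T e = (l'(f := l)) e \<odot> e"
      using S(4) f(3) fS by (metis fun_upd_apply insert_iff)
    moreover have "x = (\<Sum>e\<in>insert f S. a x e \<odot> e)" if x: "x \<in> X" for x
    proof -
      define y where "y = x - a x f \<odot> f"
      have xV: "x \<in> V" using x XV by blast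
      have "y \<in> X"
        unfolding y_def by (intro subspace_diff[OF less.prems(1)] subspace_scale[OF less.prems(1)] x f(1))
      moreover have "a y f = 0" using xV f(2) ff by (simp add: y_def a_simps)
      ultimately have "y \<in> X'" by (simp add: X'_def)
      then have "y = (\<Sum>e\<in>S. a y e \<odot> e)" using S(5) by blast
      also have "\<dots> = (\<Sum>e\<in>S. a x e \<odot> e)"
        using Sf xV f S(3) by (intro sum.cong) (auto simp: y_def a_simps orthonormal_V)
      finally have y: "y = (\<Sum>e\<in>S. a x e \<odot> e)" .
      have "x = a x f \<odot> f + y" by (simp add: y_def)
      then show ?thesis unfolding sum.insert[OF S(1) fS] y .
    qed
    ultimately show ?thesis using S(1,2) X'X f
      by (intro exI[of _ "insert f S"] exI[of _ "l'(f := l)"]) blast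
  qed
qed

corollary orthonormal_basis_exists:
  assumes "subspace X" "X \<subseteq> V" "X \<subseteq> span B" "finite B"
  shows "\<exists>S. finite S \<and> S \<subseteq> X \<and> orthonormal S \<and> (\<forall>x\<in>X. x = (\<Sum>e\<in>S. a x e \<odot> e))"
  using finite_spectral_theorem[OF assms, of "\<lambda>x. x"] by (auto simp: assms)

end

subsection \<open>Riesz projections of operators of finite rank\<close>

lemma contour_integral_circlepath_inverse:
  assumes "r > 0" "cmod (w - \<gamma>) \<noteq> r"
  shows "((\<lambda>z. c / (z - w)) has_contour_integral (if cmod (w - \<gamma>) < r then 2 * of_real pi * \<i> * c else 0))
          (circlepath \<gamma> r)"
proof (cases "cmod (w - \<gamma>) < r")
  case True
  have "((\<lambda>z. c / (z - w)) has_contour_integral (2 * of_real pi * \<i> * c)) (circlepath \<gamma> r)"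
    by (rule Cauchy_integral_circlepath[where f = "\<lambda>_. c"])
       (use True in \<open>auto intro: holomorphic_intros continuous_intros\<close>)
  then show ?thesis using True by simp
next
  case False
  have "((\<lambda>z. c / (z - w)) has_contour_integral 0) (circlepath \<gamma> r)"
  proof (rule Cauchy_theorem_convex_simple[where S = "cball \<gamma> r"])
    have "z \<noteq> w" if "z \<in> cball \<gamma> r" for z
      using that False assms by (auto simp: dist_norm norm_minus_commute)
    then show "(\<lambda>z. c / (z - w)) holomorphic_on cball \<gamma> r" by (intro holomorphic_intros) auto
  qed (use assms in auto)
  then show ?thesis using False by simp
qed

context sa_operator
begin

context
  fixes X B :: "'h set" and \<gamma> :: complex and r :: real and F :: "'h \<Rightarrow> 'h"
  assumes X: "subspace X" "X \<subseteq> V" "X \<subseteq> span B" "finite B" and TX: "\<And>x. x \<in> V \<Longrightarrow> T x \<in> X"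
    and r: "r > 0" "cmod \<gamma> > r" and regS: "\<And>z. z \<in> sphere \<gamma> r \<Longrightarrow> reg z"
    and F_V: "\<And>x. x \<in> V \<Longrightarrow> F x \<in> V"
    and F_form: "\<And>x v. x \<in> V \<Longrightarrow> v \<in> V \<Longrightarrow>
      a (F x) v = contour_integral (circlepath \<gamma> r) (\<lambda>z. a (R z x) v) / (2 * of_real pi * \<i>)"
begin

text \<open>In an orthonormal eigenbasis of \<open>X\<close> the resolvent is explicit: \<open>R z x\<close> is the sum of
  \<open>(a x e / (z - l e)) e\<close> and of \<open>1 / z\<close> times the component of \<open>x\<close> orthogonal to \<open>X\<close>. The
  point \<open>0\<close> lies outside the circle, so that component does not contribute to the integral.\<close>

lemma finite_rank_diagonal:
  obtains S l where "finite S" "S \<subseteq> X" "orthonormal S"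
    "\<And>x. x \<in> V \<Longrightarrow> T x = (\<Sum>e\<in>S. (l e * a x e) \<odot> e)"
    "\<And>e. e \<in> S \<Longrightarrow> cmod (l e - \<gamma>) \<noteq> r"
    "\<And>x. x \<in> V \<Longrightarrow> F x = (\<Sum>e\<in>{e\<in>S. cmod (l e - \<gamma>) < r}. a x e \<odot> e)"
proof -
  have XV: "x \<in> X \<Longrightarrow> x \<in> V" for x using X(2) by blast
  have "\<exists>S l. finite S \<and> S \<subseteq> X \<and> orthonormal S \<and> (\<forall>e\<in>S. T e = l e \<odot> e) \<and>
           (\<forall>x\<in>X. x = (\<Sum>e\<in>S. a x e \<odot> e))"
    by (rule finite_spectral_theorem[OF X]) (use XV in \<open>auto simp: TX T_add T_scale T_sym\<close>)
  then obtain S l where S: "finite S" "S \<subseteq> X" "orthonormal S" "\<forall>e\<in>S. T e = l e \<odot> e"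
    "\<forall>x\<in>X. x = (\<Sum>e\<in>S. a x e \<odot> e)" by blast
  have SV: "e \<in> V" if "e \<in> S" for e using that S(2) XV by blast
  have ee: "a e e = 1" if "e \<in> S" for e using orthonormal_form[OF S(3) that that] by simp
  have lreal: "cnj (l e) = l e" if e: "e \<in> S" for e
    using T_sym[OF SV[OF e] SV[OF e]] S(4)[rule_format, OF e] ee[OF e] SV[OF e] by (simp add: a_simps)
  have aT: "a (T x) e = l e * a x e" if "x \<in> V" "e \<in> S" for x e
    using T_sym[OF that(1) SV[OF that(2)]] S(4)[rule_format, OF that(2)] SV[OF that(2)] that(1)
      lreal[OF that(2)] by (simp add: a_simps)
  have Tx: "T x = (\<Sum>e\<in>S. (l e * a x e) \<odot> e)" if "x \<in> V" for x
  proof -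
    have "T x = (\<Sum>e\<in>S. a (T x) e \<odot> e)" using S(5) TX[OF that] by blast
    also have "\<dots> = (\<Sum>e\<in>S. (l e * a x e) \<odot> e)" using aT[OF that] by (intro sum.cong) auto
    finally show ?thesis .
  qed
  have zl: "z \<noteq> l e" if "reg z" "e \<in> S" for z e
  proof
    assume "z = l e"
    then have "z \<odot> e - T e = z \<odot> 0 - T 0" using S(4) that by simp
    then have "e = 0" by (rule shift_inj[OF that(1) SV[OF that(2)] V_zero])
    then show False using ee[OF that(2)] by simp
  qed
  have lr: "cmod (l e - \<gamma>) \<noteq> r" if "e \<in> S" for e
    using zl[OF regS that, of "l e"] by (auto simp: dist_norm norm_minus_commute)
  have Rz: "R z x = (\<Sum>e\<in>S. (a x e / (z - l e)) \<odot> e) + (1 / z) \<odot> (x - (\<Sum>e\<in>S. a x e \<odot> e))"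
    if z: "z \<in> sphere \<gamma> r" and x: "x \<in> V" for z x
  proof (rule R_unique[OF regS[OF z]])
    let ?p = "\<Sum>e\<in>S. a x e \<odot> e"
    let ?s = "\<Sum>e\<in>S. (a x e / (z - l e)) \<odot> e"
    let ?y = "?s + (1 / z) \<odot> (x - ?p)"
    have sV: "?s \<in> V" and pV: "?p \<in> V" using SV by (auto intro!: V_sum)
    then show y: "?y \<in> V" using x by auto
    have z0: "z \<noteq> 0" using z r by (auto simp: dist_norm)
    have ay: "a ?y e = a x e / (z - l e)" if "e \<in> S" for e
      using sV pV x SV[OF that] orthonormal_residual[OF S(3,1) x that]
        orthonormal_coeff[OF S(3,1) that, of "\<lambda>e. a x e / (z - l e)"]
      by (simp add: a_add_left a_scale_left)
    have "z \<odot> ?y - T ?y = (\<Sum>e\<in>S. (z * (a x e / (z - l e)) - l e * (a x e / (z - l e))) \<odot> e) + (x - ?p)"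
      unfolding Tx[OF y] using z0 ay
      by (simp add: scale_right_distrib scale_sum_right scale_left_diff_distrib sum_subtractf)
    also have "(\<Sum>e\<in>S. (z * (a x e / (z - l e)) - l e * (a x e / (z - l e))) \<odot> e) = ?p"
    proof (rule sum.cong)
      fix e assume "e \<in> S"
      then have "z - l e \<noteq> 0" using zl[OF regS[OF z]] by simp
      then have "z * (a x e / (z - l e)) - l e * (a x e / (z - l e)) = a x e"
        by (metis left_diff_distrib nonzero_mult_div_cancel_left times_divide_eq_right)
      then show "(z * (a x e / (z - l e)) - l e * (a x e / (z - l e))) \<odot> e = a x e \<odot> e" by simp
    qed simp
    finally show "z \<odot> ?y - T ?y = x" by simp
  qed
  have Fx: "F x = (\<Sum>e\<in>{e\<in>S. cmod (l e - \<gamma>) < r}. a x e \<odot> e)" if x: "x \<in> V" for x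
  proof (rule eqI_form[OF F_V[OF x]])
    show "(\<Sum>e\<in>{e\<in>S. cmod (l e - \<gamma>) < r}. a x e \<odot> e) \<in> V" using SV by (auto intro!: V_sum)
    fix v assume v: "v \<in> V"
    let ?p = "\<Sum>e\<in>S. a x e \<odot> e"
    define I where "I = (\<Sum>e\<in>S. if cmod (l e - \<gamma>) < r then 2 * of_real pi * \<i> * (a x e * a e v) else 0)
         + (if cmod (0 - \<gamma>) < r then 2 * of_real pi * \<i> * a (x - ?p) v else 0)"
    have "((\<lambda>z. (\<Sum>e\<in>S. (a x e * a e v) / (z - l e)) + a (x - ?p) v / (z - 0)) has_contour_integral I)
        (circlepath \<gamma> r)"
      unfolding I_def
      by (intro has_contour_integral_add has_contour_integral_sum contour_integral_circlepath_inverse r(1) lr S(1))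
         (use r in auto)
    then have "((\<lambda>z. a (R z x) v) has_contour_integral I) (circlepath \<gamma> r)"
    proof (rule has_contour_integral_eq)
      fix z assume "z \<in> path_image (circlepath \<gamma> r)"
      then have z: "z \<in> sphere \<gamma> r" using r by simp
      have pV: "?p \<in> V" using SV by (auto intro!: V_sum)
      have "a (R z x) v = (\<Sum>e\<in>S. a x e / (z - l e) * a e v) + 1 / z * a (x - ?p) v"
        unfolding Rz[OF z x] using x v pV SV
        by (subst a_add_left) (auto intro!: V_sum sum.cong simp: a_sum_left a_scale_left)
      then show "(\<Sum>e\<in>S. (a x e * a e v) / (z - l e)) + a (x - ?p) v / (z - 0) = a (R z x) v"
        by simp
    qed
    then have "a (F x) v = I / (2 * of_real pi * \<i>)"
      using F_form[OF x v] by (simp add: contour_integral_unique)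
    also have "I = 2 * of_real pi * \<i> * (\<Sum>e\<in>{e\<in>S. cmod (l e - \<gamma>) < r}. a x e * a e v)"
      using r S(1) unfolding I_def sum_distrib_left by (simp add: sum.If_cases Int_def)
    also have "\<dots> / (2 * of_real pi * \<i>) = a (\<Sum>e\<in>{e\<in>S. cmod (l e - \<gamma>) < r}. a x e \<odot> e) v"
      using SV v by (subst a_sum_left) (auto simp: a_scale_left)
    finally show "a (F x) v = a (\<Sum>e\<in>{e\<in>S. cmod (l e - \<gamma>) < r}. a x e \<odot> e) v" .
  qed
  show ?thesis by (rule that[OF S(1,2,3) Tx lr Fx])
qed

text \<open>The last estimate: on the complement of the range of \<open>F\<close> the operator \<open>T\<close> is diagonal with
  eigenvalues outside the disc, \<open>0\<close> included, hence \<open>T - \<gamma>\<close> is bounded below by \<open>r\<close> there.\<close>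

lemma finite_rank_projection:
  shows "x \<in> V \<Longrightarrow> F x \<in> X"
    and "x \<in> V \<Longrightarrow> y \<in> V \<Longrightarrow> F (x + y) = F x + F y"
    and "x \<in> V \<Longrightarrow> F (c \<odot> x) = c \<odot> F x"
    and "x \<in> V \<Longrightarrow> F (F x) = F x"
    and "x \<in> V \<Longrightarrow> y \<in> V \<Longrightarrow> a (F x) y = a x (F y)"
    and "x \<in> V \<Longrightarrow> r * nrm (x - F x) \<le> nrm (T x - \<gamma> \<odot> x)"
proof -
  obtain S l where S: "finite S" "S \<subseteq> X" "orthonormal S"
    and T: "\<And>x. x \<in> V \<Longrightarrow> T x = (\<Sum>e\<in>S. (l e * a x e) \<odot> e)"
    and l: "\<And>e. e \<in> S \<Longrightarrow> cmod (l e - \<gamma>) \<noteq> r"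
    and F: "\<And>x. x \<in> V \<Longrightarrow> F x = (\<Sum>e\<in>{e\<in>S. cmod (l e - \<gamma>) < r}. a x e \<odot> e)"
    by (rule finite_rank_diagonal, rule that)
  define S1 where "S1 = {e\<in>S. cmod (l e - \<gamma>) < r}"
  note F = F[folded S1_def]
  have S1: "finite S1" "S1 \<subseteq> S" "orthonormal S1"
    using S by (auto simp: S1_def orthonormal_def)
  have SV: "e \<in> V" if "e \<in> S" for e using that S(2) X(2) by blast
  have S1V: "e \<in> V" if "e \<in> S1" for e using that S1(2) SV by blast
  show "F x \<in> X" if "x \<in> V"
    unfolding F[OF that] using S1(2) S(2) by (intro subspace_sum[OF X(1)] subspace_scale[OF X(1)]) auto
  show "F (x + y) = F x + F y" if "x \<in> V" "y \<in> V"
    using that S1V by (simp add: F a_add_left scale_left_distrib sum.distrib)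
  show "F (c \<odot> x) = c \<odot> F x" if "x \<in> V"
    using that S1V by (simp add: F a_scale_left scale_sum_right)
  have aF: "a (F x) e = a x e" if "x \<in> V" "e \<in> S1" for x e
    unfolding F[OF that(1)] by (rule orthonormal_coeff[OF S1(3,1) that(2)])
  show "F (F x) = F x" if "x \<in> V"
  proof -
    have "F (F x) = (\<Sum>e\<in>S1. a (F x) e \<odot> e)" by (rule F[OF F_V[OF that]])
    also have "\<dots> = (\<Sum>e\<in>S1. a x e \<odot> e)" using aF[OF that] by (intro sum.cong) auto
    also have "\<dots> = F x" by (rule F[OF that, symmetric])
    finally show ?thesis .
  qed
  show "a (F x) y = a x (F y)" if "x \<in> V" "y \<in> V"
  proof -
    have "a (F x) y = (\<Sum>e\<in>S1. a x e * a e y)"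
      unfolding F[OF that(1)] using that S1V by (subst a_sum_left) (auto simp: a_scale_left)
    also have "\<dots> = (\<Sum>e\<in>S1. cnj (a y e) * a x e)"
      using that S1V a_cnj[OF _ that(2)] by (intro sum.cong) (auto simp: mult.commute)
    also have "\<dots> = a x (F y)"
      unfolding F[OF that(2)] using that S1V by (subst a_sum_right) (auto simp: a_scale_right)
    finally show ?thesis .
  qed
  show "r * nrm (x - F x) \<le> nrm (T x - \<gamma> \<odot> x)" if x: "x \<in> V"
  proof (rule power2_le_imp_le)
    let ?p = "\<Sum>e\<in>S. a x e \<odot> e"
    have pV: "?p \<in> V" using SV by (auto intro!: V_sum)
    have y: "x - ?p \<in> V" "\<And>e. e \<in> S \<Longrightarrow> a (x - ?p) e = 0"
      using x pV orthonormal_residual[OF S(3,1) x] by auto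
    define c where "c e = (if e \<in> S1 then 0 else a x e)" for e
    have "?p = F x + (\<Sum>e\<in>S. c e \<odot> e)"
    proof -
      have "F x = (\<Sum>e\<in>S. (if e \<in> S1 then a x e else 0) \<odot> e)"
        unfolding F[OF x] using S1(2) S(1) by (intro sum.mono_neutral_cong_left) auto
      then show ?thesis by (simp add: c_def flip: sum.distrib) (intro sum.cong, auto)
    qed
    then have eq: "x - F x = (\<Sum>e\<in>S. c e \<odot> e) + (x - ?p)" by (simp add: algebra_simps)
    have 1: "(nrm (x - F x))\<^sup>2 = (\<Sum>e\<in>S. (cmod (c e))\<^sup>2) + (nrm (x - ?p))\<^sup>2"
      unfolding eq by (rule nrm_sq_orthonormal[OF S(3,1) y])
    have "T x - \<gamma> \<odot> x = (\<Sum>e\<in>S. ((l e - \<gamma>) * a x e) \<odot> e) + (- \<gamma>) \<odot> (x - ?p)"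
      unfolding T[OF x]
      by (simp add: left_diff_distrib scale_left_diff_distrib sum_subtractf scale_right_diff_distrib scale_sum_right sum_negf)
    then have "(nrm (T x - \<gamma> \<odot> x))\<^sup>2 = (\<Sum>e\<in>S. (cmod ((l e - \<gamma>) * a x e))\<^sup>2) + (nrm ((- \<gamma>) \<odot> (x - ?p)))\<^sup>2"
      using nrm_sq_orthonormal[OF S(3,1), of "(- \<gamma>) \<odot> (x - ?p)" "\<lambda>e. (l e - \<gamma>) * a x e"] y SV
      by (simp only: V_scale a_scale_left) simp
    also have "\<dots> = (\<Sum>e\<in>S. (cmod (l e - \<gamma>))\<^sup>2 * (cmod (a x e))\<^sup>2) + (cmod \<gamma>)\<^sup>2 * (nrm (x - ?p))\<^sup>2"
      using y by (simp only: nrm_scale norm_mult power_mult_distrib norm_minus_cancel)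
    also have "\<dots> \<ge> (\<Sum>e\<in>S. r\<^sup>2 * (cmod (c e))\<^sup>2) + r\<^sup>2 * (nrm (x - ?p))\<^sup>2"
    proof (intro add_mono sum_mono mult_right_mono power_mono)
      fix e assume e: "e \<in> S"
      show "r\<^sup>2 * (cmod (c e))\<^sup>2 \<le> (cmod (l e - \<gamma>))\<^sup>2 * (cmod (a x e))\<^sup>2"
        using e l[OF e] r by (auto simp: c_def S1_def intro!: mult_right_mono power_mono)
    qed (use r in auto)
    finally show "(r * nrm (x - F x))\<^sup>2 \<le> (nrm (T x - \<gamma> \<odot> x))\<^sup>2"
      unfolding power_mult_distrib 1 by (simp add: sum_distrib_left distrib_left)
  qed (use x in auto)
qed

end

subsection \<open>Perturbation of the Riesz projection\<close>

text \<open>Let \<open>T'\<close> be a symmetric operator of finite rank which is close to \<open>T\<close> in norm, and let \<open>E\<close>,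
  \<open>F\<close> be the Riesz projections of \<open>T\<close> and \<open>T'\<close> for the same circle. On the eigenspace \<open>M\<close> of \<open>T\<close>
  the difference \<open>u - F u\<close> is controlled by \<open>(T - T') u = -(T' - \<gamma>) u\<close>, because \<open>T' - \<gamma>\<close> is
  bounded below by \<open>r\<close> on the complement of the range of \<open>F\<close>. The converse direction needs that \<open>F\<close> maps \<open>M\<close> onto its range: a vector \<open>w = F w\<close> orthogonal to \<open>F M\<close> is
  orthogonal to \<open>M\<close>, so \<open>E w = 0\<close> and \<open>w = F w - E w\<close>, which is shorter than \<open>w\<close> once the
  resolvents are close on the circle.\<close>

theorem Riesz_projection_perturbation:
  assumes T': "sa_operator scale V a T' L'"
    and X: "subspace X" "X \<subseteq> V" "X \<subseteq> span B" "finite B" and TX: "\<And>x. x \<in> V \<Longrightarrow> T' x \<in> X"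
    and real: "Im \<gamma> = 0" and r: "r > 0" "cmod \<gamma> > r"
    and reg: "\<And>z. z \<in> cball \<gamma> r \<Longrightarrow> z \<noteq> \<gamma> \<Longrightarrow> reg z"
    and reg': "\<And>z. z \<in> sphere \<gamma> r \<Longrightarrow> sa_operator.reg scale V a T' z"
    and E_V: "\<And>x. x \<in> V \<Longrightarrow> E x \<in> V" and F_V: "\<And>x. x \<in> V \<Longrightarrow> F x \<in> V"
    and E_form: "\<And>x v. x \<in> V \<Longrightarrow> v \<in> V \<Longrightarrow>
      a (E x) v = contour_integral (circlepath \<gamma> r) (\<lambda>z. a (R z x) v) / (2 * of_real pi * \<i>)"
    and F_form: "\<And>x v. x \<in> V \<Longrightarrow> v \<in> V \<Longrightarrow>
      a (F x) v = contour_integral (circlepath \<gamma> r) (\<lambda>z. a (sa_operator.R scale V T' z x) v) / (2 * of_real pi * \<i>)"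
    and m: "m > 0" "\<And>z x. z \<in> sphere \<gamma> r \<Longrightarrow> x \<in> V \<Longrightarrow> m * nrm x \<le> nrm (z \<odot> x - T x)"
    and \<epsilon>: "\<And>x. x \<in> V \<Longrightarrow> nrm (T x - T' x) \<le> \<epsilon> * nrm x" "0 \<le> \<epsilon>" "2 * \<epsilon> \<le> m" "2 * \<epsilon> * r < m\<^sup>2"
    and fin: "finite B'" "{u \<in> V. T u = \<gamma> \<odot> u} \<subseteq> span B'"
    and \<eta>: "\<And>u. u \<in> V \<Longrightarrow> T u = \<gamma> \<odot> u \<Longrightarrow> nrm (T u - T' u) \<le> \<eta> * nrm u" "2 * \<eta> \<le> r" "0 \<le> \<eta>"
  shows "\<And>u. u \<in> V \<Longrightarrow> T u = \<gamma> \<odot> u \<Longrightarrow> r * nrm (u - F u) \<le> \<eta> * nrm u"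
    and "\<And>x. x \<in> V \<Longrightarrow> \<exists>u\<in>V. T u = \<gamma> \<odot> u \<and> r * nrm (F x - u) \<le> 2 * \<eta> * nrm (F x)"
proof -
  interpret T': sa_operator scale V a T' L' by (rule T')
  note intros = X TX r reg' F_V F_form
  have FF: "F x \<in> X" "F (F x) = F x" "r * nrm (x - F x) \<le> nrm (T' x - \<gamma> \<odot> x)" "F (c \<odot> x) = c \<odot> F x"
    if "x \<in> V" for x c
    subgoal by (rule T'.finite_rank_projection(1)[OF intros, rotated -1]) (rule that)
    subgoal by (rule T'.finite_rank_projection(4)[OF intros, rotated -1]) (rule that)
    subgoal by (rule T'.finite_rank_projection(6)[OF intros, rotated -1]) (rule that)
    subgoal by (rule T'.finite_rank_projection(3)[OF intros, rotated -1]) (rule that)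
    done
  have FF2: "F (x + y) = F x + F y" "a (F x) y = a x (F y)" if "x \<in> V" "y \<in> V" for x y
    subgoal by (rule T'.finite_rank_projection(2)[OF intros, rotated -2]) (rule that)+
    subgoal by (rule T'.finite_rank_projection(5)[OF intros, rotated -2]) (rule that)+
    done
  show defect: "r * nrm (u - F u) \<le> \<eta> * nrm u" if "u \<in> V" "T u = \<gamma> \<odot> u" for u
  proof -
    have "r * nrm (u - F u) \<le> nrm (T' u - T u)" using FF(3)[OF that(1)] that(2) by simp
    also have "\<dots> \<le> \<eta> * nrm u" using \<eta>(1)[OF that] nrm_minus_commute[of "T' u" "T u"] that by simp
    finally show ?thesis .
  qed
  define M where "M = {u \<in> V. T u = \<gamma> \<odot> u}"
  have M: "subspace M" unfolding M_def subspace_def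
    by (auto simp: T_add T_scale scale_right_distrib mult.commute)
  have MV: "u \<in> V" if "u \<in> M" for u using that by (simp add: M_def)
  define Y where "Y = F ` M"
  have YV: "Y \<subseteq> V" using MV F_V by (auto simp: Y_def)
  have Ysub: "subspace Y"
    unfolding subspace_def
  proof (intro conjI ballI allI)
    have "F 0 = 0" using FF(4)[of 0 0] by simp
    then show "0 \<in> Y" unfolding Y_def using subspace_0[OF M] by (metis image_eqI)
    show "x + y \<in> Y" if xy: "x \<in> Y" "y \<in> Y" for x y
    proof -
      obtain u v where "u \<in> M" "v \<in> M" "x = F u" "y = F v" using xy by (auto simp: Y_def)
      then show ?thesis unfolding Y_def using FF2(1)[OF MV MV] subspace_add[OF M] by (metis image_eqI)
    qed
    show "c \<odot> x \<in> Y" if x: "x \<in> Y" for c x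
    proof -
      obtain u where "u \<in> M" "x = F u" using x by (auto simp: Y_def)
      then show ?thesis unfolding Y_def using FF(4)[OF MV] subspace_scale[OF M] by (metis image_eqI)
    qed
  qed
  have Yspan: "Y \<subseteq> span B" using FF(1) MV X(3) by (auto simp: Y_def)
  obtain S where S: "finite S" "S \<subseteq> Y" "orthonormal S" "\<forall>x\<in>Y. x = (\<Sum>e\<in>S. a x e \<odot> e)"
    using orthonormal_basis_exists[OF Ysub YV Yspan X(4)] by blast
  have onto: "w = 0" if w: "w \<in> V" "F w = w" "\<And>u. u \<in> M \<Longrightarrow> a w (F u) = 0" for w
  proof -
    have "E w = 0"
    proof (rule Riesz_projection_orthogonal[OF real r(1) reg E_V E_form w(1)])
      fix u assume u: "u \<in> V" "T u = \<gamma> \<odot> u"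
      then have "a (F w) u = a w (F u)" using FF2(2)[OF w(1) u(1)] by simp
      then show "a w u = 0" using w u by (simp add: M_def)
    qed
    have lower': "m / 2 * nrm x \<le> nrm (z \<odot> x - T' x)" if z: "z \<in> sphere \<gamma> r" and x: "x \<in> V" for z x
    proof -
      have "z \<odot> x - T x = (z \<odot> x - T' x) - (T x - T' x)" by simp
      then have "nrm (z \<odot> x - T x) \<le> nrm (z \<odot> x - T' x) + nrm (T x - T' x)"
        using x nrm_triangle_diff[of "z \<odot> x - T' x" "T x - T' x"] by (metis T_V V_diff V_scale T'.T_V)
      moreover have "\<epsilon> * nrm x \<le> m / 2 * nrm x" using \<epsilon>(3) x by (intro mult_right_mono) auto
      moreover have "m * nrm x = m / 2 * nrm x + m / 2 * nrm x" by simp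
      ultimately show ?thesis using m(2)[OF z x] \<epsilon>(1)[OF x] by linarith
    qed
    define c where "c = 2 * \<epsilon> / m\<^sup>2 * (nrm w)\<^sup>2"
    have bound: "cmod (a (T'.R z w) w - a (R z w) w) \<le> c" if z: "z \<in> sphere \<gamma> r" for z
    proof -
      have rz: "reg z" using z r by (intro reg) auto
      have rz': "T'.reg z" using reg'[OF z] .
      let ?y = "R z w"
      have y: "?y \<in> V" using rz w by simp
      have ny: "nrm ?y \<le> nrm w / m" using m z w by (intro R_bound) auto
      have "w = (z \<odot> ?y - T' ?y) - (T ?y - T' ?y)" using R_eq[OF rz w(1)] by simp
      then have "T'.R z w = T'.R z ((z \<odot> ?y - T' ?y) - (T ?y - T' ?y))" by simp
      also have "\<dots> = T'.R z (z \<odot> ?y - T' ?y) - T'.R z (T ?y - T' ?y)"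
        using y rz' by (intro T'.R_diff) auto
      also have "T'.R z (z \<odot> ?y - T' ?y) = ?y" by (rule T'.R_unique[OF rz' y refl])
      finally have "?y - T'.R z w = T'.R z (T ?y - T' ?y)" by simp
      moreover have "nrm (T'.R z (T ?y - T' ?y)) \<le> nrm (T ?y - T' ?y) / (m / 2)"
        using lower'[OF z] m y by (intro T'.R_bound) auto
      moreover have "\<dots> \<le> (\<epsilon> * (nrm w / m)) / (m / 2)"
        using \<epsilon>(1)[OF y] mult_left_mono[OF ny \<epsilon>(2)] m(1) by (intro divide_right_mono) auto
      ultimately have n: "nrm (?y - T'.R z w) \<le> 2 * \<epsilon> / m\<^sup>2 * nrm w"
        by (simp add: power2_eq_square mult_ac)
      have "cmod (a (T'.R z w) w - a ?y w) = cmod (a (?y - T'.R z w) w)"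
        using y w rz' by (simp add: a_diff_left norm_minus_commute)
      also have "\<dots> \<le> nrm (?y - T'.R z w) * nrm w" using y w rz' by (intro Cauchy_Schwarz) auto
      also have "\<dots> \<le> 2 * \<epsilon> / m\<^sup>2 * nrm w * nrm w" using n w by (intro mult_right_mono) auto
      finally show ?thesis by (simp add: c_def power2_eq_square mult_ac)
    qed
    have c0: "c \<ge> 0" unfolding c_def using \<epsilon>(2) by simp
    have cont: "(\<lambda>z. a (R z w) w) contour_integrable_on circlepath \<gamma> r"
      "(\<lambda>z. a (T'.R z w) w) contour_integrable_on circlepath \<gamma> r"
    proof -
      show "(\<lambda>z. a (R z w) w) contour_integrable_on circlepath \<gamma> r"
        by (rule contour_integrable_holomorphic_simple[OF form_R_holomorphic[OF w(1) w(1)] open_reg])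
           (use r reg in auto)
      show "(\<lambda>z. a (T'.R z w) w) contour_integrable_on circlepath \<gamma> r"
        by (rule contour_integrable_holomorphic_simple[OF T'.form_R_holomorphic[OF w(1) w(1)] T'.open_reg])
           (use r reg' in auto)
    qed
    have "a w w = a (F w) w - a (E w) w" using w \<open>E w = 0\<close> by simp
    also have "\<dots> = (contour_integral (circlepath \<gamma> r) (\<lambda>z. a (T'.R z w) w)
        - contour_integral (circlepath \<gamma> r) (\<lambda>z. a (R z w) w)) / (2 * of_real pi * \<i>)"
      unfolding E_form[OF w(1) w(1)] F_form[OF w(1) w(1)] diff_divide_distrib ..
    finally have eq: "a w w * (2 * of_real pi * \<i>) = contour_integral (circlepath \<gamma> r) (\<lambda>z. a (T'.R z w) w)
        - contour_integral (circlepath \<gamma> r) (\<lambda>z. a (R z w) w)" by simp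
    have "((\<lambda>z. a (T'.R z w) w - a (R z w) w) has_contour_integral (a w w * (2 * of_real pi * \<i>))) (circlepath \<gamma> r)"
      unfolding eq using cont by (intro has_contour_integral_diff has_contour_integral_integral)
    then have "cmod (a w w * (2 * of_real pi * \<i>)) \<le> c * (2 * pi * r)"
      by (rule has_contour_integral_bound_circlepath)
         (use bound c0 r in \<open>auto simp: dist_norm norm_minus_commute\<close>)
    then have "(nrm w)\<^sup>2 \<le> c * r"
      using a_self[OF w(1)] by (simp add: norm_mult norm_power mult.commute)
    then have "m\<^sup>2 * (nrm w)\<^sup>2 \<le> 2 * \<epsilon> * r * (nrm w)\<^sup>2"
      using m(1) by (simp add: c_def field_simps)
    then have "(nrm w)\<^sup>2 \<le> 0" using \<epsilon>(4) by (smt (verit) mult_less_cancel_right zero_le_power2)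
    then show "w = 0" using w(1) by simp
  qed
  fix x assume x: "x \<in> V"
  let ?f = "F x"
  let ?p = "\<Sum>e\<in>S. a ?f e \<odot> e"
  have pY: "?p \<in> Y" using S(2) by (intro subspace_sum[OF Ysub] subspace_scale[OF Ysub]) auto
  have fV: "?f \<in> V" using F_V x by blast
  have pV: "?p \<in> V" using pY YV by blast
  obtain u where u: "u \<in> M" "?p = F u" using pY by (auto simp: Y_def)
  have "?f - ?p = 0"
  proof (rule onto)
    show d: "?f - ?p \<in> V" using fV pV by auto
    have Fdiff: "F (y - v) = F y - F v" if "y \<in> V" "v \<in> V" for y v
      using FF2(1)[of y "(-1) \<odot> v"] FF(4)[of v "-1"] that by simp
    show "F (?f - ?p) = ?f - ?p"
      using Fdiff[OF fV pV] FF(2)[OF x] FF(2)[OF MV[OF u(1)]] u(2) by simp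
    fix v assume v: "v \<in> M"
    then have "F v \<in> Y" by (simp add: Y_def)
    then have "F v = (\<Sum>e\<in>S. a (F v) e \<odot> e)" using S(4) by blast
    then have "a (?f - ?p) (F v) = a (?f - ?p) (\<Sum>e\<in>S. a (F v) e \<odot> e)" by simp
    also have "\<dots> = (\<Sum>e\<in>S. cnj (a (F v) e) * a (?f - ?p) e)"
      using d orthonormal_V[OF S(3)]
      by (subst a_sum_right) (auto intro!: sum.cong a_scale_right simp del: a_diff_left)
    also have "\<dots> = 0" using orthonormal_residual[OF S(3,1) fV] by simp
    finally show "a (?f - ?p) (F v) = 0" .
  qed
  then have fu: "?f = F u" using u by simp
  have uV: "u \<in> V" "T u = \<gamma> \<odot> u" using u by (auto simp: M_def)
  have d: "r * nrm (u - ?f) \<le> \<eta> * nrm u" using defect[OF uV] fu by simp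
  have "nrm u \<le> nrm (u - ?f) + nrm ?f" using nrm_triangle[of "u - ?f" ?f] uV fV by simp
  moreover have "2 * nrm (u - ?f) \<le> nrm u"
  proof -
    have "r * (2 * nrm (u - ?f)) \<le> (2 * \<eta>) * nrm u" using d by simp
    also have "\<dots> \<le> r * nrm u" using \<eta>(2) uV by (intro mult_right_mono) auto
    finally show ?thesis using r(1) by simp
  qed
  ultimately have "nrm u \<le> 2 * nrm ?f" by linarith
  then have "\<eta> * nrm u \<le> 2 * \<eta> * nrm ?f" using \<eta>(3) mult_left_mono[of "nrm u" "2 * nrm ?f" \<eta>] by simp
  then have "r * nrm (?f - u) \<le> 2 * \<eta> * nrm ?f"
    using d nrm_minus_commute[OF fV uV(1)] by simp
  then show "\<exists>u\<in>V. T u = \<gamma> \<odot> u \<and> r * nrm (?f - u) \<le> 2 * \<eta> * nrm ?f" using uV by blast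
qed

end

section \<open>The space \<open>L\<^sup>2\<close> of the torus\<close>

lemma finite_torus_measure: "finite_measure (torus_measure :: (real^'n) measure)"
proof
  show "emeasure (torus_measure :: (real^'n) measure) (space torus_measure) \<noteq> \<infinity>"
    unfolding torus_measure_def
    by (simp add: emeasure_restrict_space space_restrict_space emeasure_lborel_cbox_eq)
qed

lemma l2eq_rep: "l2eq (rep_torus_l2 U) (rep_torus_l2 U)"
  using Quotient3_rep_reflp[OF Quotient3_torus_l2] .

lemma l2fun_rep [simp, intro]: "l2fun (rep_torus_l2 U)"
  using l2eq_rep[of U] by (simp add: l2eq_def)

lemma abs_rep [simp]: "abs_torus_l2 (rep_torus_l2 U) = U"
  using Quotient3_abs_rep[OF Quotient3_torus_l2] .

lemma rep_abs: "l2fun F \<Longrightarrow> l2eq (rep_torus_l2 (abs_torus_l2 F)) F"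
  by (rule Quotient3_rep_abs[OF Quotient3_torus_l2]) (simp add: l2eq_def)

lemma AE_rep_abs: "l2fun F \<Longrightarrow> AE y in torus_measure. rep_torus_l2 (abs_torus_l2 F) y = F y"
  using rep_abs by (auto simp: l2eq_def)

lemma cinner_abs:
  "l2fun F \<Longrightarrow> l2fun G \<Longrightarrow> cinner (abs_torus_l2 F) (abs_torus_l2 G) = torus_mean (\<lambda>y. F y * cnj (G y))"
  by (rule cinner.abs_eq) (auto simp: l2eq_def)

lemma cinner_abs_left: "l2fun F \<Longrightarrow> cinner (abs_torus_l2 F) W = torus_mean (\<lambda>y. F y * cnj (rep_torus_l2 W y))"
  using cinner_abs[of F "rep_torus_l2 W"] by simp

lemma cinner_abs_right: "l2fun F \<Longrightarrow> cinner U (abs_torus_l2 F) = torus_mean (\<lambda>y. rep_torus_l2 U y * cnj (F y))"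
  using cinner_abs[of "rep_torus_l2 U" F] by simp

lemma abs_torus_l2_scaleC: "l2fun F \<Longrightarrow> c *\<^sub>C abs_torus_l2 F = abs_torus_l2 (\<lambda>y. c * F y)"
  by (rule scaleC.abs_eq) (simp add: l2eq_def)

lemma abs_torus_l2_add: "l2fun F \<Longrightarrow> l2fun G \<Longrightarrow> abs_torus_l2 F + abs_torus_l2 G = abs_torus_l2 (\<lambda>y. F y + G y)"
  by (rule plus_torus_l2.abs_eq) (simp_all add: l2eq_def)

lemma abs_torus_l2_diff:
  assumes "l2fun F" "l2fun G" shows "abs_torus_l2 F - abs_torus_l2 G = abs_torus_l2 (\<lambda>y. F y - G y)"
proof -
  have "abs_torus_l2 F - abs_torus_l2 G = abs_torus_l2 F + abs_torus_l2 (\<lambda>y. (-1) * G y)"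
    unfolding abs_torus_l2_scaleC[OF assms(2), symmetric] minus_torus_l2_def uminus_torus_l2_def ..
  also have "\<dots> = abs_torus_l2 (\<lambda>y. F y + (-1) * G y)"
    using assms l2fun_cmult by (intro abs_torus_l2_add)
  finally show ?thesis by simp
qed

lemma torus_mean_sq:
  "torus_mean (\<lambda>y. F y * cnj (F y) :: complex)
     = of_real ((LINT y|torus_measure. (cmod (F y))\<^sup>2) / (2 * pi) ^ CARD('n))" for F :: "real^'n \<Rightarrow> complex"
proof -
  have "(LINT y|torus_measure. F y * cnj (F y)) = complex_of_real (LINT y|torus_measure. (cmod (F y))\<^sup>2)"
    unfolding integral_complex_of_real[symmetric] complex_norm_square[symmetric] of_real_power ..
  then show ?thesis by (simp add: torus_mean_def)
qed

lemma norm_torus_l2_abs: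
  fixes F :: "real^'n \<Rightarrow> complex" assumes "l2fun F"
  shows "(norm (abs_torus_l2 F))\<^sup>2 = (LINT y|torus_measure. (cmod (F y))\<^sup>2) / (2 * pi) ^ CARD('n)"
proof -
  have "(norm (abs_torus_l2 F))\<^sup>2 = Re (cinner (abs_torus_l2 F) (abs_torus_l2 F))"
    by (simp add: power2_norm_eq_inner inner_torus_l2_def)
  then show ?thesis using assms by (simp only: cinner_abs torus_mean_sq Re_complex_of_real)
qed

lemma cinner_add_left: "cinner (U + U') W = cinner U W + cinner U' W"
  by transfer (simp add: torus_mean_def l2eq_def distrib_right add_divide_distrib l2fun_prod_integrable)

lemma cinner_scaleC_left: "cinner (c *\<^sub>C U) W = c * cinner U W"
  by transfer (simp add: torus_mean_def mult.assoc)

lemma cinner_commute: "cinner U W = cnj (cinner W U)"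
  by transfer (simp add: torus_mean_def mult.commute flip: Bochner_Integration.integral_cnj)

lemma scaleR_scaleC: "r *\<^sub>R U = of_real r *\<^sub>C U" for U :: "('n::finite) torus_l2"
  by (simp add: scaleR_torus_l2_def)

global_interpretation L2: cinner_space scaleC UNIV cinner
  rewrites "module.span scaleC = cspan"
proof -
  show "cinner_space scaleC UNIV (cinner :: ('n::finite) torus_l2 \<Rightarrow> _)"
  proof unfold_locales
    show "cvec.subspace (UNIV :: 'n torus_l2 set)" by (simp add: cvec.subspace_def)
    fix U :: "'n torus_l2" assume "U \<noteq> 0"
    then have "0 < inner U U" by simp
    then show "0 < Re (cinner U U)" by (simp add: inner_torus_l2_def)
  qed (auto simp: cinner_add_left cinner_scaleC_left intro: cinner_commute)
  show "module.span scaleC = cspan" by (simp add: cspan_def)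
qed

lemma L2_nrm [simp]: "L2.nrm = norm"
  by (simp add: L2.nrm_def norm_torus_l2_def fun_eq_iff)

lemma cinner_ext: "(\<And>W. cinner U W = cinner U' W) \<Longrightarrow> U = U'"
  by (rule L2.eqI_form) auto

lemma norm_scaleC: "norm (c *\<^sub>C U) = cmod c * norm U"
  using L2.nrm_scale[of U c] by simp

lemma cmod_cinner_le: "cmod (cinner U W) \<le> norm U * norm W"
  using L2.Cauchy_Schwarz[of U W] by simp

lemma cinner_self: "cinner U U = of_real ((norm U)\<^sup>2)"
  using L2.a_self[of U] by simp

lemmas cinner_simps = cinner_add_left cinner_scaleC_left L2.a_add_right[OF UNIV_I UNIV_I UNIV_I]
  L2.a_scale_right[OF UNIV_I UNIV_I] L2.a_diff_left[OF UNIV_I UNIV_I UNIV_I] L2.a_diff_right[OF UNIV_I UNIV_I UNIV_I]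

lemma bounded_linear_cinner_left: "bounded_linear (\<lambda>U. cinner U W)"
proof (rule bounded_linear_intro)
  show "norm (cinner U W) \<le> norm U * norm W" for U by (rule cmod_cinner_le)
qed (auto simp: cinner_simps scaleR_scaleC scaleR_conv_of_real)

subsection \<open>Completeness\<close>

text \<open>Riesz and Fischer: along a subsequence with summable increments the representatives
  converge almost everywhere, and the limit is square integrable by Fatou's lemma.\<close>

lemma L2_complete_fast:
  fixes X :: "nat \<Rightarrow> ('n::finite) torus_l2"
  assumes fast: "\<And>k. norm (X (Suc k) - X k) \<le> (1 / 2) ^ k" and "Cauchy X"
  shows "\<exists>L. X \<longlonglongrightarrow> L"
proof -
  interpret finite_measure "torus_measure :: (real^'n) measure" by (rule finite_torus_measure)
  define M where "M = (torus_measure :: (real^'n) measure)"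
  define vol where "vol = (2 * pi) ^ CARD('n)"
  have vol: "vol > 0" by (simp add: vol_def)
  define f where "f k = rep_torus_l2 (X k)" for k
  have l2: "l2fun (f k)" for k by (simp add: f_def)
  have mb: "f k \<in> borel_measurable borel" for k using l2[of k] by (simp add: l2fun_def)
  have m: "f k \<in> borel_measurable M" for k unfolding M_def by (rule measurable_torus[OF mb])
  have per: "torus_periodic (f k)" for k using l2[of k] by (simp add: l2fun_def)
  have l2d: "l2fun (\<lambda>y. f j y - f k y)" for j k
    using l2fun_add[OF l2[of j] l2fun_cmult[OF l2[of k], of "-1"]] by simp
  have sq_int: "integrable M (\<lambda>y. (cmod (f j y - f k y))\<^sup>2)" for j k
    using l2d[of j k] by (simp add: l2fun_def M_def)
  have minus: "X j - X k = abs_torus_l2 (\<lambda>y. f j y - f k y)" for j k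
    unfolding abs_torus_l2_diff[OF l2 l2, symmetric] by (simp add: f_def)
  have sq: "(LINT y|M. (cmod (f j y - f k y))\<^sup>2) = vol * (norm (X j - X k))\<^sup>2" for j k
    unfolding minus norm_torus_l2_abs[OF l2d] using vol by (simp add: vol_def M_def)
  have nn: "(\<integral>\<^sup>+y. ennreal ((cmod (f j y - f k y))\<^sup>2) \<partial>M) = ennreal (vol * (norm (X j - X k))\<^sup>2)" for j k
    unfolding sq[symmetric] by (rule nn_integral_eq_integral[OF sq_int]) simp
  have L1: "(\<integral>\<^sup>+y. ennreal (cmod (f (Suc k) y - f k y)) \<partial>M) \<le> ennreal (2 * measure M (space M) * (1/2)^k + 2 * vol * (1/2)^k)" for k
  proof -
    let ?q = "(1/2::real)^k"
    \<comment> \<open>Weighting by \<open>?q\<close> turns the bound on the squares into a summable bound in \<open>L\<^sup>1\<close>.\<close>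
    have pt: "t \<le> ?q + t\<^sup>2 / ?q" if "t \<ge> 0" for t
    proof (cases "t \<le> ?q")
      case False
      then have "t * ?q \<le> t * t" using that by (intro mult_left_mono) auto
      then have "t \<le> t\<^sup>2 / ?q" by (simp add: field_simps power2_eq_square)
      then show ?thesis by (simp add: add_increasing)
    qed (simp add: add_increasing2)
    have i: "integrable M (\<lambda>y. ?q + (cmod (f (Suc k) y - f k y))\<^sup>2 / ?q)"
      by (intro Bochner_Integration.integrable_add integrable_divide sq_int) (simp add: M_def)
    have "(\<integral>\<^sup>+y. ennreal (cmod (f (Suc k) y - f k y)) \<partial>M)
        \<le> (\<integral>\<^sup>+y. ennreal (?q + (cmod (f (Suc k) y - f k y))\<^sup>2 / ?q) \<partial>M)"
      by (intro nn_integral_mono ennreal_leI pt) simp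
    also have "\<dots> = ennreal (LINT y|M. ?q + (cmod (f (Suc k) y - f k y))\<^sup>2 / ?q)"
      by (rule nn_integral_eq_integral[OF i]) simp
    also have "(LINT y|M. ?q + (cmod (f (Suc k) y - f k y))\<^sup>2 / ?q)
        = measure M (space M) * ?q + vol * (norm (X (Suc k) - X k))\<^sup>2 / ?q"
      by (subst Bochner_Integration.integral_add) (auto simp: sq M_def sq_int[unfolded M_def] sq[unfolded M_def])
    also have "\<dots> \<le> 2 * measure M (space M) * ?q + 2 * vol * ?q"
    proof -
      have "(norm (X (Suc k) - X k))\<^sup>2 \<le> ?q\<^sup>2" using fast[of k] by (intro power_mono) auto
      then have "vol * (norm (X (Suc k) - X k))\<^sup>2 / ?q \<le> vol * ?q\<^sup>2 / ?q"
        using vol by (intro divide_right_mono mult_left_mono) auto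
      also have "\<dots> = vol * ?q" by (simp add: power2_eq_square)
      also have "vol * ?q \<le> 2 * vol * ?q" using vol by simp
      finally have "vol * (norm (X (Suc k) - X k))\<^sup>2 / ?q \<le> 2 * vol * ?q" .
      moreover have "measure M (space M) * ?q \<le> 2 * measure M (space M) * ?q" by simp
      ultimately show ?thesis by linarith
    qed
    finally show ?thesis by (simp add: ennreal_leI)
  qed
  have "(\<integral>\<^sup>+y. (\<Sum>k. ennreal (cmod (f (Suc k) y - f k y))) \<partial>M)
      = (\<Sum>k. \<integral>\<^sup>+y. ennreal (cmod (f (Suc k) y - f k y)) \<partial>M)"
    using m by (intro nn_integral_suminf) measurable
  also have "\<dots> \<le> (\<Sum>k. ennreal (2 * measure M (space M) * (1/2)^k + 2 * vol * (1/2)^k))"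
    by (intro suminf_le L1) auto
  also have "\<dots> < \<infinity>"
  proof -
    have "summable (\<lambda>k. 2 * measure M (space M) * (1/2)^k + 2 * vol * (1/2::real)^k)"
      by (intro summable_add summable_mult summable_geometric) auto
    then show ?thesis using vol by (subst suminf_ennreal2) auto
  qed
  finally have "AE y in M. (\<Sum>k. ennreal (cmod (f (Suc k) y - f k y))) \<noteq> \<infinity>"
    using m by (intro nn_integral_PInf_AE) (auto intro!: borel_measurable_suminf_order)
  then have conv: "AE y in M. convergent (\<lambda>k. f k y)"
  proof eventually_elim
    case (elim y)
    then have "summable (\<lambda>k. cmod (f (Suc k) y - f k y))"
      by (intro summable_suminf_not_top) (auto simp: top_unique)
    then have "summable (\<lambda>k. f (Suc k) y - f k y)" by (rule summable_norm_cancel)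
    then have "convergent (\<lambda>n. \<Sum>k<n. f (Suc k) y - f k y)" by (simp add: summable_iff_convergent)
    then have "convergent (\<lambda>n. f n y - f 0 y)" by (simp add: sum_lessThan_telescope[of "\<lambda>k. f k y"])
    then have "convergent (\<lambda>n. (f n y - f 0 y) + f 0 y)" by (intro convergent_add convergent_const)
    then show ?case by simp
  qed
  define g where "g y = lim (\<lambda>k. f k y)" for y
  have gm: "g \<in> borel_measurable borel" unfolding g_def using mb by (rule borel_measurable_lim_metric)
  have gper: "torus_periodic g" using per by (simp add: torus_periodic_def g_def)
  have lim: "AE y in M. (\<lambda>k. f k y) \<longlonglongrightarrow> g y"
    using conv by eventually_elim (simp add: g_def convergent_LIMSEQ_iff)
  have est: "(\<integral>\<^sup>+y. ennreal ((cmod (g y - f k y))\<^sup>2) \<partial>M) \<le> ennreal (vol * e\<^sup>2)"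
    if "e \<ge> 0" "\<And>j. j \<ge> k \<Longrightarrow> norm (X j - X k) \<le> e" for k e
  proof -
    have "(\<integral>\<^sup>+y. ennreal ((cmod (g y - f k y))\<^sup>2) \<partial>M)
        = (\<integral>\<^sup>+y. liminf (\<lambda>j. ennreal ((cmod (f j y - f k y))\<^sup>2)) \<partial>M)"
    proof (rule nn_integral_cong_AE)
      show "AE y in M. ennreal ((cmod (g y - f k y))\<^sup>2) = liminf (\<lambda>j. ennreal ((cmod (f j y - f k y))\<^sup>2))"
        using lim
      proof eventually_elim
        case (elim y)
        then have "(\<lambda>j. ennreal ((cmod (f j y - f k y))\<^sup>2)) \<longlonglongrightarrow> ennreal ((cmod (g y - f k y))\<^sup>2)"
          by (intro tendsto_intros)
        from lim_imp_Liminf[OF _ this] show ?case by simp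
      qed
    qed
    also have "\<dots> \<le> liminf (\<lambda>j. \<integral>\<^sup>+y. ennreal ((cmod (f j y - f k y))\<^sup>2) \<partial>M)"
      using m by (intro nn_integral_liminf) measurable
    also have "\<dots> \<le> ennreal (vol * e\<^sup>2)"
    proof (rule Liminf_le)
      show "\<forall>\<^sub>F j in sequentially. (\<integral>\<^sup>+y. ennreal ((cmod (f j y - f k y))\<^sup>2) \<partial>M) \<le> ennreal (vol * e\<^sup>2)"
        using eventually_ge_at_top[of k]
      proof eventually_elim
        case (elim j)
        show ?case unfolding nn using that(2)[OF elim] vol that(1)
          by (intro ennreal_leI mult_left_mono power_mono) auto
      qed
    qed simp
    finally show ?thesis .
  qed
  have gd: "l2fun (\<lambda>y. g y - f k y)" "norm (abs_torus_l2 (\<lambda>y. g y - f k y)) \<le> e"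
    if "e \<ge> 0" "\<And>j. j \<ge> k \<Longrightarrow> norm (X j - X k) \<le> e" for k e
  proof -
    have "integrable M (\<lambda>y. (cmod (g y - f k y))\<^sup>2)"
    proof (rule integrableI_nonneg)
      show "(\<lambda>y. (cmod (g y - f k y))\<^sup>2) \<in> borel_measurable M"
        unfolding M_def by (rule measurable_torus) (use gm mb in measurable)
      show "(\<integral>\<^sup>+y. ennreal ((cmod (g y - f k y))\<^sup>2) \<partial>M) < \<infinity>"
        using est[OF that] by (auto intro: le_less_trans)
    qed auto
    then show l: "l2fun (\<lambda>y. g y - f k y)"
      using gper per[of k] gm mb[of k] by (auto simp: l2fun_def torus_periodic_def M_def)
    have "ennreal (LINT y|M. (cmod (g y - f k y))\<^sup>2) \<le> ennreal (vol * e\<^sup>2)"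
      using est[OF that] nn_integral_eq_integral[OF \<open>integrable M (\<lambda>y. (cmod (g y - f k y))\<^sup>2)\<close>] by simp
    then have "(LINT y|M. (cmod (g y - f k y))\<^sup>2) \<le> vol * e\<^sup>2" using vol by (simp add: ennreal_le_iff)
    then have "(norm (abs_torus_l2 (\<lambda>y. g y - f k y)))\<^sup>2 \<le> e\<^sup>2"
      unfolding norm_torus_l2_abs[OF l] using vol by (simp add: vol_def M_def field_simps)
    then show "norm (abs_torus_l2 (\<lambda>y. g y - f k y)) \<le> e" using that(1) by (rule power2_le_imp_le)
  qed
  obtain K where K: "\<And>i j. i \<ge> K \<Longrightarrow> j \<ge> K \<Longrightarrow> norm (X i - X j) < 1"
    using \<open>Cauchy X\<close> unfolding Cauchy_def dist_norm by (metis zero_less_one)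
  have "l2fun (\<lambda>y. g y - f K y)" by (rule gd(1)[of 1]) (use K less_imp_le in auto)
  from l2fun_add[OF this l2[of K]] have gl2: "l2fun g" by simp
  have "X \<longlonglongrightarrow> abs_torus_l2 g"
    unfolding LIMSEQ_def dist_norm
  proof (intro allI impI)
    fix e :: real assume e: "e > 0"
    then obtain N where N: "\<And>i j. i \<ge> N \<Longrightarrow> j \<ge> N \<Longrightarrow> norm (X i - X j) < e / 2"
      using \<open>Cauchy X\<close> unfolding Cauchy_def dist_norm by (metis half_gt_zero)
    have "norm (X k - abs_torus_l2 g) < e" if k: "k \<ge> N" for k
    proof -
      have d: "norm (abs_torus_l2 (\<lambda>y. g y - f k y)) \<le> e / 2"
        by (rule gd(2)) (use N k e in \<open>auto intro: less_imp_le\<close>)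
      also have "abs_torus_l2 (\<lambda>y. g y - f k y) = abs_torus_l2 g - X k"
        unfolding abs_torus_l2_diff[OF gl2 l2, symmetric] by (simp add: f_def)
      finally show ?thesis using d e by (simp add: norm_minus_commute)
    qed
    then show "\<exists>N. \<forall>k\<ge>N. norm (X k - abs_torus_l2 g) < e" by blast
  qed
  then show ?thesis by blast
qed

instance torus_l2 :: (finite) banach
proof
  fix X :: "nat \<Rightarrow> 'a torus_l2" assume C: "Cauchy X"
  have "\<forall>k. \<exists>N. \<forall>i\<ge>N. \<forall>j\<ge>N. norm (X i - X j) < (1 / 2) ^ k"
    using C unfolding Cauchy_def dist_norm by simp
  then obtain N where N: "\<And>k i j. i \<ge> N k \<Longrightarrow> j \<ge> N k \<Longrightarrow> norm (X i - X j) < (1 / 2) ^ k" by metis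
  define r where "r = rec_nat (N 0) (\<lambda>k m. Suc (max m (N (Suc k))))"
  have r0: "r 0 = N 0" and rS: "r (Suc k) = Suc (max (r k) (N (Suc k)))" for k by (simp_all add: r_def)
  have mono: "strict_mono r" by (rule strict_monoI_Suc) (simp add: rS)
  have ge: "r k \<ge> N k" for k by (cases k) (auto simp: r0 rS)
  have "norm ((X \<circ> r) (Suc k) - (X \<circ> r) k) \<le> (1 / 2) ^ k" for k
  proof -
    have "r (Suc k) \<ge> N k" using ge[of k] strict_monoD[OF mono, of k "Suc k"] by simp
    then show ?thesis using N[of k "r (Suc k)" "r k"] ge[of k] by (simp add: less_imp_le)
  qed
  moreover have "Cauchy (X \<circ> r)" using C mono by (rule Cauchy_subseq_Cauchy)
  ultimately obtain L where "(X \<circ> r) \<longlonglongrightarrow> L" using L2_complete_fast by blast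
  then have "X \<longlonglongrightarrow> L" using C mono by (metis Cauchy_converges_subseq)
  then show "convergent X" by (auto simp: convergent_def)
qed

section \<open>Smooth periodic functions\<close>

lemma torus_periodic_D: "torus_periodic F \<Longrightarrow> F (y + (2 * pi) *\<^sub>R axis j 1) = F y"
  by (simp add: torus_periodic_def)

text \<open>The functions that act on \<open>L\<^sup>2\<close> by multiplication; on the torus they are bounded.\<close>

definition cper :: "(real^'n \<Rightarrow> complex) \<Rightarrow> bool" where
  "cper g \<longleftrightarrow> continuous_on UNIV g \<and> torus_periodic g"

lemma cper_bounded_torus:
  assumes "cper g" obtains C where "C \<ge> 0" "\<And>y. y \<in> cbox 0 (\<chi> j. 2 * pi) \<Longrightarrow> cmod (g y) \<le> C"
proof -
  have "compact (g ` cbox 0 (\<chi> j. 2 * pi))"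
    by (rule compact_continuous_image[OF continuous_on_subset[OF conjunct1[OF assms[unfolded cper_def]] subset_UNIV] compact_cbox])
  from compact_imp_bounded[OF this] obtain C where "\<And>y. y \<in> cbox 0 (\<chi> j. 2 * pi) \<Longrightarrow> cmod (g y) \<le> C"
    unfolding bounded_iff by blast
  then show ?thesis by (intro that[of "max C 0"]) (auto intro: max.coboundedI1)
qed

lemma cper_measurable: "cper g \<Longrightarrow> g \<in> borel_measurable borel"
  unfolding cper_def by (intro borel_measurable_continuous_onI) auto

lemma AE_torusI: "(\<And>y. y \<in> cbox 0 (\<chi> j. 2 * pi) \<Longrightarrow> Q y) \<Longrightarrow> AE y in torus_measure. Q y"
  by (rule AE_I2) (simp add: torus_measure_def space_restrict_space)

lemma integrable_torus_bounded:
  assumes "g \<in> borel_measurable borel" "\<And>y. y \<in> cbox 0 (\<chi> j. 2 * pi) \<Longrightarrow> norm (g y) \<le> C"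
  shows "integrable torus_measure (g :: real^'n \<Rightarrow> 'b::{banach, second_countable_topology})"
proof -
  interpret finite_measure "torus_measure :: (real^'n) measure" by (rule finite_torus_measure)
  show ?thesis
  proof (rule integrable_const_bound[of _ C])
    show "AE y in torus_measure. norm (g y) \<le> C" by (rule AE_torusI) (rule assms(2))
    show "g \<in> borel_measurable torus_measure"
      using assms(1) unfolding torus_measure_def by (intro measurable_restrict_space1) simp
  qed
qed

lemma l2fun_mult_cper:
  assumes "cper g" "l2fun F" shows "l2fun (\<lambda>y. g y * F y)"
proof -
  obtain C where C: "C \<ge> 0" "\<And>y. y \<in> cbox 0 (\<chi> j. 2 * pi) \<Longrightarrow> cmod (g y) \<le> C"
    using cper_bounded_torus[OF assms(1)] by blast
  have gm: "g \<in> borel_measurable borel" by (rule cper_measurable[OF assms(1)])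
  have Fm: "F \<in> borel_measurable borel" and Fi: "integrable torus_measure (\<lambda>y. (cmod (F y))\<^sup>2)"
    using assms(2) by (auto simp: l2fun_def)
  have "integrable torus_measure (\<lambda>y. (cmod (g y * F y))\<^sup>2)"
  proof (rule Bochner_Integration.integrable_bound)
    show "integrable torus_measure (\<lambda>y. C\<^sup>2 * (cmod (F y))\<^sup>2)" using Fi by simp
    show "(\<lambda>y. (cmod (g y * F y))\<^sup>2) \<in> borel_measurable torus_measure"
      by (rule measurable_torus) (use gm Fm in measurable)
    show "AE y in torus_measure. norm ((cmod (g y * F y))\<^sup>2) \<le> norm (C\<^sup>2 * (cmod (F y))\<^sup>2)"
      by (rule AE_torusI) (auto simp: norm_mult power_mult_distrib intro!: mult_right_mono power_mono C)
  qed
  then show ?thesis using assms gm Fm by (auto simp: l2fun_def cper_def torus_periodic_def)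
qed

lemma l2fun_cper: "cper g \<Longrightarrow> l2fun g"
  using l2fun_mult_cper[of g "\<lambda>_. 1"] integrable_torus_bounded[of "\<lambda>_. 1::real" 1]
  by (simp add: l2fun_def torus_periodic_def)

definition mulop :: "(real^'n \<Rightarrow> complex) \<Rightarrow> ('n::finite) torus_l2 \<Rightarrow> 'n torus_l2" where
  "mulop g U = abs_torus_l2 (\<lambda>y. g y * rep_torus_l2 U y)"

lemma torus_mean_cong_AE:
  assumes "AE y in torus_measure. F y = G y" "F \<in> borel_measurable borel" "G \<in> borel_measurable borel"
  shows "torus_mean F = torus_mean G"
  unfolding torus_mean_def using assms by (subst integral_cong_AE[of F _ G]) (auto intro: measurable_torus)

lemma cinner_mulop:
  assumes "cper g"
  shows "cinner (mulop g U) W = torus_mean (\<lambda>y. g y * rep_torus_l2 U y * cnj (rep_torus_l2 W y))"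
  unfolding mulop_def by (rule cinner_abs_left[OF l2fun_mult_cper[OF assms l2fun_rep]])

lemma cper_cnj: "cper g \<Longrightarrow> cper (\<lambda>y. cnj (g y))"
  by (auto simp: cper_def torus_periodic_def intro!: continuous_intros)

lemma cper_mult: "cper g \<Longrightarrow> cper h \<Longrightarrow> cper (\<lambda>y. g y * h y)"
  by (auto simp: cper_def torus_periodic_def intro!: continuous_intros)

lemma cinner_mulop_right:
  assumes "cper g"
  shows "cinner U (mulop g W) = torus_mean (\<lambda>y. rep_torus_l2 U y * cnj (g y * rep_torus_l2 W y))"
  unfolding mulop_def by (rule cinner_abs_right[OF l2fun_mult_cper[OF assms l2fun_rep]])

lemma mulop_adjoint:
  assumes "cper g" shows "cinner (mulop g U) W = cinner U (mulop (\<lambda>y. cnj (g y)) W)"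
  unfolding cinner_mulop[OF assms] cinner_mulop_right[OF cper_cnj[OF assms]] by (simp add: mult_ac)

lemma mulop_add: "cper g \<Longrightarrow> mulop g (U + W) = mulop g U + mulop g W"
  by (rule cinner_ext) (simp add: mulop_adjoint cinner_simps)

lemma mulop_scaleC: "cper g \<Longrightarrow> mulop g (c *\<^sub>C U) = c *\<^sub>C mulop g U"
  by (rule cinner_ext) (simp add: mulop_adjoint cinner_simps)

lemma mulop_abs:
  assumes "cper g" "l2fun F" shows "mulop g (abs_torus_l2 F) = abs_torus_l2 (\<lambda>y. g y * F y)"
  unfolding mulop_def
proof (rule Quotient3_rel_abs[OF Quotient3_torus_l2])
  show "l2eq (\<lambda>y. g y * rep_torus_l2 (abs_torus_l2 F) y) (\<lambda>y. g y * F y)"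
    unfolding l2eq_def
  proof (intro conjI)
    show "AE y in torus_measure. g y * rep_torus_l2 (abs_torus_l2 F) y = g y * F y"
      using AE_rep_abs[OF assms(2)] by eventually_elim simp
  qed (intro l2fun_mult_cper assms l2fun_rep)+
qed

lemma mulop_mulop:
  assumes "cper g" "cper h" shows "mulop g (mulop h U) = mulop (\<lambda>y. g y * h y) U"
  unfolding mulop_def[of h] mulop_abs[OF assms(1) l2fun_mult_cper[OF assms(2) l2fun_rep]]
  by (simp add: mulop_def mult.assoc)

lemma mulop_1 [simp]: "mulop (\<lambda>_. 1) U = U"
  by (simp add: mulop_def)

lemma norm_mulop_le:
  fixes U :: "('n::finite) torus_l2"
  assumes g: "cper g" and C: "C \<ge> 0" "\<And>y. y \<in> cbox 0 (\<chi> j. 2 * pi) \<Longrightarrow> cmod (g y) \<le> C"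
  shows "norm (mulop g U) \<le> C * norm U"
proof (rule power2_le_imp_le)
  let ?F = "rep_torus_l2 U"
  have l: "l2fun (\<lambda>y. g y * ?F y)" by (rule l2fun_mult_cper[OF g l2fun_rep])
  have i: "integrable torus_measure (\<lambda>y. (cmod (g y * ?F y))\<^sup>2)" "integrable torus_measure (\<lambda>y. (cmod (?F y))\<^sup>2)"
    using l l2fun_rep[of U] by (auto simp: l2fun_def)
  have "(LINT y|torus_measure. (cmod (g y * ?F y))\<^sup>2) \<le> (LINT y|torus_measure. C\<^sup>2 * (cmod (?F y))\<^sup>2)"
  proof (rule integral_mono_AE)
    show "AE y in torus_measure. (cmod (g y * ?F y))\<^sup>2 \<le> C\<^sup>2 * (cmod (?F y))\<^sup>2"
      by (rule AE_torusI) (auto simp: norm_mult power_mult_distrib intro!: mult_right_mono power_mono C)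
  qed (use i in auto)
  then have "(norm (mulop g U))\<^sup>2 \<le> C\<^sup>2 * ((LINT y|torus_measure. (cmod (?F y))\<^sup>2) / (2 * pi) ^ CARD('n))"
    unfolding mulop_def norm_torus_l2_abs[OF l] by (simp add: divide_right_mono)
  also have "(LINT y|torus_measure. (cmod (?F y))\<^sup>2) / (2 * pi) ^ CARD('n) = (norm U)\<^sup>2"
    using norm_torus_l2_abs[OF l2fun_rep[of U]] by simp
  finally show "(norm (mulop g U))\<^sup>2 \<le> (C * norm U)\<^sup>2" by (simp add: power_mult_distrib)
qed (use C in simp)

subsection \<open>Test functions\<close>

lemma frechet_derivativeI:
  "(f has_derivative f') (at y) \<Longrightarrow> frechet_derivative f (at y) v = f' v"
  by (metis frechet_derivative_at)

lemma Ck_Suc_imp: "Ck (Suc m) f \<Longrightarrow> Ck m f"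
proof (induction m arbitrary: f)
  case 0
  then show ?case by (auto intro: differentiable_imp_continuous_on)
next
  case (Suc m)
  from Suc.prems show ?case
    unfolding Ck.simps(2)[of "Suc m"] Ck.simps(2)[of m f] using Suc.IH by blast
qed

lemma Ck_add: "Ck m f \<Longrightarrow> Ck m g \<Longrightarrow> Ck m (\<lambda>y. f y + g y)"
proof (induction m arbitrary: f g)
  case (Suc m)
  have d: "f differentiable (at y)" "g differentiable (at y)" for y
    using Suc.prems by (auto simp: differentiable_on_def)
  have "frechet_derivative (\<lambda>y. f y + g y) (at y) v = frechet_derivative f (at y) v + frechet_derivative g (at y) v" for y v
    by (rule frechet_derivativeI, rule has_derivative_add) (use d in \<open>simp_all add: frechet_derivative_works\<close>)
  then show ?case using Suc by (auto intro!: derivative_intros simp: differentiable_on_def)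
qed (auto intro: continuous_intros)

lemma Ck_mult: "Ck m f \<Longrightarrow> Ck m g \<Longrightarrow> Ck m (\<lambda>y. f y * g y)"
proof (induction m arbitrary: f g)
  case (Suc m)
  have d: "f differentiable (at y)" "g differentiable (at y)" for y
    using Suc.prems by (auto simp: differentiable_on_def)
  have "frechet_derivative (\<lambda>y. f y * g y) (at y) v
      = f y * frechet_derivative g (at y) v + frechet_derivative f (at y) v * g y" for y v
    by (rule frechet_derivativeI, rule has_derivative_mult) (use d in \<open>simp_all add: frechet_derivative_works\<close>)
  moreover have "Ck m f" "Ck m g" using Suc.prems Ck_Suc_imp by blast+
  ultimately show ?case using Suc by (auto intro!: derivative_intros Ck_add simp: differentiable_on_def)
qed (auto intro: continuous_intros)

lemma torus_test_mult: "torus_test \<phi> \<Longrightarrow> torus_test \<psi> \<Longrightarrow> torus_test (\<lambda>y. \<phi> y * \<psi> y)"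
  by (auto simp: torus_test_def torus_periodic_def intro: Ck_mult)

lemma torus_test_has_derivative:
  assumes "torus_test \<phi>" shows "(\<phi> has_derivative frechet_derivative \<phi> (at y)) (at y)"
proof -
  have "Ck (Suc 0) \<phi>" using assms unfolding torus_test_def by blast
  then show ?thesis by (auto simp: differentiable_on_def frechet_derivative_works)
qed

lemma torus_test_cper: "torus_test \<phi> \<Longrightarrow> cper \<phi>"
  unfolding torus_test_def cper_def by (metis Ck.simps(1))

lemma frechet_derivative_sum_axis:
  assumes "torus_test \<phi>"
  shows "frechet_derivative \<phi> (at y) v = (\<Sum>j\<in>UNIV. of_real (v $ j) * frechet_derivative \<phi> (at y) (axis j 1))"
proof -
  interpret bounded_linear "frechet_derivative \<phi> (at y)"
    using torus_test_has_derivative[OF assms] by (rule has_derivative_bounded_linear)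
  have "frechet_derivative \<phi> (at y) (\<Sum>j\<in>UNIV. v $ j *\<^sub>R axis j 1)
      = (\<Sum>j\<in>UNIV. of_real (v $ j) * frechet_derivative \<phi> (at y) (axis j 1))"
    by (simp only: sum scaleR) (simp add: scaleR_conv_of_real)
  also have "(\<Sum>j\<in>UNIV. v $ j *\<^sub>R axis j 1) = v"
    using basis_expansion[of v] by (simp add: scalar_mult_eq_scaleR)
  finally show ?thesis .
qed

lemma cper_test_deriv:
  fixes \<phi> :: "real^'n \<Rightarrow> complex"
  assumes "torus_test \<phi>" shows "cper (\<lambda>y. frechet_derivative \<phi> (at y) v)"
  unfolding cper_def
proof
  have "Ck (Suc 0) \<phi>" using assms unfolding torus_test_def by blast
  then have "continuous_on UNIV (\<lambda>y. frechet_derivative \<phi> (at y) (axis j 1))" for j by simp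
  then show "continuous_on UNIV (\<lambda>y. frechet_derivative \<phi> (at y) v)"
    unfolding frechet_derivative_sum_axis[OF assms, of _ v]
    by (intro continuous_on_sum continuous_on_mult continuous_on_const)
  show "torus_periodic (\<lambda>y. frechet_derivative \<phi> (at y) v)"
    unfolding torus_periodic_def
  proof (intro allI)
    fix y j
    let ?p = "(2 * pi) *\<^sub>R axis j 1 :: real^'n"
    have "(\<phi> has_derivative frechet_derivative \<phi> (at (y + ?p))) (at (y + ?p))"
      by (rule torus_test_has_derivative[OF assms])
    then have "((\<lambda>x. \<phi> (x + ?p)) has_derivative frechet_derivative \<phi> (at (y + ?p))) (at y)"
      by (intro has_derivative_compose[where g = \<phi> and f = "\<lambda>x. x + ?p" and f' = "\<lambda>x. x", simplified])
         (auto intro!: derivative_eq_intros)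
    moreover have "(\<lambda>x. \<phi> (x + ?p)) = \<phi>" using assms by (auto simp: torus_test_def torus_periodic_def)
    ultimately show "frechet_derivative \<phi> (at (y + ?p)) v = frechet_derivative \<phi> (at y) v"
      by (metis frechet_derivative_at)
  qed
qed

subsection \<open>Integrals of derivatives\<close>

lemma torus_integral_HK:
  assumes "continuous_on UNIV (g :: real^'n \<Rightarrow> complex)"
  shows "(LINT y|torus_measure. g y) = integral (cbox 0 (\<chi> j. 2 * pi)) g"
proof -
  have "set_integrable lborel (cbox 0 (\<chi> j. 2 * pi)) g"
    unfolding set_integrable_def
    by (intro borel_integrable_compact compact_cbox continuous_on_subset[OF assms]) simp
  then show ?thesis
    unfolding torus_measure_def
    by (simp add: integral_restrict_space set_borel_integral_eq_integral(2) flip: set_lebesgue_integral_def)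
qed

text \<open>Translating a periodic function does not change its integral over a period cell: moving the
  cell along a coordinate axis exchanges two slabs that differ by a period.\<close>

lemma periodic_integral_shift:
  fixes g :: "real^'n \<Rightarrow> complex"
  assumes g: "cper g" and h: "h \<ge> 0"
  shows "integral (cbox 0 (\<chi> j. 2 * pi)) (\<lambda>y. g (y + h *\<^sub>R axis j 1)) = integral (cbox 0 (\<chi> j. 2 * pi)) g"
proof -
  define c where "c = (\<chi> i. 2 * pi) - (2 * pi) *\<^sub>R (axis j 1 :: real^'n)"
  define Q where "Q s t = cbox (s *\<^sub>R axis j 1) (c + t *\<^sub>R axis j 1)" for s t :: real
  have Q: "x \<in> Q s t \<longleftrightarrow> (\<forall>i. if i = j then s \<le> x $ i \<and> x $ i \<le> t else 0 \<le> x $ i \<and> x $ i \<le> 2 * pi)" for x s t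
    by (auto simp: Q_def c_def mem_box_cart axis_def)
  have int: "g integrable_on cbox u v" for u v
    using g by (intro integrable_continuous) (auto simp: cper_def intro: continuous_on_subset)
  have add: "integral (Q s t) g = integral (Q s m) g + integral (Q m t) g" if "s \<le> m" "m \<le> t" for s m t
  proof -
    have 1: "Q s t \<inter> {x. x \<bullet> axis j 1 \<le> m} = Q s m"
      using that by (fastforce simp: Q inner_axis split: if_splits)
    have 2: "Q s t \<inter> {x. x \<bullet> axis j 1 \<ge> m} = Q m t"
      using that by (fastforce simp: Q inner_axis split: if_splits)
    have "(g has_integral (integral (Q s m) g + integral (Q m t) g)) (Q s t)"
      unfolding Q_def[of s t]
      by (rule has_integral_split[where k = "axis j 1" and c = m])
         (use 1 2 int in \<open>auto simp: Q_def axis_in_Basis_iff integrable_integral\<close>)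
    then show ?thesis by (rule integral_unique)
  qed
  have shift: "integral (Q s t) (\<lambda>y. g (y + d *\<^sub>R axis j 1)) = integral (Q (s + d) (t + d)) g" for s t d
    using integral_shift_cbox_plus[of "s *\<^sub>R axis j 1" "c + t *\<^sub>R axis j 1" g "d *\<^sub>R axis j 1"]
    by (simp add: Q_def o_def add_ac scaleR_left_distrib)
  have per: "integral (Q (2 * pi) (2 * pi + h)) g = integral (Q 0 h) g"
    using shift[of 0 h "2 * pi"] g by (simp add: cper_def torus_periodic_def add.commute)
  have Q0: "cbox 0 (\<chi> j. 2 * pi) = Q 0 (2 * pi)" by (simp add: Q_def c_def)
  have "integral (Q 0 (2 * pi)) (\<lambda>y. g (y + h *\<^sub>R axis j 1)) = integral (Q h (2 * pi + h)) g"
    using shift[of 0 "2 * pi" h] by simp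
  also have "\<dots> = integral (Q 0 (2 * pi)) g"
    using add[of 0 h "2 * pi + h"] add[of 0 "2 * pi" "2 * pi + h"] per h by simp
  finally show ?thesis by (simp only: Q0)
qed

text \<open>The mean of \<open>\<phi> (y + h e\<^sub>j)\<close> over the torus is independent of \<open>h\<close>; its derivative at \<open>h = 0\<close> is
  the mean of \<open>\<partial>\<^sub>j \<phi>\<close>.\<close>

lemma torus_mean_deriv:
  fixes \<phi> :: "real^'n \<Rightarrow> complex"
  assumes "torus_test \<phi>"
  shows "torus_mean (\<lambda>y. frechet_derivative \<phi> (at y) v) = 0"
proof -
  let ?B = "cbox 0 (\<chi> j. 2 * pi) :: (real^'n) set"
  have axis0: "integral ?B (\<lambda>y. frechet_derivative \<phi> (at y) (axis j 1)) = 0" for j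
  proof -
    let ?e = "axis j 1 :: real^'n"
    let ?D = "\<lambda>y. frechet_derivative \<phi> (at y) ?e"
    have cD: "continuous_on UNIV ?D" using cper_test_deriv[OF assms] by (auto simp: cper_def)
    have c\<phi>: "continuous_on UNIV \<phi>" using torus_test_cper[OF assms] by (auto simp: cper_def)
    have "((\<lambda>h. integral ?B (\<lambda>y. \<phi> (y + h *\<^sub>R ?e))) has_vector_derivative integral ?B (\<lambda>y. ?D (y + 0 *\<^sub>R ?e)))
        (at 0 within {0..1})"
    proof (rule leibniz_rule_vector_derivative)
      fix h y
      have "(\<phi> has_derivative frechet_derivative \<phi> (at (y + h *\<^sub>R ?e))) (at (y + h *\<^sub>R ?e))"
        by (rule torus_test_has_derivative[OF assms])
      moreover have "((\<lambda>h. y + h *\<^sub>R ?e) has_vector_derivative ?e) (at h within {0..1})"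
        by (auto intro!: derivative_eq_intros)
      ultimately have "((\<phi> \<circ> (\<lambda>h. y + h *\<^sub>R ?e)) has_vector_derivative ?D (y + h *\<^sub>R ?e)) (at h within {0..1})"
        by (intro vector_derivative_diff_chain_within) (auto intro: has_derivative_at_withinI)
      then show "((\<lambda>h. \<phi> (y + h *\<^sub>R ?e)) has_vector_derivative ?D (y + h *\<^sub>R ?e)) (at h within {0..1})"
        by (simp add: o_def)
    next
      show "(\<lambda>y. \<phi> (y + h *\<^sub>R ?e)) integrable_on ?B" for h
        by (intro integrable_continuous continuous_on_compose2[OF c\<phi>] continuous_intros) auto
      show "continuous_on ({0..1} \<times> ?B) (\<lambda>(h, y). ?D (y + h *\<^sub>R ?e))"
        unfolding split_def by (intro continuous_on_compose2[OF cD] continuous_intros) auto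
    qed auto
    moreover have "((\<lambda>h. integral ?B (\<lambda>y. \<phi> (y + h *\<^sub>R ?e))) has_vector_derivative 0) (at 0 within {0..1})"
      by (rule has_vector_derivative_transform[where f = "\<lambda>_. integral ?B \<phi>"])
         (auto simp: periodic_integral_shift[OF torus_test_cper[OF assms]])
    ultimately have "integral ?B (\<lambda>y. ?D (y + 0 *\<^sub>R ?e)) = 0"
      by (rule vector_derivative_unique_within_closed_interval[of 0 1 0, unfolded cbox_interval, rotated 2]) auto
    then show ?thesis by simp
  qed
  have c: "continuous_on UNIV (\<lambda>y. frechet_derivative \<phi> (at y) w)" for w
    using cper_test_deriv[OF assms] by (auto simp: cper_def)
  have "integral ?B (\<lambda>y. frechet_derivative \<phi> (at y) v)
      = (\<Sum>j\<in>UNIV. integral ?B (\<lambda>y. of_real (v $ j) * frechet_derivative \<phi> (at y) (axis j 1)))"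
    unfolding frechet_derivative_sum_axis[OF assms, of _ v]
    by (intro integral_sum integrable_continuous continuous_intros continuous_on_subset[OF c]) auto
  also have "\<dots> = 0" using axis0 by simp
  finally show ?thesis unfolding torus_mean_def torus_integral_HK[OF c] by simp
qed

section \<open>Fourier series on the torus\<close>

definition freq :: "int^'n \<Rightarrow> real^'n \<Rightarrow> real" where
  "freq k v = (\<Sum>j\<in>UNIV. of_int (k $ j) * v $ j)"

definition chi :: "int^'n \<Rightarrow> real^'n \<Rightarrow> complex" where
  "chi k y = exp (\<i> * of_real (freq k y))"

lemma expo_chi: "expo k = abs_torus_l2 (chi k)"
  by (simp add: expo_def chi_def[abs_def] freq_def)

lemma freq_add_left: "freq (k + l) v = freq k v + freq l v"
  by (simp add: freq_def distrib_right sum.distrib)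

lemma freq_uminus_left: "freq (- k) v = - freq k v"
  by (simp add: freq_def sum_negf)

lemma bounded_linear_freq: "bounded_linear (freq k)"
  unfolding freq_def[abs_def]
  by (intro bounded_linear_sum bounded_linear_const_mult bounded_linear_vec_nth)

lemma freq_axis [simp]: "freq k (axis j 1) = of_int (k $ j)"
  by (simp add: freq_def axis_def if_distrib cong: if_cong)

lemma chi_add: "chi (k + l) y = chi k y * chi l y"
  by (simp add: chi_def freq_add_left distrib_left exp_add)

lemma cnj_chi: "cnj (chi k y) = chi (- k) y"
  by (simp add: chi_def freq_uminus_left exp_cnj)

lemma cmod_chi [simp]: "cmod (chi k y) = 1"
  by (simp add: chi_def)

lemma chi_0 [simp]: "chi 0 y = 1"
  by (simp add: chi_def freq_def)

lemma torus_periodic_chi: "torus_periodic (chi k)"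
  unfolding torus_periodic_def
proof (intro allI)
  fix y j
  interpret bounded_linear "freq k" by (rule bounded_linear_freq)
  have "chi k (y + (2 * pi) *\<^sub>R axis j 1) = chi k y * exp (2 * of_int (k $ j) * of_real pi * \<i>)"
    by (simp add: chi_def add scaleR distrib_left exp_add mult_ac)
  also have "exp (2 * of_int (k $ j) * of_real pi * \<i>) = 1"
    unfolding exp_eq_1 by (auto intro!: exI[of _ "k $ j"])
  finally show "chi k (y + (2 * pi) *\<^sub>R axis j 1) = chi k y" by simp
qed

lemma chi_has_derivative: "(chi k has_derivative (\<lambda>v. \<i> * of_real (freq k v) * chi k y)) (at y)"
proof -
  have "bounded_linear (\<lambda>v. \<i> * complex_of_real (freq k v))"
    by (intro bounded_linear_const_mult bounded_linear_compose[OF bounded_linear_of_real] bounded_linear_freq)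
  then have "((\<lambda>v. \<i> * complex_of_real (freq k v)) has_derivative (\<lambda>v. \<i> * of_real (freq k v))) (at y)"
    by (rule bounded_linear_imp_has_derivative)
  moreover have "(exp has_derivative (\<lambda>w. exp z * w)) (at z)" for z :: complex
    using DERIV_exp[of z] by (simp add: has_field_derivative_def)
  ultimately have "((\<lambda>v. exp (\<i> * complex_of_real (freq k v))) has_derivative
      (\<lambda>v. exp (\<i> * complex_of_real (freq k y)) * (\<i> * of_real (freq k v)))) (at y)"
    by (rule has_derivative_compose)
  then show ?thesis by (simp add: chi_def[abs_def] mult_ac)
qed

lemma frechet_derivative_chi: "frechet_derivative (chi k) (at y) v = \<i> * of_real (freq k v) * chi k y"
  by (rule frechet_derivativeI[OF chi_has_derivative])

lemma Ck_const: "Ck m (\<lambda>_. c)"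
proof (induction m arbitrary: c)
  case (Suc m)
  have "frechet_derivative (\<lambda>_. c) (at y) v = 0" for y v :: "real^'a"
    by (rule frechet_derivativeI[where f' = "\<lambda>_. 0"]) simp
  then show ?case using Suc[of 0] by (simp add: differentiable_on_def)
qed simp

lemma Ck_chi: "Ck m (chi k)"
proof (induction m)
  case 0
  show ?case
    unfolding Ck.simps continuous_on_eq_continuous_within
    using has_derivative_continuous[OF chi_has_derivative[of k]] by blast
next
  case (Suc m)
  have "chi k differentiable_on UNIV"
    unfolding differentiable_on_def differentiable_def using chi_has_derivative[of k] by blast
  then show ?case
    unfolding Ck.simps frechet_derivative_chi using Ck_mult[OF Ck_const Suc] by blast
qed

lemma torus_test_chi: "torus_test (chi k)"
  by (simp add: torus_test_def torus_periodic_chi Ck_chi)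

lemma cper_chi: "cper (chi k)"
  by (rule torus_test_cper[OF torus_test_chi])

lemma torus_mean_cmult: "torus_mean (\<lambda>y. c * F y) = c * torus_mean F"
  by (simp add: torus_mean_def)

lemma torus_mean_1: "torus_mean (\<lambda>_::real^'n. 1) = 1"
proof -
  have "(LINT y|(torus_measure :: (real^'n) measure). (1::complex)) = of_real (measure torus_measure (space (torus_measure :: (real^'n) measure)))"
    by (simp add: scaleR_conv_of_real)
  also have "measure torus_measure (space (torus_measure :: (real^'n) measure)) = measure lborel (cbox 0 (\<chi> j. 2 * pi) :: (real^'n) set)"
    unfolding torus_measure_def by (subst measure_restrict_space) (simp_all add: space_restrict_space)
  also have "\<dots> = (2 * pi) ^ CARD('n)"
    by (simp add: content_cbox_cart interval_eq_empty_cart)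
  finally show ?thesis by (simp add: torus_mean_def)
qed

lemma torus_mean_chi: "torus_mean (chi k) = (if k = 0 then 1 else 0)"
proof (cases "k = 0")
  case True
  then have "chi k = (\<lambda>_. 1)" by (simp add: fun_eq_iff)
  then show ?thesis using True by (simp add: torus_mean_1)
next
  case False
  then obtain j where j: "k $ j \<noteq> 0" by (auto simp: vec_eq_iff)
  have "torus_mean (\<lambda>y. (\<i> * of_int (k $ j)) * chi k y) = 0"
    using torus_mean_deriv[OF torus_test_chi, of k "axis j 1"] by (simp add: frechet_derivative_chi mult_ac)
  then have "torus_mean (chi k) = 0" using j by (simp only: torus_mean_cmult) simp
  then show ?thesis using False by simp
qed

lemma cinner_expo: "cinner (expo k) (expo l) = (if k = l then 1 else 0)"
proof -
  have "cinner (expo k) (expo l) = torus_mean (chi (k - l))"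
    unfolding expo_chi cinner_abs[OF l2fun_cper[OF cper_chi] l2fun_cper[OF cper_chi]]
    by (simp add: cnj_chi flip: chi_add)
  then show ?thesis by (simp add: torus_mean_chi)
qed

lemma norm_expo [simp]: "norm (expo k) = 1"
proof -
  have "complex_of_real ((norm (expo k))\<^sup>2) = 1" using cinner_self[of "expo k"] cinner_expo[of k k] by simp
  then have "(norm (expo k))\<^sup>2 = 1" unfolding of_real_eq_1_iff .
  then show ?thesis by (simp add: power2_eq_1_iff) (use norm_ge_zero[of "expo k"] in linarith)
qed

lemma mulop_chi_expo: "mulop (chi k) (expo l) = expo (k + l)"
  unfolding expo_chi mulop_abs[OF cper_chi l2fun_cper[OF cper_chi]] by (simp add: chi_add[abs_def])

lemma expo_eq_mulop: "cper g \<Longrightarrow> abs_torus_l2 g = mulop g (expo 0)"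
  unfolding expo_chi using mulop_abs[OF _ l2fun_cper[OF cper_chi], of g 0] by simp

definition fc :: "('n::finite) torus_l2 \<Rightarrow> int^'n \<Rightarrow> complex" where
  "fc U k = cinner U (expo k)"

lemma fc_simps: "fc (U + W) k = fc U k + fc W k" "fc (U - W) k = fc U k - fc W k" "fc (c *\<^sub>C U) k = c * fc U k"
  by (simp_all add: fc_def cinner_simps)

lemma cmod_fc_le: "cmod (fc U k) \<le> norm U"
  using cmod_cinner_le[of U "expo k"] by (simp add: fc_def)

subsection \<open>Completeness of the exponentials\<close>

inductive trigpoly :: "(real^'n \<Rightarrow> complex) \<Rightarrow> bool" where
  chi: "trigpoly (chi k)"
| cmult: "trigpoly g \<Longrightarrow> trigpoly (\<lambda>y. c * g y)"
| add: "trigpoly g \<Longrightarrow> trigpoly h \<Longrightarrow> trigpoly (\<lambda>y. g y + h y)"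

lemma trigpoly_const: "trigpoly (\<lambda>_. c)"
  using trigpoly.cmult[OF trigpoly.chi[of 0], of c] by simp

lemma trigpoly_sum: "(\<And>j. j \<in> J \<Longrightarrow> trigpoly (g j)) \<Longrightarrow> trigpoly (\<lambda>y. \<Sum>j\<in>J. g j y)"
  by (induction J rule: infinite_finite_induct) (auto intro: trigpoly_const trigpoly.add)

lemma trigpoly_chi_mult: "trigpoly g \<Longrightarrow> trigpoly (\<lambda>y. chi k y * g y)"
proof (induction rule: trigpoly.induct)
  case (chi l)
  show ?case using trigpoly.chi[of "k + l"] by (simp add: chi_add[abs_def])
next
  case (cmult g c)
  show ?case using trigpoly.cmult[OF cmult.IH, of c] by (simp add: mult_ac)
next
  case (add g h)
  show ?case using trigpoly.add[OF add.IH] by (simp add: distrib_left)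
qed

lemma trigpoly_mult: "trigpoly f \<Longrightarrow> trigpoly g \<Longrightarrow> trigpoly (\<lambda>y. f y * g y)"
proof (induction rule: trigpoly.induct)
  case (cmult f c)
  show ?case using trigpoly.cmult[OF cmult.IH[OF cmult.prems], of c] by (simp add: mult_ac)
next
  case (add f h)
  show ?case using trigpoly.add[OF add.IH(1)[OF add.prems] add.IH(2)[OF add.prems]] by (simp add: distrib_right)
qed (rule trigpoly_chi_mult)

lemma trigpoly_cper: "trigpoly g \<Longrightarrow> cper g"
proof (induction rule: trigpoly.induct)
  case (chi k)
  show ?case by (rule cper_chi)
qed (auto simp: cper_def torus_periodic_def intro!: continuous_intros)

text \<open>The embedding of the torus into \<open>\<complex>\<^sup>n\<close>. Polynomials in its real coordinates are trigonometric
  polynomials.\<close>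

definition torus_point :: "real^'n \<Rightarrow> complex^'n" where
  "torus_point y = (\<chi> j. exp (\<i> * of_real (y $ j)))"

lemma trigpoly_torus_point:
  "trigpoly (\<lambda>y. of_real (Re (torus_point y $ j)))" "trigpoly (\<lambda>y. of_real (Im (torus_point y $ j)))"
proof -
  have e: "torus_point y $ j = chi (axis j 1) y" for y
    by (simp add: torus_point_def chi_def freq_def axis_def if_distrib if_distribR cong: if_cong)
  have "of_real (Re (torus_point y $ j)) = (1 / 2) * (chi (axis j 1) y + chi (- axis j 1) y)"
    "of_real (Im (torus_point y $ j)) = (1 / (2 * \<i>)) * (chi (axis j 1) y + (-1) * chi (- axis j 1) y)" for y
    unfolding e cnj_chi[symmetric] by (simp_all add: complex_eq_iff)
  then show "trigpoly (\<lambda>y. of_real (Re (torus_point y $ j)))" "trigpoly (\<lambda>y. of_real (Im (torus_point y $ j)))"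
    by (simp_all only:) (intro trigpoly.intros)+
qed

lemma trigpoly_polynomial:
  "real_polynomial_function p \<Longrightarrow> trigpoly (\<lambda>y. of_real (p (torus_point y)))"
proof (induction rule: real_polynomial_function.induct)
  case (linear f)
  interpret f: bounded_linear f by (rule linear)
  have expand: "f z = (\<Sum>j\<in>UNIV. Re (z $ j) * f (axis j 1) + Im (z $ j) * f (axis j \<i>))" for z :: "complex^'a"
  proof -
    have "z = (\<Sum>j\<in>UNIV. Re (z $ j) *\<^sub>R axis j 1 + Im (z $ j) *\<^sub>R axis j \<i>)"
      by (simp add: vec_eq_iff axis_def complex_eq_iff if_distrib if_distribR sum.distrib cong: if_cong)
    then have "f z = f (\<Sum>j\<in>UNIV. Re (z $ j) *\<^sub>R axis j 1 + Im (z $ j) *\<^sub>R axis j \<i>)" by simp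
    then show ?thesis by (simp add: f.sum f.add f.scaleR)
  qed
  have "(\<lambda>y. complex_of_real (f (torus_point y))) = (\<lambda>y. \<Sum>j\<in>UNIV.
      of_real (Re (torus_point y $ j)) * of_real (f (axis j 1)) + of_real (Im (torus_point y $ j)) * of_real (f (axis j \<i>)))"
    by (intro ext, subst expand) (simp only: of_real_sum of_real_add of_real_mult)
  then show ?case
    by (simp only:) (intro trigpoly_sum trigpoly.add trigpoly_mult trigpoly_const trigpoly_torus_point)
next
  case (const c)
  show ?case by (rule trigpoly_const)
next
  case (add f g)
  then show ?case using trigpoly.add by fastforce
next
  case (mult f g)
  then show ?case using trigpoly_mult by fastforce
qed

lemma continuous_torus_point: "continuous_on S torus_point"
  unfolding torus_point_def[abs_def] by (intro continuous_on_vec_lambda continuous_intros)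

lemma periodic_torus_point: "torus_point (y + (2 * pi) *\<^sub>R axis j 1) = torus_point y"
proof -
  have "exp (\<i> * of_real (2 * pi)) = 1" using exp_two_pi_i by (simp add: mult_ac)
  then show ?thesis by (auto simp: torus_point_def vec_eq_iff axis_def distrib_left exp_add)
qed

text \<open>By the Stone--Weierstrass theorem a continuous function of \<open>torus_point y\<close> is a uniform limit of
  trigonometric polynomials, against which \<open>U\<close> integrates to zero.\<close>

lemma cinner_continuous_zero:
  fixes U :: "('n::finite) torus_l2" and h :: "complex^'n \<Rightarrow> real"
  assumes U: "\<And>k. fc U k = 0" and h: "continuous_on UNIV h"
  shows "torus_mean (\<lambda>y. rep_torus_l2 U y * of_real (h (torus_point y))) = 0"
proof -
  have cp: "cper (\<lambda>y. complex_of_real (h (torus_point y)))"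
    unfolding cper_def torus_periodic_def periodic_torus_point
    by (auto intro!: continuous_intros continuous_on_compose2[OF h continuous_torus_point])
  have inner: "torus_mean (\<lambda>y. rep_torus_l2 U y * g y) = cinner U (abs_torus_l2 (\<lambda>y. cnj (g y)))" if "cper g" for g
    by (subst cinner_abs_right) (auto intro!: l2fun_cper cper_cnj that)
  have zero: "cinner U (abs_torus_l2 (\<lambda>y. cnj (g y))) = 0" if "trigpoly g" for g
    using that
  proof (induction rule: trigpoly.induct)
    case (chi k)
    then show ?case using U[of "- k"] by (simp add: cnj_chi[abs_def] fc_def expo_chi)
  next
    case (cmult g c)
    have "l2fun (\<lambda>y. cnj (g y))" by (intro l2fun_cper cper_cnj trigpoly_cper cmult)
    from abs_torus_l2_scaleC[OF this, of "cnj c", symmetric] show ?case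
      using cmult.IH by (simp add: cinner_simps)
  next
    case (add g h)
    have "l2fun (\<lambda>y. cnj (g y))" "l2fun (\<lambda>y. cnj (h y))" by (intro l2fun_cper cper_cnj trigpoly_cper add)+
    from abs_torus_l2_add[OF this, symmetric] show ?case
      using add.IH by (simp add: cinner_simps)
  qed
  have "cmod (cinner U (abs_torus_l2 (\<lambda>y. cnj (of_real (h (torus_point y)))))) \<le> norm U * e" if e: "e > 0" for e
  proof -
    let ?S = "{z :: complex^'n. \<forall>j. norm (z $ j) = 1}"
    have "compact ?S"
    proof (rule compact_Int_closed[of "cball 0 (real CARD('n))" ?S, THEN back_subst[of compact]])
      show "closed ?S" by (intro closed_Collect_all closed_Collect_eq continuous_intros)
      show "cball 0 (real CARD('n)) \<inter> ?S = ?S"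
      proof -
        have "norm z \<le> real CARD('n)" if "z \<in> ?S" for z :: "complex^'n"
        proof -
          have "norm z \<le> (\<Sum>j\<in>UNIV. norm (z $ j))" unfolding norm_vec_def by (rule L2_set_le_sum) simp
          then show ?thesis using that by simp
        qed
        then show ?thesis by auto
      qed
    qed auto
    then obtain p where p: "real_polynomial_function p" "\<And>z. z \<in> ?S \<Longrightarrow> \<bar>h z - p z\<bar> < e"
      using Stone_Weierstrass_real_polynomial_function[OF _ continuous_on_subset[OF h subset_UNIV] e] by blast
    let ?d = "\<lambda>y. complex_of_real (h (torus_point y)) - of_real (p (torus_point y))"
    have tp: "trigpoly (\<lambda>y. complex_of_real (p (torus_point y)))" by (rule trigpoly_polynomial[OF p(1)])
    have cd: "cper ?d"
      using cp trigpoly_cper[OF tp] by (auto simp: cper_def torus_periodic_def intro!: continuous_intros)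
    have diff: "abs_torus_l2 (\<lambda>y. cnj (of_real (h (torus_point y)))) - abs_torus_l2 (\<lambda>y. cnj (of_real (p (torus_point y))))
        = abs_torus_l2 ?d"
      using cp trigpoly_cper[OF tp] by (subst abs_torus_l2_diff) (auto intro: l2fun_cper)
    have "cinner U (abs_torus_l2 (\<lambda>y. cnj (of_real (h (torus_point y))))) = cinner U (abs_torus_l2 ?d)"
      unfolding diff[symmetric] cinner_simps zero[OF tp] by simp
    also have "cmod \<dots> \<le> norm U * norm (abs_torus_l2 ?d)" by (rule cmod_cinner_le)
    also have "norm (abs_torus_l2 ?d) \<le> e * norm (expo 0 :: 'n torus_l2)"
      unfolding expo_eq_mulop[OF cd]
    proof (rule norm_mulop_le[OF cd])
      fix y :: "real^'n"
      have "torus_point y \<in> ?S" by (simp add: torus_point_def)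
      then have "\<bar>h (torus_point y) - p (torus_point y)\<bar> < e" by (rule p(2))
      then show "cmod (?d y) \<le> e" by (metis less_imp_le norm_of_real of_real_diff)
    qed (use e in simp)
    finally show ?thesis by (simp add: mult_left_mono)
  qed
  note small = this
  have "cmod (cinner U (abs_torus_l2 (\<lambda>y. cnj (of_real (h (torus_point y)))))) \<le> 0 + e" if "e > 0" for e
  proof -
    have p: "norm U + 1 > 0" by (rule add_nonneg_pos) auto
    then have "e / (norm U + 1) > 0" using that by (intro divide_pos_pos)
    from small[OF this] have "cmod (cinner U (abs_torus_l2 (\<lambda>y. cnj (of_real (h (torus_point y)))))) \<le> norm U * (e / (norm U + 1))" .
    also have "\<dots> \<le> (norm U + 1) * (e / (norm U + 1))" using that p by (intro mult_right_mono) auto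
    also have "\<dots> = 0 + e" using p by simp
    finally show ?thesis .
  qed
  then have "cmod (cinner U (abs_torus_l2 (\<lambda>y. cnj (of_real (h (torus_point y)))))) \<le> 0"
    by (rule field_le_epsilon)
  then show ?thesis unfolding inner[OF cp] by simp
qed

lemma cos_gt_iff:
  fixes t w :: real
  assumes "0 < w" "w \<le> pi" "\<bar>t\<bar> \<le> 2 * pi - w"
  shows "cos w < cos t \<longleftrightarrow> \<bar>t\<bar> < w"
proof (cases "\<bar>t\<bar> \<le> pi")
  case True
  then have "cos w < cos \<bar>t\<bar> \<longleftrightarrow> \<bar>t\<bar> < w" using assms by (intro cos_mono_less_eq) auto
  then show ?thesis by simp
next
  case False
  have "cos t = cos \<bar>t\<bar>" by simp
  also have "\<dots> = cos (2 * pi - \<bar>t\<bar>)" by (simp add: cos_diff)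
  also have "\<dots> \<le> cos w" using assms False by (intro cos_monotone_0_pi_le) auto
  finally show ?thesis using False assms by auto
qed

lemma tendsto_min_indicator:
  "(\<lambda>m. min 1 (real m * max 0 t)) \<longlonglongrightarrow> (if t > 0 then 1 else 0)" for t :: real
proof (cases "t > 0")
  case True
  have "\<forall>\<^sub>F m in sequentially. min 1 (real m * max 0 t) = 1"
  proof -
    obtain M where M: "1 < real M * t" using reals_Archimedean3[OF True] by blast
    have "min 1 (real m * max 0 t) = 1" if "m \<ge> M" for m
    proof -
      have "real M * t \<le> real m * t" using that True by (intro mult_right_mono) auto
      then have "1 \<le> real m * t" using M by linarith
      then show ?thesis using True by (simp add: max_def)
    qed
    then show ?thesis by (auto simp: eventually_sequentially)
  qed
  then show ?thesis using True by (simp add: tendsto_eventually)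
qed (simp add: max_def)

lemma prod_indicator: "finite J \<Longrightarrow> (\<Prod>j\<in>J. if Q j then 1 else 0 :: real) = (if \<forall>j\<in>J. Q j then 1 else 0)"
  by (induction J rule: finite_induct) auto

text \<open>The indicator of an open box in the torus is a bounded limit of continuous functions of the
  torus point, so \<open>U\<close> integrates to zero over every box.\<close>

lemma box_integral_zero:
  fixes U :: "('n::finite) torus_l2" and a b :: "real^'n"
  assumes U: "\<And>k. fc U k = 0" and ab: "\<And>j. 0 \<le> a $ j" "\<And>j. a $ j < b $ j" "\<And>j. b $ j \<le> 2 * pi"
  shows "(LINT y|torus_measure. rep_torus_l2 U y * of_real (indicator (box a b) y)) = 0"
proof -
  define c where "c j = (a $ j + b $ j) / 2" for j
  define w where "w j = (b $ j - a $ j) / 2" for j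
  define h where "h m z = (\<Prod>j\<in>UNIV. min 1 (real m * max 0 (Re (z $ j * exp (- (\<i> * of_real (c j)))) - cos (w j))))"
    for m :: nat and z :: "complex^'n"
  have hc: "continuous_on UNIV (h m)" for m
    unfolding h_def by (intro continuous_intros)
  have h01: "0 \<le> h m z" "h m z \<le> 1" for m z
    unfolding h_def by (auto intro!: prod_nonneg prod_le_1)
  have hlim: "(\<lambda>m. h m (torus_point y)) \<longlonglongrightarrow> indicator (box a b) y" if y: "y \<in> cbox 0 (\<chi> j. 2 * pi)" for y
  proof -
    have re: "Re (torus_point y $ j * exp (- (\<i> * of_real (c j)))) = cos (y $ j - c j)" for j
      by (simp add: torus_point_def flip: exp_add) (simp add: Re_exp flip: right_diff_distrib)
    have pos: "cos (y $ j - c j) - cos (w j) > 0 \<longleftrightarrow> a $ j < y $ j \<and> y $ j < b $ j" for j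
    proof -
      have yj: "0 \<le> y $ j" "y $ j \<le> 2 * pi" using y by (auto simp: mem_box_cart)
      have "cos (w j) < cos (y $ j - c j) \<longleftrightarrow> \<bar>y $ j - c j\<bar> < w j"
      proof (rule cos_gt_iff)
        show "\<bar>y $ j - c j\<bar> \<le> 2 * pi - w j" "0 < w j" "w j \<le> pi"
          using yj ab[of j] by (auto simp: c_def w_def field_simps)
      qed
      also have "\<dots> \<longleftrightarrow> a $ j < y $ j \<and> y $ j < b $ j" by (auto simp: c_def w_def field_simps)
      finally show ?thesis by simp
    qed
    have "(\<lambda>m. h m (torus_point y)) \<longlonglongrightarrow> (\<Prod>j\<in>UNIV. if cos (y $ j - c j) - cos (w j) > 0 then 1 else 0)"
      unfolding h_def re by (intro tendsto_prod tendsto_min_indicator)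
    also have "(\<Prod>j\<in>UNIV. if cos (y $ j - c j) - cos (w j) > 0 then 1 else 0) = (indicator (box a b) y :: real)"
      unfolding pos by (subst prod_indicator) (auto simp: mem_box_cart indicator_def)
    finally show ?thesis .
  qed
  let ?F = "rep_torus_l2 U"
  have Fm: "?F \<in> borel_measurable borel" using l2fun_rep[of U] by (simp add: l2fun_def)
  have one: "cper (\<lambda>_. 1)" by (simp add: cper_def torus_periodic_def)
  have Fi: "integrable torus_measure ?F"
    using l2fun_prod_integrable[OF l2fun_rep[of U] l2fun_cper[OF one]] by simp
  have hm: "(\<lambda>y. h m (torus_point y)) \<in> borel_measurable borel" for m
    by (intro borel_measurable_continuous_onI continuous_on_compose2[OF hc continuous_torus_point]) auto
  have "(\<lambda>m. LINT y|torus_measure. ?F y * of_real (h m (torus_point y)))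
      \<longlonglongrightarrow> (LINT y|torus_measure. ?F y * of_real (indicator (box a b) y))"
  proof (rule integral_dominated_convergence[where w = "\<lambda>y. norm (?F y)"])
    show "(\<lambda>y. ?F y * of_real (indicator (box a b) y)) \<in> borel_measurable torus_measure"
      by (rule measurable_torus) (use Fm in measurable)
    show "(\<lambda>y. ?F y * of_real (h m (torus_point y))) \<in> borel_measurable torus_measure" for m
      by (rule measurable_torus) (use Fm hm[of m] in measurable)
    show "AE y in torus_measure. (\<lambda>m. ?F y * of_real (h m (torus_point y))) \<longlonglongrightarrow> ?F y * of_real (indicator (box a b) y)"
      by (rule AE_torusI) (intro tendsto_intros hlim)
    show "AE y in torus_measure. norm (?F y * of_real (h m (torus_point y))) \<le> norm (?F y)" for m
      using h01 by (intro AE_torusI) (simp add: norm_mult mult_left_le)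
  qed (use Fi in auto)
  moreover have "(LINT y|torus_measure. ?F y * of_real (h m (torus_point y))) = 0" for m
    using cinner_continuous_zero[OF U hc, of m] by (simp add: torus_mean_def)
  ultimately have "(\<lambda>m::nat. 0) \<longlonglongrightarrow> (LINT y|torus_measure. ?F y * of_real (indicator (box a b) y))"
    by (simp only:)
  then show ?thesis by (simp only: LIMSEQ_const_iff)
qed

text \<open>The measures with the densities \<open>f\<^sup>+\<close> and \<open>f\<^sup>-\<close> agree on the boxes, an intersection-stable
  generator of the Borel sets, so they are equal.\<close>

lemma AE_zero_of_box_integrals:
  fixes f :: "'a::euclidean_space \<Rightarrow> real"
  assumes f: "integrable lborel f" and zero: "\<And>a b. (LINT x|lborel. f x * indicator (box a b) x) = 0"
  shows "AE x in lborel. f x = 0"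
proof -
  have fm [measurable]: "f \<in> borel_measurable borel" using borel_measurable_integrable[OF f] by simp
  have nnfin: "(\<integral>\<^sup>+x. ennreal (f x) \<partial>lborel) < \<infinity>" "(\<integral>\<^sup>+x. ennreal (- f x) \<partial>lborel) < \<infinity>"
    using f integrable_minus[OF f] by (auto simp: real_integrable_def top.not_eq_extremum)
  have eq: "(\<integral>\<^sup>+x. ennreal (f x) * indicator (box a b) x \<partial>lborel) = (\<integral>\<^sup>+x. ennreal (- f x) * indicator (box a b) x \<partial>lborel)" for a b
  proof -
    let ?g = "\<lambda>x. f x * indicator (box a b) x"
    have gi: "integrable lborel ?g" using integrable_mult_indicator[of "box a b" lborel f] f by (simp add: mult.commute)
    have e: "ennreal (f x) * indicator (box a b) x = ennreal (?g x)" "ennreal (- f x) * indicator (box a b) x = ennreal (- ?g x)" for x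
      by (auto simp: indicator_def)
    have fin: "(\<integral>\<^sup>+x. ennreal (?g x) \<partial>lborel) \<noteq> \<infinity>" "(\<integral>\<^sup>+x. ennreal (- ?g x) \<partial>lborel) \<noteq> \<infinity>"
      using gi by (auto simp: real_integrable_def)
    have cancel: "s = t" if "s \<noteq> \<infinity>" "t \<noteq> \<infinity>" "enn2real s - enn2real t = 0" for s t :: ennreal
    proof -
      have "s = ennreal (enn2real s)" "t = ennreal (enn2real t)"
        using that(1,2) by (simp_all add: less_top)
      then show ?thesis using that(3) by simp
    qed
    have "enn2real (\<integral>\<^sup>+x. ennreal (?g x) \<partial>lborel) - enn2real (\<integral>\<^sup>+x. ennreal (- ?g x) \<partial>lborel) = 0"
      using zero[of a b] real_lebesgue_integral_def[OF gi] by simp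
    then have "(\<integral>\<^sup>+x. ennreal (?g x) \<partial>lborel) = (\<integral>\<^sup>+x. ennreal (- ?g x) \<partial>lborel)"
      by (rule cancel[OF fin])
    then show ?thesis by (simp only: e)
  qed
  have "density lborel (\<lambda>x. ennreal (f x)) = density lborel (\<lambda>x. ennreal (- f x))"
  proof (rule measure_eqI_generator_eq[where E = "range (\<lambda>(a, b). box a b)" and \<Omega> = UNIV
        and A = "\<lambda>n::nat. box (- (real n *\<^sub>R One)) (real n *\<^sub>R One :: 'a)"])
    show "Int_stable (range (\<lambda>(a, b). box a b :: 'a set))"
      by (auto simp: Int_stable_def box_Int_box)
    show "sets (density lborel (\<lambda>x. ennreal (f x))) = sigma_sets UNIV (range (\<lambda>(a, b). box a b :: 'a set))"
      "sets (density lborel (\<lambda>x. ennreal (- f x))) = sigma_sets UNIV (range (\<lambda>(a, b). box a b :: 'a set))"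
      by (simp_all add: borel_eq_box)
    show "(\<Union>n::nat. box (- (real n *\<^sub>R One)) (real n *\<^sub>R One :: 'a)) = UNIV"
      using UN_box_eq_UNIV by simp
    show "range (\<lambda>n::nat. box (- (real n *\<^sub>R One)) (real n *\<^sub>R One :: 'a)) \<subseteq> range (\<lambda>(a, b). box a b)" by auto
    show "emeasure (density lborel (\<lambda>x. ennreal (f x))) (box (- (real n *\<^sub>R One)) (real n *\<^sub>R One :: 'a)) \<noteq> \<infinity>" for n
    proof -
      have "(\<integral>\<^sup>+x. ennreal (f x) * indicator (box (- (real n *\<^sub>R One)) (real n *\<^sub>R One)) x \<partial>lborel) \<le> (\<integral>\<^sup>+x. ennreal (f x) \<partial>lborel)"
        by (intro nn_integral_mono) (auto simp: indicator_def)
      then show ?thesis using nnfin(1) by (subst emeasure_density) (auto simp: top.not_eq_extremum)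
    qed
    show "emeasure (density lborel (\<lambda>x. ennreal (f x))) X = emeasure (density lborel (\<lambda>x. ennreal (- f x))) X"
      if "X \<in> range (\<lambda>(a, b). box a b)" for X
      using that by (auto simp: emeasure_density eq)
  qed auto
  then have "AE x in lborel. ennreal (f x) = ennreal (- f x)"
    by (intro sigma_finite_measure.density_unique[OF sigma_finite_lborel]) auto
  then show ?thesis
  proof eventually_elim
    case (elim x)
    have "\<not> f x > 0"
    proof
      assume pos: "f x > 0"
      have "ennreal (- f x) = 0" by (rule ennreal_neg) (use pos in linarith)
      with elim have "ennreal (f x) = 0" by (rule trans)
      then show False using pos unfolding ennreal_eq_0_iff by linarith
    qed
    moreover have "\<not> f x < 0"
    proof
      assume neg: "f x < 0"
      have "ennreal (f x) = 0" by (rule ennreal_neg) (use neg in linarith)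
      with elim[symmetric] have "ennreal (- f x) = 0" by (rule trans)
      then show False using neg unfolding ennreal_eq_0_iff by linarith
    qed
    ultimately show ?case by simp
  qed
qed

theorem fc_eq_0_imp:
  fixes U :: "('n::finite) torus_l2"
  assumes U: "\<And>k. fc U k = 0" shows "U = 0"
proof -
  let ?F = "rep_torus_l2 U"
  let ?B = "cbox 0 (\<chi> j. 2 * pi) :: (real^'n) set"
  let ?b = "(\<chi> j. 2 * pi) :: real^'n"
  have one: "cper (\<lambda>_. 1)" by (simp add: cper_def torus_periodic_def)
  have Fi: "integrable torus_measure ?F"
    using l2fun_prod_integrable[OF l2fun_rep[of U] l2fun_cper[OF one]] by simp
  have G: "integrable lborel (\<lambda>y. indicator ?B y *\<^sub>R ?F y)"
    using Fi unfolding torus_measure_def by (subst (asm) integrable_restrict_space) auto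
  have AEbd: "AE y in lborel. y \<in> ?B \<longrightarrow> y \<in> box 0 ?b"
  proof -
    have "?B - box 0 ?b \<in> null_sets lborel"
      using negligible_frontier_interval[of 0 ?b]
      by (simp add: negligible_iff_null_sets null_sets_completion_iff)
    then show ?thesis by (rule AE_not_in[THEN AE_mp]) auto
  qed
  have zero: "(LINT y|lborel. (indicator ?B y *\<^sub>R ?F y) * of_real (indicator (box a b) y)) = 0" for a b :: "real^'n"
  proof -
    define a' where "a' = (\<chi> j. max (a $ j) 0)"
    define b' where "b' = (\<chi> j. min (b $ j) (2 * pi))"
    have int: "box a b \<inter> box 0 ?b = box a' b'"
      by (auto simp: a'_def b'_def mem_box_cart)
    have "(LINT y|lborel. (indicator ?B y *\<^sub>R ?F y) * of_real (indicator (box a b) y))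
        = (LINT y|lborel. indicator ?B y *\<^sub>R (?F y * of_real (indicator (box a' b') y)))"
    proof (rule integral_cong_AE)
      show "AE y in lborel. (indicator ?B y *\<^sub>R ?F y) * of_real (indicator (box a b) y)
          = indicator ?B y *\<^sub>R (?F y * of_real (indicator (box a' b') y))"
        using AEbd unfolding int[symmetric] by eventually_elim (auto simp: indicator_def)
      have [measurable]: "?F \<in> borel_measurable borel" using l2fun_rep[of U] by (simp add: l2fun_def)
      show "(\<lambda>y. (indicator ?B y *\<^sub>R ?F y) * of_real (indicator (box a b) y)) \<in> borel_measurable lborel"
        "(\<lambda>y. indicator ?B y *\<^sub>R (?F y * of_real (indicator (box a' b') y))) \<in> borel_measurable lborel"
        by measurable
    qed
    also have "\<dots> = (LINT y|torus_measure. ?F y * of_real (indicator (box a' b') y))"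
      unfolding torus_measure_def by (subst integral_restrict_space) auto
    also have "\<dots> = 0"
    proof (cases "\<forall>j. a' $ j < b' $ j")
      case True
      then show ?thesis by (intro box_integral_zero[OF U]) (auto simp: a'_def b'_def)
    next
      case False
      then have "box a' b' = {}" by (auto simp: interval_eq_empty_cart not_less)
      then show ?thesis by simp
    qed
    finally show ?thesis .
  qed
  have "AE y in lborel. Re (indicator ?B y *\<^sub>R ?F y) = 0" "AE y in lborel. Im (indicator ?B y *\<^sub>R ?F y) = 0"
  proof -
    have i: "integrable lborel (\<lambda>y. (indicator ?B y *\<^sub>R ?F y) * of_real (indicator (box a b) y))" for a b
      using integrable_mult_indicator[of "box a b" lborel, OF _ G] by (simp add: scaleR_conv_of_real mult_ac)
    show "AE y in lborel. Re (indicator ?B y *\<^sub>R ?F y) = 0"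
    proof (rule AE_zero_of_box_integrals)
      show "integrable lborel (\<lambda>y. Re (indicator ?B y *\<^sub>R ?F y))" by (rule integrable_Re[OF G])
      show "(LINT y|lborel. Re (indicator ?B y *\<^sub>R ?F y) * indicator (box a b) y) = 0" for a b
        using arg_cong[OF zero[of a b], of Re] integral_Re[OF i[of a b]] by (simp add: mult.assoc)
    qed
    show "AE y in lborel. Im (indicator ?B y *\<^sub>R ?F y) = 0"
    proof (rule AE_zero_of_box_integrals)
      show "integrable lborel (\<lambda>y. Im (indicator ?B y *\<^sub>R ?F y))" by (rule integrable_Im[OF G])
      show "(LINT y|lborel. Im (indicator ?B y *\<^sub>R ?F y) * indicator (box a b) y) = 0" for a b
        using arg_cong[OF zero[of a b], of Im] integral_Im[OF i[of a b]] by (simp add: mult.assoc)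
    qed
  qed
  then have "AE y in lborel. y \<in> ?B \<longrightarrow> ?F y = 0"
    by eventually_elim (auto simp: complex_eq_iff)
  then have "AE y in torus_measure. ?F y = 0"
    unfolding torus_measure_def by (subst AE_restrict_space_iff) auto
  then have "abs_torus_l2 ?F = abs_torus_l2 (\<lambda>_. 0)"
    by (intro Quotient3_rel_abs[OF Quotient3_torus_l2]) (simp add: l2eq_def l2fun_zero)
  then show ?thesis by (simp add: zero_torus_l2_def)
qed

subsection \<open>Parseval's identity\<close>

definition fsum :: "(int^'n) set \<Rightarrow> ('n::finite) torus_l2 \<Rightarrow> 'n torus_l2" where
  "fsum J U = (\<Sum>k\<in>J. fc U k *\<^sub>C expo k)"

definition cube :: "nat \<Rightarrow> (int^'n) set" where
  "cube n = {k. \<forall>j. \<bar>k $ j\<bar> \<le> int n}"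

lemma finite_cube: "finite (cube n :: (int^'n) set)"
proof -
  have "cube n \<subseteq> vec_lambda ` (PiE UNIV (\<lambda>_::'n. {- int n..int n}))"
  proof
    fix k :: "int^'n" assume "k \<in> cube n"
    then have "- int n \<le> k $ j \<and> k $ j \<le> int n" for j by (simp add: cube_def abs_le_iff minus_le_iff)
    then have "(\<lambda>j. k $ j) \<in> PiE UNIV (\<lambda>_. {- int n..int n})" by auto
    moreover have "k = vec_lambda (\<lambda>j. k $ j)" by simp
    ultimately show "k \<in> vec_lambda ` (PiE UNIV (\<lambda>_::'n. {- int n..int n}))" by blast
  qed
  moreover have "finite (PiE UNIV (\<lambda>_::'n. {- int n..int n}))" by (intro finite_PiE) auto
  ultimately show ?thesis by (blast intro: finite_subset)
qed

lemma finite_subset_cube: "finite (J :: (int^'n) set) \<Longrightarrow> \<exists>n. J \<subseteq> cube n"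
proof -
  assume J: "finite J"
  define n where "n = nat (\<Sum>k\<in>J. \<Sum>j\<in>UNIV. \<bar>k $ j\<bar>)"
  have "\<bar>k $ j\<bar> \<le> int n" if "k \<in> J" for k :: "int^'n" and j
  proof -
    have "\<bar>k $ j\<bar> \<le> (\<Sum>j\<in>UNIV. \<bar>k $ j\<bar>)" by (rule member_le_sum) auto
    also have "\<dots> \<le> (\<Sum>k\<in>J. \<Sum>j\<in>UNIV. \<bar>k $ j\<bar>)" using J that by (intro member_le_sum) (auto intro: sum_nonneg)
    moreover have "0 \<le> (\<Sum>k\<in>J. \<Sum>j\<in>UNIV. \<bar>k $ j\<bar>)" by (intro sum_nonneg) auto
    ultimately show ?thesis by (simp add: n_def)
  qed
  then show ?thesis by (auto simp: cube_def)
qed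

lemma cube_mono: "m \<le> n \<Longrightarrow> cube m \<subseteq> cube n"
  by (fastforce simp: cube_def intro: order_trans)

lemma fc_sum: "fc (\<Sum>k\<in>J. c k *\<^sub>C expo k) l = (if l \<in> J then c l else 0)" if "finite J"
proof -
  have "fc (\<Sum>k\<in>J. c k *\<^sub>C expo k) l = (\<Sum>k\<in>J. c k * (if k = l then 1 else 0))"
    unfolding fc_def by (subst L2.a_sum_left) (auto simp: cinner_simps cinner_expo)
  also have "\<dots> = (\<Sum>k\<in>J. if k = l then c l else 0)" by (intro sum.cong) auto
  finally show ?thesis using that by simp
qed

lemma fc_fsum: "finite J \<Longrightarrow> fc (fsum J U) l = (if l \<in> J then fc U l else 0)"
  unfolding fsum_def by (rule fc_sum)

lemma norm_fsum: "finite J \<Longrightarrow> (norm (fsum J U))\<^sup>2 = (\<Sum>k\<in>J. (cmod (fc U k))\<^sup>2)"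
proof -
  assume J: "finite J"
  have "cinner (fsum J U) (fsum J U) = (\<Sum>k\<in>J. cnj (fc U k) * fc (fsum J U) k)"
    unfolding fsum_def[of J U] fc_def[of "sum _ _"] by (subst L2.a_sum_right) (auto simp: cinner_simps)
  also have "\<dots> = (\<Sum>k\<in>J. of_real ((cmod (fc U k))\<^sup>2))"
    using J by (intro sum.cong) (auto simp: fc_fsum complex_norm_square mult.commute simp del: of_real_power)
  finally have "complex_of_real ((norm (fsum J U))\<^sup>2) = of_real (\<Sum>k\<in>J. (cmod (fc U k))\<^sup>2)"
    by (simp add: cinner_self)
  then show ?thesis unfolding of_real_eq_iff .
qed

lemma norm_diff_fsum:
  assumes J: "finite J" shows "(norm (U - fsum J U))\<^sup>2 = (norm U)\<^sup>2 - (\<Sum>k\<in>J. (cmod (fc U k))\<^sup>2)"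
proof -
  have "cinner U (fsum J U) = (\<Sum>k\<in>J. of_real ((cmod (fc U k))\<^sup>2))"
    unfolding fsum_def
    by (subst L2.a_sum_right) (auto simp: cinner_simps fc_def[symmetric] complex_norm_square mult.commute simp del: of_real_power)
  then have "Re (cinner U (fsum J U)) = (\<Sum>k\<in>J. (cmod (fc U k))\<^sup>2)" by (simp flip: of_real_sum)
  then show ?thesis using L2.nrm_sq_diff[of U "fsum J U"] norm_fsum[OF J] by simp
qed

lemma Bessel: "finite J \<Longrightarrow> (\<Sum>k\<in>J. (cmod (fc U k))\<^sup>2) \<le> (norm U)\<^sup>2"
  using norm_diff_fsum[of J U] zero_le_power2[of "norm (U - fsum J U)"] by linarith

lemma fsum_cube_tendsto: "(\<lambda>n. fsum (cube n) U) \<longlonglongrightarrow> U"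
proof -
  let ?X = "\<lambda>n. fsum (cube n) U"
  let ?s = "\<lambda>n. \<Sum>k\<in>cube n. (cmod (fc U k))\<^sup>2"
  have inc: "incseq ?s"
    using finite_cube cube_mono by (auto simp: incseq_def intro!: sum_mono2)
  have "\<forall>n. ?s n \<le> (norm U)\<^sup>2" using Bessel[OF finite_cube, where U = U] by blast
  from incseq_convergent[OF inc this] have "convergent ?s" unfolding convergent_def by blast
  then have "Cauchy ?s" by (rule convergent_Cauchy)
  have diff: "(norm (?X n - ?X m))\<^sup>2 = ?s n - ?s m" if "m \<le> n" for m n
  proof -
    have "?X n - ?X m = fsum (cube n - cube m) U"
      unfolding fsum_def using sum_diff[OF finite_cube cube_mono[OF that], of "\<lambda>k. fc U k *\<^sub>C expo k"] by simp
    then show ?thesis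
      using sum_diff[OF finite_cube cube_mono[OF that], of "\<lambda>k. (cmod (fc U k))\<^sup>2"] norm_fsum[OF finite_Diff[OF finite_cube], of n "cube m" U]
      by simp
  qed
  have "Cauchy ?X"
    unfolding Cauchy_altdef2
  proof (intro allI impI)
    fix e :: real assume "e > 0"
    then obtain M where M: "\<And>m n. m \<ge> M \<Longrightarrow> n \<ge> M \<Longrightarrow> \<bar>?s m - ?s n\<bar> < e\<^sup>2"
      using \<open>Cauchy ?s\<close> unfolding Cauchy_def dist_real_def by (meson zero_less_power)
    have "dist (?X n) (?X M) < e" if "n \<ge> M" for n
    proof -
      have "(norm (?X n - ?X M))\<^sup>2 < e\<^sup>2" using diff[OF that] M[OF that order_refl] by linarith
      then show ?thesis using \<open>e > 0\<close> unfolding dist_norm by (rule power2_less_imp_less[OF _ less_imp_le])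
    qed
    then show "\<exists>N. \<forall>n\<ge>N. dist (?X n) (?X N) < e" by blast
  qed
  then have "convergent ?X" by (simp only: Cauchy_convergent_iff)
  then obtain L where L: "?X \<longlonglongrightarrow> L" unfolding convergent_def by blast
  have "fc L k = fc U k" for k
  proof (rule LIMSEQ_unique)
    show "(\<lambda>n. fc (?X n) k) \<longlonglongrightarrow> fc L k"
      unfolding fc_def by (rule bounded_linear.tendsto[OF bounded_linear_cinner_left L])
    obtain m where "k \<in> cube m" using finite_subset_cube[of "{k}"] by auto
    then have "fc (?X n) k = fc U k" if "n \<ge> m" for n
      using cube_mono[OF that] by (auto simp: fc_fsum finite_cube)
    then show "(\<lambda>n. fc (?X n) k) \<longlonglongrightarrow> fc U k"
      by (intro tendsto_eventually) (auto simp: eventually_sequentially)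
  qed
  then have "L - U = 0" by (intro fc_eq_0_imp) (simp add: fc_simps)
  then show ?thesis using L by simp
qed

lemma fc_eqI: "(\<And>k. fc U k = fc W k) \<Longrightarrow> U = W"
  using fc_eq_0_imp[of "U - W"] by (simp add: fc_simps)

text \<open>The tail of \<open>U\<close> is the limit of its partial sums over growing cubes, and Bessel's inequality
  bounds those in terms of \<open>W\<close>.\<close>

lemma norm_tail_le:
  assumes J: "finite J" and C: "C \<ge> 0" and I: "finite I"
    and le: "\<And>k. k \<notin> J \<Longrightarrow> (cmod (fc U k))\<^sup>2 \<le> C * (\<Sum>i\<in>I. (cmod (fc (W i) k))\<^sup>2)"
  shows "(norm (U - fsum J U))\<^sup>2 \<le> C * (\<Sum>i\<in>I. (norm (W i))\<^sup>2)"
proof -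
  have "(\<lambda>n. (norm (fsum (cube n) U - fsum J U))\<^sup>2) \<longlonglongrightarrow> (norm (U - fsum J U))\<^sup>2"
    by (intro tendsto_intros fsum_cube_tendsto)
  moreover have "\<forall>\<^sub>F n in sequentially. (norm (fsum (cube n) U - fsum J U))\<^sup>2 \<le> C * (\<Sum>i\<in>I. (norm (W i))\<^sup>2)"
  proof -
    obtain m where m: "J \<subseteq> cube m" using finite_subset_cube[OF J] by blast
    have "(norm (fsum (cube n) U - fsum J U))\<^sup>2 \<le> C * (\<Sum>i\<in>I. (norm (W i))\<^sup>2)" if "n \<ge> m" for n
    proof -
      have sub: "J \<subseteq> cube n" using m cube_mono[OF that] by blast
      have "fsum (cube n) U - fsum J U = fsum (cube n - J) U"
        unfolding fsum_def using sum_diff[OF finite_cube sub, of "\<lambda>k. fc U k *\<^sub>C expo k"] by simp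
      then have "(norm (fsum (cube n) U - fsum J U))\<^sup>2 = (\<Sum>k\<in>cube n - J. (cmod (fc U k))\<^sup>2)"
        by (simp add: norm_fsum finite_cube)
      also have "\<dots> \<le> (\<Sum>k\<in>cube n - J. C * (\<Sum>i\<in>I. (cmod (fc (W i) k))\<^sup>2))"
        by (intro sum_mono le) auto
      also have "\<dots> = C * (\<Sum>i\<in>I. \<Sum>k\<in>cube n - J. (cmod (fc (W i) k))\<^sup>2)"
        unfolding sum_distrib_left[symmetric] by (subst sum.swap) simp
      also have "\<dots> \<le> C * (\<Sum>i\<in>I. (norm (W i))\<^sup>2)"
        using C by (intro mult_left_mono sum_mono Bessel) (auto simp: finite_cube)
      finally show ?thesis .
    qed
    then show ?thesis by (auto simp: eventually_sequentially)
  qed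
  ultimately show ?thesis by (intro tendsto_upperbound) auto
qed

lemma norm_fsum_mono:
  assumes "finite J" "J' \<subseteq> J" shows "norm (U - fsum J U) \<le> norm (U - fsum J' U)"
proof (rule power2_le_imp_le)
  have "finite J'" using assms by (rule finite_subset[rotated])
  then show "(norm (U - fsum J U))\<^sup>2 \<le> (norm (U - fsum J' U))\<^sup>2"
    using assms sum_mono2[OF assms, of "\<lambda>k. (cmod (fc U k))\<^sup>2"] by (simp add: norm_diff_fsum)
qed simp

subsection \<open>Weak derivatives in Fourier space\<close>

text \<open>In this form the weak derivative is a family of conditions on \<open>(U, G)\<close> that are linear and
  continuous in \<open>L\<^sup>2\<close>.\<close>

lemma weak_deriv_cinner:
  "weak_deriv v U G \<longleftrightarrow> (\<forall>\<phi>. torus_test \<phi> \<longrightarrow>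
     cinner U (abs_torus_l2 (\<lambda>y. cnj (frechet_derivative \<phi> (at y) v))) = - cinner G (abs_torus_l2 (\<lambda>y. cnj (\<phi> y))))"
proof -
  have "torus_mean (\<lambda>y. rep_torus_l2 U y * g y) = cinner U (abs_torus_l2 (\<lambda>y. cnj (g y)))"
    if "cper g" for g :: "real^'a \<Rightarrow> complex" and U
    by (subst cinner_abs_right) (auto intro!: l2fun_cper cper_cnj that)
  then show ?thesis
    unfolding weak_deriv_def by (auto simp: torus_test_cper cper_test_deriv)
qed

lemma weak_deriv_fc:
  assumes "weak_deriv v U G" shows "fc G k = \<i> * of_real (freq k v) * fc U k"
proof -
  have c: "(\<lambda>y. cnj (\<i> * of_real (freq (- k) v) * chi (- k) y)) = (\<lambda>y. (\<i> * of_real (freq k v)) * chi k y)"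
    by (simp add: freq_uminus_left cnj_chi fun_eq_iff)
  have "cinner U (abs_torus_l2 (\<lambda>y. (\<i> * of_real (freq k v)) * chi k y)) = - cinner G (abs_torus_l2 (chi k))"
    using assms[unfolded weak_deriv_cinner, rule_format, OF torus_test_chi[of "- k"]]
    unfolding frechet_derivative_chi c by (simp add: cnj_chi)
  then show ?thesis
    unfolding abs_torus_l2_scaleC[OF l2fun_cper[OF cper_chi], symmetric] expo_chi[symmetric]
    by (simp add: fc_def cinner_simps)
qed

lemma weak_deriv_unique: "weak_deriv v U G \<Longrightarrow> weak_deriv v U G' \<Longrightarrow> G = G'"
  by (rule fc_eqI) (simp add: weak_deriv_fc)

lemma weak_deriv_add: "weak_deriv v U G \<Longrightarrow> weak_deriv v U' G' \<Longrightarrow> weak_deriv v (U + U') (G + G')"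
  by (simp add: weak_deriv_cinner cinner_simps)

lemma weak_deriv_scaleC: "weak_deriv v U G \<Longrightarrow> weak_deriv v (c *\<^sub>C U) (c *\<^sub>C G)"
  by (simp add: weak_deriv_cinner cinner_simps)

lemma weak_deriv_0: "weak_deriv v 0 0"
  using weak_deriv_scaleC[of v 0 _ 0] by (simp add: weak_deriv_cinner)

lemma weak_deriv_limit:
  assumes "\<And>n. weak_deriv v (X n) (H n)" "X \<longlonglongrightarrow> U" "H \<longlonglongrightarrow> G" shows "weak_deriv v U G"
  unfolding weak_deriv_cinner
proof (intro allI impI)
  fix \<phi> :: "real^'a \<Rightarrow> complex" assume \<phi>: "torus_test \<phi>"
  let ?a = "abs_torus_l2 (\<lambda>y. cnj (frechet_derivative \<phi> (at y) v))"
  let ?b = "abs_torus_l2 (\<lambda>y. cnj (\<phi> y))"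
  have "(\<lambda>n. cinner (X n) ?a) \<longlonglongrightarrow> cinner U ?a"
    by (rule bounded_linear.tendsto[OF bounded_linear_cinner_left assms(2)])
  moreover have "(\<lambda>n. - cinner (H n) ?b) \<longlonglongrightarrow> - cinner G ?b"
    by (intro tendsto_minus bounded_linear.tendsto[OF bounded_linear_cinner_left assms(3)])
  moreover have "cinner (X n) ?a = - cinner (H n) ?b" for n
    using assms(1)[of n] \<phi> by (simp add: weak_deriv_cinner)
  ultimately show "cinner U ?a = - cinner G ?b" by (simp add: LIMSEQ_unique)
qed

lemma frechet_derivative_chi_mult:
  assumes "torus_test \<phi>"
  shows "frechet_derivative (\<lambda>y. chi k y * \<phi> y) (at y) v
      = chi k y * frechet_derivative \<phi> (at y) v + \<i> * of_real (freq k v) * chi k y * \<phi> y"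
  by (rule frechet_derivativeI)
     (rule has_derivative_eq_rhs[OF has_derivative_mult[OF chi_has_derivative torus_test_has_derivative[OF assms]]], simp)

text \<open>Modulation by a character shifts the weak gradient; applied to \<open>\<chi>\<close> itself it also shows that
  exponentials are weakly differentiable.\<close>

lemma weak_deriv_modulate:
  assumes "weak_deriv v U G"
  shows "weak_deriv v (mulop (chi k) U) (mulop (chi k) (G + (\<i> * of_real (freq k v)) *\<^sub>C U))"
  unfolding weak_deriv_cinner
proof (intro allI impI)
  fix \<phi> :: "real^'a \<Rightarrow> complex" assume \<phi>: "torus_test \<phi>"
  let ?w = "\<i> * complex_of_real (freq k v)"
  let ?a = "\<lambda>\<psi>. abs_torus_l2 (\<lambda>y. cnj (\<psi> y))"
  have l: "l2fun (\<lambda>y. cnj (g y))" if "cper g" for g :: "real^'a \<Rightarrow> complex"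
    by (intro l2fun_cper cper_cnj that)
  have mod: "cinner (mulop (chi k) X) (?a g) = cinner X (?a (\<lambda>y. chi k y * g y))" if "cper g" for X g
    unfolding mulop_adjoint[OF cper_chi] mulop_abs[OF cper_cnj[OF cper_chi] l[OF that]] by (simp add: mult.commute)
  have c1: "cper (\<lambda>y. frechet_derivative \<phi> (at y) v)" and c2: "cper \<phi>" "cper (\<lambda>y. chi k y * \<phi> y)"
    using cper_test_deriv[OF \<phi>] torus_test_cper[OF \<phi>] cper_mult[OF cper_chi] by auto
  have c3: "cper (\<lambda>y. frechet_derivative (\<lambda>y. chi k y * \<phi> y) (at y) v)"
    by (rule cper_test_deriv[OF torus_test_mult[OF torus_test_chi \<phi>]])
  have "?a (\<lambda>y. frechet_derivative (\<lambda>y. chi k y * \<phi> y) (at y) v) - cnj ?w *\<^sub>C ?a (\<lambda>y. chi k y * \<phi> y)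
      = abs_torus_l2 (\<lambda>y. cnj (frechet_derivative (\<lambda>y. chi k y * \<phi> y) (at y) v) - cnj ?w * cnj (chi k y * \<phi> y))"
    unfolding abs_torus_l2_scaleC[OF l[OF c2(2)]] by (rule abs_torus_l2_diff[OF l[OF c3] l2fun_cmult[OF l[OF c2(2)]]])
  also have "\<dots> = ?a (\<lambda>y. chi k y * frechet_derivative \<phi> (at y) v)"
    by (rule arg_cong[of _ _ abs_torus_l2]) (simp add: frechet_derivative_chi_mult[OF \<phi>] fun_eq_iff)
  finally have "?a (\<lambda>y. frechet_derivative (\<lambda>y. chi k y * \<phi> y) (at y) v) - cnj ?w *\<^sub>C ?a (\<lambda>y. chi k y * \<phi> y)
      = ?a (\<lambda>y. chi k y * frechet_derivative \<phi> (at y) v)" .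
  then have "cinner U (?a (\<lambda>y. chi k y * frechet_derivative \<phi> (at y) v))
      = cinner U (?a (\<lambda>y. frechet_derivative (\<lambda>y. chi k y * \<phi> y) (at y) v) - cnj ?w *\<^sub>C ?a (\<lambda>y. chi k y * \<phi> y))"
    by (simp only:)
  also have "\<dots> = cinner U (?a (\<lambda>y. frechet_derivative (\<lambda>y. chi k y * \<phi> y) (at y) v)) - ?w * cinner U (?a (\<lambda>y. chi k y * \<phi> y))"
    unfolding cinner_simps complex_cnj_cnj ..
  also have "cinner U (?a (\<lambda>y. frechet_derivative (\<lambda>y. chi k y * \<phi> y) (at y) v)) = - cinner G (?a (\<lambda>y. chi k y * \<phi> y))"
    using assms torus_test_mult[OF torus_test_chi \<phi>] by (simp add: weak_deriv_cinner)
  finally show "cinner (mulop (chi k) U) (?a (\<lambda>y. frechet_derivative \<phi> (at y) v))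
      = - cinner (mulop (chi k) (G + ?w *\<^sub>C U)) (?a \<phi>)"
    unfolding mod[OF c1] mod[OF c2(1)] by (simp add: cinner_simps)
qed

lemma weak_deriv_expo: "weak_deriv v (expo k) ((\<i> * of_real (freq k v)) *\<^sub>C expo k)"
proof -
  have "weak_deriv v (expo 0) 0"
    unfolding weak_deriv_def
  proof (intro allI impI)
    fix \<phi> :: "real^'a \<Rightarrow> complex" assume \<phi>: "torus_test \<phi>"
    have one: "AE y in torus_measure. rep_torus_l2 (expo 0) y = 1"
      using AE_rep_abs[OF l2fun_cper[OF cper_chi], of 0] by (simp add: expo_chi)
    have zero: "AE y in torus_measure. rep_torus_l2 0 y = 0"
      using AE_rep_abs[OF l2fun_zero] by (simp add: zero_torus_l2_def)
    have m: "rep_torus_l2 X \<in> borel_measurable borel" for X :: "'a torus_l2"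
      using l2fun_rep[of X] by (simp add: l2fun_def)
    have "torus_mean (\<lambda>y. rep_torus_l2 (expo 0) y * frechet_derivative \<phi> (at y) v)
        = torus_mean (\<lambda>y. frechet_derivative \<phi> (at y) v)"
      using one m cper_measurable[OF cper_test_deriv[OF \<phi>]]
      by (intro torus_mean_cong_AE borel_measurable_times) (auto elim: eventually_mono)
    moreover have "torus_mean (\<lambda>y. rep_torus_l2 0 y * \<phi> y) = torus_mean (\<lambda>_::real^'a. 0)"
    proof (rule torus_mean_cong_AE)
      show "AE y in torus_measure. rep_torus_l2 0 y * \<phi> y = 0" using zero by eventually_elim simp
      show "(\<lambda>y. rep_torus_l2 0 y * \<phi> y) \<in> borel_measurable borel"
        using m cper_measurable[OF torus_test_cper[OF \<phi>]] by (rule borel_measurable_times)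
    qed simp
    ultimately show "torus_mean (\<lambda>y. rep_torus_l2 (expo 0) y * frechet_derivative \<phi> (at y) v)
        = - torus_mean (\<lambda>y. rep_torus_l2 0 y * \<phi> y)"
      using torus_mean_deriv[OF \<phi>] by (simp add: torus_mean_def)
  qed
  from weak_deriv_modulate[OF this, of k] show ?thesis
    by (simp add: mulop_scaleC[OF cper_chi] mulop_chi_expo)
qed

section \<open>The form and the Hilbert space \<open>V\<close>\<close>

lemma bounded_bilinear_scaleC: "bounded_bilinear (scaleC :: complex \<Rightarrow> ('n::finite) torus_l2 \<Rightarrow> _)"
proof
  fix c e :: complex and U W :: "'n torus_l2" and r :: real
  show "(c + e) *\<^sub>C U = c *\<^sub>C U + e *\<^sub>C U" by (rule cvec.scale_left_distrib)
  show "c *\<^sub>C (U + W) = c *\<^sub>C U + c *\<^sub>C W" by (rule cvec.scale_right_distrib)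
  show "(r *\<^sub>R c) *\<^sub>C U = r *\<^sub>R (c *\<^sub>C U)" by (simp add: scaleR_scaleC scaleR_conv_of_real)
  show "c *\<^sub>C (r *\<^sub>R U) = r *\<^sub>R (c *\<^sub>C U)" by (simp add: scaleR_scaleC mult.commute)
  show "\<exists>K. \<forall>c (U :: 'n torus_l2). norm (c *\<^sub>C U) \<le> norm c * norm U * K"
    by (intro exI[of _ 1]) (simp add: norm_scaleC)
qed

lemma has_weak_Pgrad_unique: "has_weak_Pgrad P U G \<Longrightarrow> has_weak_Pgrad P U H \<Longrightarrow> G = H"
  unfolding has_weak_Pgrad_def vec_eq_iff by (intro allI, rule weak_deriv_unique) (erule spec)+

lemma Pgrad_eqI: "has_weak_Pgrad P U G \<Longrightarrow> Pgrad P U = G"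
  unfolding Pgrad_def by (rule the_equality, assumption, rule has_weak_Pgrad_unique)

lemma HP1I: "has_weak_Pgrad P U G \<Longrightarrow> U \<in> HP1 P"
  by (auto simp: HP1_def)

lemma has_weak_Pgrad: "U \<in> HP1 P \<Longrightarrow> has_weak_Pgrad P U (Pgrad P U)"
  unfolding HP1_def by (auto simp: Pgrad_eqI)

lemma weak_deriv_Pgrad: "U \<in> HP1 P \<Longrightarrow> weak_deriv (P $ i) U (Pgrad P U $ i)"
  using has_weak_Pgrad by (auto simp: has_weak_Pgrad_def)

lemma has_weak_Pgrad_add:
  "U \<in> HP1 P \<Longrightarrow> W \<in> HP1 P \<Longrightarrow> has_weak_Pgrad P (U + W) (Pgrad P U + Pgrad P W)"
  by (simp add: has_weak_Pgrad_def weak_deriv_add weak_deriv_Pgrad)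

lemma has_weak_Pgrad_scaleC:
  "U \<in> HP1 P \<Longrightarrow> has_weak_Pgrad P (c *\<^sub>C U) (\<chi> i. c *\<^sub>C (Pgrad P U $ i))"
  by (simp add: has_weak_Pgrad_def weak_deriv_scaleC weak_deriv_Pgrad)

lemma subspace_HP1: "cvec.subspace (HP1 P)"
  unfolding cvec.subspace_def
proof (intro conjI ballI allI)
  have "has_weak_Pgrad P 0 0" by (simp add: has_weak_Pgrad_def weak_deriv_0)
  then show "0 \<in> HP1 P" by (rule HP1I)
qed (rule HP1I, rule has_weak_Pgrad_add has_weak_Pgrad_scaleC, assumption+)+

lemma HP1_add: "U \<in> HP1 P \<Longrightarrow> W \<in> HP1 P \<Longrightarrow> U + W \<in> HP1 P"
  and HP1_scaleC: "U \<in> HP1 P \<Longrightarrow> c *\<^sub>C U \<in> HP1 P"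
  and HP1_diff: "U \<in> HP1 P \<Longrightarrow> W \<in> HP1 P \<Longrightarrow> U - W \<in> HP1 P"
  by (rule cvec.subspace_add[OF subspace_HP1] cvec.subspace_scale[OF subspace_HP1] cvec.subspace_diff[OF subspace_HP1],
      assumption+)+

lemma Pgrad_add: "U \<in> HP1 P \<Longrightarrow> W \<in> HP1 P \<Longrightarrow> Pgrad P (U + W) = Pgrad P U + Pgrad P W"
  by (rule Pgrad_eqI[OF has_weak_Pgrad_add])

lemma Pgrad_scaleC: "U \<in> HP1 P \<Longrightarrow> Pgrad P (c *\<^sub>C U) = (\<chi> i. c *\<^sub>C (Pgrad P U $ i))"
  by (rule Pgrad_eqI[OF has_weak_Pgrad_scaleC])

lemma Pgrad_diff: "U \<in> HP1 P \<Longrightarrow> W \<in> HP1 P \<Longrightarrow> Pgrad P (U - W) = Pgrad P U - Pgrad P W"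
  using Pgrad_add[of U P "(-1) *\<^sub>C W"] HP1_scaleC[of W P "-1"] Pgrad_scaleC[of W P "-1"]
  by (simp add: vec_eq_iff)

lemma has_weak_Pgrad_expo: "has_weak_Pgrad P (expo k) (\<chi> i. (\<i> * of_real (freq k (P $ i))) *\<^sub>C expo k)"
  by (simp add: has_weak_Pgrad_def weak_deriv_expo)

lemma expo_HP1: "expo k \<in> HP1 P"
  by (rule HP1I[OF has_weak_Pgrad_expo])

lemma HP1_complete:
  fixes X :: "nat \<Rightarrow> ('n::finite) torus_l2" and P :: "real^'n^'d"
  assumes X: "\<And>n. X n \<in> HP1 P" and C: "Cauchy (\<lambda>n. (X n, Pgrad P (X n)))"
  shows "\<exists>L\<in>HP1 P. (\<lambda>n. normV P (X n - L)) \<longlonglongrightarrow> 0"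
proof -
  obtain Z where Z: "(\<lambda>n. (X n, Pgrad P (X n))) \<longlonglongrightarrow> Z"
    using C unfolding Cauchy_convergent_iff convergent_def by blast
  obtain L G where LG: "Z = (L, G)" by (cases Z)
  have 1: "X \<longlonglongrightarrow> L" using tendsto_fst[OF Z] LG by simp
  have 2: "(\<lambda>n. Pgrad P (X n)) \<longlonglongrightarrow> G" using tendsto_snd[OF Z] LG by simp
  have "weak_deriv (P $ i) L (G $ i)" for i
    by (rule weak_deriv_limit[OF weak_deriv_Pgrad[OF X] 1 tendsto_vec_nth[OF 2]])
  then have G: "has_weak_Pgrad P L G" by (simp add: has_weak_Pgrad_def)
  then have L: "L \<in> HP1 P" "Pgrad P L = G" by (rule HP1I, rule Pgrad_eqI)
  have "normV P (X n - L) = norm ((X n, Pgrad P (X n)) - Z)" for n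
    using X L by (simp add: normV_eq_norm Pgrad_diff LG)
  moreover have "(\<lambda>n. norm ((X n, Pgrad P (X n)) - Z)) \<longlonglongrightarrow> 0"
    using Z by (simp add: LIM_zero tendsto_norm_zero)
  ultimately have "(\<lambda>n. normV P (X n - L)) \<longlonglongrightarrow> 0" by (simp only:)
  then show ?thesis using L(1) by blast
qed

text \<open>Square integrable gradients see the coefficient on the whole torus, so ellipticity is required at
  every point. It is inherited from the image of \<open>P\<^sup>T\<close> in \<open>elliptic_everywhere\<close>.\<close>

locale elliptic_form =
  fixes P :: "real^'n^'d" and A :: "real^'n \<Rightarrow> real^'d^'d" and C0 :: real
  assumes A_cont: "continuous_on UNIV A" and A_per: "torus_periodic A" and C0: "C0 > 0"
    and elliptic: "C0 * (norm \<xi>)\<^sup>2 \<le> \<xi> \<bullet> (A y *v \<xi>)"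
    and hermitian: "U \<in> HP1 P \<Longrightarrow> W \<in> HP1 P \<Longrightarrow> aform P A U W = cnj (aform P A W U)"
begin

abbreviation coeffA :: "'d \<Rightarrow> 'd \<Rightarrow> real^'n \<Rightarrow> complex" where
  "coeffA i j \<equiv> (\<lambda>y. of_real (A y $ i $ j))"

lemma cper_coeff: "cper (coeffA i j)"
proof -
  have "continuous_on UNIV (\<lambda>y. A y $ i $ j)"
    by (intro continuous_on_component A_cont continuous_on_compose2[OF continuous_on_component, of UNIV] continuous_intros)
  then show ?thesis using A_per by (auto simp: cper_def torus_periodic_def intro!: continuous_intros)
qed

text \<open>The leading part of the form, as a form on vectors of gradients.\<close>

definition bform :: "'n torus_l2^'d \<Rightarrow> 'n torus_l2^'d \<Rightarrow> complex" where
  "bform G H = (\<Sum>i\<in>UNIV. \<Sum>j\<in>UNIV. cinner (mulop (coeffA i j) (G $ j)) (H $ i))"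

lemma bform_mean:
  "bform G H = torus_mean (\<lambda>y. \<Sum>i\<in>UNIV. (\<Sum>j\<in>UNIV. coeffA i j y * rep_torus_l2 (G $ j) y) * cnj (rep_torus_l2 (H $ i) y))"
proof -
  have i: "integrable torus_measure (\<lambda>y. coeffA i j y * rep_torus_l2 (G $ j) y * cnj (rep_torus_l2 (H $ i) y))" for i j
    by (rule l2fun_prod_integrable[OF l2fun_mult_cper[OF cper_coeff l2fun_rep] l2fun_rep])
  show ?thesis
    unfolding bform_def cinner_mulop[OF cper_coeff] torus_mean_def sum_distrib_right
    by (simp add: sum_divide_distrib[symmetric] Bochner_Integration.integral_sum i Bochner_Integration.integrable_sum)
qed

lemma aform_bform: "aform P A U W = bform (Pgrad P U) (Pgrad P W) + cinner U W"
  unfolding aform_def bform_mean ..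

lemma bform_bound: "\<exists>C\<ge>0. \<forall>G H. cmod (bform G H) \<le> C * norm G * norm H"
proof -
  have "\<exists>C\<ge>0. \<forall>U. norm (mulop (coeffA i j) U) \<le> C * norm U" for i j
    using cper_bounded_torus[OF cper_coeff] norm_mulop_le[OF cper_coeff] by metis
  then obtain C where C: "\<And>i j. C i j \<ge> 0" "\<And>i j U. norm (mulop (coeffA i j) U) \<le> C i j * norm U" by metis
  define B where "B = (\<Sum>i\<in>UNIV. \<Sum>j\<in>UNIV. C i j)"
  have "cmod (bform G H) \<le> B * norm G * norm H" for G H
  proof -
    have "cmod (bform G H) \<le> (\<Sum>i\<in>UNIV. \<Sum>j\<in>UNIV. cmod (cinner (mulop (coeffA i j) (G $ j)) (H $ i)))"
      unfolding bform_def by (intro order_trans[OF norm_sum] sum_mono order_refl)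
    also have "\<dots> \<le> (\<Sum>i\<in>UNIV. \<Sum>j\<in>UNIV. C i j * (norm G * norm H))"
    proof (intro sum_mono)
      fix i j
      have "cmod (cinner (mulop (coeffA i j) (G $ j)) (H $ i)) \<le> norm (mulop (coeffA i j) (G $ j)) * norm (H $ i)"
        by (rule cmod_cinner_le)
      also have "\<dots> \<le> (C i j * norm G) * norm H"
        using C(1)[of i j] by (intro mult_mono order_trans[OF C(2)] mult_left_mono Finite_Cartesian_Product.norm_nth_le) auto
      finally show "cmod (cinner (mulop (coeffA i j) (G $ j)) (H $ i)) \<le> C i j * (norm G * norm H)" by (simp add: mult.assoc)
    qed
    also have "\<dots> = B * norm G * norm H" by (simp add: B_def sum_distrib_right mult.assoc)
    finally show ?thesis .
  qed
  moreover have "B \<ge> 0" unfolding B_def by (intro sum_nonneg C(1))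
  ultimately show ?thesis by blast
qed

text \<open>\<open>A\<close> has real entries, so in the quadratic form at \<open>x + \<i> y\<close> the cross terms between \<open>x\<close> and \<open>y\<close>
  are purely imaginary.\<close>

lemma complex_elliptic:
  fixes z :: "'d \<Rightarrow> complex"
  shows "C0 * (\<Sum>i\<in>UNIV. (cmod (z i))\<^sup>2) \<le> Re (\<Sum>i\<in>UNIV. (\<Sum>j\<in>UNIV. coeffA i j y * z j) * cnj (z i))"
proof -
  let ?x = "(\<chi> i. Re (z i)) :: real^'d" and ?y = "(\<chi> i. Im (z i)) :: real^'d"
  have n: "(\<Sum>i\<in>UNIV. (cmod (z i))\<^sup>2) = (norm ?x)\<^sup>2 + (norm ?y)\<^sup>2"
    by (simp add: norm_vec_def L2_set_def sum_nonneg cmod_power2 sum.distrib)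
  have "Re (\<Sum>i\<in>UNIV. (\<Sum>j\<in>UNIV. coeffA i j y * z j) * cnj (z i)) = ?x \<bullet> (A y *v ?x) + ?y \<bullet> (A y *v ?y)"
    by (simp add: inner_vec_def matrix_vector_mult_def sum_distrib_left sum_distrib_right sum.distrib mult_ac)
  then show ?thesis using elliptic[of ?x y] elliptic[of ?y y] by (simp add: n distrib_left)
qed

lemma bform_coercive: "C0 * (norm G)\<^sup>2 \<le> Re (bform G G)"
proof -
  let ?z = "\<lambda>y i. rep_torus_l2 (G $ i) y"
  let ?f = "\<lambda>y. \<Sum>i\<in>UNIV. (\<Sum>j\<in>UNIV. coeffA i j y * ?z y j) * cnj (?z y i)"
  let ?vol = "(2 * pi) ^ CARD('n)"
  have i1: "integrable torus_measure (\<lambda>y. (cmod (?z y i))\<^sup>2)" for i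
    using l2fun_rep[of "G $ i"] by (simp add: l2fun_def)
  have i2: "integrable torus_measure ?f"
    unfolding sum_distrib_right
    by (intro Bochner_Integration.integrable_sum l2fun_prod_integrable[OF l2fun_mult_cper[OF cper_coeff l2fun_rep] l2fun_rep])
  have "(norm G)\<^sup>2 = (\<Sum>i\<in>UNIV. (norm (abs_torus_l2 (\<lambda>y. ?z y i)))\<^sup>2)"
    by (simp add: norm_vec_def L2_set_def sum_nonneg)
  also have "\<dots> = (LINT y|torus_measure. (\<Sum>i\<in>UNIV. (cmod (?z y i))\<^sup>2)) / ?vol"
    using i1 by (simp only: norm_torus_l2_abs[OF l2fun_rep] Bochner_Integration.integral_sum sum_divide_distrib)
  finally have n: "(norm G)\<^sup>2 = (LINT y|torus_measure. (\<Sum>i\<in>UNIV. (cmod (?z y i))\<^sup>2)) / ?vol" .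
  have "(LINT y|torus_measure. C0 * (\<Sum>i\<in>UNIV. (cmod (?z y i))\<^sup>2)) \<le> (LINT y|torus_measure. Re (?f y))"
    by (intro integral_mono complex_elliptic integrable_Re i2 integrable_mult_right Bochner_Integration.integrable_sum i1)
  also have "\<dots> = Re (LINT y|torus_measure. ?f y)" by (rule integral_Re[OF i2])
  finally have "C0 * (norm G)\<^sup>2 \<le> Re (LINT y|torus_measure. ?f y) / ?vol"
    unfolding n by (simp add: divide_right_mono)
  also have "Re (LINT y|torus_measure. ?f y) / ?vol = Re (bform G G)"
  proof -
    have "(2 * complex_of_real pi) ^ CARD('n) = of_real ?vol" by simp
    then show ?thesis unfolding bform_mean torus_mean_def by (simp only: Re_divide_of_real)
  qed
  finally show ?thesis .
qed

lemma bform_add_left: "bform (G + G') H = bform G H + bform G' H"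
  unfolding bform_def vector_add_component mulop_add[OF cper_coeff] cinner_add_left sum.distrib ..

lemma bform_scaleC_left: "bform (\<chi> i. c *\<^sub>C (G $ i)) H = c * bform G H"
  unfolding bform_def vec_lambda_beta mulop_scaleC[OF cper_coeff] cinner_scaleC_left sum_distrib_left ..

lemma aform_add_left:
  "U \<in> HP1 P \<Longrightarrow> U' \<in> HP1 P \<Longrightarrow> aform P A (U + U') W = aform P A U W + aform P A U' W"
  unfolding aform_bform by (simp add: Pgrad_add bform_add_left cinner_add_left)

lemma aform_scaleC_left: "U \<in> HP1 P \<Longrightarrow> aform P A (c *\<^sub>C U) W = c * aform P A U W"
  unfolding aform_bform by (simp add: Pgrad_scaleC bform_scaleC_left cinner_scaleC_left distrib_left)

lemma aform_coercive:
  assumes "U \<in> HP1 P"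
  shows "(norm U)\<^sup>2 + C0 * (norm (Pgrad P U))\<^sup>2 \<le> Re (aform P A U U)"
  using bform_coercive[of "Pgrad P U"] by (simp add: aform_bform cinner_self flip: of_real_power)

lemma normV_sq: "(normV P U)\<^sup>2 = (norm U)\<^sup>2 + (norm (Pgrad P U))\<^sup>2"
  by (simp add: normV_eq_norm norm_prod_def)

sublocale V: cinner_space scaleC "HP1 P" "aform P A"
  rewrites "module.span scaleC = cspan"
proof -
  show "cinner_space scaleC (HP1 P) (aform P A)"
  proof unfold_locales
    fix U assume U: "U \<in> HP1 P" "U \<noteq> 0"
    have "0 < (norm U)\<^sup>2 + C0 * (norm (Pgrad P U))\<^sup>2" using U C0 by (intro add_pos_nonneg) auto
    then show "0 < Re (aform P A U U)" using aform_coercive[OF U(1)] by linarith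
  qed (rule subspace_HP1 aform_add_left aform_scaleC_left hermitian; assumption)+
  show "module.span scaleC = cspan" by (simp add: cspan_def)
qed

lemma norm_le_nrm: "U \<in> HP1 P \<Longrightarrow> norm U \<le> V.nrm U"
proof (rule power2_le_imp_le)
  assume U: "U \<in> HP1 P"
  have "0 \<le> C0 * (norm (Pgrad P U))\<^sup>2" using C0 by simp
  then show "(norm U)\<^sup>2 \<le> (V.nrm U)\<^sup>2" using aform_coercive[OF U] V.nrm_sq[OF U] by linarith
qed simp

lemma norm_equiv:
  obtains c1 c2 where "c1 > 0" "c2 > 0" "\<And>U. U \<in> HP1 P \<Longrightarrow> c1 * normV P U \<le> V.nrm U"
    "\<And>U. U \<in> HP1 P \<Longrightarrow> V.nrm U \<le> c2 * normV P U"
proof -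
  obtain C where C: "C \<ge> 0" "\<And>G H. cmod (bform G H) \<le> C * norm G * norm H" using bform_bound by blast
  have nV: "normV P U \<ge> 0" for U by (simp add: normV_eq_norm)
  have lo2: "min 1 C0 * (normV P U)\<^sup>2 \<le> (V.nrm U)\<^sup>2" if U: "U \<in> HP1 P" for U
  proof -
    have "min 1 C0 * (norm U)\<^sup>2 \<le> 1 * (norm U)\<^sup>2" "min 1 C0 * (norm (Pgrad P U))\<^sup>2 \<le> C0 * (norm (Pgrad P U))\<^sup>2"
      by (intro mult_right_mono; simp)+
    then show ?thesis
      using aform_coercive[OF U] V.nrm_sq[OF U] unfolding normV_sq distrib_left by linarith
  qed
  have lo: "sqrt (min 1 C0) * normV P U \<le> V.nrm U" if "U \<in> HP1 P" for U
  proof (rule power2_le_imp_le)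
    have "(sqrt (min 1 C0))\<^sup>2 = min 1 C0" using C0 by (intro real_sqrt_pow2) simp
    then show "(sqrt (min 1 C0) * normV P U)\<^sup>2 \<le> (V.nrm U)\<^sup>2"
      using lo2[OF that] by (simp only: power_mult_distrib)
  qed (use that in simp)
  have hi2: "(V.nrm U)\<^sup>2 \<le> (C + 1) * (normV P U)\<^sup>2" if U: "U \<in> HP1 P" for U
  proof -
    have "(V.nrm U)\<^sup>2 = Re (bform (Pgrad P U) (Pgrad P U)) + (norm U)\<^sup>2"
      using V.nrm_sq[OF U] by (simp add: aform_bform cinner_self flip: of_real_power)
    also have "Re (bform (Pgrad P U) (Pgrad P U)) \<le> C * (norm (Pgrad P U))\<^sup>2"
      using C(2)[of "Pgrad P U" "Pgrad P U"] complex_Re_le_cmod[of "bform (Pgrad P U) (Pgrad P U)"]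
      by (simp add: power2_eq_square mult.assoc)
    also have "C * (norm (Pgrad P U))\<^sup>2 + (norm U)\<^sup>2 \<le> (C + 1) * (normV P U)\<^sup>2"
      using C(1) mult_nonneg_nonneg[OF C(1) zero_le_power2[of "norm U"]] zero_le_power2[of "norm (Pgrad P U)"]
      unfolding normV_sq distrib_left distrib_right by simp
    finally show ?thesis by simp
  qed
  have hi: "V.nrm U \<le> sqrt (C + 1) * normV P U" if "U \<in> HP1 P" for U
  proof (rule power2_le_imp_le)
    have "(sqrt (C + 1))\<^sup>2 = C + 1" using C(1) by (intro real_sqrt_pow2) simp
    then show "(V.nrm U)\<^sup>2 \<le> (sqrt (C + 1) * normV P U)\<^sup>2" using hi2[OF that] by (simp only: power_mult_distrib)
    show "0 \<le> sqrt (C + 1) * normV P U" using C(1) nV by (intro mult_nonneg_nonneg) auto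
  qed
  show ?thesis by (rule that[of "sqrt (min 1 C0)" "sqrt (C + 1)"]) (use lo hi C0 C(1) in auto)
qed

lemma V_complete: "V.complete_in (HP1 P)"
  unfolding V.complete_in_def
proof (intro allI impI, elim conjE)
  fix X :: "nat \<Rightarrow> 'n torus_l2"
  assume X: "\<forall>n. X n \<in> HP1 P" and cau: "\<forall>e>0. \<exists>M. \<forall>m\<ge>M. \<forall>n\<ge>M. V.nrm (X m - X n) < e"
  obtain c1 c2 where c: "c1 > 0" "c2 > 0" "\<And>U. U \<in> HP1 P \<Longrightarrow> c1 * normV P U \<le> V.nrm U"
    "\<And>U. U \<in> HP1 P \<Longrightarrow> V.nrm U \<le> c2 * normV P U" by (rule norm_equiv) blast
  have "Cauchy (\<lambda>n. (X n, Pgrad P (X n)))"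
    unfolding Cauchy_def
  proof (intro allI impI)
    fix e :: real assume "e > 0"
    then have "e * c1 > 0" using c(1) by simp
    then obtain M where M: "\<forall>m\<ge>M. \<forall>n\<ge>M. V.nrm (X m - X n) < e * c1" using cau by blast
    have "dist (X m, Pgrad P (X m)) (X n, Pgrad P (X n)) < e" if "m \<ge> M" "n \<ge> M" for m n
    proof -
      have "dist (X m, Pgrad P (X m)) (X n, Pgrad P (X n)) = normV P (X m - X n)"
        using X by (simp add: dist_norm normV_eq_norm Pgrad_diff)
      moreover have "c1 * normV P (X m - X n) < c1 * e"
        using c(3)[of "X m - X n"] M that X HP1_diff[of "X m" P "X n"] by (simp add: mult.commute) (smt (verit, best))
      ultimately show ?thesis using c(1) by simp
    qed
    then show "\<exists>M. \<forall>m\<ge>M. \<forall>n\<ge>M. dist (X m, Pgrad P (X m)) (X n, Pgrad P (X n)) < e" by blast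
  qed
  with X obtain L where L: "L \<in> HP1 P" "(\<lambda>n. normV P (X n - L)) \<longlonglongrightarrow> 0" using HP1_complete[of X P] by blast
  have "(\<lambda>n. V.nrm (X n - L)) \<longlonglongrightarrow> 0"
  proof (rule tendsto_sandwich[of "\<lambda>_. 0" _ _ "\<lambda>n. c2 * normV P (X n - L)"])
    show "(\<lambda>n. c2 * normV P (X n - L)) \<longlonglongrightarrow> 0" by (rule tendsto_mult_right_zero[OF L(2)])
    show "\<forall>\<^sub>F n in sequentially. 0 \<le> V.nrm (X n - L)"
      by (rule always_eventually) (use X L in \<open>auto intro: HP1_diff\<close>)
    show "\<forall>\<^sub>F n in sequentially. V.nrm (X n - L) \<le> c2 * normV P (X n - L)"
      by (rule always_eventually) (use X L c(4) in \<open>auto intro: HP1_diff\<close>)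
  qed simp
  then show "\<exists>l\<in>HP1 P. (\<lambda>n. V.nrm (X n - l)) \<longlonglongrightarrow> 0" using L(1) by blast
qed

subsection \<open>The solution operator\<close>

lemma solution_op_exists: "\<exists>!U. U \<in> HP1 P \<and> (\<forall>W\<in>HP1 P. aform P A U W = cinner F W)"
proof -
  have "\<exists>U\<in>HP1 P. \<forall>W\<in>HP1 P. aform P A U W = cinner F W"
  proof (rule V.Riesz_representation[OF subspace_HP1 subset_refl V_complete, where C = "norm F"])
    show "cmod (cinner F W) \<le> norm F * V.nrm W" if "W \<in> HP1 P" for W
      by (rule order_trans[OF cmod_cinner_le mult_left_mono[OF norm_le_nrm[OF that] norm_ge_zero]])
  qed (auto simp: cinner_simps)
  moreover have "U = U'" if "U \<in> HP1 P" "U' \<in> HP1 P" "\<And>W. W \<in> HP1 P \<Longrightarrow> aform P A U W = cinner F W"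
    "\<And>W. W \<in> HP1 P \<Longrightarrow> aform P A U' W = cinner F W" for U U'
    using that by (intro V.eqI_form) auto
  ultimately show ?thesis by blast
qed

lemma solution_op_V: "solution_op P A F \<in> HP1 P"
  and solution_op_form: "W \<in> HP1 P \<Longrightarrow> aform P A (solution_op P A F) W = cinner F W"
  using theI'[OF solution_op_exists[of F]] unfolding solution_op_def by blast+

lemma solution_op_unique:
  "U \<in> HP1 P \<Longrightarrow> (\<And>W. W \<in> HP1 P \<Longrightarrow> aform P A U W = cinner F W) \<Longrightarrow> solution_op P A F = U"
  using solution_op_exists[of F] solution_op_V[of F] solution_op_form[of _ F] by blast

lemma solution_op_add: "solution_op P A (F + G) = solution_op P A F + solution_op P A G"
  by (rule solution_op_unique)
     (simp_all add: solution_op_V HP1_add aform_add_left solution_op_form cinner_simps)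

lemma solution_op_scaleC: "solution_op P A (c *\<^sub>C F) = c *\<^sub>C solution_op P A F"
  by (rule solution_op_unique)
     (simp_all add: solution_op_V HP1_scaleC aform_scaleC_left solution_op_form cinner_simps)

lemma solution_op_bound: "V.nrm (solution_op P A F) \<le> norm F"
proof -
  let ?U = "solution_op P A F"
  have U: "?U \<in> HP1 P" by (rule solution_op_V)
  have "(V.nrm ?U)\<^sup>2 \<le> cmod (cinner F ?U)"
    using solution_op_form[OF U] V.nrm_sq[OF U] complex_Re_le_cmod[of "cinner F ?U"] by simp
  also have "\<dots> \<le> norm F * V.nrm ?U"
    by (rule order_trans[OF cmod_cinner_le mult_left_mono[OF norm_le_nrm[OF U] norm_ge_zero]])
  finally have "V.nrm ?U * V.nrm ?U \<le> norm F * V.nrm ?U" by (simp add: power2_eq_square)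
  then show ?thesis using V.nrm_nonneg[OF U] by (cases "V.nrm ?U = 0") (auto simp: mult_le_cancel_right)
qed

lemma sa_operator_solution_op: "sa_operator scaleC (HP1 P) (aform P A) (solution_op P A) 1"
proof unfold_locales
  show "V.nrm (solution_op P A U) \<le> 1 * V.nrm U" if "U \<in> HP1 P" for U
    using solution_op_bound[of U] norm_le_nrm[OF that] by simp
  show "aform P A (solution_op P A U) W = aform P A U (solution_op P A W)" if "U \<in> HP1 P" "W \<in> HP1 P" for U W
    using solution_op_form[OF that(2), of U] solution_op_form[OF that(1), of W]
      hermitian[OF that(1) solution_op_V, of W] cinner_commute[of U W] by simp
qed (auto simp: V_complete solution_op_V solution_op_add solution_op_scaleC)

end

section \<open>Spectral projections as contour integrals\<close>

lemma spectral_proj_cong: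
  assumes "\<And>U. U \<in> HP1 P \<Longrightarrow> B U = B' U"
  shows "spectral_proj P B c r = spectral_proj P B' c r"
proof -
  have "resolvent P B z U = resolvent P B' z U" for z U
    unfolding resolvent_def inv_into_def using assms by (intro arg_cong[of _ _ Eps] ext) auto
  then have "resolvent P B = resolvent P B'" by (intro ext)
  then show ?thesis by (simp add: spectral_proj_def[abs_def])
qed

context elliptic_form
begin

lemma bounded_linear_weak_deriv_functional:
  "bounded_linear (\<lambda>Z :: 'n torus_l2 \<times> ('n torus_l2^'d). cinner (fst Z) X + cinner (snd Z $ i) Y)"
  by (rule bounded_linear_add[OF bounded_linear_compose[OF bounded_linear_cinner_left bounded_linear_fst]
        bounded_linear_compose[OF bounded_linear_cinner_left
          bounded_linear_compose[OF bounded_linear_vec_nth bounded_linear_snd]]])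

lemma bounded_linear_form_functional:
  "bounded_linear (\<lambda>Z :: 'n torus_l2 \<times> ('n torus_l2^'d). bform (snd Z) H + cinner (fst Z) W)"
proof (intro bounded_linear_add bounded_linear_compose[OF bounded_linear_cinner_left bounded_linear_fst])
  obtain C where C: "\<And>G H. cmod (bform G H) \<le> C * norm G * norm H" using bform_bound by blast
  have "bounded_linear (\<lambda>G. bform G H)"
  proof (rule bounded_linear_intro)
    show "bform (G + G') H = bform G H + bform G' H" for G G' by (rule bform_add_left)
    show "bform (r *\<^sub>R G) H = r *\<^sub>R bform G H" for r G
    proof -
      have "r *\<^sub>R G = (\<chi> i. of_real r *\<^sub>C (G $ i))" by (simp add: vec_eq_iff scaleR_scaleC)
      then show ?thesis by (simp add: bform_scaleC_left scaleR_conv_of_real)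
    qed
    show "norm (bform G H) \<le> norm G * (C * norm H)" for G using C[of G H] by (simp add: mult_ac)
  qed
  then show "bounded_linear (\<lambda>Z :: 'n torus_l2 \<times> ('n torus_l2^'d). bform (snd Z) H)"
    by (rule bounded_linear_compose[OF _ bounded_linear_snd])
qed

text \<open>The graph of the weak gradient is closed, so integrating a continuous curve in
  \<open>L\<^sup>2 \<times> (L\<^sup>2)\<^sup>d\<close> that stays in the graph gives a point of the graph.\<close>

lemma V_integral_exists:
  assumes g: "\<And>t. t \<in> {0..1} \<Longrightarrow> g t \<in> HP1 P"
    and cont: "continuous_on {0..1} (\<lambda>t. (g t, Pgrad P (g t)))"
  obtains I where "has_V_integral P g I" "\<And>I'. has_V_integral P g I' \<Longrightarrow> I' = I"
    "\<And>W. ((\<lambda>t. aform P A (g t) W) has_integral aform P A I W) {0..1}"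
proof -
  obtain Z where Z: "((\<lambda>t. (g t, Pgrad P (g t))) has_integral Z) {0..1}"
    using integrable_continuous_interval[OF cont] by (auto simp: integrable_on_def)
  obtain I G where IG: "Z = (I, G)" by (cases Z)
  have "weak_deriv (P $ i) I (G $ i)" for i
    unfolding weak_deriv_cinner
  proof (intro allI impI)
    fix \<phi> :: "real^'n \<Rightarrow> complex" assume \<phi>: "torus_test \<phi>"
    let ?X = "abs_torus_l2 (\<lambda>y. cnj (frechet_derivative \<phi> (at y) (P $ i)))"
    let ?Y = "abs_torus_l2 (\<lambda>y. cnj (\<phi> y))"
    have zero: "cinner (g t) ?X + cinner (Pgrad P (g t) $ i) ?Y = 0" if "t \<in> {0..1}" for t
      using weak_deriv_Pgrad[OF g[OF that], of i] \<phi> by (simp add: weak_deriv_cinner)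
    have "((\<lambda>t. cinner (g t) ?X + cinner (Pgrad P (g t) $ i) ?Y) has_integral (cinner I ?X + cinner (G $ i) ?Y)) {0..1}"
      using has_integral_linear[OF Z bounded_linear_weak_deriv_functional[of ?X i ?Y]] by (simp add: o_def IG)
    moreover have "((\<lambda>t. cinner (g t) ?X + cinner (Pgrad P (g t) $ i) ?Y) has_integral 0) {0..1}"
      by (rule has_integral_is_0) (rule zero)
    ultimately have "cinner I ?X + cinner (G $ i) ?Y = 0" by (rule has_integral_unique)
    then show "cinner I ?X = - cinner (G $ i) ?Y" by (simp add: add_eq_0_iff2)
  qed
  then have "has_weak_Pgrad P I G" by (simp add: has_weak_Pgrad_def)
  then have I: "I \<in> HP1 P" "Pgrad P I = G" by (rule HP1I, rule Pgrad_eqI)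
  have hI: "has_V_integral P g I" using I Z g by (simp add: has_V_integral_def IG)
  have un: "I' = I" if "has_V_integral P g I'" for I'
  proof -
    have "((\<lambda>t. (g t, Pgrad P (g t))) has_integral (I', Pgrad P I')) {0..1}" using that by (simp add: has_V_integral_def)
    from has_integral_unique[OF this Z] show ?thesis by (simp add: IG)
  qed
  have "((\<lambda>t. aform P A (g t) W) has_integral aform P A I W) {0..1}" for W
    using has_integral_linear[OF Z bounded_linear_form_functional[of "Pgrad P W" W]]
    by (simp add: o_def IG aform_bform I)
  with hI un show ?thesis using that by blast
qed

text \<open>The vector-valued integral commutes with the continuous functionals \<open>a (\<cdot>) W\<close>, which turns it into
  a contour integral of a scalar function.\<close>

lemma spectral_proj_form:
  assumes B: "sa_operator scaleC (HP1 P) (aform P A) B L" and r: "r > 0"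
    and reg: "\<And>z. z \<in> sphere \<gamma> r \<Longrightarrow> sa_operator.reg scaleC (HP1 P) (aform P A) B z" and U: "U \<in> HP1 P"
  shows "spectral_proj P B \<gamma> r U \<in> HP1 P"
    and "aform P A (spectral_proj P B \<gamma> r U) W
      = contour_integral (circlepath \<gamma> r) (\<lambda>z. aform P A (sa_operator.R scaleC (HP1 P) B z U) W) / (2 * of_real pi * \<i>)"
proof -
  interpret B: sa_operator scaleC "HP1 P" "aform P A" B L
    rewrites "module.span scaleC = cspan" by (rule B) (simp add: cspan_def)
  have res: "resolvent P B = B.R" by (intro ext) (simp add: resolvent_def B.R_def)
  obtain m where m: "m > 0" "\<And>z x. z \<in> sphere \<gamma> r \<Longrightarrow> x \<in> HP1 P \<Longrightarrow> m * V.nrm x \<le> V.nrm (z *\<^sub>C x - B x)"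
    using B.uniform_lower_bound[OF compact_sphere reg] by blast
  obtain c1 c2 where c: "c1 > 0" "c2 > 0" "\<And>U. U \<in> HP1 P \<Longrightarrow> c1 * normV P U \<le> V.nrm U"
    "\<And>U. U \<in> HP1 P \<Longrightarrow> V.nrm U \<le> c2 * normV P U" by (rule norm_equiv) blast
  define \<rho> where "\<rho> z = (B.R z U, Pgrad P (B.R z U))" for z
  have lip: "dist (\<rho> z) (\<rho> w) \<le> (V.nrm U / m\<^sup>2 / c1) * dist z w" if z: "z \<in> sphere \<gamma> r" and w: "w \<in> sphere \<gamma> r" for z w
  proof -
    have V: "B.R z U \<in> HP1 P" "B.R w U \<in> HP1 P" "B.R z (B.R w U) \<in> HP1 P" using reg z w U by auto
    have "V.nrm (B.R z (B.R w U)) \<le> V.nrm (B.R w U) / m" using m z V(2) by (intro B.R_bound) auto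
    also have "\<dots> \<le> (V.nrm U / m) / m" using m w U by (intro divide_right_mono B.R_bound) auto
    finally have n: "V.nrm (B.R z (B.R w U)) \<le> V.nrm U / m\<^sup>2" by (simp add: power2_eq_square)
    have "dist (\<rho> z) (\<rho> w) = normV P (B.R z U - B.R w U)"
      using V by (simp add: \<rho>_def dist_norm normV_eq_norm Pgrad_diff)
    also have "\<dots> \<le> V.nrm (B.R z U - B.R w U) / c1"
      using c(3)[OF HP1_diff[OF V(1,2)]] c(1) by (simp add: field_simps)
    also have "V.nrm (B.R z U - B.R w U) = dist z w * V.nrm (B.R z (B.R w U))"
      unfolding B.resolvent_identity[OF reg[OF z] reg[OF w] U] V.nrm_scale[OF V(3)]
      by (simp add: dist_norm norm_minus_commute)
    also have "dist z w * V.nrm (B.R z (B.R w U)) / c1 \<le> dist z w * (V.nrm U / m\<^sup>2) / c1"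
      using n c(1) by (intro divide_right_mono mult_left_mono) auto
    finally show ?thesis by (simp add: mult_ac)
  qed
  have cont\<rho>: "continuous_on (sphere \<gamma> r) \<rho>"
  proof (rule lipschitz_on_continuous_on)
    show "(V.nrm U / m\<^sup>2 / c1)-lipschitz_on (sphere \<gamma> r) \<rho>"
      using lip m(1) c(1) U by (intro lipschitz_onI) auto
  qed
  let ?c = "circlepath \<gamma> r"
  define c' where "c' t = vector_derivative ?c (at t within {0..1})" for t
  have c'eq: "c' t = 2 * of_real pi * \<i> * r * exp (2 * of_real pi * \<i> * t)" if "t \<in> {0..1}" for t
    using vector_derivative_circlepath01[of t \<gamma> r] that by (simp add: c'_def)
  have on: "?c t \<in> sphere \<gamma> r" if "t \<in> {0..1}" for t
    using that r path_image_circlepath[of \<gamma> r] by (auto simp: path_image_def)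
  define g where "g t = c' t *\<^sub>C resolvent P B (?c t) U" for t
  have RV: "B.R (?c t) U \<in> HP1 P" if "t \<in> {0..1}" for t using reg[OF on[OF that]] U by auto
  have gV: "g t \<in> HP1 P" if "t \<in> {0..1}" for t
    unfolding g_def res by (rule HP1_scaleC[OF RV[OF that]])
  have "continuous_on {0..1} (\<lambda>t. (g t, Pgrad P (g t)))"
  proof -
    have cc: "continuous_on {0..1} c'"
      by (rule continuous_on_eq[of _ "\<lambda>t. 2 * of_real pi * \<i> * r * exp (2 * of_real pi * \<i> * of_real t)"])
         (auto simp: c'eq intro!: continuous_intros)
    have c\<rho>: "continuous_on {0..1} (\<lambda>t. \<rho> (?c t))"
      by (rule continuous_on_compose2[OF cont\<rho>])
         (use on in \<open>auto simp: circlepath_def part_circlepath_def linepath_def intro!: continuous_intros\<close>)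
    note c1 = continuous_on_fst[OF c\<rho>, unfolded \<rho>_def fst_conv]
      and c2 = continuous_on_snd[OF c\<rho>, unfolded \<rho>_def snd_conv]
    have "continuous_on {0..1} (\<lambda>t. (c' t *\<^sub>C B.R (?c t) U, \<chi> i. c' t *\<^sub>C (Pgrad P (B.R (?c t) U) $ i)))"
      by (intro continuous_on_Pair continuous_on_vec_lambda bounded_bilinear.continuous_on[OF bounded_bilinear_scaleC] cc c1
          continuous_on_component[OF c2])
    then show ?thesis
      by (rule continuous_on_eq) (simp add: g_def res Pgrad_scaleC RV)
  qed
  then obtain I where I: "has_V_integral P g I" "\<And>I'. has_V_integral P g I' \<Longrightarrow> I' = I"
    "\<And>W. ((\<lambda>t. aform P A (g t) W) has_integral aform P A I W) {0..1}"
    using V_integral_exists[of g] gV by blast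
  have IV: "I \<in> HP1 P" using I(1) by (simp add: has_V_integral_def)
  have "(THE I. has_V_integral P g I) = I" using I(1,2) by (rule the_equality)
  then have sp: "spectral_proj P B \<gamma> r U = (1 / (2 * of_real pi * \<i>)) *\<^sub>C I"
    by (simp add: spectral_proj_def g_def[abs_def] c'_def)
  then show "spectral_proj P B \<gamma> r U \<in> HP1 P" using IV by (simp add: HP1_scaleC)
  have "((\<lambda>t. aform P A (B.R (?c t) U) W * c' t) has_integral aform P A I W) {0..1}"
    by (rule has_integral_eq[OF _ I(3)[of W]]) (simp add: g_def res aform_scaleC_left RV)
  then have "((\<lambda>z. aform P A (B.R z U) W) has_contour_integral aform P A I W) ?c"
    by (simp add: has_contour_integral_def c'_def)
  then show "aform P A (spectral_proj P B \<gamma> r U) W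
      = contour_integral ?c (\<lambda>z. aform P A (B.R z U) W) / (2 * of_real pi * \<i>)"
    by (simp add: sp aform_scaleC_left IV contour_integral_unique)
qed

lemma a_adjoint_sa:
  assumes B: "sa_operator scaleC (HP1 P) (aform P A) B L" and W: "W \<in> HP1 P"
  shows "a_adjoint P A B W = B W"
proof -
  interpret B: sa_operator scaleC "HP1 P" "aform P A" B L
    rewrites "module.span scaleC = cspan" by (rule B) (simp add: cspan_def)
  show ?thesis
    unfolding a_adjoint_def
  proof (rule the_equality)
    show "B W \<in> HP1 P \<and> (\<forall>U\<in>HP1 P. aform P A (B U) W = aform P A U (B W))" using W B.T_sym by auto
    fix X assume X: "X \<in> HP1 P \<and> (\<forall>U\<in>HP1 P. aform P A (B U) W = aform P A U X)"
    show "X = B W"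
    proof (rule V.eqI_form)
      fix v assume v: "v \<in> HP1 P"
      have "aform P A v X = aform P A v (B W)" using X v B.T_sym[OF v W] by simp
      then show "aform P A X v = aform P A (B W) v"
        using hermitian[of X v] hermitian[of "B W" v] X v W by simp
    qed (use X W in auto)
  qed
qed

text \<open>The norms of \<open>V\<close> and of the form are equivalent, and for self-adjoint operators the lower bound
  already yields bijectivity.\<close>

lemma resolvent_set_reg:
  assumes B: "sa_operator scaleC (HP1 P) (aform P A) B L"
  shows "z \<in> resolvent_set P B \<longleftrightarrow> sa_operator.reg scaleC (HP1 P) (aform P A) B z"
proof -
  interpret B: sa_operator scaleC "HP1 P" "aform P A" B L
    rewrites "module.span scaleC = cspan" by (rule B) (simp add: cspan_def)
  obtain c1 c2 where c: "c1 > 0" "c2 > 0" "\<And>U. U \<in> HP1 P \<Longrightarrow> c1 * normV P U \<le> V.nrm U"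
    "\<And>U. U \<in> HP1 P \<Longrightarrow> V.nrm U \<le> c2 * normV P U" by (rule norm_equiv) blast
  have nV: "normV P U \<ge> 0" for U by (simp add: normV_eq_norm)
  show ?thesis
  proof
    assume "z \<in> resolvent_set P B"
    then obtain M where M: "\<And>U. U \<in> HP1 P \<Longrightarrow> normV P U \<le> M * normV P (z *\<^sub>C U - B U)"
      unfolding resolvent_set_def by blast
    define M' where "M' = max M 1"
    have M': "M' > 0" by (simp add: M'_def)
    have "c1 / (c2 * M') * V.nrm U \<le> V.nrm (z *\<^sub>C U - B U)" if U: "U \<in> HP1 P" for U
    proof -
      have SU: "z *\<^sub>C U - B U \<in> HP1 P" using U by auto
      have "V.nrm U \<le> c2 * normV P U" using c U by blast
      also have "\<dots> \<le> c2 * (M' * normV P (z *\<^sub>C U - B U))"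
        using c(2) by (intro mult_left_mono order_trans[OF M[OF U]] mult_right_mono nV) (auto simp: M'_def)
      also have "\<dots> \<le> c2 * (M' * (V.nrm (z *\<^sub>C U - B U) / c1))"
        using c(1,2) M' c(3)[OF SU] by (intro mult_left_mono) (auto simp: field_simps)
      finally show ?thesis using c(1,2) M' by (simp add: field_simps)
    qed
    moreover have "c1 / (c2 * M') > 0" using c(1,2) M' by simp
    ultimately show "B.reg z" unfolding B.reg_def by blast
  next
    assume z: "B.reg z"
    then obtain e where e: "e > 0" "\<And>U. U \<in> HP1 P \<Longrightarrow> e * V.nrm U \<le> V.nrm (z *\<^sub>C U - B U)" unfolding B.reg_def by blast
    have "normV P U \<le> (c2 / (c1 * e)) * normV P (z *\<^sub>C U - B U)" if U: "U \<in> HP1 P" for U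
    proof -
      have SU: "z *\<^sub>C U - B U \<in> HP1 P" using U by auto
      have "e * (c1 * normV P U) \<le> e * V.nrm U" using c(3)[OF U] e(1) by (intro mult_left_mono) auto
      also have "\<dots> \<le> c2 * normV P (z *\<^sub>C U - B U)" using e(2)[OF U] c(4)[OF SU] by linarith
      finally show ?thesis using e(1) c(1) by (simp add: field_simps)
    qed
    moreover have "bij_betw (\<lambda>U. z *\<^sub>C U - B U) (HP1 P) (HP1 P)"
      unfolding bij_betw_def inj_on_def
    proof (intro conjI ballI impI)
      show "x = y" if "x \<in> HP1 P" "y \<in> HP1 P" "z *\<^sub>C x - B x = z *\<^sub>C y - B y" for x y
        using B.shift_inj[OF z that] .
      show "(\<lambda>U. z *\<^sub>C U - B U) ` HP1 P = HP1 P"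
      proof
        show "(\<lambda>U. z *\<^sub>C U - B U) ` HP1 P \<subseteq> HP1 P" by auto
        show "HP1 P \<subseteq> (\<lambda>U. z *\<^sub>C U - B U) ` HP1 P"
        proof
          fix x assume "x \<in> HP1 P"
          then obtain y where "y \<in> HP1 P" "z *\<^sub>C y - B y = x" using B.shift_surj[OF z] by blast
          then show "x \<in> (\<lambda>U. z *\<^sub>C U - B U) ` HP1 P" by (intro image_eqI[of _ _ y]) simp_all
        qed
      qed
    qed
    ultimately show "z \<in> resolvent_set P B" unfolding resolvent_set_def by blast
  qed
qed

section \<open>Galerkin projections\<close>

definition VN_index :: "nat \<Rightarrow> (int^'n) set" where
  "VN_index N = {k. \<forall>j. - real N / 2 \<le> of_int (k $ j) \<and> of_int (k $ j) < real N / 2}"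

lemma VN_eq: "VN N = cspan (expo ` VN_index N)"
  by (simp add: VN_def VN_index_def)

lemma finite_VN_index: "finite (VN_index N :: (int^'n) set)"
proof (rule finite_subset[OF _ finite_cube])
  show "VN_index N \<subseteq> (cube N :: (int^'n) set)"
  proof
    fix k :: "int^'n" assume k: "k \<in> VN_index N"
    have "\<bar>k $ j\<bar> \<le> int N" for j
    proof -
      have "- real N / 2 \<le> of_int (k $ j)" "of_int (k $ j) < real N / 2" using k by (auto simp: VN_index_def)
      then have "\<bar>of_int (k $ j)\<bar> \<le> real N" by linarith
      then show ?thesis by linarith
    qed
    then show "k \<in> cube N" by (simp add: cube_def)
  qed
qed

lemma subspace_VN: "cvec.subspace (VN N :: 'n torus_l2 set)"
  unfolding VN_eq by (rule cvec.subspace_span)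

lemma VN_HP1: "VN N \<subseteq> HP1 P"
  unfolding VN_eq by (rule cvec.span_minimal[OF _ subspace_HP1]) (auto intro: expo_HP1)

lemma fsum_VN: "fsum (VN_index N) U \<in> VN N"
  unfolding fsum_def VN_eq by (intro cvec.span_sum cvec.span_scale cvec.span_base imageI)

lemma galerkin_unique:
  assumes "X \<in> VN N" "\<And>W. W \<in> VN N \<Longrightarrow> aform P A (X - U) W = 0"
    "X' \<in> VN N" "\<And>W. W \<in> VN N \<Longrightarrow> aform P A (X' - U) W = 0" "U \<in> HP1 P"
  shows "X = X'"
proof -
  have V: "X \<in> HP1 P" "X' \<in> HP1 P" using assms VN_HP1 by auto
  have d: "X - X' \<in> VN N" using assms by (intro cvec.subspace_diff[OF subspace_VN])
  have "X - X' = (X - U) - (X' - U)" by simp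
  then have "aform P A (X - X') (X - X') = aform P A ((X - U) - (X' - U)) (X - X')" by simp
  also have "\<dots> = 0"
    using assms(2)[OF d] assms(4)[OF d] V assms(5)
    by (subst V.a_diff_left) (auto intro: HP1_diff)
  finally have "V.nrm (X - X') = 0" by (simp add: V.nrm_def)
  then show ?thesis using V by (simp add: HP1_diff)
qed

lemma galerkin_exists:
  assumes U: "U \<in> HP1 P"
  shows "\<exists>X\<in>VN N. \<forall>W\<in>VN N. aform P A (X - U) W = 0"
proof -
  have "VN N \<subseteq> cspan (expo ` VN_index N)" by (simp add: VN_eq)
  from V.orthonormal_basis_exists[OF subspace_VN VN_HP1 this finite_imageI[OF finite_VN_index]]
  obtain S where S: "finite S" "S \<subseteq> VN N" "V.orthonormal S" "\<forall>x\<in>VN N. x = (\<Sum>e\<in>S. aform P A x e *\<^sub>C e)" by blast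
  let ?X = "\<Sum>e\<in>S. aform P A U e *\<^sub>C e"
  have SV: "e \<in> HP1 P" if "e \<in> S" for e using that S(2) VN_HP1 by blast
  have X: "?X \<in> VN N" using S(2) by (intro cvec.subspace_sum[OF subspace_VN] cvec.subspace_scale[OF subspace_VN]) auto
  have XV: "?X \<in> HP1 P" using X VN_HP1 by blast
  have "aform P A (?X - U) W = 0" if W: "W \<in> VN N" for W
  proof -
    have WS: "W = (\<Sum>e\<in>S. aform P A W e *\<^sub>C e)" using S(4) W by blast
    have d: "?X - U \<in> HP1 P" using XV U by (rule HP1_diff)
    have z: "aform P A (?X - U) e = 0" if "e \<in> S" for e
      using V.orthonormal_residual[OF S(3,1) U that] XV U SV[OF that] by (simp add: V.a_diff_left)
    have "aform P A (?X - U) (\<Sum>e\<in>S. aform P A W e *\<^sub>C e) = (\<Sum>e\<in>S. aform P A (?X - U) (aform P A W e *\<^sub>C e))"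
      using d SV by (intro V.a_sum_right) (auto intro: HP1_scaleC)
    also have "\<dots> = 0" using d SV z by (intro sum.neutral) (simp add: V.a_scale_right)
    finally show ?thesis by (subst WS)
  qed
  then show ?thesis using X by blast
qed

lemma galerkin_props:
  assumes U: "U \<in> HP1 P"
  shows galerkin_VN: "galerkin_proj P A N U \<in> VN N"
    and galerkin_orth: "W \<in> VN N \<Longrightarrow> aform P A (galerkin_proj P A N U - U) W = 0"
proof -
  have "\<exists>!X. X \<in> VN N \<and> (\<forall>W\<in>VN N. aform P A (X - U) W = 0)"
    using galerkin_exists[OF U, of N] galerkin_unique[OF _ _ _ _ U] by blast
  from theI'[OF this] show "galerkin_proj P A N U \<in> VN N"
    "W \<in> VN N \<Longrightarrow> aform P A (galerkin_proj P A N U - U) W = 0"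
    unfolding galerkin_proj_def by blast+
qed

lemma galerkin_V: "U \<in> HP1 P \<Longrightarrow> galerkin_proj P A N U \<in> HP1 P"
  by (rule subsetD[OF VN_HP1 galerkin_VN])

lemma galerkin_form: "U \<in> HP1 P \<Longrightarrow> W \<in> VN N \<Longrightarrow> aform P A (galerkin_proj P A N U) W = aform P A U W"
  using galerkin_orth[of U W N] galerkin_V[of U N] VN_HP1[of N] by (simp add: V.a_diff_left subset_iff)

lemma galerkin_eqI:
  assumes "X \<in> VN N" "\<And>W. W \<in> VN N \<Longrightarrow> aform P A X W = aform P A U W" "U \<in> HP1 P"
  shows "galerkin_proj P A N U = X"
proof (rule galerkin_unique[OF galerkin_VN[OF assms(3)] galerkin_orth[OF assms(3)] assms(1) _ assms(3)])
  show "aform P A (X - U) W = 0" if "W \<in> VN N" for W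
    using assms that VN_HP1[of N] by (subst V.a_diff_left) auto
qed assumption

lemma galerkin_add:
  "U \<in> HP1 P \<Longrightarrow> W \<in> HP1 P \<Longrightarrow> galerkin_proj P A N (U + W) = galerkin_proj P A N U + galerkin_proj P A N W"
  using cvec.subspace_add[OF subspace_VN galerkin_VN galerkin_VN]
  by (intro galerkin_eqI) (simp_all add: aform_add_left galerkin_V galerkin_form HP1_add)

lemma galerkin_scaleC: "U \<in> HP1 P \<Longrightarrow> galerkin_proj P A N (c *\<^sub>C U) = c *\<^sub>C galerkin_proj P A N U"
  using cvec.subspace_scale[OF subspace_VN galerkin_VN]
  by (intro galerkin_eqI) (simp_all add: aform_scaleC_left galerkin_V galerkin_form HP1_scaleC)

lemma galerkin_sym:
  assumes "U \<in> HP1 P" "W \<in> HP1 P"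
  shows "aform P A (galerkin_proj P A N U) W = aform P A U (galerkin_proj P A N W)"
proof -
  have "aform P A (galerkin_proj P A N U) W = cnj (aform P A (galerkin_proj P A N W) (galerkin_proj P A N U))"
    using hermitian[OF galerkin_V[OF assms(1)] assms(2), of N] galerkin_form[OF assms(2) galerkin_VN[OF assms(1)], of N] by simp
  also have "\<dots> = aform P A (galerkin_proj P A N U) (galerkin_proj P A N W)"
    using hermitian[OF galerkin_V galerkin_V, of U W N N] assms by simp
  also have "\<dots> = aform P A U (galerkin_proj P A N W)"
    using galerkin_form[OF assms(1) galerkin_VN[OF assms(2)]] .
  finally show ?thesis .
qed

lemma galerkin_best:
  assumes U: "U \<in> HP1 P" and W: "W \<in> VN N"
  shows "V.nrm (U - galerkin_proj P A N U) \<le> V.nrm (U - W)"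
proof (rule power2_le_imp_le)
  let ?G = "galerkin_proj P A N U"
  have GV: "?G \<in> HP1 P" and WV: "W \<in> HP1 P" using galerkin_V[OF U] W VN_HP1 by auto
  have d: "?G - W \<in> VN N" by (rule cvec.subspace_diff[OF subspace_VN galerkin_VN[OF U] W])
  have "aform P A (U - ?G) (?G - W) = 0"
    using galerkin_form[OF U d] U GV HP1_diff[OF GV WV] by (simp add: V.a_diff_left)
  then have "(V.nrm ((U - ?G) + (?G - W)))\<^sup>2 = (V.nrm (U - ?G))\<^sup>2 + (V.nrm (?G - W))\<^sup>2"
    using V.nrm_sq_add[OF HP1_diff[OF U GV] HP1_diff[OF GV WV]] by simp
  then show "(V.nrm (U - ?G))\<^sup>2 \<le> (V.nrm (U - W))\<^sup>2" by simp
qed (use assms VN_HP1 in \<open>auto intro!: V.nrm_nonneg HP1_diff\<close>)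

lemma galerkin_nrm: "U \<in> HP1 P \<Longrightarrow> V.nrm (galerkin_proj P A N U) \<le> V.nrm U"
proof (rule power2_le_imp_le)
  assume U: "U \<in> HP1 P"
  let ?G = "galerkin_proj P A N U"
  have GV: "?G \<in> HP1 P" using galerkin_V[OF U] .
  have "aform P A (U - ?G) ?G = 0"
    using galerkin_form[OF U galerkin_VN[OF U]] U GV by (simp add: V.a_diff_left)
  then have "(V.nrm ((U - ?G) + ?G))\<^sup>2 = (V.nrm (U - ?G))\<^sup>2 + (V.nrm ?G)\<^sup>2"
    using V.nrm_sq_add[OF HP1_diff[OF U GV] GV] by simp
  then show "(V.nrm ?G)\<^sup>2 \<le> (V.nrm U)\<^sup>2" by simp
qed (rule V.nrm_nonneg)

lemma sa_operator_TN: "sa_operator scaleC (HP1 P) (aform P A) (TN P A N) 1"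
proof -
  interpret K: sa_operator scaleC "HP1 P" "aform P A" "solution_op P A" 1
    rewrites "module.span scaleC = cspan" by (rule sa_operator_solution_op) (simp add: cspan_def)
  show ?thesis
  proof unfold_locales
    fix U W assume U: "U \<in> HP1 P" and W: "W \<in> HP1 P"
    show "TN P A N U \<in> HP1 P" unfolding TN_def o_def by (intro galerkin_V solution_op_V)
    show "TN P A N (U + W) = TN P A N U + TN P A N W"
      unfolding TN_def o_def using U W by (simp add: galerkin_add galerkin_V solution_op_V solution_op_add)
    show "TN P A N (c *\<^sub>C U) = c *\<^sub>C TN P A N U" for c
      unfolding TN_def o_def using U by (simp add: galerkin_scaleC galerkin_V solution_op_V solution_op_scaleC)
    have "V.nrm (TN P A N U) \<le> V.nrm (solution_op P A (galerkin_proj P A N U))"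
      unfolding TN_def o_def by (intro galerkin_nrm solution_op_V)
    also have "\<dots> \<le> 1 * V.nrm (galerkin_proj P A N U)" by (rule K.T_bound[OF galerkin_V[OF U]])
    also have "\<dots> \<le> 1 * V.nrm U" using galerkin_nrm[OF U] by simp
    finally show "V.nrm (TN P A N U) \<le> 1 * V.nrm U" .
    show "aform P A (TN P A N U) W = aform P A U (TN P A N W)"
      unfolding TN_def o_def
      using galerkin_sym[OF solution_op_V W] K.T_sym[OF galerkin_V[OF U] galerkin_V[OF W]] galerkin_sym[OF U solution_op_V]
      by simp
  qed (rule V_complete)
qed

lemma TN_VN: "TN P A N U \<in> VN N"
  unfolding TN_def o_def by (intro galerkin_VN solution_op_V)

end

section \<open>Convergence of the Galerkin method\<close>

definition kvec :: "int^'n \<Rightarrow> real^'n" where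
  "kvec k = (\<chi> j. of_int (k $ j))"

lemma freq_kvec: "freq k v = v \<bullet> kvec k"
  by (simp add: freq_def kvec_def inner_vec_def mult.commute)

lemma sum_freq_sq: "(\<Sum>i\<in>UNIV. (freq k (P $ i))\<^sup>2) = (norm (P *v kvec k))\<^sup>2"
  by (simp add: norm_vec_def L2_set_def sum_nonneg matrix_vector_mul_component freq_kvec)

lemma Hs_fc:
  fixes U :: "('n::finite) torus_l2"
  shows "U \<in> Hs s \<Longrightarrow> \<exists>D. \<forall>k. fc D k = (\<i> * of_int (k $ j)) ^ s * fc U k"
proof (induction s arbitrary: U)
  case 0
  show ?case by (intro exI[of _ U]) simp
next
  case (Suc s)
  have "\<exists>G\<in>Hs s. weak_deriv (axis j 1) U G" using Suc.prems by simp
  then obtain G where G: "G \<in> Hs s" "weak_deriv (axis j 1) U G" by blast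
  then obtain D where "\<forall>k. fc D k = (\<i> * of_int (k $ j)) ^ s * fc G k" using Suc.IH by blast
  then show ?case using weak_deriv_fc[OF G(2)] by (intro exI[of _ D]) (simp add: mult_ac)
qed

context elliptic_form
begin

lemma Pgrad_fc: "U \<in> HP1 P \<Longrightarrow> fc (Pgrad P U $ i) k = \<i> * of_real (freq k (P $ i)) * fc U k"
  by (rule weak_deriv_fc[OF weak_deriv_Pgrad])

lemma fsum_HP1: "fsum J U \<in> HP1 P"
  unfolding fsum_def by (intro cvec.subspace_sum[OF subspace_HP1] HP1_scaleC expo_HP1)

lemma Pgrad_fsum:
  assumes J: "finite J" and U: "U \<in> HP1 P" shows "Pgrad P (fsum J U) $ i = fsum J (Pgrad P U $ i)"
  by (rule fc_eqI) (simp add: Pgrad_fc[OF fsum_HP1] fc_fsum[OF J] Pgrad_fc[OF U])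

lemma normV_tail:
  assumes J: "finite J" and U: "U \<in> HP1 P"
  shows "(normV P (U - fsum J U))\<^sup>2 = (norm (U - fsum J U))\<^sup>2 + (\<Sum>i\<in>UNIV. (norm (Pgrad P U $ i - fsum J (Pgrad P U $ i)))\<^sup>2)"
  unfolding normV_sq
  by (simp add: Pgrad_diff U fsum_HP1 norm_vec_def[of "Pgrad P U - _"] L2_set_def sum_nonneg Pgrad_fsum[OF J U])

lemma cube_subset_VN_index: "2 * n + 2 \<le> N \<Longrightarrow> cube n \<subseteq> VN_index N"
proof
  fix k :: "int^'n" assume N: "2 * n + 2 \<le> N" and k: "k \<in> cube n"
  have "- real N / 2 \<le> of_int (k $ j) \<and> of_int (k $ j) < real N / 2" for j
  proof -
    have "\<bar>k $ j\<bar> \<le> int n" using k by (simp add: cube_def)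
    then have "\<bar>real_of_int (k $ j)\<bar> \<le> real n" by linarith
    moreover have "real n < real N / 2" using N by linarith
    ultimately show ?thesis by linarith
  qed
  then show "k \<in> VN_index N" by (simp add: VN_index_def)
qed

lemma VN_index_large: "k \<notin> VN_index N \<Longrightarrow> \<exists>j. real N / 2 \<le> \<bar>of_int (k $ j)\<bar>"
proof (rule ccontr)
  assume k: "k \<notin> VN_index N" and "\<not> (\<exists>j. real N / 2 \<le> \<bar>of_int (k $ j)\<bar>)"
  then have "\<bar>of_int (k $ j)\<bar> < real N / 2" for j by (auto simp: not_le)
  then have "- real N / 2 \<le> of_int (k $ j) \<and> of_int (k $ j) < real N / 2" for j
    by (smt (verit) minus_divide_left)
  then show False using k by (simp add: VN_index_def)
qed

lemma fsum_VN_tendsto: "(\<lambda>N. norm (U - fsum (VN_index N) U)) \<longlonglongrightarrow> 0" for U :: "'n torus_l2"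
proof (rule LIMSEQ_I)
  fix e :: real assume "e > 0"
  then obtain n where n: "norm (fsum (cube n) U - U) < e"
    using fsum_cube_tendsto[of U] by (metis LIMSEQ_iff order_refl)
  have "norm (U - fsum (VN_index N) U) < e" if "N \<ge> 2 * n + 2" for N
    using norm_fsum_mono[OF finite_VN_index cube_subset_VN_index[OF that], of U] n
    by (simp add: norm_minus_commute)
  then show "\<exists>no. \<forall>N\<ge>no. norm (norm (U - fsum (VN_index N) U) - 0) < e" by auto
qed

lemma galerkin_tendsto:
  assumes U: "U \<in> HP1 P" shows "(\<lambda>N. V.nrm (U - galerkin_proj P A N U)) \<longlonglongrightarrow> 0"
proof -
  obtain c1 c2 where c: "c1 > 0" "c2 > 0" "\<And>U. U \<in> HP1 P \<Longrightarrow> c1 * normV P U \<le> V.nrm U"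
    "\<And>U. U \<in> HP1 P \<Longrightarrow> V.nrm U \<le> c2 * normV P U" by (rule norm_equiv) blast
  have nV: "normV P U \<ge> 0" for U by (simp add: normV_eq_norm)
  have "(\<lambda>N. (norm (U - fsum (VN_index N) U))\<^sup>2 + (\<Sum>i\<in>UNIV. (norm (Pgrad P U $ i - fsum (VN_index N) (Pgrad P U $ i)))\<^sup>2))
      \<longlonglongrightarrow> 0\<^sup>2 + (\<Sum>i\<in>(UNIV::'d set). 0\<^sup>2)"
    by (intro tendsto_intros fsum_VN_tendsto)
  then have "(\<lambda>N. sqrt ((normV P (U - fsum (VN_index N) U))\<^sup>2)) \<longlonglongrightarrow> sqrt 0"
    unfolding normV_tail[OF finite_VN_index U] by (intro tendsto_real_sqrt) simp
  then have lim: "(\<lambda>N. normV P (U - fsum (VN_index N) U)) \<longlonglongrightarrow> 0" using nV by simp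
  show ?thesis
  proof (rule tendsto_sandwich[of "\<lambda>_. 0" _ _ "\<lambda>N. c2 * normV P (U - fsum (VN_index N) U)"])
    show "(\<lambda>N. c2 * normV P (U - fsum (VN_index N) U)) \<longlonglongrightarrow> 0" by (rule tendsto_mult_right_zero[OF lim])
    show "\<forall>\<^sub>F N in sequentially. 0 \<le> V.nrm (U - galerkin_proj P A N U)"
      by (rule always_eventually) (intro allI V.nrm_nonneg HP1_diff U galerkin_V)
    show "\<forall>\<^sub>F N in sequentially. V.nrm (U - galerkin_proj P A N U) \<le> c2 * normV P (U - fsum (VN_index N) U)"
      by (rule always_eventually)
         (rule allI, rule order_trans[OF galerkin_best[OF U fsum_VN] c(4)[OF HP1_diff[OF U fsum_HP1]]])
  qed simp
qed

text \<open>A frequency outside the index box has a component \<open>k\<^sub>j\<close> of modulus at least \<open>N/2\<close>, and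
  the coefficients of the gradient are bounded by the largest component. Hence one derivative is
  spent on the norm of \<open>V\<close>, and the other \<open>s - 1\<close> yield the rate.\<close>

lemma galerkin_rate:
  assumes U: "U \<in> HP1 P" "U \<in> Hs s" and s: "s \<ge> 1"
  shows "\<exists>C\<ge>0. \<forall>N\<ge>1. V.nrm (U - galerkin_proj P A N U) \<le> C * (1 + (real N)\<^sup>2) powr ((1 - real s) / 2)"
proof -
  obtain p where p: "s = Suc p" using s by (cases s) auto
  obtain c1 c2 where c: "c1 > 0" "c2 > 0" "\<And>U. U \<in> HP1 P \<Longrightarrow> c1 * normV P U \<le> V.nrm U"
    "\<And>U. U \<in> HP1 P \<Longrightarrow> V.nrm U \<le> c2 * normV P U" by (rule norm_equiv) blast
  have nV: "normV P U \<ge> 0" for U by (simp add: normV_eq_norm)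
  have "\<forall>j. \<exists>D. \<forall>k. fc D k = (\<i> * of_int (k $ j)) ^ s * fc U k" using Hs_fc[OF U(2)] by blast
  from choice[OF this] obtain D where D: "\<And>j k. fc (D j) k = (\<i> * of_int (k $ j)) ^ s * fc U k" by blast
  define S where "S = (\<Sum>j\<in>UNIV. (norm (D j))\<^sup>2)"
  have S0: "S \<ge> 0" by (simp add: S_def sum_nonneg)
  define B where "B = 1 + (\<Sum>i\<in>UNIV. \<Sum>j\<in>UNIV. \<bar>P $ i $ j\<bar>)"
  have B1: "B \<ge> 1" by (simp add: B_def sum_nonneg)
  have key: "(norm (X - fsum (VN_index N) X))\<^sup>2 \<le> B\<^sup>2 * (8 / (1 + (real N)\<^sup>2)) ^ p * S"
    if N: "N \<ge> 1" and X: "\<And>k m. (\<And>j. \<bar>of_int (k $ j)\<bar> \<le> m) \<Longrightarrow> m \<ge> 1 \<Longrightarrow> cmod (fc X k) \<le> B * m * cmod (fc U k)" for X N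
    unfolding S_def
  proof (rule norm_tail_le[OF finite_VN_index])
    fix k :: "int^'n" assume "k \<notin> VN_index N"
    then obtain j0 where j0: "real N / 2 \<le> \<bar>of_int (k $ j0)\<bar>"
      using VN_index_large by blast
    obtain j where j: "\<And>i. \<bar>k $ i\<bar> \<le> \<bar>k $ j\<bar>"
    proof -
      have "Max (range (\<lambda>i. \<bar>k $ i\<bar>)) \<in> range (\<lambda>i. \<bar>k $ i\<bar>)" by (rule Max_in) auto
      then obtain j where "Max (range (\<lambda>i. \<bar>k $ i\<bar>)) = \<bar>k $ j\<bar>" by blast
      moreover have "\<bar>k $ i\<bar> \<le> Max (range (\<lambda>i. \<bar>k $ i\<bar>))" for i by (rule Max_ge) auto
      ultimately show ?thesis using that[of j] by simp
    qed
    define m where "m = real_of_int \<bar>k $ j\<bar>"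
    have mN: "m \<ge> real N / 2" using j0 j[of j0] by (simp add: m_def)
    have m1: "m \<ge> 1"
    proof -
      have "m > 0" using mN N by linarith
      then show ?thesis by (simp add: m_def)
    qed
    have "cmod (fc X k) \<le> B * m * cmod (fc U k)"
      by (rule X) (use j m1 in \<open>auto simp: m_def simp flip: of_int_abs\<close>)
    then have 1: "(cmod (fc X k))\<^sup>2 \<le> B\<^sup>2 * (m\<^sup>2 * (cmod (fc U k))\<^sup>2)"
      using power_mono[of "cmod (fc X k)" "B * m * cmod (fc U k)" 2] by (simp add: power_mult_distrib mult_ac)
    have 2: "(cmod (fc (D j) k))\<^sup>2 = (m\<^sup>2) ^ p * (m\<^sup>2 * (cmod (fc U k))\<^sup>2)"
    proof -
      have "cmod (fc (D j) k) = m ^ Suc p * cmod (fc U k)"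
        by (simp add: D p norm_mult norm_power m_def)
      then show ?thesis by (simp add: power_mult_distrib power2_eq_square mult_ac)
    qed
    have Npos: "1 + (real N)\<^sup>2 > 0" by (rule add_pos_nonneg) auto
    have "(1 + (real N)\<^sup>2) / 8 \<le> m\<^sup>2"
    proof -
      have "(real N / 2)\<^sup>2 \<le> m\<^sup>2" using mN by (intro power_mono) auto
      moreover have "1 \<le> (real N)\<^sup>2" using N by simp
      ultimately show ?thesis by (simp add: power_divide)
    qed
    then have 3: "((1 + (real N)\<^sup>2) / 8) ^ p \<le> (m\<^sup>2) ^ p" using Npos by (intro power_mono) auto
    have "(8 / (1 + (real N)\<^sup>2)) ^ p * ((1 + (real N)\<^sup>2) / 8) ^ p = 1"
    proof -
      have "(8 / x) ^ p * (x / 8) ^ p = 1" if "x > 0" for x :: real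
        using that by (simp flip: power_mult_distrib)
      from this[OF Npos] show ?thesis .
    qed
    then have "m\<^sup>2 * (cmod (fc U k))\<^sup>2 = (8 / (1 + (real N)\<^sup>2)) ^ p * (((1 + (real N)\<^sup>2) / 8) ^ p * (m\<^sup>2 * (cmod (fc U k))\<^sup>2))"
      by (simp flip: mult.assoc)
    also have "\<dots> \<le> (8 / (1 + (real N)\<^sup>2)) ^ p * ((m\<^sup>2) ^ p * (m\<^sup>2 * (cmod (fc U k))\<^sup>2))"
      using Npos by (intro mult_left_mono mult_right_mono 3) auto
    also have "\<dots> = (8 / (1 + (real N)\<^sup>2)) ^ p * (cmod (fc (D j) k))\<^sup>2" by (simp only: 2)
    also have "\<dots> \<le> (8 / (1 + (real N)\<^sup>2)) ^ p * (\<Sum>j\<in>UNIV. (cmod (fc (D j) k))\<^sup>2)"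
      using Npos by (intro mult_left_mono member_le_sum) auto
    finally have "B\<^sup>2 * (m\<^sup>2 * (cmod (fc U k))\<^sup>2) \<le> B\<^sup>2 * ((8 / (1 + (real N)\<^sup>2)) ^ p * (\<Sum>j\<in>UNIV. (cmod (fc (D j) k))\<^sup>2))"
      by (intro mult_left_mono) auto
    then show "(cmod (fc X k))\<^sup>2 \<le> B\<^sup>2 * (8 / (1 + (real N)\<^sup>2)) ^ p * (\<Sum>j\<in>UNIV. (cmod (fc (D j) k))\<^sup>2)"
      using 1 by (simp add: mult.assoc)
  qed (auto intro!: mult_nonneg_nonneg zero_le_power divide_nonneg_nonneg)
  have XU: "cmod (fc U k) \<le> B * m * cmod (fc U k)" if "m \<ge> 1" for k :: "int^'n" and m
    using that B1 mult_mono[of 1 B 1 m] by (intro mult_right_mono[of 1 "B * m", simplified]) auto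
  have XG: "cmod (fc (Pgrad P U $ i) k) \<le> B * m * cmod (fc U k)"
    if k: "\<And>j. \<bar>of_int (k $ j)\<bar> \<le> m" "m \<ge> 1" for i and k :: "int^'n" and m
  proof -
    have "\<bar>freq k (P $ i)\<bar> \<le> (\<Sum>j\<in>UNIV. \<bar>of_int (k $ j) * P $ i $ j\<bar>)" unfolding freq_def by (rule sum_abs)
    also have "\<dots> \<le> (\<Sum>j\<in>UNIV. m * \<bar>P $ i $ j\<bar>)"
      by (intro sum_mono, unfold abs_mult) (intro mult_right_mono k(1) abs_ge_zero)
    also have "\<dots> = m * (\<Sum>j\<in>UNIV. \<bar>P $ i $ j\<bar>)" by (simp add: sum_distrib_left)
    also have "\<dots> \<le> m * B"
    proof (intro mult_left_mono)
      have "(\<Sum>j\<in>UNIV. \<bar>P $ i $ j\<bar>) \<le> (\<Sum>i\<in>UNIV. \<Sum>j\<in>UNIV. \<bar>P $ i $ j\<bar>)" by (rule member_le_sum) (auto intro: sum_nonneg)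
      then show "(\<Sum>j\<in>UNIV. \<bar>P $ i $ j\<bar>) \<le> B" by (simp add: B_def)
    qed (use k in simp)
    finally have "\<bar>freq k (P $ i)\<bar> \<le> B * m" by (simp add: mult.commute)
    then show ?thesis unfolding Pgrad_fc[OF U(1)] by (simp add: norm_mult mult_right_mono)
  qed
  define Q where "Q = (1 + real CARD('d)) * (B\<^sup>2 * 8 ^ p * S)"
  have Q0: "Q \<ge> 0" using S0 by (simp add: Q_def)
  have "V.nrm (U - galerkin_proj P A N U) \<le> (c2 * sqrt Q) * (1 + (real N)\<^sup>2) powr ((1 - real s) / 2)" if N: "N \<ge> 1" for N
  proof -
    let ?J = "VN_index N :: (int^'n) set"
    let ?x = "1 + (real N)\<^sup>2"
    have x: "?x > 0" by (rule add_pos_nonneg) auto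
    have "(normV P (U - fsum ?J U))\<^sup>2
        \<le> B\<^sup>2 * (8 / ?x) ^ p * S + (\<Sum>i\<in>(UNIV::'d set). B\<^sup>2 * (8 / ?x) ^ p * S)"
      unfolding normV_tail[OF finite_VN_index U(1)]
      by (intro add_mono sum_mono key[OF N] XU XG) auto
    also have "\<dots> = Q * (1 / ?x ^ p)" by (simp add: Q_def power_divide algebra_simps)
    also have "1 / ?x ^ p = (?x powr ((1 - real s) / 2))\<^sup>2"
    proof -
      have "(?x powr ((1 - real s) / 2))\<^sup>2 = ?x powr (- real p)"
        using x by (simp add: p powr_power)
      also have "\<dots> = 1 / ?x ^ p" using x by (simp add: powr_minus powr_realpow inverse_eq_divide)
      finally show ?thesis ..
    qed
    also have "Q * (?x powr ((1 - real s) / 2))\<^sup>2 = (sqrt Q * ?x powr ((1 - real s) / 2))\<^sup>2"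
      using Q0 by (simp add: power_mult_distrib)
    finally have "normV P (U - fsum ?J U) \<le> sqrt Q * ?x powr ((1 - real s) / 2)"
      by (rule power2_le_imp_le) (use Q0 in simp)
    then have "c2 * normV P (U - fsum ?J U) \<le> c2 * (sqrt Q * ?x powr ((1 - real s) / 2))"
      using c(2) by (intro mult_left_mono) auto
    moreover have "V.nrm (U - galerkin_proj P A N U) \<le> c2 * normV P (U - fsum ?J U)"
      by (rule order_trans[OF galerkin_best[OF U(1) fsum_VN] c(4)[OF HP1_diff[OF U(1) fsum_HP1]]])
    ultimately show ?thesis by (simp add: mult.assoc)
  qed
  then show ?thesis using c(2) Q0 by (intro exI[of _ "c2 * sqrt Q"]) auto
qed

text \<open>For square \<open>P\<close> the norm of \<open>V\<close> controls high frequencies, so the solution operator is a norm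
  limit of operators of finite rank, and \<open>T\<^sub>N\<close> converges to it in norm.\<close>

lemma low_frequency_approx:
  assumes c: "c > 0" "\<And>x. c * norm x \<le> norm (P *v x)" and U: "U \<in> HP1 P" and M: "M \<ge> 1"
  shows "norm (U - fsum (VN_index M) U) \<le> 2 / (c * sqrt C0 * real M) * V.nrm U"
proof (rule power2_le_imp_le)
  have "(norm (U - fsum (VN_index M) U))\<^sup>2 \<le> (2 / (c * real M))\<^sup>2 * (\<Sum>i\<in>UNIV. (norm (Pgrad P U $ i))\<^sup>2)"
  proof (rule norm_tail_le[OF finite_VN_index])
    fix k :: "int^'n" assume "k \<notin> VN_index M"
    then obtain j where j: "real M / 2 \<le> \<bar>of_int (k $ j)\<bar>"
      using VN_index_large by blast
    have "\<bar>of_int (k $ j)\<bar> \<le> norm (kvec k)" using component_le_norm_cart[of "kvec k" j] by (simp add: kvec_def)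
    then have "c * (real M / 2) \<le> norm (P *v kvec k)"
      using j c(1) by (intro order_trans[OF _ c(2)] mult_left_mono) auto
    then have "(c * (real M / 2))\<^sup>2 \<le> (norm (P *v kvec k))\<^sup>2" using c(1) by (intro power_mono) auto
    then have "(c * (real M / 2))\<^sup>2 * (cmod (fc U k))\<^sup>2 \<le> (norm (P *v kvec k))\<^sup>2 * (cmod (fc U k))\<^sup>2"
      by (intro mult_right_mono) auto
    also have "\<dots> = (\<Sum>i\<in>UNIV. (cmod (fc (Pgrad P U $ i) k))\<^sup>2)"
      by (simp add: Pgrad_fc[OF U] norm_mult power_mult_distrib sum_freq_sq[symmetric] sum_distrib_right)
    finally have "(2 / (c * real M))\<^sup>2 * ((c * (real M / 2))\<^sup>2 * (cmod (fc U k))\<^sup>2)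
        \<le> (2 / (c * real M))\<^sup>2 * (\<Sum>i\<in>UNIV. (cmod (fc (Pgrad P U $ i) k))\<^sup>2)"
      by (intro mult_left_mono) auto
    moreover have "(2 / (c * real M))\<^sup>2 * (c * (real M / 2))\<^sup>2 = 1"
      using c(1) M by (simp flip: power_mult_distrib)
    ultimately show "(cmod (fc U k))\<^sup>2 \<le> (2 / (c * real M))\<^sup>2 * (\<Sum>i\<in>UNIV. (cmod (fc (Pgrad P U $ i) k))\<^sup>2)"
      by (simp flip: mult.assoc)
  qed auto
  also have "(\<Sum>i\<in>UNIV. (norm (Pgrad P U $ i))\<^sup>2) = (norm (Pgrad P U))\<^sup>2"
    by (simp add: norm_vec_def[of "Pgrad P U"] L2_set_def sum_nonneg)
  also have "(2 / (c * real M))\<^sup>2 * (norm (Pgrad P U))\<^sup>2 \<le> (2 / (c * real M))\<^sup>2 * ((V.nrm U)\<^sup>2 / C0)"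
  proof (intro mult_left_mono)
    have "C0 * (norm (Pgrad P U))\<^sup>2 \<le> (norm U)\<^sup>2 + C0 * (norm (Pgrad P U))\<^sup>2" by simp
    also have "\<dots> \<le> (V.nrm U)\<^sup>2" unfolding V.nrm_sq[OF U] by (rule aform_coercive[OF U])
    finally show "(norm (Pgrad P U))\<^sup>2 \<le> (V.nrm U)\<^sup>2 / C0"
      unfolding pos_le_divide_eq[OF C0] by (simp only: mult.commute)
  qed simp
  also have "\<dots> = (2 / (c * sqrt C0 * real M) * V.nrm U)\<^sup>2"
  proof -
    have "(sqrt C0)\<^sup>2 = C0" using C0 by simp
    then show ?thesis by (simp only: power_mult_distrib power_divide) simp
  qed
  finally show "(norm (U - fsum (VN_index M) U))\<^sup>2 \<le> (2 / (c * sqrt C0 * real M) * V.nrm U)\<^sup>2" .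
qed (use c C0 U in simp)

text \<open>Low frequencies span a finite-dimensional space, on which pointwise convergence of the Galerkin
  projections is uniform. High frequencies are small in \<open>L\<^sup>2\<close>, and \<open>K\<close> is bounded from \<open>L\<^sup>2\<close> to \<open>V\<close>.\<close>

lemma defect_solution_op_small:
  assumes c: "c > 0" "\<And>x. c * norm x \<le> norm (P *v x)" and \<epsilon>: "\<epsilon> > 0"
  shows "\<forall>\<^sub>F N in sequentially. \<forall>U\<in>HP1 P.
    V.nrm (solution_op P A U - galerkin_proj P A N (solution_op P A U)) \<le> \<epsilon> * V.nrm U"
proof -
  let ?K = "solution_op P A"
  let ?d = "\<lambda>N U. U - galerkin_proj P A N U"
  have dV: "?d N U \<in> HP1 P" if "U \<in> HP1 P" for N U by (intro HP1_diff galerkin_V that)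
  obtain M :: nat where M: "4 / (c * sqrt C0 * \<epsilon>) < real M" using reals_Archimedean2 by blast
  have cC: "c * sqrt C0 > 0" using c C0 by simp
  have "0 < 4 / (c * sqrt C0 * \<epsilon>)" using cC \<epsilon> by simp
  then have "0 < real M" using M by linarith
  then have M1: "M \<ge> 1" by simp
  have Mle: "2 / (c * sqrt C0 * real M) \<le> \<epsilon> / 2"
  proof -
    have "4 < real M * ((c * sqrt C0) * \<epsilon>)"
      using M mult_pos_pos[OF cC \<epsilon>] by (simp only: pos_divide_less_eq)
    then have "4 \<le> \<epsilon> * ((c * sqrt C0) * real M)" by (simp add: mult_ac)
    moreover have "(c * sqrt C0) * real M > 0" using cC \<open>0 < real M\<close> by (rule mult_pos_pos)
    ultimately have "4 / ((c * sqrt C0) * real M) \<le> \<epsilon>" by (simp only: pos_divide_le_eq)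
    then show ?thesis by simp
  qed
  let ?J = "VN_index M :: (int^'n) set"
  have "(\<lambda>N. \<Sum>k\<in>?J. V.nrm (?d N (?K (expo k)))) \<longlonglongrightarrow> (\<Sum>k\<in>?J. 0)"
    by (intro tendsto_sum galerkin_tendsto solution_op_V)
  then have "\<forall>\<^sub>F N in sequentially. (\<Sum>k\<in>?J. V.nrm (?d N (?K (expo k)))) < \<epsilon> / 2"
    using \<epsilon> by (intro order_tendstoD) auto
  then show ?thesis
  proof eventually_elim
    case (elim N)
    show ?case
    proof
      fix U assume U: "U \<in> HP1 P"
      let ?f = "fsum ?J U"
      have dlin: "?d N (X + Y) = ?d N X + ?d N Y" if "X \<in> HP1 P" "Y \<in> HP1 P" for X Y
        using that by (simp add: galerkin_add algebra_simps)
      have dsum: "?d N (\<Sum>k\<in>I. h k *\<^sub>C X k) = (\<Sum>k\<in>I. h k *\<^sub>C ?d N (X k))"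
        if "finite I" "\<And>k. X k \<in> HP1 P" for I :: "(int^'n) set" and h X
        using that(1)
      proof (induction I rule: finite_induct)
        case empty
        show ?case using galerkin_scaleC[of 0 N 0] by simp
      next
        case (insert k I)
        have s: "(\<Sum>k\<in>I. h k *\<^sub>C X k) \<in> HP1 P" using that(2) by (intro V.V_sum HP1_scaleC)
        have "?d N (h k *\<^sub>C X k) = h k *\<^sub>C ?d N (X k)"
          using that(2) by (simp add: galerkin_scaleC cvec.scale_right_diff_distrib)
        then show ?case using insert dlin[OF HP1_scaleC[OF that(2)] s, of "h k" k] by simp
      qed
      have Kf: "?K ?f = (\<Sum>k\<in>?J. fc U k *\<^sub>C ?K (expo k))"
      proof -
        have "?K (\<Sum>k\<in>I. fc U k *\<^sub>C expo k) = (\<Sum>k\<in>I. fc U k *\<^sub>C ?K (expo k))" if "finite I" for I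
          using that
        proof (induction I rule: finite_induct)
          case empty
          show ?case using solution_op_scaleC[of 0 0] by simp
        qed (simp add: solution_op_add solution_op_scaleC)
        then show ?thesis using finite_VN_index unfolding fsum_def by blast
      qed
      have "?d N (?K ?f) = (\<Sum>k\<in>?J. fc U k *\<^sub>C ?d N (?K (expo k)))"
        unfolding Kf by (rule dsum[OF finite_VN_index solution_op_V])
      then have "V.nrm (?d N (?K ?f)) \<le> (\<Sum>k\<in>?J. V.nrm (fc U k *\<^sub>C ?d N (?K (expo k))))"
        using dV[OF solution_op_V] by (simp only:) (intro V.nrm_sum_le HP1_scaleC)
      also have "\<dots> \<le> (\<Sum>k\<in>?J. V.nrm U * V.nrm (?d N (?K (expo k))))"
      proof (rule sum_mono)
        fix k
        have "cmod (fc U k) \<le> V.nrm U" using cmod_fc_le[of U k] norm_le_nrm[OF U] by linarith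
        then show "V.nrm (fc U k *\<^sub>C ?d N (?K (expo k))) \<le> V.nrm U * V.nrm (?d N (?K (expo k)))"
          unfolding V.nrm_scale[OF dV[OF solution_op_V]]
          by (intro mult_right_mono V.nrm_nonneg dV solution_op_V)
      qed
      also have "\<dots> = V.nrm U * (\<Sum>k\<in>?J. V.nrm (?d N (?K (expo k))))" by (simp add: sum_distrib_left)
      also have "\<dots> \<le> V.nrm U * (\<epsilon> / 2)" using elim U by (intro mult_left_mono) auto
      finally have 1: "V.nrm (?d N (?K ?f)) \<le> \<epsilon> / 2 * V.nrm U" by (simp add: mult.commute)
      have "V.nrm (?d N (?K (U - ?f))) \<le> V.nrm (?K (U - ?f))"
        using galerkin_best[OF solution_op_V[of "U - ?f"] cvec.subspace_0[OF subspace_VN], of N] by simp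
      also have "\<dots> \<le> norm (U - ?f)" by (rule solution_op_bound)
      also have "\<dots> \<le> 2 / (c * sqrt C0 * real M) * V.nrm U" by (rule low_frequency_approx[OF c U M1])
      also have "\<dots> \<le> \<epsilon> / 2 * V.nrm U" using Mle U by (intro mult_right_mono) auto
      finally have 2: "V.nrm (?d N (?K (U - ?f))) \<le> \<epsilon> / 2 * V.nrm U" .
      have "?K U = ?K ?f + ?K (U - ?f)" by (simp flip: solution_op_add)
      then have "?d N (?K U) = ?d N (?K ?f) + ?d N (?K (U - ?f))"
        using dlin[OF solution_op_V solution_op_V] by metis
      then have "V.nrm (?d N (?K U)) \<le> V.nrm (?d N (?K ?f)) + V.nrm (?d N (?K (U - ?f)))"
        by (simp only:) (intro V.nrm_triangle dV solution_op_V)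
      then show "V.nrm (?d N (?K U)) \<le> \<epsilon> * V.nrm U" using 1 2 by linarith
    qed
  qed
qed

lemma TN_tendsto_norm:
  assumes c: "c > 0" "\<And>x. c * norm x \<le> norm (P *v x)" and \<epsilon>: "\<epsilon> > 0"
  shows "\<forall>\<^sub>F N in sequentially. \<forall>U\<in>HP1 P. V.nrm (solution_op P A U - TN P A N U) \<le> \<epsilon> * V.nrm U"
proof -
  interpret K: sa_operator scaleC "HP1 P" "aform P A" "solution_op P A" 1
    rewrites "module.span scaleC = cspan" by (rule sa_operator_solution_op) (simp add: cspan_def)
  let ?K = "solution_op P A"
  have "\<epsilon> / 2 > 0" using \<epsilon> by simp
  from defect_solution_op_small[OF c this] show ?thesis
  proof eventually_elim
    case (elim N)
    let ?G = "galerkin_proj P A N"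
    show ?case
    proof
      fix U assume U: "U \<in> HP1 P"
      let ?g = "U - ?G U"
      have g: "?g \<in> HP1 P" by (intro HP1_diff galerkin_V U)
      have Kg: "?K ?g \<in> HP1 P" by (rule solution_op_V)
      have KKg: "?K (?K ?g) - ?G (?K (?K ?g)) \<in> HP1 P" by (intro HP1_diff galerkin_V solution_op_V)
      text \<open>\<open>K (1 - \<Pi>)\<close> is the adjoint of \<open>(1 - \<Pi>) K\<close>.\<close>
      have "aform P A (?K ?g) (?K ?g) = aform P A ?g (?K (?K ?g))" by (rule K.T_sym[OF g Kg])
      also have "\<dots> = aform P A U (?K (?K ?g) - ?G (?K (?K ?g)))"
        using U g solution_op_V galerkin_V galerkin_sym[OF U solution_op_V, of N "?K ?g"]
        by (simp add: V.a_diff_left V.a_diff_right)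
      finally have "(V.nrm (?K ?g))\<^sup>2 \<le> cmod (aform P A U (?K (?K ?g) - ?G (?K (?K ?g))))"
        using V.nrm_sq[OF Kg] complex_Re_le_cmod by simp
      also have "\<dots> \<le> V.nrm U * (\<epsilon> / 2 * V.nrm (?K ?g))"
        using elim[rule_format, OF Kg] by (intro order_trans[OF V.Cauchy_Schwarz[OF U KKg]] mult_left_mono V.nrm_nonneg U)
      finally have "V.nrm (?K ?g) * V.nrm (?K ?g) \<le> (\<epsilon> / 2 * V.nrm U) * V.nrm (?K ?g)"
        by (simp add: power2_eq_square mult_ac)
      then have 1: "V.nrm (?K ?g) \<le> \<epsilon> / 2 * V.nrm U"
        using V.nrm_nonneg[OF Kg] V.nrm_nonneg[OF U] \<epsilon> by (cases "V.nrm (?K ?g) = 0") (auto simp: mult_le_cancel_right)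
      have eq: "?K U - TN P A N U = (?K U - ?G (?K U)) + ?G (?K ?g)"
      proof -
        have "?K U = ?K ?g + ?K (?G U)" by (simp flip: solution_op_add)
        then have "?G (?K U) = ?G (?K ?g) + ?G (?K (?G U))"
          using galerkin_add[OF solution_op_V solution_op_V] by metis
        then show ?thesis by (simp add: TN_def)
      qed
      have "V.nrm (?K U - TN P A N U) \<le> V.nrm (?K U - ?G (?K U)) + V.nrm (?G (?K ?g))"
        unfolding eq by (intro V.nrm_triangle HP1_diff galerkin_V solution_op_V)
      also have "\<dots> \<le> \<epsilon> / 2 * V.nrm U + \<epsilon> / 2 * V.nrm U"
        using elim[rule_format, OF U] order_trans[OF galerkin_nrm[OF Kg] 1] by (rule add_mono)
      finally show "V.nrm (?K U - TN P A N U) \<le> \<epsilon> * V.nrm U" by simp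
    qed
  qed
qed

text \<open>For an eigenvector, \<open>K u - T\<^sub>N u = \<gamma> (u - \<Pi> u) + \<Pi> K (u - \<Pi> u)\<close>, and \<open>\<Pi>\<close> and \<open>K\<close> have norm at
  most \<open>1\<close>.\<close>

lemma TN_defect_eigenvector:
  assumes U: "U \<in> HP1 P" "solution_op P A U = \<gamma> *\<^sub>C U"
  shows "V.nrm (solution_op P A U - TN P A N U) \<le> (1 + cmod \<gamma>) * V.nrm (U - galerkin_proj P A N U)"
proof -
  interpret K: sa_operator scaleC "HP1 P" "aform P A" "solution_op P A" 1
    rewrites "module.span scaleC = cspan" by (rule sa_operator_solution_op) (simp add: cspan_def)
  let ?K = "solution_op P A" and ?G = "galerkin_proj P A N"
  let ?g = "U - ?G U"
  have g: "?g \<in> HP1 P" by (intro HP1_diff galerkin_V U)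
  have eq: "?K U - TN P A N U = \<gamma> *\<^sub>C ?g + ?G (?K ?g)"
  proof -
    have "?K U = ?K ?g + ?K (?G U)" by (simp flip: solution_op_add)
    then have "?G (?K U) = ?G (?K ?g) + ?G (?K (?G U))"
      using galerkin_add[OF solution_op_V solution_op_V] by metis
    moreover have "?K U - ?G (?K U) = \<gamma> *\<^sub>C ?g"
      unfolding U(2) galerkin_scaleC[OF U(1)] cvec.scale_right_diff_distrib ..
    ultimately show ?thesis by (simp add: TN_def algebra_simps)
  qed
  have "V.nrm (?G (?K ?g)) \<le> V.nrm ?g"
    using K.T_bound[OF g] by (intro order_trans[OF galerkin_nrm[OF solution_op_V]]) simp
  moreover have "V.nrm (?K U - TN P A N U) \<le> V.nrm (\<gamma> *\<^sub>C ?g) + V.nrm (?G (?K ?g))"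
    unfolding eq by (intro V.nrm_triangle HP1_scaleC g galerkin_V solution_op_V)
  moreover have "V.nrm (\<gamma> *\<^sub>C ?g) = cmod \<gamma> * V.nrm ?g" by (rule V.nrm_scale[OF g])
  ultimately show ?thesis by (simp add: distrib_right)
qed

end

section \<open>Ellipticity on the whole torus\<close>

lemma torus_periodic_int:
  assumes F: "torus_periodic F" shows "F (y + (2 * pi) *\<^sub>R kvec h) = F y"
proof -
  have one: "F (y + (2 * pi * of_int n) *\<^sub>R axis j 1) = F y" for y n j
  proof (induction n rule: int_induct[where k = 0])
    case base
    show ?case by simp
  next
    case (step1 i)
    have "y + (2 * pi * of_int (i + 1)) *\<^sub>R axis j 1 = (y + (2 * pi * of_int i) *\<^sub>R axis j 1) + (2 * pi) *\<^sub>R axis j 1"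
      by (simp add: algebra_simps flip: scaleR_left_distrib)
    then show ?case using step1 torus_periodic_D[OF F] by metis
  next
    case (step2 i)
    have "y + (2 * pi * of_int i) *\<^sub>R axis j 1 = (y + (2 * pi * of_int (i - 1)) *\<^sub>R axis j 1) + (2 * pi) *\<^sub>R axis j 1"
      by (simp add: algebra_simps flip: scaleR_left_distrib)
    then show ?case using step2 torus_periodic_D[OF F] by metis
  qed
  have "F (y + (\<Sum>j\<in>J. (2 * pi * of_int (h $ j)) *\<^sub>R axis j 1)) = F y" if "finite J" for J
    using that
  proof (induction J rule: finite_induct)
    case (insert j J)
    have eq: "y + (\<Sum>j\<in>insert j J. (2 * pi * of_int (h $ j)) *\<^sub>R axis j 1)
        = (y + (\<Sum>j\<in>J. (2 * pi * of_int (h $ j)) *\<^sub>R axis j 1)) + (2 * pi * of_int (h $ j)) *\<^sub>R axis j 1"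
      using insert by (simp add: add_ac)
    show ?case unfolding eq one by (rule insert.IH)
  qed simp
  moreover have "(\<Sum>j\<in>UNIV. (2 * pi * of_int (h $ j)) *\<^sub>R axis j 1) = (2 * pi) *\<^sub>R kvec h"
    by (simp add: vec_eq_iff kvec_def axis_def if_distrib cong: if_cong)
  ultimately show ?thesis by (metis finite)
qed

text \<open>A direction \<open>w\<close> avoiding the countably many hyperplanes \<open>(P k)\<^sup>\<bottom>\<close> makes the entries of
  \<open>P\<^sup>T w\<close> rationally independent; Kronecker's theorem then makes the line \<open>t P\<^sup>T w\<close> dense in the
  torus.\<close>

lemma projection_matrix_kvec:
  assumes "projection_matrix P" "P *v kvec k = 0" shows "k = 0"
proof -
  have "(\<Sum>j\<in>UNIV. of_rat (of_int (k $ j)) *\<^sub>R column j P) = P *v kvec k"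
    by (simp add: matrix_mult_sum kvec_def scalar_mult_eq_scaleR)
  then have "(\<Sum>j\<in>UNIV. of_rat (of_int (k $ j)) *\<^sub>R column j P) = 0" using assms(2) by (rule trans)
  moreover have "\<forall>q. (\<Sum>j\<in>UNIV. of_rat (q j) *\<^sub>R column j P) = 0 \<longrightarrow> (\<forall>j. q j = 0)"
    using assms(1) unfolding projection_matrix_def by blast
  ultimately have "\<forall>j. rat_of_int (k $ j) = 0"
    using spec[of _ "\<lambda>j. rat_of_int (k $ j)"] by (metis (no_types))
  then show ?thesis by (simp add: vec_eq_iff)
qed

lemma generic_direction:
  fixes P :: "real^'n^'d"
  assumes P: "projection_matrix P"
  obtains w where "\<And>k. k \<noteq> 0 \<Longrightarrow> (P *v kvec k) \<bullet> w \<noteq> 0"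
proof -
  have cnt: "countable (UNIV :: (int^'n) set)"
  proof -
    have "inj (\<lambda>k :: int^'n. (\<lambda>j. k $ j))" by (auto simp: inj_def vec_eq_iff fun_eq_iff)
    moreover have "countable (UNIV :: ('n \<Rightarrow> int) set)"
      using countable_PiE[of "UNIV :: 'n set" "\<lambda>_. UNIV :: int set"] by (simp add: PiE_UNIV_domain)
    ultimately show ?thesis by (metis countable_image_inj_eq countable_subset subset_UNIV)
  qed
  have "negligible (\<Union>k\<in>{k::int^'n. k \<noteq> 0}. {w. (P *v kvec k) \<bullet> w = 0})"
  proof (intro negligible_countable_Union)
    show "countable ((\<lambda>k. {w. (P *v kvec k) \<bullet> w = 0}) ` {k::int^'n. k \<noteq> 0})"
      using cnt by (intro countable_image) (rule countable_subset[OF subset_UNIV])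
    show "negligible S" if S: "S \<in> (\<lambda>k. {w. (P *v kvec k) \<bullet> w = 0}) ` {k::int^'n. k \<noteq> 0}" for S
    proof -
      obtain k :: "int^'n" where k: "k \<noteq> 0" "S = {w. (P *v kvec k) \<bullet> w = 0}" using S by blast
      have "P *v kvec k \<noteq> 0" using projection_matrix_kvec[OF P] k(1) by blast
      then show ?thesis unfolding k(2) by (intro negligible_hyperplane) simp
    qed
  qed
  then have "(\<Union>k\<in>{k::int^'n. k \<noteq> 0}. {w. (P *v kvec k) \<bullet> w = 0}) \<noteq> UNIV"
    using non_negligible_UNIV by metis
  then show ?thesis using that by blast
qed

lemma dense_orbit:
  fixes P :: "real^'n^'d"
  assumes P: "projection_matrix P" and e: "e > 0"
  obtains x h where "\<And>j. \<bar>(transpose P *v x) $ j - 2 * pi * of_int (h $ j) - y $ j\<bar> < e"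
proof -
  obtain w where w: "\<And>k. k \<noteq> 0 \<Longrightarrow> (P *v kvec k) \<bullet> w \<noteq> 0" using generic_direction[OF P] by blast
  define \<theta> where "\<theta> j = (transpose P *v w) $ j" for j
  have \<theta>sum: "(\<Sum>j\<in>UNIV. of_int (k $ j) * \<theta> j) = (P *v kvec k) \<bullet> w" for k
  proof -
    have "(P *v kvec k) \<bullet> w = (w v* P) \<bullet> kvec k" by (simp only: inner_commute[of _ w] dot_lmul_matrix)
    then have "(P *v kvec k) \<bullet> w = kvec k \<bullet> (transpose P *v w)"
      by (simp only: transpose_matrix_vector inner_commute[of "kvec k"])
    then show ?thesis by (simp add: inner_vec_def kvec_def \<theta>_def)
  qed
  obtain b :: "nat \<Rightarrow> 'n" where b: "bij_betw b {..<CARD('n)} UNIV"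
    using bij_betw_from_nat_into_finite ex_bij_betw_nat_finite[of "UNIV :: 'n set"] by (auto simp: atLeast0LessThan)
  have inj\<theta>: "inj \<theta>"
  proof (rule injI)
    fix i j assume eq: "\<theta> i = \<theta> j"
    show "i = j"
    proof (rule ccontr)
      assume ij: "i \<noteq> j"
      let ?k = "(\<chi> l. (if l = i then 1 else 0) - (if l = j then 1 else 0)) :: int^'n"
      have "?k $ i \<noteq> 0" using ij by simp
      then have k0: "?k \<noteq> 0" by (metis zero_index)
      have "(\<Sum>l\<in>UNIV. of_int (?k $ l) * \<theta> l)
          = (\<Sum>l\<in>UNIV. (if l = i then \<theta> l else 0) - (if l = j then \<theta> l else 0))"
        by (rule sum.cong) auto
      also have "\<dots> = 0" using eq by (simp add: sum_subtractf)
      finally show False using w[OF k0] \<theta>sum[of ?k] by simp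
    qed
  qed
  define \<theta>' where "\<theta>' i = \<theta> (b i)" for i
  have inj': "inj_on \<theta>' {..<CARD('n)}"
  proof (rule inj_onI)
    fix i j assume ij: "i \<in> {..<CARD('n)}" "j \<in> {..<CARD('n)}" "\<theta>' i = \<theta>' j"
    then have "b i = b j" using injD[OF inj\<theta>] by (simp add: \<theta>'_def)
    then show "i = j" using b ij(1,2) by (meson bij_betw_def inj_onD)
  qed
  interpret Z: module "\<lambda>r x. real_of_int r * x" by unfold_locales (auto simp: algebra_simps)
  have "module.independent (\<lambda>r. (*) (real_of_int r)) (\<theta>' ` {..<CARD('n)})"
  proof
    assume "Z.dependent (\<theta>' ` {..<CARD('n)})"
    then obtain u v where u: "(\<Sum>v\<in>\<theta>' ` {..<CARD('n)}. of_int (u v) * v) = 0"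
      "v \<in> \<theta>' ` {..<CARD('n)}" "u v \<noteq> 0"
      using Z.dependent_finite[of "\<theta>' ` {..<CARD('n)}"] by auto
    have im: "\<theta>' ` {..<CARD('n)} = range \<theta>"
      using b by (auto simp: \<theta>'_def bij_betw_def image_image[symmetric])
    let ?k = "(\<chi> j. u (\<theta> j)) :: int^'n"
    have "(P *v kvec ?k) \<bullet> w = (\<Sum>j\<in>UNIV. of_int (u (\<theta> j)) * \<theta> j)" using \<theta>sum[of ?k] by simp
    also have "\<dots> = (\<Sum>v\<in>range \<theta>. of_int (u v) * v)" by (simp add: sum.reindex[OF inj\<theta>])
    also have "\<dots> = 0" using u(1) im by simp
    finally have "?k = 0" using w by blast
    then have "u (\<theta> j) = 0" for j by (metis vec_lambda_beta zero_index)
    then show False using u(2,3) im by auto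
  qed
  then obtain t h where th: "\<And>i. i < CARD('n) \<Longrightarrow> \<bar>t * \<theta>' i - of_int (h i) - y $ b i / (2 * pi)\<bar> < e / (2 * pi)"
    using Kronecker_thm_1[OF _ inj', of "e / (2 * pi)" "\<lambda>i. y $ b i / (2 * pi)"] e by auto
  define g where "g = inv_into {..<CARD('n)} b"
  have g: "g j < CARD('n)" "b (g j) = j" for j
    using b by (auto simp: g_def bij_betw_def inv_into_into[of j b "{..<CARD('n)}", simplified] f_inv_into_f)
  let ?x = "(2 * pi * t) *\<^sub>R w"
  let ?h = "(\<chi> j. h (g j)) :: int^'n"
  have "\<bar>(transpose P *v ?x) $ j - 2 * pi * of_int (?h $ j) - y $ j\<bar> < e" for j
  proof -
    have "(transpose P *v ?x) $ j - 2 * pi * of_int (?h $ j) - y $ j = 2 * pi * (t * \<theta> j - of_int (h (g j)) - y $ j / (2 * pi))"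
      by (simp add: \<theta>_def matrix_vector_mult_scaleR right_diff_distrib)
    also have "\<bar>\<dots>\<bar> = 2 * pi * \<bar>t * \<theta> j - of_int (h (g j)) - y $ j / (2 * pi)\<bar>" by (simp add: abs_mult)
    also have "\<dots> < 2 * pi * (e / (2 * pi))"
      using th[OF g(1), of j] by (intro mult_strict_left_mono) (auto simp: \<theta>'_def g)
    finally show ?thesis by simp
  qed
  then show ?thesis by (rule that)
qed

lemma elliptic_everywhere:
  fixes P :: "real^'n^'d" and A :: "real^'n \<Rightarrow> real^'d^'d"
  assumes P: "projection_matrix P" and A: "continuous_on UNIV A" "torus_periodic A"
    and ell: "\<And>x. C0 * (norm \<xi>)\<^sup>2 \<le> \<xi> \<bullet> (A (transpose P *v x) *v \<xi>)"
  shows "C0 * (norm \<xi>)\<^sup>2 \<le> \<xi> \<bullet> (A y *v \<xi>)"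
proof -
  have "\<exists>z. norm (z - y) < inverse (real (Suc m)) \<and> C0 * (norm \<xi>)\<^sup>2 \<le> \<xi> \<bullet> (A z *v \<xi>)" for m
  proof -
    let ?e = "inverse (real (Suc m)) / real CARD('n)"
    have "?e > 0" by simp
    then obtain x h where xh: "\<And>j. \<bar>(transpose P *v x) $ j - 2 * pi * of_int (h $ j) - y $ j\<bar> < ?e"
      using dense_orbit[OF P, of ?e y] by blast
    let ?z = "transpose P *v x + (2 * pi) *\<^sub>R kvec (- h)"
    have "norm (?z - y) \<le> (\<Sum>j\<in>UNIV. \<bar>(?z - y) $ j\<bar>)" by (rule norm_le_l1_cart)
    also have "\<dots> < (\<Sum>j\<in>(UNIV::'n set). ?e)"
      using xh by (intro sum_strict_mono) (auto simp: kvec_def)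
    finally have "norm (?z - y) < inverse (real (Suc m))" by simp
    moreover have "A ?z = A (transpose P *v x)" by (rule torus_periodic_int[OF A(2)])
    ultimately show ?thesis using ell[of x] by (intro exI[of _ ?z]) simp
  qed
  then obtain z where z: "\<And>m. norm (z m - y) < inverse (real (Suc m))" "\<And>m. C0 * (norm \<xi>)\<^sup>2 \<le> \<xi> \<bullet> (A (z m) *v \<xi>)"
    by metis
  have "(\<lambda>m. z m - y) \<longlonglongrightarrow> 0"
    by (rule Lim_null_comparison[OF _ LIMSEQ_inverse_real_of_nat])
       (rule always_eventually, rule allI, rule less_imp_le[OF z(1)])
  then have "z \<longlonglongrightarrow> y" by (simp add: LIM_zero_iff)
  moreover have "continuous_on UNIV (\<lambda>y. \<xi> \<bullet> (A y *v \<xi>))"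
    unfolding inner_vec_def matrix_vector_mult_def vec_lambda_beta inner_real_def
    by (intro continuous_on_sum continuous_on_mult continuous_on_const continuous_on_component A(1))
  ultimately have "(\<lambda>m. \<xi> \<bullet> (A (z m) *v \<xi>)) \<longlonglongrightarrow> \<xi> \<bullet> (A y *v \<xi>)"
    by (auto simp: continuous_on_eq_continuous_at continuous_at_sequentially o_def)
  then show ?thesis by (rule LIMSEQ_le_const) (use z(2) in auto)
qed

section \<open>Rank deficiency excludes isolated eigenvalues of finite multiplicity\<close>

context sa_operator
begin

text \<open>With \<open>d = T x - \<gamma> x\<close>, the resolvent satisfies \<open>R z x = (x + R z d) / (z - \<gamma>)\<close>. The first term
  integrates to \<open>x\<close>, and the second one is of the size of \<open>d\<close>.\<close>

lemma Riesz_projection_approx: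
  assumes r: "r > 0" and m: "m > 0" "\<And>z x. z \<in> sphere \<gamma> r \<Longrightarrow> x \<in> V \<Longrightarrow> m * nrm x \<le> nrm (z \<odot> x - T x)"
    and E_V: "\<And>x. x \<in> V \<Longrightarrow> E x \<in> V"
    and E_form: "\<And>x v. x \<in> V \<Longrightarrow> v \<in> V \<Longrightarrow>
      a (E x) v = contour_integral (circlepath \<gamma> r) (\<lambda>z. a (R z x) v) / (2 * of_real pi * \<i>)"
    and x: "x \<in> V"
  shows "nrm (E x - x) \<le> nrm (T x - \<gamma> \<odot> x) / m"
proof -
  define d where "d = T x - \<gamma> \<odot> x"
  have d: "d \<in> V" using x by (simp add: d_def)
  have reg: "reg z" if "z \<in> sphere \<gamma> r" for z using m that unfolding reg_def by blast
  define v where "v = E x - x"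
  have v: "v \<in> V" using x E_V by (simp add: v_def)
  have form: "a (R z x) v = a x v / (z - \<gamma>) + a (R z d) v / (z - \<gamma>)" if z: "z \<in> sphere \<gamma> r" for z
  proof -
    have z0: "z - \<gamma> \<noteq> 0" using z r by auto
    have "R z ((z - \<gamma>) \<odot> x) = R z ((z \<odot> x - T x) + d)"
      by (simp add: d_def scale_left_diff_distrib)
    also have "\<dots> = x + R z d"
      using R_unique[OF reg[OF z] x refl] x d reg[OF z] by (simp add: R_add)
    finally have "(z - \<gamma>) \<odot> R z x = x + R z d" using R_scale[OF reg[OF z] x] by simp
    then have "a ((z - \<gamma>) \<odot> R z x) v = a (x + R z d) v" by simp
    then have "(z - \<gamma>) * a (R z x) v = a x v + a (R z d) v"
      using x d v reg[OF z] by (simp add: a_scale_left a_add_left)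
    then have "a (R z x) v = (a x v + a (R z d) v) / (z - \<gamma>)" using z0 by (simp add: field_simps)
    then show ?thesis by (simp add: add_divide_distrib)
  qed
  have i1: "((\<lambda>z. a x v / (z - \<gamma>)) has_contour_integral (2 * of_real pi * \<i> * a x v)) (circlepath \<gamma> r)"
    using contour_integral_circlepath_inverse[of r \<gamma> \<gamma> "a x v"] r by simp
  have "(\<lambda>z. a (R z x) v) contour_integrable_on circlepath \<gamma> r"
    by (rule contour_integrable_holomorphic_simple[OF form_R_holomorphic[OF x v] open_reg])
       (use r reg in auto)
  then have i2: "((\<lambda>z. a (R z x) v) has_contour_integral (2 * of_real pi * \<i> * a (E x) v)) (circlepath \<gamma> r)"
    using E_form[OF x v] by (simp add: has_contour_integral_integral)
  have "((\<lambda>z. a (R z x) v - a x v / (z - \<gamma>)) has_contour_integral (2 * of_real pi * \<i> * a (E x) v - 2 * of_real pi * \<i> * a x v)) (circlepath \<gamma> r)"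
    by (rule has_contour_integral_diff[OF i2 i1])
  then have "cmod (2 * of_real pi * \<i> * a (E x) v - 2 * of_real pi * \<i> * a x v) \<le> (nrm d / m * nrm v / r) * (2 * pi * r)"
  proof (rule has_contour_integral_bound_circlepath)
    fix z assume "cmod (z - \<gamma>) = r"
    then have z: "z \<in> sphere \<gamma> r" by (simp add: dist_norm norm_minus_commute)
    have "cmod (a (R z d) v) \<le> nrm (R z d) * nrm v" using d v reg[OF z] by (intro Cauchy_Schwarz) auto
    also have "\<dots> \<le> nrm d / m * nrm v" using m z d v by (intro mult_right_mono R_bound) auto
    finally show "cmod (a (R z x) v - a x v / (z - \<gamma>)) \<le> nrm d / m * nrm v / r"
      unfolding form[OF z] add_diff_cancel_left' norm_divide \<open>cmod (z - \<gamma>) = r\<close>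
      using r by (intro divide_right_mono) auto
  qed (use r m d v in auto)
  also have "2 * of_real pi * \<i> * a (E x) v - 2 * of_real pi * \<i> * a x v = 2 * of_real pi * \<i> * a v v"
  proof -
    have "a v v = a (E x) v - a x v" using a_diff_left[OF E_V[OF x] x v] by (simp only: v_def[symmetric])
    then show ?thesis by (simp only: right_diff_distrib)
  qed
  also have "cmod \<dots> = 2 * pi * (nrm v)\<^sup>2" by (simp add: norm_mult a_self[OF v] norm_power v)
  finally have "2 * pi * (nrm v)\<^sup>2 \<le> (nrm d / m * nrm v / r) * (2 * pi * r)" .
  also have "\<dots> = 2 * pi * (nrm d / m * nrm v)" using r by simp
  finally have "(nrm v)\<^sup>2 \<le> nrm d / m * nrm v"
    by (rule mult_left_le_imp_le) simp
  then have "nrm v * nrm v \<le> (nrm d / m) * nrm v" by (simp only: power2_eq_square)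
  then have "nrm v \<le> nrm d / m" if "nrm v > 0" using that by (rule mult_right_le_imp_le)
  moreover have "0 \<le> nrm d / m" using m(1) nrm_nonneg[OF d] by simp
  ultimately have "nrm v \<le> nrm d / m" using nrm_nonneg[OF v] by linarith
  then show ?thesis by (simp only: v_def d_def)
qed

end

text \<open>A vector \<open>v\<close> in the kernel of \<open>P\<close> has large multiples that are close to integer vectors, by
  Dirichlet's simultaneous approximation theorem. Rescaling \<open>v\<close> beforehand makes the component
  \<open>j0\<close> grow.\<close>

lemma small_frequencies:
  fixes P :: "real^'n^'d"
  assumes "CARD('d) < CARD('n)" "rank P = CARD('d)"
  obtains k :: "nat \<Rightarrow> int^'n" and j0 where "\<And>m::nat. \<bar>k m $ j0\<bar> \<ge> int m" "(\<lambda>m. P *v kvec (k m)) \<longlonglongrightarrow> 0"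
proof -
  have "\<not> inj ((*v) P)" using assms full_rank_injective[of P] by auto
  then obtain v where v: "P *v v = 0" "v \<noteq> 0"
    by (metis (no_types, lifting) injI matrix_vector_mult_diff_distrib right_minus_eq)
  obtain j0 where j0: "v $ j0 \<noteq> 0" using v(2) by (auto simp: vec_eq_iff)
  obtain b :: "nat \<Rightarrow> 'n" where b: "bij_betw b {..<CARD('n)} UNIV"
    using ex_bij_betw_nat_finite[of "UNIV :: 'n set"] by (auto simp: atLeast0LessThan)
  define g where "g = inv_into {..<CARD('n)} b"
  have g: "g j < CARD('n)" "b (g j) = j" for j
    using b by (auto simp: g_def bij_betw_def inv_into_into[of j b "{..<CARD('n)}", simplified] f_inv_into_f)
  obtain D where D: "\<And>x. norm (P *v x) \<le> norm x * D"
    using bounded_linear.bounded[OF matrix_vector_mul_bounded_linear[of P]] by blast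
  have "\<exists>k::int^'n. \<bar>k $ j0\<bar> \<ge> int m \<and> norm (P *v kvec k) \<le> \<bar>D\<bar> * real CARD('n) * inverse (real (Suc m))" for m
  proof -
    define v' where "v' = (real (Suc m) / v $ j0) *\<^sub>R v"
    have v'0: "v' $ j0 = real (Suc m)" using j0 by (simp add: v'_def)
    have Pv': "P *v v' = 0" using v(1) by (simp add: v'_def matrix_vector_mult_scaleR)
    obtain q p where q: "0 < q" "\<And>i. i < CARD('n) \<Longrightarrow> \<bar>of_int q * v' $ b i - of_int (p i)\<bar> < 1 / real (Suc m)"
      using Dirichlet_approx_simult[of "Suc m" "CARD('n)" "\<lambda>i. v' $ b i"] by (metis zero_less_Suc)
    define k where "k = ((\<chi> j. p (g j)) :: int^'n)"
    have close: "\<bar>of_int q * v' $ j - of_int (k $ j)\<bar> < 1 / real (Suc m)" for j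
      using q(2)[OF g(1), of j] by (simp add: k_def g)
    have "\<bar>k $ j0\<bar> \<ge> int m"
    proof -
      define R where "R = real (Suc m)"
      have "1 / R \<le> 1" by (simp add: R_def)
      then have "of_int q * R - 1 < of_int (k $ j0)" using close[of j0] unfolding v'0 R_def[symmetric] by linarith
      moreover have "1 * R \<le> of_int q * R" using q(1) by (intro mult_right_mono) (auto simp: R_def)
      moreover have "R = real m + 1" by (simp add: R_def)
      ultimately have "real m < of_int (k $ j0)" by linarith
      then show ?thesis by linarith
    qed
    moreover have "norm (P *v kvec k) \<le> \<bar>D\<bar> * real CARD('n) * inverse (real (Suc m))"
    proof -
      let ?d = "kvec k - of_int q *\<^sub>R v'"
      have "P *v kvec k = P *v ?d" using Pv' by (simp add: matrix_vector_mult_diff_distrib matrix_vector_mult_scaleR)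
      then have "norm (P *v kvec k) \<le> norm ?d * D" using D[of ?d] by simp
      also have "\<dots> \<le> norm ?d * \<bar>D\<bar>" by (intro mult_left_mono) auto
      also have "norm ?d \<le> (\<Sum>j\<in>UNIV. \<bar>?d $ j\<bar>)" by (rule norm_le_l1_cart)
      also have "\<dots> \<le> (\<Sum>j\<in>(UNIV::'n set). 1 / real (Suc m))"
        using close by (intro sum_mono) (simp add: kvec_def abs_minus_commute less_imp_le)
      finally show ?thesis by (simp add: mult_right_mono field_simps)
    qed
    ultimately show ?thesis by blast
  qed
  then obtain k :: "nat \<Rightarrow> int^'n" where k: "\<And>m. \<bar>k m $ j0\<bar> \<ge> int m"
    "\<And>m. norm (P *v kvec (k m)) \<le> \<bar>D\<bar> * real CARD('n) * inverse (real (Suc m))" by metis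
  have "(\<lambda>m. \<bar>D\<bar> * real CARD('n) * inverse (real (Suc m))) \<longlonglongrightarrow> 0"
    by (rule tendsto_mult_right_zero[OF LIMSEQ_inverse_real_of_nat])
  then have "(\<lambda>m. P *v kvec (k m)) \<longlonglongrightarrow> 0"
    by (rule Lim_null_comparison[rotated]) (use k(2) in auto)
  then show ?thesis using that k(1) by blast
qed

text \<open>Characters of growing frequency tend weakly to zero (Riemann--Lebesgue).\<close>

lemma modulation_weakly_null:
  fixes U W :: "('n::finite) torus_l2" and k :: "nat \<Rightarrow> int^'n"
  assumes k: "\<And>m. \<bar>k m $ j0\<bar> \<ge> int m"
  shows "(\<lambda>m. cinner (mulop (chi (k m)) U) W) \<longlonglongrightarrow> 0"
proof -
  have iso: "norm (mulop (chi l) X) \<le> norm X" for l and X :: "'n torus_l2"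
    using norm_mulop_le[OF cper_chi, of 1 l X] by simp
  have coeff: "(\<lambda>m. fc W (k m + l)) \<longlonglongrightarrow> 0" for l
  proof (rule LIMSEQ_I)
    fix e :: real assume "e > 0"
    then obtain n where n: "norm (fsum (cube n) W - W) < e"
      using fsum_cube_tendsto[of W] by (metis LIMSEQ_iff order_refl)
    have "norm (fc W (k m + l) - 0) < e" if m: "m \<ge> n + nat \<bar>l $ j0\<bar> + 1" for m
    proof -
      have "\<bar>(k m + l) $ j0\<bar> \<ge> \<bar>k m $ j0\<bar> - \<bar>l $ j0\<bar>" by simp
      then have "\<not> \<bar>(k m + l) $ j0\<bar> \<le> int n" using k[of m] m by linarith
      then have "k m + l \<notin> cube n" unfolding cube_def by blast
      then have "fc W (k m + l) = fc (W - fsum (cube n) W) (k m + l)" by (simp add: fc_simps fc_fsum finite_cube)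
      then have "cmod (fc W (k m + l)) \<le> norm (W - fsum (cube n) W)" using cmod_fc_le by metis
      then show ?thesis using n by (simp add: norm_minus_commute)
    qed
    then show "\<exists>no. \<forall>m\<ge>no. norm (fc W (k m + l) - 0) < e" by blast
  qed
  have fin: "(\<lambda>m. cinner (mulop (chi (k m)) (fsum J U)) W) \<longlonglongrightarrow> 0" if "finite J" for J
  proof -
    have "cinner (mulop (chi (k m)) (fsum J U)) W = (\<Sum>l\<in>J. fc U l * cnj (fc W (k m + l)))" for m
      using that unfolding fsum_def
    proof (induction J rule: finite_induct)
      case empty
      show ?case using mulop_scaleC[OF cper_chi, of "k m" 0 0] by simp
    next
      case (insert l J)
      then show ?case
        by (simp add: mulop_add[OF cper_chi] mulop_scaleC[OF cper_chi] mulop_chi_expo cinner_simps)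
           (simp add: fc_def cinner_commute[of W])
    qed
    moreover have "(\<lambda>m. \<Sum>l\<in>J. fc U l * cnj (fc W (k m + l))) \<longlonglongrightarrow> (\<Sum>l\<in>J. fc U l * cnj 0)"
      by (intro tendsto_intros coeff)
    ultimately show ?thesis by simp
  qed
  show ?thesis
  proof (rule LIMSEQ_I)
    fix e :: real assume e: "e > 0"
    have nW: "norm W + 1 > 0" by (rule add_nonneg_pos) auto
    have "e / (2 * (norm W + 1)) > 0" using e nW by simp
    then obtain n where n: "norm (fsum (cube n) U - U) < e / (2 * (norm W + 1))"
      using fsum_cube_tendsto[of U] by (metis LIMSEQ_iff order_refl)
    obtain M where M: "\<And>m. m \<ge> M \<Longrightarrow> cmod (cinner (mulop (chi (k m)) (fsum (cube n) U)) W) < e / 2"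
      using LIMSEQ_D[OF fin[OF finite_cube], of "e/2" n] e by auto
    have "norm (cinner (mulop (chi (k m)) U) W - 0) < e" if "m \<ge> M" for m
    proof -
      have "U = (U - fsum (cube n) U) + fsum (cube n) U" by simp
      then have eq: "cinner (mulop (chi (k m)) U) W
          = cinner (mulop (chi (k m)) (U - fsum (cube n) U)) W + cinner (mulop (chi (k m)) (fsum (cube n) U)) W"
        by (metis mulop_add[OF cper_chi] cinner_add_left)
      have "cmod (cinner (mulop (chi (k m)) (U - fsum (cube n) U)) W) \<le> norm (U - fsum (cube n) U) * norm W"
        by (rule order_trans[OF cmod_cinner_le mult_right_mono[OF iso]]) simp
      also have "\<dots> \<le> e / (2 * (norm W + 1)) * (norm W + 1)"
        using n e nW by (intro mult_mono) (auto simp: norm_minus_commute intro: less_imp_le)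
      also have "\<dots> = e / 2"
      proof -
        have "e / (2 * q) * q = e / 2" if "q > 0" for q :: real using that by simp
        from this[OF nW] show ?thesis .
      qed
      finally show ?thesis
        using M[OF that] norm_triangle_ineq[of "cinner (mulop (chi (k m)) (U - fsum (cube n) U)) W" "cinner (mulop (chi (k m)) (fsum (cube n) U)) W"]
        unfolding eq diff_zero by linarith
    qed
    then show "\<exists>no. \<forall>m\<ge>no. norm (cinner (mulop (chi (k m)) U) W - 0) < e" by blast
  qed
qed

context elliptic_form
begin

lemma modulation_Pgrad:
  assumes "U \<in> HP1 P"
  shows "mulop (chi k) U \<in> HP1 P"
    and "Pgrad P (mulop (chi k) U) = (\<chi> i. mulop (chi k) (Pgrad P U $ i + (\<i> * of_real (freq k (P $ i))) *\<^sub>C U))"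
proof -
  have "has_weak_Pgrad P (mulop (chi k) U) (\<chi> i. mulop (chi k) (Pgrad P U $ i + (\<i> * of_real (freq k (P $ i))) *\<^sub>C U))"
    unfolding has_weak_Pgrad_def vec_lambda_beta
    by (intro allI weak_deriv_modulate weak_deriv_Pgrad assms)
  then show "mulop (chi k) U \<in> HP1 P"
    "Pgrad P (mulop (chi k) U) = (\<chi> i. mulop (chi k) (Pgrad P U $ i + (\<i> * of_real (freq k (P $ i))) *\<^sub>C U))"
    by (rule HP1I, rule Pgrad_eqI)
qed

lemma bform_modulate: "bform (\<chi> i. mulop (chi k) (G $ i)) H = bform G (\<chi> i. mulop (chi (- k)) (H $ i))"
proof -
  have "cinner (mulop (coeffA i j) (mulop (chi k) (G $ j))) (H $ i)
      = cinner (mulop (coeffA i j) (G $ j)) (mulop (chi (- k)) (H $ i))" for i j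
  proof -
    have "mulop (coeffA i j) (mulop (chi k) (G $ j)) = mulop (chi k) (mulop (coeffA i j) (G $ j))"
      by (simp add: mulop_mulop[OF cper_coeff cper_chi] mulop_mulop[OF cper_chi cper_coeff] mult.commute)
    then show ?thesis by (simp add: mulop_adjoint[OF cper_chi] cnj_chi[abs_def])
  qed
  then show ?thesis by (simp add: bform_def)
qed

lemma bform_add_right: "bform G (H + H') = bform G H + bform G H'"
  unfolding bform_def vector_add_component L2.a_add_right[OF UNIV_I UNIV_I UNIV_I] sum.distrib ..

text \<open>Modulation by a character commutes with the form up to an error of the size of the
  directional frequency \<open>P k\<close>.\<close>

lemma modulation_form:
  obtains C where "C \<ge> 0" "\<And>U W k. U \<in> HP1 P \<Longrightarrow> W \<in> HP1 P \<Longrightarrow>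
    cmod (aform P A (mulop (chi k) U) W - aform P A U (mulop (chi (- k)) W))
      \<le> C * norm (P *v kvec k) * V.nrm U * V.nrm W"
proof -
  obtain B where B: "B \<ge> 0" "\<And>G H. cmod (bform G H) \<le> B * norm G * norm H" using bform_bound by blast
  obtain c1 c2 where c: "c1 > 0" "c2 > 0" "\<And>U. U \<in> HP1 P \<Longrightarrow> c1 * normV P U \<le> V.nrm U"
    "\<And>U. U \<in> HP1 P \<Longrightarrow> V.nrm U \<le> c2 * normV P U" by (rule norm_equiv) blast
  have n1: "norm U \<le> V.nrm U / c1" and n2: "norm (Pgrad P U) \<le> V.nrm U / c1" if "U \<in> HP1 P" for U
  proof -
    have "normV P U \<le> V.nrm U / c1" using c(3)[OF that] c(1) by (simp add: field_simps)
    moreover have "norm U \<le> normV P U" "norm (Pgrad P U) \<le> normV P U"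
      using norm_fst_le[of U "Pgrad P U"] norm_snd_le[of "Pgrad P U" U] by (simp_all add: normV_eq_norm)
    ultimately show "norm U \<le> V.nrm U / c1" "norm (Pgrad P U) \<le> V.nrm U / c1" by linarith+
  qed
  have iso: "norm (mulop (chi l) X) \<le> norm X" for l and X :: "'n torus_l2"
    using norm_mulop_le[OF cper_chi, of 1 l X] by simp
  have isov: "norm (\<chi> i. mulop (chi l) (G $ i)) \<le> norm G" for l and G :: "'n torus_l2^'d"
    unfolding norm_vec_def by (rule L2_set_mono) (auto intro: iso)
  have twist: "norm (\<chi> i. (\<i> * of_real (freq k (P $ i))) *\<^sub>C X) = norm (P *v kvec k) * norm X" for k and X :: "'n torus_l2"
  proof -
    have "(norm (\<chi> i. (\<i> * of_real (freq k (P $ i))) *\<^sub>C X))\<^sup>2 = (\<Sum>i\<in>UNIV. (freq k (P $ i))\<^sup>2 * (norm X)\<^sup>2)"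
      by (simp add: norm_vec_def L2_set_def sum_nonneg norm_scaleC norm_mult power_mult_distrib)
    also have "\<dots> = (norm (P *v kvec k) * norm X)\<^sup>2"
      by (simp add: sum_distrib_right[symmetric] sum_freq_sq power_mult_distrib)
    finally show ?thesis by (simp add: power2_eq_iff_nonneg)
  qed
  have "cmod (aform P A (mulop (chi k) U) W - aform P A U (mulop (chi (- k)) W))
      \<le> (2 * B / c1\<^sup>2) * norm (P *v kvec k) * V.nrm U * V.nrm W" if U: "U \<in> HP1 P" and W: "W \<in> HP1 P" for U W k
  proof -
    let ?\<theta> = "\<lambda>k X. (\<chi> i. (\<i> * of_real (freq k (P $ i))) *\<^sub>C X) :: 'n torus_l2^'d"
    let ?M = "\<lambda>k G. (\<chi> i. mulop (chi k) (G $ i)) :: 'n torus_l2^'d"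
    have "bform (Pgrad P (mulop (chi k) U)) (Pgrad P W) = bform (?M k (Pgrad P U + ?\<theta> k U)) (Pgrad P W)"
      by (simp add: modulation_Pgrad(2)[OF U])
    also have "\<dots> = bform (Pgrad P U) (?M (- k) (Pgrad P W)) + bform (?\<theta> k U) (?M (- k) (Pgrad P W))"
      unfolding bform_modulate bform_add_left ..
    finally have 1: "bform (Pgrad P (mulop (chi k) U)) (Pgrad P W)
      = bform (Pgrad P U) (?M (- k) (Pgrad P W)) + bform (?\<theta> k U) (?M (- k) (Pgrad P W))" .
    have "Pgrad P (mulop (chi (- k)) W) = ?M (- k) (Pgrad P W) + ?M (- k) (?\<theta> (- k) W)"
      by (simp add: modulation_Pgrad(2)[OF W] vec_eq_iff mulop_add[OF cper_chi])
    then have 2: "bform (Pgrad P U) (Pgrad P (mulop (chi (- k)) W))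
      = bform (Pgrad P U) (?M (- k) (Pgrad P W)) + bform (Pgrad P U) (?M (- k) (?\<theta> (- k) W))"
      by (simp add: bform_add_right)
    have 3: "cinner (mulop (chi k) U) W = cinner U (mulop (chi (- k)) W)"
      by (simp add: mulop_adjoint[OF cper_chi] cnj_chi[abs_def])
    have km: "norm (P *v kvec (- k)) = norm (P *v kvec k)"
    proof -
      have "kvec (- k) = - kvec k" by (simp add: kvec_def vec_eq_iff)
      then have "P *v kvec (- k) = - (P *v kvec k)" by (simp add: linear_neg[OF matrix_vector_mul_linear])
      then show ?thesis by simp
    qed
    have b1: "cmod (bform (?\<theta> k U) (?M (- k) (Pgrad P W))) \<le> B * (norm (P *v kvec k) * (V.nrm U / c1)) * (V.nrm W / c1)"
    proof -
      have "cmod (bform (?\<theta> k U) (?M (- k) (Pgrad P W))) \<le> B * norm (?\<theta> k U) * norm (?M (- k) (Pgrad P W))" by (rule B(2))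
      also have "\<dots> \<le> B * (norm (P *v kvec k) * (V.nrm U / c1)) * (V.nrm W / c1)"
        unfolding twist using B(1) c(1) n1[OF U] order_trans[OF isov n2[OF W]] V.nrm_nonneg[OF U]
        by (intro mult_mono mult_left_mono) auto
      finally show ?thesis .
    qed
    have b2: "cmod (bform (Pgrad P U) (?M (- k) (?\<theta> (- k) W))) \<le> B * (V.nrm U / c1) * (norm (P *v kvec k) * (V.nrm W / c1))"
    proof -
      have "cmod (bform (Pgrad P U) (?M (- k) (?\<theta> (- k) W))) \<le> B * norm (Pgrad P U) * norm (?M (- k) (?\<theta> (- k) W))" by (rule B(2))
      also have "\<dots> \<le> B * (V.nrm U / c1) * (norm (P *v kvec k) * (V.nrm W / c1))"
      proof (intro mult_mono mult_left_mono)
        have "norm (?M (- k) (?\<theta> (- k) W)) \<le> norm (?\<theta> (- k) W)" by (rule isov)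
        also have "\<dots> = norm (P *v kvec k) * norm W" by (simp only: twist km)
        also have "\<dots> \<le> norm (P *v kvec k) * (V.nrm W / c1)" by (intro mult_left_mono n1 W) auto
        finally show "norm (?M (- k) (?\<theta> (- k) W)) \<le> norm (P *v kvec k) * (V.nrm W / c1)" .
      qed (use B(1) c(1) n2[OF U] V.nrm_nonneg[OF U] in auto)
      finally show ?thesis .
    qed
    have eq: "aform P A (mulop (chi k) U) W - aform P A U (mulop (chi (- k)) W)
        = bform (?\<theta> k U) (?M (- k) (Pgrad P W)) - bform (Pgrad P U) (?M (- k) (?\<theta> (- k) W))"
      unfolding aform_bform 1 2 3 by simp
    have "cmod (aform P A (mulop (chi k) U) W - aform P A U (mulop (chi (- k)) W))
        \<le> B * (norm (P *v kvec k) * (V.nrm U / c1)) * (V.nrm W / c1) + B * (V.nrm U / c1) * (norm (P *v kvec k) * (V.nrm W / c1))"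
      unfolding eq by (rule order_trans[OF norm_triangle_ineq4 add_mono[OF b1 b2]])
    also have "\<dots> = (2 * B / c1\<^sup>2) * norm (P *v kvec k) * V.nrm U * V.nrm W"
      by (simp add: power2_eq_square mult_ac)
    finally show ?thesis .
  qed
  then show ?thesis using that[of "2 * B / c1\<^sup>2"] B(1) c(1) by auto
qed

text \<open>The equation \<open>a (\<gamma> U) y = (U, y)\<close> is tested with the residual, modulated backwards. Moving the
  modulation over to \<open>U\<close> costs the error of \<open>modulation_form\<close>.\<close>

lemma modulated_eigenvector:
  assumes U: "U \<in> HP1 P" "solution_op P A U = \<gamma> *\<^sub>C U"
  obtains C where "\<And>k. V.nrm (solution_op P A (mulop (chi k) U) - \<gamma> *\<^sub>C mulop (chi k) U) \<le> C * norm (P *v kvec k)"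
proof -
  obtain C where C: "C \<ge> 0" "\<And>U W k. U \<in> HP1 P \<Longrightarrow> W \<in> HP1 P \<Longrightarrow>
    cmod (aform P A (mulop (chi k) U) W - aform P A U (mulop (chi (- k)) W))
      \<le> C * norm (P *v kvec k) * V.nrm U * V.nrm W" using modulation_form by blast
  have "V.nrm (solution_op P A (mulop (chi k) U) - \<gamma> *\<^sub>C mulop (chi k) U)
      \<le> (cmod \<gamma> * C * V.nrm U) * norm (P *v kvec k)" for k
  proof -
    let ?x = "mulop (chi k) U"
    let ?w = "solution_op P A ?x - \<gamma> *\<^sub>C ?x"
    have x: "?x \<in> HP1 P" by (rule modulation_Pgrad(1)[OF U(1)])
    have w: "?w \<in> HP1 P" by (intro HP1_diff HP1_scaleC x solution_op_V)
    let ?y = "mulop (chi (- k)) ?w"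
    have y: "?y \<in> HP1 P" by (rule modulation_Pgrad(1)[OF w])
    have "cinner ?x ?w = cinner U ?y" by (simp add: mulop_adjoint[OF cper_chi] cnj_chi[abs_def])
    also have "\<dots> = aform P A (\<gamma> *\<^sub>C U) ?y" unfolding U(2)[symmetric] by (rule solution_op_form[OF y, symmetric])
    finally have "aform P A (solution_op P A ?x) ?w = \<gamma> * aform P A U ?y"
      using solution_op_form[OF w, of ?x] aform_scaleC_left[OF U(1)] by simp
    then have "aform P A ?w ?w = - \<gamma> * (aform P A ?x ?w - aform P A U ?y)"
      using V.a_diff_left[OF solution_op_V HP1_scaleC[OF x] w, of ?x \<gamma>] aform_scaleC_left[OF x]
      by (simp add: right_diff_distrib)
    then have "cmod (aform P A ?w ?w) = cmod \<gamma> * cmod (aform P A ?x ?w - aform P A U ?y)" by (simp add: norm_mult)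
    moreover have "cmod (aform P A ?w ?w) = (V.nrm ?w)\<^sup>2" using V.a_self[OF w] by (simp add: norm_power V.nrm_nonneg[OF w])
    ultimately have "(V.nrm ?w)\<^sup>2 \<le> cmod \<gamma> * (C * norm (P *v kvec k) * V.nrm U * V.nrm ?w)"
      using C(2)[OF U(1) w, of k] by (simp add: mult_left_mono)
    then have sq: "V.nrm ?w * V.nrm ?w \<le> (cmod \<gamma> * C * V.nrm U * norm (P *v kvec k)) * V.nrm ?w"
      by (simp add: power2_eq_square mult_ac)
    then have "V.nrm ?w \<le> cmod \<gamma> * C * V.nrm U * norm (P *v kvec k)" if "V.nrm ?w > 0"
      using that by (rule mult_right_le_imp_le)
    moreover have "0 \<le> cmod \<gamma> * C * V.nrm U * norm (P *v kvec k)"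
      using C(1) V.nrm_nonneg[OF U(1)] by simp
    ultimately show ?thesis using V.nrm_nonneg[OF w] by linarith
  qed
  then show ?thesis by (rule that)
qed

text \<open>If \<open>P\<close> is not square, there are characters of arbitrarily high frequency with arbitrarily small
  \<open>P k\<close>. Modulating an eigenvector by them produces approximate eigenvectors that tend weakly
  to zero, whereas their images under the Riesz projection stay in the finite-dimensional
  eigenspace, at vanishing distance: a contradiction.\<close>

lemma isolated_eigenvalue_imp_square:
  assumes rank: "CARD('d) \<le> CARD('n)" "rank P = CARD('d)"
    and real: "Im \<gamma> = 0" and r: "r > 0"
    and reg: "\<And>z. z \<in> cball \<gamma> r \<Longrightarrow> z \<noteq> \<gamma> \<Longrightarrow> sa_operator.reg scaleC (HP1 P) (aform P A) (solution_op P A) z"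
    and U: "U \<in> HP1 P" "U \<noteq> 0" "solution_op P A U = \<gamma> *\<^sub>C U"
    and fin: "finite B" "{U \<in> HP1 P. solution_op P A U = \<gamma> *\<^sub>C U} \<subseteq> cspan B"
  shows "CARD('d) = CARD('n)"
proof (rule ccontr)
  assume "CARD('d) \<noteq> CARD('n)"
  then have "CARD('d) < CARD('n)" using rank(1) by simp
  then obtain k :: "nat \<Rightarrow> int^'n" and j0 where k: "\<And>m. \<bar>k m $ j0\<bar> \<ge> int m" "(\<lambda>m. P *v kvec (k m)) \<longlonglongrightarrow> 0"
    using small_frequencies rank(2) by blast
  let ?K = "solution_op P A"
  note K = sa_operator_solution_op
  interpret K: sa_operator scaleC "HP1 P" "aform P A" ?K 1
    rewrites "module.span scaleC = cspan" by (rule K) (simp add: cspan_def)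
  define E where "E = spectral_proj P ?K \<gamma> r"
  have regS: "K.reg z" if "z \<in> sphere \<gamma> r" for z using that r by (intro reg) auto
  have E_V: "E X \<in> HP1 P" if "X \<in> HP1 P" for X unfolding E_def by (rule spectral_proj_form(1)[OF K r regS that])
  have E_form: "aform P A (E X) W = contour_integral (circlepath \<gamma> r) (\<lambda>z. aform P A (K.R z X) W) / (2 * of_real pi * \<i>)"
    if "X \<in> HP1 P" "W \<in> HP1 P" for X W unfolding E_def by (rule spectral_proj_form(2)[OF K r regS that(1)])
  obtain m where m: "m > 0" "\<And>z x. z \<in> sphere \<gamma> r \<Longrightarrow> x \<in> HP1 P \<Longrightarrow> m * V.nrm x \<le> V.nrm (z *\<^sub>C x - ?K x)"
    using K.uniform_lower_bound[OF compact_sphere regS] by blast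
  define x where "x n = mulop (chi (k n)) U" for n
  have x: "x n \<in> HP1 P" for n unfolding x_def by (rule modulation_Pgrad(1)[OF U(1)])
  obtain C where C: "\<And>l. V.nrm (?K (mulop (chi l) U) - \<gamma> *\<^sub>C mulop (chi l) U) \<le> C * norm (P *v kvec l)"
    using modulated_eigenvector[OF U(1,3)] by blast
  have close: "norm (E (x n) - x n) \<le> C / m * norm (P *v kvec (k n))" for n
  proof -
    have "norm (E (x n) - x n) \<le> V.nrm (E (x n) - x n)" by (rule norm_le_nrm[OF HP1_diff[OF E_V[OF x] x]])
    also have "\<dots> \<le> V.nrm (?K (x n) - \<gamma> *\<^sub>C x n) / m"
      by (rule K.Riesz_projection_approx[OF r m E_V E_form x])
    also have "\<dots> \<le> (C * norm (P *v kvec (k n))) / m"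
      using m(1) C[of "k n"] by (intro divide_right_mono) (auto simp: x_def)
    finally show ?thesis by simp
  qed
  have lim0: "(\<lambda>n. E (x n) - x n) \<longlonglongrightarrow> 0"
  proof (rule Lim_null_comparison)
    show "\<forall>\<^sub>F n in sequentially. norm (E (x n) - x n) \<le> C / m * norm (P *v kvec (k n))"
      by (rule always_eventually) (use close in blast)
    show "(\<lambda>n. C / m * norm (P *v kvec (k n))) \<longlonglongrightarrow> 0"
      by (intro tendsto_mult_right_zero tendsto_norm_zero k(2))
  qed
  define M where "M = {U \<in> HP1 P. ?K U = \<gamma> *\<^sub>C U}"
  have Msub: "cvec.subspace M"
    unfolding M_def cvec.subspace_def
    using cvec.subspace_0[OF subspace_HP1] solution_op_scaleC[of 0 0]
    by (auto simp: HP1_add HP1_scaleC solution_op_add solution_op_scaleC cvec.scale_right_distrib mult.commute)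
  have EM: "E (x n) \<in> M" for n
    using K.Riesz_projection_range[OF real r reg E_V E_form x] E_V[OF x] by (simp add: M_def)
  obtain S where S: "finite S" "L2.orthonormal S" "\<forall>X\<in>M. X = (\<Sum>e\<in>S. cinner X e *\<^sub>C e)"
    using L2.orthonormal_basis_exists[OF Msub subset_UNIV _ fin(1)] fin(2) unfolding M_def by blast
  have "(\<lambda>n. cinner (E (x n)) e) \<longlonglongrightarrow> 0" for e
  proof -
    have "(\<lambda>n. cinner (E (x n) - x n) e + cinner (x n) e) \<longlonglongrightarrow> cinner 0 e + 0"
      unfolding x_def
      by (intro tendsto_add modulation_weakly_null[OF k(1)]
          bounded_linear.tendsto[OF bounded_linear_cinner_left lim0[unfolded x_def]])
    then show ?thesis by (simp add: cinner_simps)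
  qed
  then have "(\<lambda>n. \<Sum>e\<in>S. cinner (E (x n)) e *\<^sub>C e) \<longlonglongrightarrow> (\<Sum>e\<in>S. 0 *\<^sub>C e)"
    by (intro tendsto_sum bounded_bilinear.tendsto[OF bounded_bilinear_scaleC] tendsto_const)
  moreover have "(\<lambda>n. \<Sum>e\<in>S. cinner (E (x n)) e *\<^sub>C e) = (\<lambda>n. E (x n))"
    using S(3) EM by (intro ext) metis
  ultimately have "(\<lambda>n. E (x n)) \<longlonglongrightarrow> 0" by simp
  from tendsto_diff[OF this lim0] have "x \<longlonglongrightarrow> 0" by simp
  then have "(\<lambda>n. norm (x n)) \<longlonglongrightarrow> 0" by (rule tendsto_norm_zero)
  moreover have "norm U \<le> norm (x n)" for n
  proof -
    have "U = mulop (chi (- k n)) (x n)"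
      unfolding x_def mulop_mulop[OF cper_chi cper_chi] by (simp flip: chi_add)
    then show ?thesis using norm_mulop_le[OF cper_chi, of 1 "- k n" "x n"] by simp
  qed
  ultimately have "norm U \<le> 0" by (intro LIMSEQ_le_const) auto
  then show False using U(2) by simp
qed

end

section \<open>The gap estimate\<close>

lemma gap1_le:
  assumes le: "\<And>U. U \<in> Y \<Longrightarrow> \<exists>W\<in>Z. normV P (U - W) \<le> C * normV P U" and C: "C \<ge> 0"
  shows "gap1 P Y Z \<le> C"
proof (cases "\<exists>U\<in>Y. normV P U = 1")
  case True
  have "(SUP U\<in>{U \<in> Y. normV P U = 1}. distV P U Z) \<le> C"
  proof (rule cSUP_least)
    show "{U \<in> Y. normV P U = 1} \<noteq> {}" using True by blast
    fix U assume "U \<in> {U \<in> Y. normV P U = 1}"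
    then obtain W where W: "W \<in> Z" "normV P (U - W) \<le> C" using le[of U] by auto
    have "distV P U Z \<le> normV P (U - W)"
      unfolding distV_def by (rule cINF_lower[OF _ W(1)]) (auto intro!: bdd_belowI2[of _ 0] simp: normV_eq_norm)
    then show "distV P U Z \<le> C" using W(2) by linarith
  qed
  then show ?thesis using True by (simp add: gap1_def)
qed (use C in \<open>simp add: gap1_def\<close>)

context elliptic_form
begin

text \<open>The constant is uniform over the eigenspace because it has a finite orthonormal basis.\<close>

lemma eigenspace_galerkin_rate:
  assumes fin: "finite B" "{U \<in> HP1 P. solution_op P A U = \<gamma> *\<^sub>C U} \<subseteq> cspan B"
    and Hs: "\<And>U. U \<in> HP1 P \<Longrightarrow> solution_op P A U = \<gamma> *\<^sub>C U \<Longrightarrow> U \<noteq> 0 \<Longrightarrow> U \<in> Hs s" and s: "s \<ge> 1"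
  obtains D where "D \<ge> 0" "\<And>N U. N \<ge> 1 \<Longrightarrow> U \<in> HP1 P \<Longrightarrow> solution_op P A U = \<gamma> *\<^sub>C U \<Longrightarrow>
    V.nrm (U - galerkin_proj P A N U) \<le> D * (1 + (real N)\<^sup>2) powr ((1 - real s) / 2) * V.nrm U"
proof -
  define M where "M = {U \<in> HP1 P. solution_op P A U = \<gamma> *\<^sub>C U}"
  define q where "q N = (1 + (real N)\<^sup>2) powr ((1 - real s) / 2)" for N
  have Msub: "cvec.subspace M"
    unfolding M_def cvec.subspace_def
    using cvec.subspace_0[OF subspace_HP1] solution_op_scaleC[of 0 0]
    by (auto simp: HP1_add HP1_scaleC solution_op_add solution_op_scaleC cvec.scale_right_distrib mult.commute)
  have MV: "M \<subseteq> HP1 P" by (auto simp: M_def)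
  obtain S where S: "finite S" "S \<subseteq> M" "V.orthonormal S" "\<forall>X\<in>M. X = (\<Sum>e\<in>S. aform P A X e *\<^sub>C e)"
    using V.orthonormal_basis_exists[OF Msub MV _ fin(1)] fin(2) unfolding M_def by blast
  have SV: "e \<in> HP1 P" if "e \<in> S" for e using that S(2) MV by blast
  have nS: "V.nrm e = 1" if "e \<in> S" for e
    using V.orthonormal_form[OF S(3) that that] by (simp add: V.nrm_def)
  have "\<exists>C\<ge>0. \<forall>N\<ge>1. V.nrm (e - galerkin_proj P A N e) \<le> C * q N" if e: "e \<in> S" for e
  proof -
    have "e \<noteq> 0" using nS[OF e] by auto
    moreover have "e \<in> HP1 P" "solution_op P A e = \<gamma> *\<^sub>C e" using e S(2) by (auto simp: M_def)
    ultimately have "e \<in> Hs s" using Hs by blast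
    then show ?thesis using galerkin_rate[OF SV[OF e] _ s] unfolding q_def by blast
  qed
  then have "\<forall>e\<in>S. \<exists>C. C \<ge> 0 \<and> (\<forall>N\<ge>1. V.nrm (e - galerkin_proj P A N e) \<le> C * q N)" by blast
  from bchoice[OF this] obtain C where C: "\<And>e. e \<in> S \<Longrightarrow> C e \<ge> 0"
    "\<And>e N. e \<in> S \<Longrightarrow> N \<ge> 1 \<Longrightarrow> V.nrm (e - galerkin_proj P A N e) \<le> C e * q N" by blast
  define D where "D = (\<Sum>e\<in>S. C e)"
  have "V.nrm (U - galerkin_proj P A N U) \<le> D * q N * V.nrm U"
    if N: "N \<ge> 1" and U: "U \<in> HP1 P" "solution_op P A U = \<gamma> *\<^sub>C U" for N U
  proof -
    let ?W = "\<Sum>e\<in>S. aform P A U e *\<^sub>C galerkin_proj P A N e"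
    have "U = (\<Sum>e\<in>S. aform P A U e *\<^sub>C e)" using S(4) U by (auto simp: M_def)
    then have eq: "U - ?W = (\<Sum>e\<in>S. aform P A U e *\<^sub>C (e - galerkin_proj P A N e))"
      by (simp add: cvec.scale_right_diff_distrib sum_subtractf)
    have "?W \<in> VN N"
      by (intro cvec.subspace_sum[OF subspace_VN] cvec.subspace_scale[OF subspace_VN] galerkin_VN SV)
    then have "V.nrm (U - galerkin_proj P A N U) \<le> V.nrm (U - ?W)" by (rule galerkin_best[OF U(1)])
    also have "\<dots> \<le> (\<Sum>e\<in>S. V.nrm (aform P A U e *\<^sub>C (e - galerkin_proj P A N e)))"
      unfolding eq by (intro V.nrm_sum_le HP1_scaleC HP1_diff galerkin_V SV)
    also have "\<dots> \<le> (\<Sum>e\<in>S. V.nrm U * (C e * q N))"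
    proof (rule sum_mono)
      fix e assume e: "e \<in> S"
      have d: "e - galerkin_proj P A N e \<in> HP1 P" by (intro HP1_diff galerkin_V SV e)
      have "cmod (aform P A U e) \<le> V.nrm U" using V.Cauchy_Schwarz[OF U(1) SV[OF e]] nS[OF e] by simp
      then show "V.nrm (aform P A U e *\<^sub>C (e - galerkin_proj P A N e)) \<le> V.nrm U * (C e * q N)"
        unfolding V.nrm_scale[OF d]
        using C(2)[OF e N] V.nrm_nonneg[OF d] V.nrm_nonneg[OF U(1)] by (intro mult_mono) auto
    qed
    also have "\<dots> = D * q N * V.nrm U" by (simp add: D_def sum_distrib_left sum_distrib_right mult_ac)
    finally show ?thesis .
  qed
  moreover have "D \<ge> 0" unfolding D_def by (intro sum_nonneg C(1))
  ultimately show ?thesis using that unfolding q_def by blast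
qed

text \<open>The constant \<open>\<epsilon>\<close> of the proof is the norm distance of \<open>K\<close> and \<open>T\<^sub>N\<close> up to which the circle stays in
  the resolvent set of \<open>T\<^sub>N\<close> and the ranges of the two projections correspond to each other. The
  rate itself comes from the defect on the eigenspace alone.\<close>

theorem spectral_gap_estimate:
  assumes rank: "CARD('d) \<le> CARD('n)" "rank P = CARD('d)"
    and eig: "\<exists>U. eigenvector P (solution_op P A) \<gamma> U"
    and mult: "finite_algebraic_multiplicity P (solution_op P A) \<gamma>"
    and r: "r > 0" and \<gamma>0: "\<gamma> \<noteq> 0"
    and iso: "cball \<gamma> r \<inter> (spectrum P (solution_op P A) \<union> {0}) = {\<gamma>}"
    and s: "s \<ge> 1"
    and Hs: "\<forall>U \<in> spectral_proj P (solution_op P A) \<gamma> r ` HP1 P. eigenvector P (solution_op P A) \<gamma> U \<longrightarrow> U \<in> Hs s"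
  shows "cnj \<gamma> = \<gamma>"
    and "\<exists>C>0. \<forall>\<^sub>F N in sequentially.
      gap P (spectral_proj P (TN P A N) \<gamma> r ` HP1 P) (spectral_proj P (solution_op P A) \<gamma> r ` HP1 P)
        \<le> C * (1 + (real N)\<^sup>2) powr ((1 - real s) / 2)"
proof -
  let ?K = "solution_op P A"
  let ?q = "\<lambda>N::nat. (1 + (real N)\<^sup>2) powr ((1 - real s) / 2)"
  note K = sa_operator_solution_op
  interpret K: sa_operator scaleC "HP1 P" "aform P A" ?K 1
    rewrites "module.span scaleC = cspan" by (rule K) (simp add: cspan_def)
  obtain U0 where U0: "U0 \<in> HP1 P" "U0 \<noteq> 0" "?K U0 = \<gamma> *\<^sub>C U0" using eig by (auto simp: eigenvector_def)
  show real': "cnj \<gamma> = \<gamma>"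
  proof -
    have "aform P A U0 U0 \<noteq> 0" using V.a_pos[OF U0(1,2)] by auto
    moreover have "\<gamma> * aform P A U0 U0 = cnj \<gamma> * aform P A U0 U0"
      using K.T_sym[OF U0(1) U0(1)] unfolding U0(3) V.a_scale_left[OF U0(1) U0(1)] V.a_scale_right[OF U0(1) U0(1)] .
    ultimately show ?thesis by simp
  qed
  then have real: "Im \<gamma> = 0" by (simp add: complex_eq_iff)
  have reg: "K.reg z" if "z \<in> cball \<gamma> r" "z \<noteq> \<gamma>" for z
  proof -
    have "z \<notin> spectrum P ?K"
    proof
      assume "z \<in> spectrum P ?K"
      then have "z \<in> cball \<gamma> r \<inter> (spectrum P ?K \<union> {0})" using that(1) by simp
      then show False using that(2) unfolding iso by simp
    qed
    then have "z \<in> resolvent_set P ?K" by (simp add: spectrum_def)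
    then show ?thesis using resolvent_set_reg[OF K] by blast
  qed
  have regS: "K.reg z" if "z \<in> sphere \<gamma> r" for z using that r by (intro reg) auto
  have \<gamma>r: "cmod \<gamma> > r"
  proof -
    have "0 \<notin> cball \<gamma> r"
    proof
      assume "0 \<in> cball \<gamma> r"
      then have "0 \<in> cball \<gamma> r \<inter> (spectrum P ?K \<union> {0})" by simp
      then show False using \<gamma>0 unfolding iso by simp
    qed
    then show ?thesis by simp
  qed
  obtain B where B: "finite B" "generalized_eigenspace P ?K \<gamma> \<subseteq> cspan B"
    using mult unfolding finite_algebraic_multiplicity_def by blast
  have MB: "{U \<in> HP1 P. ?K U = \<gamma> *\<^sub>C U} \<subseteq> cspan B"
  proof
    fix U assume "U \<in> {U \<in> HP1 P. ?K U = \<gamma> *\<^sub>C U}"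
    then have "U \<in> HP1 P" "((\<lambda>W. \<gamma> *\<^sub>C W - ?K W) ^^ 1) U = 0" by auto
    then have "U \<in> generalized_eigenspace P ?K \<gamma>" unfolding generalized_eigenspace_def by blast
    then show "U \<in> cspan B" using B(2) by blast
  qed
  have "CARD('d) = CARD('n)" by (rule isolated_eigenvalue_imp_square[OF rank real r reg U0 B(1) MB])
  then have "inj ((*v) P)" using rank(2) full_rank_injective[of P] by simp
  then obtain c where c: "c > 0" "\<And>x. c * norm x \<le> norm (P *v x)"
    using linear_inj_bounded_below_pos[OF matrix_vector_mul_linear, of P] by blast
  define E where "E = spectral_proj P ?K \<gamma> r"
  have E_V: "E X \<in> HP1 P" if "X \<in> HP1 P" for X unfolding E_def by (rule spectral_proj_form(1)[OF K r regS that])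
  have E_form: "aform P A (E X) W = contour_integral (circlepath \<gamma> r) (\<lambda>z. aform P A (K.R z X) W) / (2 * of_real pi * \<i>)"
    if "X \<in> HP1 P" "W \<in> HP1 P" for X W unfolding E_def by (rule spectral_proj_form(2)[OF K r regS that(1)])
  have E_eig: "E U = U" if "U \<in> HP1 P" "?K U = \<gamma> *\<^sub>C U" for U
    by (rule K.Riesz_projection_eigenvector[OF real r reg E_V E_form that])
  have E_range: "?K (E U) = \<gamma> *\<^sub>C E U" if "U \<in> HP1 P" for U
    by (rule K.Riesz_projection_range[OF real r reg E_V E_form that])
  have HsM: "U \<in> Hs s" if "U \<in> HP1 P" "?K U = \<gamma> *\<^sub>C U" "U \<noteq> 0" for U
  proof -
    have "U \<in> spectral_proj P ?K \<gamma> r ` HP1 P" using E_eig[OF that(1,2)] that(1) unfolding E_def by (metis image_eqI)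
    moreover have "eigenvector P ?K \<gamma> U" using that by (simp add: eigenvector_def)
    ultimately show ?thesis using Hs by blast
  qed
  obtain m where m: "m > 0" "\<And>z x. z \<in> sphere \<gamma> r \<Longrightarrow> x \<in> HP1 P \<Longrightarrow> m * V.nrm x \<le> V.nrm (z *\<^sub>C x - ?K x)"
    using K.uniform_lower_bound[OF compact_sphere regS] by blast
  obtain D where D: "D \<ge> 0" "\<And>N U. N \<ge> 1 \<Longrightarrow> U \<in> HP1 P \<Longrightarrow> ?K U = \<gamma> *\<^sub>C U \<Longrightarrow>
    V.nrm (U - galerkin_proj P A N U) \<le> D * ?q N * V.nrm U"
    using eigenspace_galerkin_rate[OF B(1) MB HsM s] by blast
  obtain c1 c2 where cc: "c1 > 0" "c2 > 0" "\<And>U. U \<in> HP1 P \<Longrightarrow> c1 * normV P U \<le> V.nrm U"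
    "\<And>U. U \<in> HP1 P \<Longrightarrow> V.nrm U \<le> c2 * normV P U" by (rule norm_equiv) blast
  define \<epsilon> where "\<epsilon> = Min {m / 2, m\<^sup>2 / (4 * r), r / 2}"
  have \<epsilon>: "\<epsilon> > 0" "\<epsilon> \<le> m / 2" "\<epsilon> \<le> m\<^sup>2 / (4 * r)" "\<epsilon> \<le> r / 2" using m(1) r by (auto simp: \<epsilon>_def)
  define L where "L = (1 + cmod \<gamma>) * D"
  have L0: "L \<ge> 0" using D(1) by (simp add: L_def)
  define C where "C = 2 * c2 / (c1 * r) * L"
  have C0': "C \<ge> 0" using cc(1,2) r L0 by (simp add: C_def)
  have "\<forall>\<^sub>F N in sequentially. gap P (spectral_proj P (TN P A N) \<gamma> r ` HP1 P) (E ` HP1 P) \<le> (C + 1) * ?q N"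
    using TN_tendsto_norm[OF c \<epsilon>(1)] eventually_ge_at_top[of 1]
  proof eventually_elim
    case (elim N)
    note T = sa_operator_TN[of N]
    interpret T: sa_operator scaleC "HP1 P" "aform P A" "TN P A N" 1
      rewrites "module.span scaleC = cspan" by (rule T) (simp add: cspan_def)
    define F where "F = spectral_proj P (TN P A N) \<gamma> r"
    text \<open>The smaller of the two available bounds: \<open>\<epsilon>\<close> ensures \<open>2 \<eta> \<le> r\<close>, so that \<open>F u\<close> is at least half as long
      as \<open>u\<close>, even if the rate gives no decay, as for \<open>s = 1\<close>.\<close>
    define \<eta> where "\<eta> = min \<epsilon> (L * ?q N)"
    have \<eta>: "2 * \<eta> \<le> r" "0 \<le> \<eta>" "\<eta> \<le> L * ?q N" using \<epsilon> L0 by (auto simp: \<eta>_def)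
    have reg': "T.reg z" if z: "z \<in> sphere \<gamma> r" for z
    proof -
      have "m / 2 * V.nrm x \<le> V.nrm (z *\<^sub>C x - TN P A N x)" if x: "x \<in> HP1 P" for x
      proof -
        have V: "z *\<^sub>C x - TN P A N x \<in> HP1 P" "?K x - TN P A N x \<in> HP1 P" using x by auto
        have "z *\<^sub>C x - ?K x = (z *\<^sub>C x - TN P A N x) - (?K x - TN P A N x)" by simp
        then have "V.nrm (z *\<^sub>C x - ?K x) \<le> V.nrm (z *\<^sub>C x - TN P A N x) + V.nrm (?K x - TN P A N x)"
          using V.nrm_triangle_diff[OF V] by metis
        moreover have "V.nrm (?K x - TN P A N x) \<le> \<epsilon> * V.nrm x" using elim(1) x by blast
        moreover have "\<epsilon> * V.nrm x \<le> m / 2 * V.nrm x" using \<epsilon>(2) V.nrm_nonneg[OF x] by (rule mult_right_mono)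
        moreover have "m * V.nrm x = m / 2 * V.nrm x + m / 2 * V.nrm x" by simp
        ultimately show ?thesis using m(2)[OF z x] by linarith
      qed
      moreover have "m / 2 > 0" using m(1) by simp
      ultimately show ?thesis unfolding T.reg_def by blast
    qed
    have F_V: "F X \<in> HP1 P" if "X \<in> HP1 P" for X unfolding F_def by (rule spectral_proj_form(1)[OF T r reg' that])
    have F_form: "aform P A (F X) W = contour_integral (circlepath \<gamma> r) (\<lambda>z. aform P A (T.R z X) W) / (2 * of_real pi * \<i>)"
      if "X \<in> HP1 P" "W \<in> HP1 P" for X W unfolding F_def by (rule spectral_proj_form(2)[OF T r reg' that(1)])
    have VNsub: "VN N \<subseteq> cspan (expo ` VN_index N)" by (simp add: VN_eq)
    have \<epsilon>2: "2 * \<epsilon> \<le> m" "2 * \<epsilon> * r < m\<^sup>2" "0 \<le> \<epsilon>"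
    proof -
      show "2 * \<epsilon> \<le> m" "0 \<le> \<epsilon>" using \<epsilon> by auto
      have "2 * \<epsilon> * r \<le> 2 * (m\<^sup>2 / (4 * r)) * r" using \<epsilon>(3) r by (intro mult_right_mono mult_left_mono) auto
      also have "\<dots> = m\<^sup>2 / 2" using r by simp
      also have "\<dots> < m\<^sup>2" using m(1) by simp
      finally show "2 * \<epsilon> * r < m\<^sup>2" .
    qed
    have \<eta>1: "V.nrm (?K u - TN P A N u) \<le> \<eta> * V.nrm u" if u: "u \<in> HP1 P" "?K u = \<gamma> *\<^sub>C u" for u
    proof -
      have "V.nrm (?K u - TN P A N u) \<le> (1 + cmod \<gamma>) * V.nrm (u - galerkin_proj P A N u)"
        by (rule TN_defect_eigenvector[OF u])
      also have "\<dots> \<le> (1 + cmod \<gamma>) * (D * ?q N * V.nrm u)" using D(2)[OF elim(2) u] by (intro mult_left_mono) auto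
      finally have "V.nrm (?K u - TN P A N u) \<le> L * ?q N * V.nrm u" by (simp add: L_def mult_ac)
      moreover have "V.nrm (?K u - TN P A N u) \<le> \<epsilon> * V.nrm u" using elim(1) u(1) by blast
      ultimately show ?thesis unfolding \<eta>_def min_def by auto
    qed
    have elim1: "V.nrm (?K x - TN P A N x) \<le> \<epsilon> * V.nrm x" if "x \<in> HP1 P" for x using elim(1) that by blast
    note pert = K.Riesz_projection_perturbation[OF T subspace_VN VN_HP1 VNsub finite_imageI[OF finite_VN_index]
      TN_VN real r \<gamma>r reg reg' E_V F_V E_form F_form m elim1 \<epsilon>2(3,1,2) B(1) MB \<eta>1 \<eta>(1,2)]
    have pert1: "r * V.nrm (u - F u) \<le> \<eta> * V.nrm u" if "u \<in> HP1 P" "?K u = \<gamma> *\<^sub>C u" for u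
      by (rule pert(1)[rotated -2]) (rule that)+
    have pert2: "\<exists>u\<in>HP1 P. ?K u = \<gamma> *\<^sub>C u \<and> r * V.nrm (F x - u) \<le> 2 * \<eta> * V.nrm (F x)" if "x \<in> HP1 P" for x
      by (rule pert(2)[rotated -1]) (rule that)
    have toV: "normV P X \<le> C * ?q N * normV P Y"
      if "X \<in> HP1 P" "Y \<in> HP1 P" "r * V.nrm X \<le> 2 * \<eta> * V.nrm Y" for X Y
    proof -
      have "r * (c1 * normV P X) \<le> r * V.nrm X" using cc(3)[OF that(1)] r by (intro mult_left_mono) auto
      also have "\<dots> \<le> 2 * \<eta> * V.nrm Y" by (rule that(3))
      also have "\<dots> \<le> 2 * (L * ?q N) * (c2 * normV P Y)"
        using \<eta> cc(4)[OF that(2)] V.nrm_nonneg[OF that(2)] L0 by (intro mult_mono) auto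
      finally have "(c1 * r) * normV P X \<le> (c1 * r) * (C * ?q N * normV P Y)"
        using cc(1) r by (simp add: C_def mult_ac)
      then show ?thesis using cc(1) r by simp
    qed
    have q0: "?q N \<ge> 0" by simp
    have "gap1 P (F ` HP1 P) (E ` HP1 P) \<le> C * ?q N"
    proof (rule gap1_le)
      fix Y assume "Y \<in> F ` HP1 P"
      then obtain x where x: "x \<in> HP1 P" "Y = F x" by blast
      obtain u where u: "u \<in> HP1 P" "?K u = \<gamma> *\<^sub>C u" "r * V.nrm (F x - u) \<le> 2 * \<eta> * V.nrm (F x)"
        using pert2[OF x(1)] by blast
      have "u \<in> E ` HP1 P" using E_eig[OF u(1,2)] u(1) by (metis image_eqI)
      moreover have "normV P (Y - u) \<le> C * ?q N * normV P Y"
        unfolding x(2) by (rule toV[OF HP1_diff[OF F_V[OF x(1)] u(1)] F_V[OF x(1)] u(3)])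
      ultimately show "\<exists>W\<in>E ` HP1 P. normV P (Y - W) \<le> C * ?q N * normV P Y" by blast
    qed (use C0' q0 in simp)
    moreover have "gap1 P (E ` HP1 P) (F ` HP1 P) \<le> C * ?q N"
    proof (rule gap1_le)
      fix Y assume "Y \<in> E ` HP1 P"
      then obtain x where x: "x \<in> HP1 P" "Y = E x" by blast
      have Y: "Y \<in> HP1 P" "?K Y = \<gamma> *\<^sub>C Y" using E_V[OF x(1)] E_range[OF x(1)] x(2) by auto
      have "r * V.nrm (Y - F Y) \<le> 2 * \<eta> * V.nrm Y"
        using pert1[OF Y] mult_nonneg_nonneg[OF \<eta>(2) V.nrm_nonneg[OF Y(1)]] by simp
      then have "normV P (Y - F Y) \<le> C * ?q N * normV P Y" by (rule toV[OF HP1_diff[OF Y(1) F_V[OF Y(1)]] Y(1)])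
      then show "\<exists>W\<in>F ` HP1 P. normV P (Y - W) \<le> C * ?q N * normV P Y" using Y(1) by blast
    qed (use C0' q0 in simp)
    ultimately have "gap P (F ` HP1 P) (E ` HP1 P) \<le> C * ?q N" by (simp add: gap_def)
    also have "\<dots> \<le> (C + 1) * ?q N" by (intro mult_right_mono) auto
    finally show "gap P (spectral_proj P (TN P A N) \<gamma> r ` HP1 P) (E ` HP1 P) \<le> (C + 1) * ?q N" by (simp only: F_def)
  qed
  then show "\<exists>C>0. \<forall>\<^sub>F N in sequentially.
      gap P (spectral_proj P (TN P A N) \<gamma> r ` HP1 P) (spectral_proj P ?K \<gamma> r ` HP1 P) \<le> C * ?q N"
    unfolding E_def using C0' by (intro exI[of _ "C + 1"]) auto
qed

end

theorem mainTheorem3: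
  fixes P :: "real^'n^'d"
    and \<alpha> :: "real^'d \<Rightarrow> real^'d^'d"
    and A :: "real^'n \<Rightarrow> real^'d^'d"
    and C0 C1 r :: real
    and \<gamma> :: complex
    and s :: nat
  defines "V \<equiv> HP1 P"
    and "K \<equiv> solution_op P A"
  defines "E \<equiv> spectral_proj P K \<gamma> r"
    and "E' \<equiv> spectral_proj P (a_adjoint P A K) (cnj \<gamma>) r"
    and "F \<equiv> \<lambda>N. spectral_proj P (TN P A N) \<gamma> r"
    and "F' \<equiv> \<lambda>N. spectral_proj P (a_adjoint P A (TN P A N)) (cnj \<gamma>) r"
  assumes "projection_matrix P"
    and "continuous_on UNIV A" and "torus_periodic A"
    and "\<forall>x. \<alpha> x = A (transpose P *v x)"
    and "bounded (range \<alpha>)"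
    and "C0 > 0" and "C1 > 0"
    and "\<forall>x \<xi>. C0 * (norm \<xi>)\<^sup>2 \<le> \<xi> \<bullet> (\<alpha> x *v \<xi>) \<and> \<xi> \<bullet> (\<alpha> x *v \<xi>) \<le> C1 * (norm \<xi>)\<^sup>2"
    and a_hermitian: "\<forall>U\<in>V. \<forall>W\<in>V. aform P A U W = cnj (aform P A W U)"
    and "\<gamma> \<noteq> 0"
    and "\<exists>U. eigenvector P K \<gamma> U"
    and "\<gamma> isolated_in spectrum P K"
    and "finite_algebraic_multiplicity P K \<gamma>"
    and "r > 0"
    and "sphere \<gamma> r \<subseteq> resolvent_set P K"
    and "cball \<gamma> r \<inter> (spectrum P K \<union> {0}) = {\<gamma>}"
    and "s \<ge> 1"
    and "\<forall>U \<in> E ` V. eigenvector P K \<gamma> U \<longrightarrow> U \<in> Hs s"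
  shows "\<exists>C>0. \<forall>\<^sub>F N in sequentially.
           gap P (F N ` V) (E ` V) \<le> C * (1 + (real N)\<^sup>2) powr ((1 - real s) / 2) \<and>
           gap P (F' N ` V) (E' ` V) \<le> C * (1 + (real N)\<^sup>2) powr ((1 - real s) / 2)"
proof -
  note proj = \<open>projection_matrix P\<close>
  have rank: "CARD('d) \<le> CARD('n)" "rank P = CARD('d)" using proj by (simp_all add: projection_matrix_def)
  interpret elliptic_form P A C0
  proof
    show "C0 * (norm \<xi>)\<^sup>2 \<le> \<xi> \<bullet> (A y *v \<xi>)" for \<xi> y
    proof (rule elliptic_everywhere[OF proj \<open>continuous_on UNIV A\<close> \<open>torus_periodic A\<close>])
      show "C0 * (norm \<xi>)\<^sup>2 \<le> \<xi> \<bullet> (A (transpose P *v x) *v \<xi>)" for x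
        using \<open>\<forall>x. \<alpha> x = A (transpose P *v x)\<close>
          \<open>\<forall>x \<xi>. C0 * (norm \<xi>)\<^sup>2 \<le> \<xi> \<bullet> (\<alpha> x *v \<xi>) \<and> \<xi> \<bullet> (\<alpha> x *v \<xi>) \<le> C1 * (norm \<xi>)\<^sup>2\<close> by metis
    qed
    show "aform P A U W = cnj (aform P A W U)" if "U \<in> HP1 P" "W \<in> HP1 P" for U W
      using a_hermitian that unfolding V_def by blast
  qed (fact \<open>continuous_on UNIV A\<close> \<open>torus_periodic A\<close> \<open>C0 > 0\<close>)+
  note est = spectral_gap_estimate[OF rank \<open>\<exists>U. eigenvector P K \<gamma> U\<close>[unfolded K_def]
    \<open>finite_algebraic_multiplicity P K \<gamma>\<close>[unfolded K_def] \<open>r > 0\<close> \<open>\<gamma> \<noteq> 0\<close>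
    \<open>cball \<gamma> r \<inter> (spectrum P K \<union> {0}) = {\<gamma>}\<close>[unfolded K_def] \<open>s \<ge> 1\<close>
    \<open>\<forall>U \<in> E ` V. eigenvector P K \<gamma> U \<longrightarrow> U \<in> Hs s\<close>[unfolded E_def V_def K_def]]
  text \<open>\<open>K\<close> and \<open>T\<^sub>N\<close> are self-adjoint and \<open>\<gamma>\<close> is real, so the adjoint problem is the same one.\<close>
  have "E' = E"
    unfolding E'_def E_def est(1) K_def
    by (rule spectral_proj_cong) (rule a_adjoint_sa[OF sa_operator_solution_op])
  moreover have "F' N = F N" for N
    unfolding F'_def F_def est(1)
    by (rule spectral_proj_cong) (rule a_adjoint_sa[OF sa_operator_TN])
  moreover have "\<exists>C>0. \<forall>\<^sub>F N in sequentially. gap P (F N ` V) (E ` V) \<le> C * (1 + (real N)\<^sup>2) powr ((1 - real s) / 2)"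
    unfolding E_def F_def V_def K_def by (rule est(2))
  ultimately show ?thesis by simp
qed

end
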